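(* Let $L_4$ be the lattice $\mathbb Z^3$ with Gram matrix $G_4=\begin{pmatrix}4&0&-6\\0&6&-6\\-6&-6&12\end{pmatrix}$. The representation of $G=O(\mathcal D,q)$ on $S_{3/2}(\rho_{L_4})$ is absolutely irreducible, so the Petersson Gram matrix $P_{3/2}$ in the echelon basis is a scalar multiple of the unique (up to scale) invariant symmetric form: $$P_{3/2}=t\cdot B_S,\qquad B_S=\begin{pmatrix}\tfrac43&0&0&-\tfrac23\\0&\tfrac43&\tfrac23&0\\0&\tfrac23&\tfrac43&0\\-\tfrac23&0&0&\tfrac43\end{pmatrix}\ \text{exactly},\qquad t\in\mathbb R_{>0}.$$ Here $B_S=\tfrac1{48}\sum_{\sigma\in G}R_\sigma^\top R_\sigma$, where $R_\sigma$ is the matrix of $\sigma$ on $S_{3/2}(\rho_{L_4})$ in the echelon basis; and $\tfrac32B_S$ is the Gram matrix of the root lattice $A_2\oplus A_2$. Consequently every section-layer shadow norm is a rational multiple of $1/t$, with exactly computable ratios: writing $\lambda_\varepsilon=\Phi\varepsilon$ and $r(\varepsilon)=\lambda_\varepsilon^\top B_S^{-1}\lambda_\varepsilon\in\mathbb Q$, flipping a single sign of an unobstructed ($\lambda=0$, e.g. deck-invariant) orientation gives $r=4$ or $r=8$ according to the slot class (channel $m$) of the flipped pair, and a double flip across the two classes realizes $r=20$; thus ratios of $\|\Xi\|^2$ such as $8:20=2:5$ are exact.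
   Context: $\mathcal D=L_4^\vee/L_4$ (order $72$), $q(\gamma)=(\gamma,\gamma)/2\bmod1$; $O(\mathcal D,q)$ (order $48$) acts by $(\sigma F)_\gamma=F_{\sigma^{-1}\gamma}$. Weil representation of $\mathrm{Mp}_2(\mathbb Z)$ on $\mathbb C[\mathcal D]$: $\rho_{L_4}(T)\mathfrak e_\gamma=e(q(\gamma))\mathfrak e_\gamma$, $\rho_{L_4}(S)\mathfrak e_\gamma=\frac{e(-1/8)}{\sqrt{72}}\sum_\delta e(-(\gamma,\delta))\mathfrak e_\delta$, $e(x)=e^{2\pi ix}$. $S_{3/2}(\rho_{L_4})$: cusp forms with $F(A\tau)=\varphi(\tau)^3\rho_{L_4}(A,\varphi)F(\tau)$; dimension $4$; coefficients $c_F(\gamma,e)$ of $q^e\mathfrak e_\gamma$. The echelon basis is the basis in reduced row echelon form with respect to Fourier coefficients (ordered by increasing exponent). Petersson product: $\langle f,g\rangle=\int_{\mathcal F}\sum_\gamma f_\gamma\overline{g_\gamma}y^{3/2}\frac{dx\,dy}{y^2}$, $\mathcal F$ the standard fundamental domain of $\mathrm{SL}_2(\mathbb Z)$; $P_{3/2}$ is the matrix of pairings of echelon basis elements. Non-torsion reflective slots: the $24$ pairs $(\mu,m)$, $m\in\{\tfrac1{12},\tfrac16\}$ (the two slot classes, or channels), $q(\mu)\equiv m\bmod1$, forming $12$ pairs $\{\mu,-\mu\}$. The order-three isometry $M'=\begin{pmatrix}46&69&-75\\30&43&-48\\55&81&-89\end{pmatrix}$ of $L_4$ permutes the pairs in four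 orbits of length three; fix representatives of the pairs permuted by $M'$. $\Phi$ is the $4\times12$ matrix of coefficients $c_b(\mu,m)$ of the echelon basis elements $b$ at the representatives; its entries are in $\{0,\pm1\}$. An orientation is $\varepsilon\in\{\pm1\}^{12}$; it is deck-invariant if constant on each $M'$-orbit, and then $\Phi\varepsilon=0$. A flip changes the sign of one entry of $\varepsilon$. The section-layer shadow $\Xi$ of $\varepsilon$ is the Riesz representative in $S_{3/2}(\rho_{L_4})$ of the functional with values $\lambda_\varepsilon$ on the echelon basis, so $\|\Xi\|^2=r(\varepsilon)/t$. (The odd unit prescription $\sum\varepsilon_\mu q^{-m}(\mathfrak e_\mu-\mathfrak e_{-\mu})$ pairs to $2\Phi\varepsilon$, which multiplies every $r$ by $4$ and changes no ratio.) *)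

theory Defs
  imports
    "HOL-Analysis.Analysis"
    "HOL-Algebra.Coset"
    "HOL-Algebra.Bij"
    "HOL-Library.Function_Algebras"
begin

section \<open>The lattice and its discriminant form\<close>

definition G4 :: "real^3^3" where
  "G4 = vector [vector [4, 0, -6], vector [0, 6, -6], vector [-6, -6, 12]]"

definition bil :: "real^3 \<Rightarrow> real^3 \<Rightarrow> real" where
  "bil x y = x \<bullet> (G4 *v y)"

definition L4 :: "(real^3) set" where
  "L4 = {x. \<forall>i. x $ i \<in> \<int>}"

definition dual_L4 :: "(real^3) set" where
  "dual_L4 = {x. \<forall>y\<in>L4. bil x y \<in> \<int>}"

definition dual_group :: "(real^3) monoid" where
  "dual_group = \<lparr>carrier = dual_L4, monoid.mult = (+), one = 0\<rparr>"

type_synonym coset = "(real^3) set"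

definition disc_group :: "coset monoid" where
  "disc_group = dual_group Mod L4"

abbreviation Disc :: "coset set" where
  "Disc \<equiv> carrier disc_group"

text \<open>The quadratic and bilinear form of the discriminant group take values modulo 1; they are
  represented by their values in the interval from 0 (included) to 1 (excluded).\<close>

definition disc_q :: "coset \<Rightarrow> real" where
  "disc_q \<gamma> = (let v = (SOME v. v \<in> \<gamma>) in frac (bil v v / 2))"

definition disc_b :: "coset \<Rightarrow> coset \<Rightarrow> real" where
  "disc_b \<gamma> \<delta> = (let v = (SOME v. v \<in> \<gamma>); w = (SOME w. w \<in> \<delta>) in frac (bil v w))"

definition O_disc :: "(coset \<Rightarrow> coset) set" where
  "O_disc = {\<sigma> \<in> auto disc_group. \<forall>\<gamma>\<in>Disc. disc_q (\<sigma> \<gamma>) = disc_q \<gamma>}"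


section \<open>The Weil representation\<close>

definition e2pi :: "complex \<Rightarrow> complex" where
  "e2pi x = exp (2 * of_real pi * \<i> * x)"

definition upper_half :: "complex set" where
  "upper_half = {\<tau>. Im \<tau> > 0}"

definition moebius :: "int^2^2 \<Rightarrow> complex \<Rightarrow> complex" where
  "moebius A \<tau> = (of_int (A$1$1) * \<tau> + of_int (A$1$2)) / (of_int (A$2$1) * \<tau> + of_int (A$2$2))"

text \<open>Elements of the metaplectic group are pairs of a matrix and a square root of the
  automorphy factor; only the values of the root on the upper half-plane matter.\<close>

type_synonym mp2 = "(int^2^2) \<times> (complex \<Rightarrow> complex)"

definition mp2_T :: mp2 where
  "mp2_T = (vector [vector [1, 1], vector [0, 1]], \<lambda>\<tau>. 1)"

definition mp2_S :: mp2 where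
  "mp2_S = (vector [vector [0, -1], vector [1, 0]], csqrt)"

definition mp2_mult :: "mp2 \<Rightarrow> mp2 \<Rightarrow> mp2" where
  "mp2_mult g h = (fst g ** fst h, \<lambda>\<tau>. snd g (moebius (fst h) \<tau>) * snd h \<tau>)"

text \<open>A vector of the group algebra of the discriminant group is its family of coordinates with
  respect to the standard basis; coordinates outside the discriminant group are 0.  The two
  operators below are the linear extensions of
  \<open>e_\<gamma> \<mapsto> e(q(\<gamma>)) e_\<gamma>\<close> and
  \<open>e_\<gamma> \<mapsto> e(-1/8)/sqrt 72 \<Sum>\<delta>. e(-(\<gamma>,\<delta>)) e_\<delta>\<close>.\<close>

type_synonym disc_vec = "coset \<Rightarrow> complex"

definition weil_T :: "disc_vec \<Rightarrow> disc_vec" where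
  "weil_T v = (\<lambda>\<gamma>. if \<gamma> \<in> Disc then e2pi (of_real (disc_q \<gamma>)) * v \<gamma> else 0)"

definition weil_S :: "disc_vec \<Rightarrow> disc_vec" where
  "weil_S v = (\<lambda>\<delta>. if \<delta> \<in> Disc
     then e2pi (- 1 / 8) / of_real (sqrt 72) * (\<Sum>\<gamma>\<in>Disc. e2pi (- of_real (disc_b \<gamma> \<delta>)) * v \<gamma>)
     else 0)"

text \<open>The graph of the Weil representation, as the multiplicative closure of its values on the
  generators.  The product rule alone reaches all of the metaplectic group, since \<open>S\<close> has order 8
  and \<open>(ST)^3 = S^2\<close>.\<close>

inductive weil_rep :: "mp2 \<Rightarrow> (disc_vec \<Rightarrow> disc_vec) \<Rightarrow> bool" where
  T: "weil_rep mp2_T weil_T"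
| S: "weil_rep mp2_S weil_S"
| mult: "weil_rep g M \<Longrightarrow> weil_rep h N \<Longrightarrow> weil_rep (mp2_mult g h) (M \<circ> N)"


section \<open>Cusp forms of weight 3/2\<close>

text \<open>Forms are extended by 0 outside the upper half-plane and outside the discriminant group.\<close>

type_synonym form = "complex \<Rightarrow> disc_vec"

definition form_scale :: "complex \<Rightarrow> form \<Rightarrow> form" where
  "form_scale c F = (\<lambda>\<tau> \<gamma>. c * F \<tau> \<gamma>)"

interpretation form: vector_space form_scale
  by unfold_locales (auto simp: form_scale_def fun_eq_iff algebra_simps)

definition fourier_expansion :: "form \<Rightarrow> (coset \<Rightarrow> real \<Rightarrow> complex) \<Rightarrow> bool" where
  "fourier_expansion F c \<longleftrightarrow>
     (\<forall>\<gamma> e. \<gamma> \<notin> Disc \<or> e - disc_q \<gamma> \<notin> \<int> \<longrightarrow> c \<gamma> e = 0) \<and>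
     (\<forall>\<gamma>\<in>Disc. \<forall>\<tau>\<in>upper_half.
        ((\<lambda>e. c \<gamma> e * e2pi (of_real e * \<tau>)) has_sum F \<tau> \<gamma>) {e. e - disc_q \<gamma> \<in> \<int>})"

definition fourier_coeff :: "form \<Rightarrow> coset \<Rightarrow> real \<Rightarrow> complex" where
  "fourier_coeff F = (THE c. fourier_expansion F c)"

definition S32 :: "form set" where
  "S32 = {F.
     (\<forall>\<tau> \<gamma>. \<tau> \<notin> upper_half \<or> \<gamma> \<notin> Disc \<longrightarrow> F \<tau> \<gamma> = 0) \<and>
     (\<forall>\<gamma>\<in>Disc. (\<lambda>\<tau>. F \<tau> \<gamma>) holomorphic_on upper_half) \<and>
     (\<forall>A \<phi> M. weil_rep (A, \<phi>) M \<longrightarrow>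
        (\<forall>\<tau>\<in>upper_half. \<forall>\<gamma>\<in>Disc. F (moebius A \<tau>) \<gamma> = \<phi> \<tau> ^ 3 * M (F \<tau>) \<gamma>)) \<and>
     (\<exists>c. fourier_expansion F c \<and> (\<forall>\<gamma> e. e \<le> 0 \<longrightarrow> c \<gamma> e = 0))}"

definition fund_domain :: "complex set" where
  "fund_domain = {\<tau>. Im \<tau> > 0 \<and> \<bar>Re \<tau>\<bar> \<le> 1 / 2 \<and> cmod \<tau> \<ge> 1}"

definition petersson :: "form \<Rightarrow> form \<Rightarrow> complex" where
  "petersson F H = set_lebesgue_integral lborel fund_domain
     (\<lambda>\<tau>. (\<Sum>\<gamma>\<in>Disc. F \<tau> \<gamma> * cnj (H \<tau> \<gamma>)) * of_real (Im \<tau> powr (3 / 2) / (Im \<tau>)\<^sup>2))"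

definition act :: "(coset \<Rightarrow> coset) \<Rightarrow> form \<Rightarrow> form" where
  "act \<sigma> F = (\<lambda>\<tau> \<gamma>. if \<gamma> \<in> Disc then F \<tau> (inv_into Disc \<sigma> \<gamma>) else 0)"

text \<open>Forms have complex coefficients, so absolute irreducibility is irreducibility over the
  complex numbers.\<close>

definition abs_irreducible_S32 :: bool where
  "abs_irreducible_S32 \<longleftrightarrow>
     form.subspace S32 \<and> S32 \<noteq> {0} \<and> (\<forall>\<sigma>\<in>O_disc. act \<sigma> ` S32 \<subseteq> S32) \<and>
     (\<forall>W. form.subspace W \<and> W \<subseteq> S32 \<and> (\<forall>\<sigma>\<in>O_disc. act \<sigma> ` W \<subseteq> W) \<longrightarrow> W = {0} \<or> W = S32)"


section \<open>The echelon basis\<close>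

text \<open>The reduced row echelon form depends on a total order of the Fourier indices
  \<open>(\<gamma>, e)\<close>.  They are ordered by increasing exponent \<open>e\<close>; ties are broken by enumerating the
  discriminant group as \<open>G4\<inverse> n + L4\<close> with \<open>n\<close> running lexicographically through the triples of
  natural numbers, each class being placed at its first occurrence.  The signs and positions of
  the off-diagonal entries of \<open>B_S\<close> depend on the tie-breaking.\<close>

definition labels :: "coset \<Rightarrow> (nat \<times> nat \<times> nat) set" where
  "labels \<gamma> = {(a, b, c). \<exists>v\<in>\<gamma>. G4 *v v = vector [real a, real b, real c]}"

definition disc_less :: "coset \<Rightarrow> coset \<Rightarrow> bool" where
  "disc_less \<gamma> \<delta> \<longleftrightarrow>
     (\<exists>n\<in>labels \<gamma>. \<forall>m\<in>labels \<delta>. (n, m) \<in> less_than <*lex*> less_than <*lex*> less_than)"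

type_synonym findex = "coset \<times> real"

definition findices :: "findex set" where
  "findices = {(\<gamma>, e). \<gamma> \<in> Disc \<and> e - disc_q \<gamma> \<in> \<int>}"

definition findex_less :: "findex \<Rightarrow> findex \<Rightarrow> bool" where
  "findex_less s s' \<longleftrightarrow> snd s < snd s' \<or> (snd s = snd s' \<and> disc_less (fst s) (fst s'))"

abbreviation coeff_at :: "form \<Rightarrow> findex \<Rightarrow> complex" where
  "coeff_at F s \<equiv> fourier_coeff F (fst s) (snd s)"

text \<open>Families of four basis elements are indexed by the type \<open>4\<close>, in the order 1, 2, 3, 4
  (note that the literal 4 denotes the same element as 0).\<close>

definition is_echelon_basis :: "(4 \<Rightarrow> form) \<Rightarrow> bool" where
  "is_echelon_basis b \<longleftrightarrow>
     inj b \<and> form.independent (range b) \<and> form.span (range b) = S32 \<and>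
     (\<exists>p :: 4 \<Rightarrow> findex.
        range p \<subseteq> findices \<and>
        findex_less (p 1) (p 2) \<and> findex_less (p 2) (p 3) \<and> findex_less (p 3) (p 4) \<and>
        (\<forall>i. \<forall>s\<in>findices. findex_less s (p i) \<longrightarrow> coeff_at (b i) s = 0) \<and>
        (\<forall>i j. coeff_at (b j) (p i) = (if j = i then 1 else 0)))"

definition echelon_basis :: "4 \<Rightarrow> form" where
  "echelon_basis = (THE b. is_echelon_basis b)"

definition P32 :: "complex^4^4" where
  "P32 = (\<chi> i j. petersson (echelon_basis i) (echelon_basis j))"

definition rep_matrix :: "(coset \<Rightarrow> coset) \<Rightarrow> complex^4^4" where
  "rep_matrix \<sigma> = (THE R. \<forall>j. act \<sigma> (echelon_basis j) =
     (\<Sum>i\<in>UNIV. form_scale (R $ i $ j) (echelon_basis i)))"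

definition invariant_symmetric :: "complex^4^4 \<Rightarrow> bool" where
  "invariant_symmetric B \<longleftrightarrow> transpose B = B \<and>
     (\<forall>\<sigma>\<in>O_disc. transpose (rep_matrix \<sigma>) ** B ** rep_matrix \<sigma> = B)"

definition BS :: "real^4^4" where
  "BS = vector [vector [4/3, 0, 0, -2/3],
                vector [0, 4/3, 2/3, 0],
                vector [0, 2/3, 4/3, 0],
                vector [-2/3, 0, 0, 4/3]]"

abbreviation BSc :: "complex^4^4" where
  "BSc \<equiv> map_matrix of_real BS"


section \<open>The root lattice of type A2 + A2\<close>

definition A2 :: "(real^3) set" where
  "A2 = {x. (\<forall>i. x $ i \<in> \<int>) \<and> (\<Sum>i\<in>UNIV. x $ i) = 0}"

definition is_gram_of_lattice :: "real^4^4 \<Rightarrow> 'a::real_inner set \<Rightarrow> bool" where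
  "is_gram_of_lattice B \<Lambda> \<longleftrightarrow> (\<exists>v :: 4 \<Rightarrow> 'a.
     inj v \<and> independent (range v) \<and>
     \<Lambda> = {x. \<exists>k :: 4 \<Rightarrow> int. x = (\<Sum>i\<in>UNIV. of_int (k i) *\<^sub>R v i)} \<and>
     (\<forall>i j. v i \<bullet> v j = B $ i $ j))"


section \<open>Reflective slots, orientations and shadows\<close>

definition slots :: "findex set" where
  "slots = {(\<mu>, m). \<mu> \<in> Disc \<and> m \<in> {1/12, 1/6} \<and> m - disc_q \<mu> \<in> \<int>}"

definition slot_neg :: "findex \<Rightarrow> findex" where
  "slot_neg s = (uminus ` fst s, snd s)"

definition deck :: "real^3^3" where
  "deck = vector [vector [46, 69, -75], vector [30, 43, -48], vector [55, 81, -89]]"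

definition slot_deck :: "findex \<Rightarrow> findex" where
  "slot_deck s = ((*v) deck ` fst s, snd s)"

text \<open>A choice of one representative in each pair \<open>{\<mu>, -\<mu>}\<close> of slots, such that the
  representatives are permuted by the order-three isometry.\<close>

definition slot_reps :: "findex set \<Rightarrow> bool" where
  "slot_reps Q \<longleftrightarrow> Q \<subseteq> slots \<and> slot_deck ` Q = Q \<and>
     (\<forall>s\<in>slots. (s \<in> Q) \<noteq> (slot_neg s \<in> Q))"

definition Phi :: "findex \<Rightarrow> complex^4" where
  "Phi s = (\<chi> i. coeff_at (echelon_basis i) s)"

definition orientation :: "findex set \<Rightarrow> (findex \<Rightarrow> int) \<Rightarrow> bool" where
  "orientation Q \<epsilon> \<longleftrightarrow> (\<forall>s\<in>Q. \<epsilon> s \<in> {1, -1})"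

definition deck_invariant :: "findex set \<Rightarrow> (findex \<Rightarrow> int) \<Rightarrow> bool" where
  "deck_invariant Q \<epsilon> \<longleftrightarrow> (\<forall>s\<in>Q. \<epsilon> (slot_deck s) = \<epsilon> s)"

definition flip :: "findex \<Rightarrow> (findex \<Rightarrow> int) \<Rightarrow> findex \<Rightarrow> int" where
  "flip s \<epsilon> = \<epsilon>(s := - \<epsilon> s)"

definition lam :: "findex set \<Rightarrow> (findex \<Rightarrow> int) \<Rightarrow> complex^4" where
  "lam Q \<epsilon> = (\<Sum>s\<in>Q. of_int (\<epsilon> s) *s Phi s)"

definition r_val :: "findex set \<Rightarrow> (findex \<Rightarrow> int) \<Rightarrow> complex" where
  "r_val Q \<epsilon> = (\<Sum>i\<in>UNIV. \<Sum>j\<in>UNIV. lam Q \<epsilon> $ i * matrix_inv BSc $ i $ j * lam Q \<epsilon> $ j)"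

text \<open>\<open>\<Xi>\<close> represents, in the second argument of the Petersson product, the linear functional
  whose value on the \<open>i\<close>-th echelon basis element is \<open>\<lambda> i\<close>.\<close>

definition is_shadow :: "findex set \<Rightarrow> (findex \<Rightarrow> int) \<Rightarrow> form \<Rightarrow> bool" where
  "is_shadow Q \<epsilon> \<Xi> \<longleftrightarrow> \<Xi> \<in> S32 \<and> (\<forall>i. petersson (echelon_basis i) \<Xi> = lam Q \<epsilon> $ i)"

definition shadow :: "findex set \<Rightarrow> (findex \<Rightarrow> int) \<Rightarrow> form" where
  "shadow Q \<epsilon> = (THE \<Xi>. is_shadow Q \<epsilon> \<Xi>)"

definition norm_sq :: "form \<Rightarrow> complex" where
  "norm_sq F = petersson F F"

end

theory Submission
  imports Defs "HOL-Complex_Analysis.Complex_Analysis"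
begin

text \<open>The discriminant form is the sum of three copies of a form on \<open>\<int>/2\<close> and two copies of a form on
  \<open>\<int>/3\<close>; its orthogonal group permutes the five summands, with signs on the last two.  The product
  of \<open>\<eta>\<^sup>2\<close> and a unary theta series, tensored with an alternating and an odd vector, is a cusp form, and
  four of its translates under the group are the echelon basis.  They span because a cusp form is
  determined by its coefficients at exponent \<open>1/12\<close> (otherwise its invariant norm would vanish at the cusp
  to too high an order), and because pairing it with theta vectors of complementary type yields scalar
  modular forms of small weight whose vanishing constant terms are two linear relations between these
  coefficients.  Four explicit isometries then force every invariant form, in particular the Petersson
  product, to be a multiple of \<open>BS\<close>; all statements on shadows follow by linear algebra over the rationals.\<close>

section \<open>Series of exponentials of quadratic polynomials\<close>

text \<open>The dimension is caught between two bounds. Twelve classes carry a coefficient at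
  exponent 1/12; oddness pairs them off, and \<open>S32_coeff_relation\<close>, applied to a form
  and to its image under the exchange of the two 3-parts, removes two more. So at most four
  coefficients are free, and the four translates of the theta product realise them. The relation
  rests on pairings that start at q^(2/3). This order exceeds k/12 for weight k <= 6, so such a
  pairing vanishes identically; at weight 10 its quotient by \<open>eta\<close>^16 has weight 2, and
  a primitive of the quotient is invariant, which kills the constant term. The plain theta vectors
  give a single equation. This is why the gradient forms appear: they replace the leading
  coefficients 2 and 3 by -10 and -9, still with admissible weights, and together the equations form
  a nonsingular system. On the side of the shadows, all ratios come from geometry: the slot columns
  of \<open>Phi\<close> are roots of one A2 summand (exponent 1/12) or sums of one root from each
  summand (exponent 1/6).\<close>

lemma e2pi_add: "e2pi (x + y) = e2pi x * e2pi y"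
  by (simp add: e2pi_def ring_distribs exp_add)

lemma e2pi_diff: "e2pi (x - y) = e2pi x / e2pi y"
  by (simp add: e2pi_def ring_distribs exp_diff)

lemma e2pi_minus: "e2pi (- x) = inverse (e2pi x)"
  by (simp add: e2pi_def exp_minus)

lemma e2pi_0 [simp]: "e2pi 0 = 1"
  by (simp add: e2pi_def)

lemma e2pi_nz [simp]: "e2pi x \<noteq> 0"
  by (simp add: e2pi_def)

lemma e2pi_of_int [simp]: "e2pi (of_int n) = 1"
  unfolding e2pi_def using exp_integer_2pi[of "of_int n"] by (simp add: mult_ac)

lemma e2pi_eq_1_iff: "e2pi x = 1 \<longleftrightarrow> x \<in> \<int>"
  by (auto simp: e2pi_def complex_is_Int_iff exp_eq_1 elim!: Ints_cases)

lemma norm_e2pi: "norm (e2pi x) = exp (- 2 * pi * Im x)"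
  by (simp add: e2pi_def)

lemma e2pi_power: "e2pi x ^ n = e2pi (of_nat n * x)"
  by (simp add: e2pi_def exp_of_nat_mult[symmetric] mult_ac)

lemma holomorphic_e2pi [holomorphic_intros]:
  "f holomorphic_on S \<Longrightarrow> (\<lambda>z. e2pi (f z)) holomorphic_on S"
  unfolding e2pi_def by (intro holomorphic_intros)

lemma summable_exp_abs_int: "(\<lambda>n::int. exp (- \<bar>real_of_int n\<bar>)) summable_on UNIV"
proof -
  have nat: "(\<lambda>n::nat. exp (- real n)) summable_on UNIV"
  proof -
    have "summable (\<lambda>n::nat. exp (-1::real) ^ n)"
      by (rule summable_geometric) simp
    then have "summable (\<lambda>n::nat. exp (- real n))"
      by (simp add: exp_of_nat_mult[symmetric])
    then show ?thesis
      by (subst summable_on_UNIV_nonneg_real_iff) auto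
  qed
  have 1: "(\<lambda>n::int. exp (- \<bar>real_of_int n\<bar>)) summable_on range int"
    by (subst summable_on_reindex) (auto simp: inj_on_def o_def nat)
  have 2: "(\<lambda>n::int. exp (- \<bar>real_of_int n\<bar>)) summable_on range (\<lambda>n. - int n)"
    by (subst summable_on_reindex) (auto simp: inj_on_def o_def nat)
  have "UNIV = range int \<union> range (\<lambda>n. - int n)"
  proof -
    have "z \<in> range int \<union> range (\<lambda>n. - int n)" for z
      by (cases z rule: int_cases2) auto
    then show ?thesis by blast
  qed
  moreover have "(\<lambda>n::int. exp (- \<bar>real_of_int n\<bar>)) summable_on (range int \<union> range (\<lambda>n. - int n))"
    using summable_on_union[OF 1 2] .
  ultimately show ?thesis by simp
qed

lemma summable_gauss_int:
  assumes "a > 0"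
  shows "(\<lambda>n::int. c * exp (- a * real_of_int n ^ 2 + b * \<bar>real_of_int n\<bar>)) summable_on UNIV"
proof (rule summable_on_cmult_right, rule summable_on_comparison_test)
  show "(\<lambda>n::int. exp ((b + 1)\<^sup>2 / (4 * a)) * exp (- \<bar>real_of_int n\<bar>)) summable_on UNIV"
    by (intro summable_on_cmult_right summable_exp_abs_int)
next
  fix n :: int
  define x where "x = \<bar>real_of_int n\<bar>"
  \<comment> \<open>Completing the square: the constant (b + 1)^2 / (4a) absorbs the linear term and
    leaves the summable majorant exp(-|n|).\<close>
  have "0 \<le> (2 * a * x - (b + 1))\<^sup>2 / (4 * a)"
    using assms by simp
  also have "\<dots> = a * x\<^sup>2 - (b + 1) * x + (b + 1)\<^sup>2 / (4 * a)"
    using assms by (simp add: field_simps power2_eq_square)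
  finally have "- a * x\<^sup>2 + b * x \<le> (b + 1)\<^sup>2 / (4 * a) - x"
    by (simp add: algebra_simps)
  then have "exp (- a * x\<^sup>2 + b * x) \<le> exp ((b + 1)\<^sup>2 / (4 * a) - x)"
    by simp
  then show "exp (- a * real_of_int n ^ 2 + b * \<bar>real_of_int n\<bar>)
      \<le> exp ((b + 1)\<^sup>2 / (4 * a)) * exp (- \<bar>real_of_int n\<bar>)"
    by (simp add: x_def exp_add[symmetric])
qed auto

text \<open>The Weierstrass M-test on a closed disc around each point gives uniform convergence of
  the finite partial sums, and uniform limits of holomorphic functions are holomorphic.\<close>

lemma holomorphic_infsum:
  fixes f :: "'i \<Rightarrow> complex \<Rightarrow> complex"
  assumes "open S" and hol: "\<And>i. i \<in> I \<Longrightarrow> f i holomorphic_on S"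
    and bnd: "\<And>z. z \<in> S \<Longrightarrow> \<exists>d>0. \<exists>M. cball z d \<subseteq> S \<and> M summable_on I \<and>
                 (\<forall>i\<in>I. \<forall>w\<in>cball z d. norm (f i w) \<le> M i)"
  shows "(\<lambda>z. \<Sum>\<^sub>\<infinity>i\<in>I. f i z) holomorphic_on S"
proof -
  have "\<exists>f'. ((\<lambda>z. \<Sum>\<^sub>\<infinity>i\<in>I. f i z) has_field_derivative f') (at z)" if z: "z \<in> S" for z
  proof -
    obtain d M where d: "d > 0" "cball z d \<subseteq> S" "M summable_on I"
      "\<And>i w. i \<in> I \<Longrightarrow> w \<in> cball z d \<Longrightarrow> norm (f i w) \<le> M i"
      using bnd[OF z] by blast
    have ul: "uniform_limit (cball z d) (\<lambda>X y. \<Sum>x\<in>X. f x y) (\<lambda>y. \<Sum>\<^sub>\<infinity>x\<in>I. f x y) (finite_subsets_at_top I)"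
      by (rule Weierstrass_m_test_general) (use d in auto)
    have ev: "\<forall>\<^sub>F X in finite_subsets_at_top I. continuous_on (cball z d) (\<lambda>y. \<Sum>x\<in>X. f x y) \<and>
        (\<lambda>y. \<Sum>x\<in>X. f x y) holomorphic_on ball z d"
    proof (rule eventually_finite_subsets_at_top_weakI)
      fix X assume X: "finite X" "X \<subseteq> I"
      have "(\<lambda>y. \<Sum>x\<in>X. f x y) holomorphic_on S"
        using X hol by (intro holomorphic_on_sum) auto
      then show "continuous_on (cball z d) (\<lambda>y. \<Sum>x\<in>X. f x y) \<and>
        (\<lambda>y. \<Sum>x\<in>X. f x y) holomorphic_on ball z d"
        using d ball_subset_cball by (meson holomorphic_on_imp_continuous_on holomorphic_on_subset)
    qed
    have "(\<lambda>y. \<Sum>\<^sub>\<infinity>x\<in>I. f x y) holomorphic_on ball z d"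
      by (rule holomorphic_uniform_limit[OF ev ul]) auto
    then show ?thesis
      using d by (meson centre_in_ball holomorphic_derivI open_ball)
  qed
  then show ?thesis
    using assms(1) by (simp add: holomorphic_on_open)
qed

text \<open>A theta series with the linear and constant terms of the exponent kept as separate
  arguments, so that every translation law becomes a shift of the summation index.\<close>

definition qs :: "complex \<Rightarrow> complex \<Rightarrow> complex \<Rightarrow> complex" where
  "qs A B C = (\<Sum>\<^sub>\<infinity>n::int. e2pi (of_int n ^ 2 * A + of_int n * B + C))"

text \<open>Only a lower bound of Im A and upper bounds of |B| and |C| enter, so a single majorant
  serves a whole disc of parameters.\<close>

lemma norm_quad_le:
  assumes "Im A \<ge> \<alpha>" "norm B \<le> \<beta>" "norm C \<le> \<gamma>"
  shows "norm (e2pi (of_int n ^ 2 * A + of_int n * B + C))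
    \<le> exp (2 * pi * \<gamma>) * exp (- (2 * pi * \<alpha>) * real_of_int n ^ 2 + (2 * pi * \<beta>) * \<bar>real_of_int n\<bar>)"
proof -
  have 1: "Im (of_int n ^ 2 * A) = real_of_int n ^ 2 * Im A"
    by (simp flip: of_int_power)
  have 2: "Im (of_int n * B) \<ge> - (\<bar>real_of_int n\<bar> * \<beta>)"
  proof -
    have "\<bar>Im (of_int n * B)\<bar> \<le> norm (of_int n * B)" by (rule abs_Im_le_cmod)
    also have "\<dots> \<le> \<bar>real_of_int n\<bar> * \<beta>" using assms by (simp add: norm_mult mult_left_mono)
    finally show ?thesis by linarith
  qed
  have 3: "Im C \<ge> - \<gamma>" using abs_Im_le_cmod[of C] assms by linarith
  have 4: "real_of_int n ^ 2 * Im A \<ge> real_of_int n ^ 2 * \<alpha>" using assms by (simp add: mult_left_mono)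
  have 5: "Im (of_int n ^ 2 * A + of_int n * B + C) \<ge> real_of_int n ^ 2 * \<alpha> - \<bar>real_of_int n\<bar> * \<beta> - \<gamma>"
    using 1 2 3 4 unfolding plus_complex.sel by linarith
  have "2 * pi * Im (of_int n ^ 2 * A + of_int n * B + C) \<ge> 2 * pi * (real_of_int n ^ 2 * \<alpha> - \<bar>real_of_int n\<bar> * \<beta> - \<gamma>)"
    using 5 by (intro mult_left_mono) auto
  then show ?thesis
    unfolding norm_e2pi exp_add[symmetric] by (simp add: algebra_simps)
qed

lemma abs_summable_quad:
  assumes "Im A > 0"
  shows "(\<lambda>n::int. norm (e2pi (of_int n ^ 2 * A + of_int n * B + C))) summable_on UNIV"
proof (rule summable_on_comparison_test)
  show "(\<lambda>n::int. exp (2 * pi * norm C) * exp (- (2 * pi * Im A) * real_of_int n ^ 2 + (2 * pi * norm B) * \<bar>real_of_int n\<bar>)) summable_on UNIV"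
    using assms by (intro summable_gauss_int) simp
qed (use norm_quad_le[of "Im A" A B "norm B" C "norm C"] in simp_all)

lemma qs_has_sum:
  assumes "Im A > 0"
  shows "((\<lambda>n::int. e2pi (of_int n ^ 2 * A + of_int n * B + C)) has_sum qs A B C) UNIV"
  unfolding qs_def by (rule has_sum_infsum, rule abs_summable_summable, rule abs_summable_quad[OF assms])

lemma holomorphic_qs:
  assumes S: "open S" and hol: "A holomorphic_on S" "B holomorphic_on S" "C holomorphic_on S"
    and pos: "\<And>z. z \<in> S \<Longrightarrow> Im (A z) > 0"
  shows "(\<lambda>z. qs (A z) (B z) (C z)) holomorphic_on S"
  unfolding qs_def
proof (rule holomorphic_infsum[OF S])
  fix n :: int
  show "(\<lambda>z. e2pi (of_int n ^ 2 * A z + of_int n * B z + C z)) holomorphic_on S"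
    by (intro holomorphic_intros hol)
next
  fix z assume z: "z \<in> S"
  obtain d where d: "d > 0" "cball z d \<subseteq> S" using S z open_contains_cball by blast
  have cont: "continuous_on (cball z d) A" "continuous_on (cball z d) B" "continuous_on (cball z d) C"
    using hol d(2) by (meson holomorphic_on_imp_continuous_on continuous_on_subset)+
  have ne: "cball z d \<noteq> {}" using d by auto
  have "continuous_on (cball z d) (\<lambda>w. Im (A w))"
    using cont by (intro continuous_intros)
  from continuous_attains_inf[OF compact_cball ne this]
  obtain w0 where w0: "w0 \<in> cball z d" "\<And>w. w \<in> cball z d \<Longrightarrow> Im (A w0) \<le> Im (A w)" by blast
  have "bounded (B ` cball z d)" "bounded (C ` cball z d)"
    using cont by (auto intro!: compact_continuous_image compact_imp_bounded)
  then obtain \<beta> \<gamma> where "\<forall>w\<in>cball z d. norm (B w) \<le> \<beta>" "\<forall>w\<in>cball z d. norm (C w) \<le> \<gamma>"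
    unfolding bounded_iff by auto
  then have bd: "\<And>w. w \<in> cball z d \<Longrightarrow> norm (B w) \<le> \<beta>" "\<And>w. w \<in> cball z d \<Longrightarrow> norm (C w) \<le> \<gamma>"
    by blast+
  have "Im (A w0) > 0" using pos w0(1) d(2) by blast
  then have "(\<lambda>n::int. exp (2 * pi * \<gamma>) * exp (- (2 * pi * Im (A w0)) * real_of_int n ^ 2 + (2 * pi * \<beta>) * \<bar>real_of_int n\<bar>)) summable_on UNIV"
    by (intro summable_gauss_int) simp
  moreover have "norm (e2pi (of_int n ^ 2 * A w + of_int n * B w + C w))
      \<le> exp (2 * pi * \<gamma>) * exp (- (2 * pi * Im (A w0)) * real_of_int n ^ 2 + (2 * pi * \<beta>) * \<bar>real_of_int n\<bar>)"
    if "w \<in> cball z d" for w n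
    using that by (intro norm_quad_le w0 bd)
  ultimately show "\<exists>d>0. \<exists>M. cball z d \<subseteq> S \<and> M summable_on (UNIV::int set) \<and>
        (\<forall>n\<in>UNIV. \<forall>w\<in>cball z d. norm (e2pi (of_int n ^ 2 * A w + of_int n * B w + C w)) \<le> M n)"
    using d by blast
qed

lemma qs_const: "qs A B C = e2pi C * qs A B 0"
  unfolding qs_def by (simp add: e2pi_add infsum_cmult_right'[symmetric] mult_ac)

text \<open>Reindexing by k. In \<open>theta_inversion_imag\<close> this yields the
  quasi-periodicity of the theta function and the periodicity of its transform.\<close>

lemma qs_shift: "qs A (B + 2 * of_int k * A) (C + of_int k ^ 2 * A + of_int k * B) = qs A B C"
proof -
  have "qs A B C = (\<Sum>\<^sub>\<infinity>n::int. e2pi (of_int (n + k) ^ 2 * A + of_int (n + k) * B + C))"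
    unfolding qs_def
    by (rule infsum_reindex_bij_witness[of _ "\<lambda>n. n + k" "\<lambda>n. n - k"]) auto
  also have "\<dots> = qs A (B + 2 * of_int k * A) (C + of_int k ^ 2 * A + of_int k * B)"
    unfolding qs_def by (intro infsum_cong arg_cong[of _ _ e2pi]) (simp add: algebra_simps power2_eq_square)
  finally show ?thesis by simp
qed

lemma qs_reflect: "qs A (- B) C = qs A B C"
  unfolding qs_def
  by (rule infsum_reindex_bij_witness[of _ uminus uminus]) auto

lemma qs_add_int: "qs A (B + of_int k) C = qs A B C"
  unfolding qs_def
proof (intro infsum_cong)
  fix n :: int
  have "of_int n ^ 2 * A + of_int n * (B + of_int k) + C = (of_int n ^ 2 * A + of_int n * B + C) + of_int (n * k)"
    by (simp add: algebra_simps)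
  then show "e2pi (of_int n ^ 2 * A + of_int n * (B + of_int k) + C) = e2pi (of_int n ^ 2 * A + of_int n * B + C)"
    by (simp only: e2pi_add e2pi_of_int mult_1_right)
qed

lemma infsum_int_split:
  fixes g :: "int \<Rightarrow> complex"
  assumes "N > 0" "g summable_on UNIV"
  shows "infsum g UNIV = (\<Sum>j<N. \<Sum>\<^sub>\<infinity>m::int. g (int N * m + int j))"
proof -
  have bij: "bij_betw (\<lambda>(j, m). int N * m + int j) ({..<N} \<times> UNIV) UNIV"
  proof (rule bij_betwI[where g = "\<lambda>k. (nat (k mod int N), k div int N)"])
    show "(\<lambda>k. (nat (k mod int N), k div int N)) \<in> UNIV \<rightarrow> {..<N} \<times> UNIV"
      using assms(1) by (auto simp: nat_less_iff)
    show "(nat ((case x of (j, m) \<Rightarrow> int N * m + int j) mod int N), (case x of (j, m) \<Rightarrow> int N * m + int j) div int N) = x"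
      if "x \<in> {..<N} \<times> UNIV" for x
      using that by (cases x) simp
    show "(case (nat (y mod int N), y div int N) of (j, m) \<Rightarrow> int N * m + int j) = y" for y
      using assms(1) by simp
  qed simp
  have eq: "(\<lambda>x. g (case x of (j, m) \<Rightarrow> int N * m + int j)) = (\<lambda>(j, m). g (int N * m + int j))"
    by auto
  have s: "(\<lambda>(j, m). g (int N * m + int j)) summable_on ({..<N} \<times> UNIV)"
    using summable_on_reindex_bij_betw[OF bij, of g] assms(2) unfolding eq by blast
  have "infsum g UNIV = infsum (\<lambda>(j, m). g (int N * m + int j)) ({..<N} \<times> UNIV)"
    using infsum_reindex_bij_betw[OF bij, of g] unfolding eq by (rule sym)
  also have "\<dots> = (\<Sum>\<^sub>\<infinity>j\<in>{..<N}. \<Sum>\<^sub>\<infinity>m::int. g (int N * m + int j))"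
    by (rule infsum_Sigma'_banach[OF s, symmetric])
  also have "\<dots> = (\<Sum>j<N. \<Sum>\<^sub>\<infinity>m::int. g (int N * m + int j))"
    by (rule infsum_finite) simp
  finally show ?thesis .
qed

section \<open>The inversion formula for theta series\<close>

lemma const_of_zero_deriv:
  fixes P :: "complex \<Rightarrow> complex"
  assumes "\<And>z. (P has_field_derivative 0) (at z)"
  shows "P x = P y"
  using has_field_derivative_zero_constant[of UNIV P] assms by fastforce

lemma entire_primitive:
  assumes "f holomorphic_on UNIV"
  shows "\<exists>G. \<forall>z. (G has_field_derivative f z) (at z)"
  using holomorphic_convex_primitive'[of UNIV f] assms by auto

lemma entire_deriv:
  assumes "f holomorphic_on UNIV"
  shows "(f has_field_derivative deriv f z) (at z)"
  using assms by (simp add: holomorphic_derivI[of f UNIV])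

text \<open>Chernoff's argument: dividing by \<open>e(z) - 1\<close> makes the Fourier coefficients telescope.\<close>

lemma entire_periodic_eq_0:
  fixes d :: "complex \<Rightarrow> complex"
  assumes hol: "d holomorphic_on UNIV" and per: "\<And>z. d (z + 1) = d z"
    and coeff: "\<And>n::int. \<exists>H. (\<forall>z. (H has_field_derivative d z * e2pi (- of_int n * z)) (at z)) \<and> H 1 = H 0"
  shows "d z0 = 0"
proof -
  define c where "c = d z0"
  define E where "E = (\<lambda>z. e2pi (z - z0) - 1)"
  \<comment> \<open>The quotient of d - c by E, completed at its removable singularities (the zeros
    of E) by the quotient of derivatives.\<close>
  define g where "g = (\<lambda>z. if E z = 0 then deriv d z / deriv E z else (d z - c) / E z)"
  have perI: "d (z + of_int k) = d z" for z k
  proof -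
    have nat: "d (z + of_nat m) = d z" for z m
      by (induction m) (auto simp: per add.assoc[symmetric] add.commute[of 1])
    show ?thesis
    proof (cases k rule: int_cases2)
      case (nonneg m) then show ?thesis using nat[of z m] by simp
    next
      case (nonpos m) then show ?thesis using nat[of "z - of_nat m" m] by simp
    qed
  qed
  have E0: "E z = 0 \<longleftrightarrow> z - z0 \<in> \<int>" for z
    by (simp add: E_def e2pi_eq_1_iff)
  have d0: "d z = c" if "E z = 0" for z
  proof -
    from that have "z - z0 \<in> \<int>" by (simp add: E0)
    then obtain k where "z - z0 = of_int k" by (elim Ints_cases)
    then have "z = z0 + of_int k" by (simp add: algebra_simps)
    then show ?thesis by (simp add: perI c_def)
  qed
  have derE: "(E has_field_derivative 2 * of_real pi * \<i> * e2pi (z - z0)) (at z)" for z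
    unfolding E_def e2pi_def by (auto intro!: derivative_eq_intros)
  have holE: "E holomorphic_on UNIV"
    unfolding E_def by (intro holomorphic_intros)
  have gE: "g z * E z = d z - c" for z
    by (simp add: g_def d0)
  have holg: "g holomorphic_on UNIV"
  proof -
    have "\<exists>f'. (g has_field_derivative f') (at p)" for p
    proof (cases "E p = 0")
      case False
      have "isCont E p" by (rule DERIV_isCont[OF derE])
      then have "(E \<longlongrightarrow> E p) (nhds p)"
        by (simp add: isCont_def tendsto_at_iff_tendsto_nhds)
      then have "\<forall>\<^sub>F z in nhds p. E z \<noteq> 0"
        using False by (rule tendsto_imp_eventually_ne)
      then have "\<forall>\<^sub>F z in nhds p. g z = (d z - c) / E z"
        by eventually_elim (simp add: g_def)
      moreover have "\<exists>f'. ((\<lambda>z. (d z - c) / E z) has_field_derivative f') (at p)"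
      proof -
        from DERIV_divide[OF DERIV_diff[OF entire_deriv[OF hol] DERIV_const] derE False] show ?thesis by blast
      qed
      ultimately show ?thesis by (metis DERIV_cong_ev)
    next
      case True
      \<comment> \<open>Near a zero p of E the function g is the ratio of the difference quotients
        of d and E at p. Both are entire, and the second is nonzero at p because E has only simple
        zeros.\<close>
      define \<phi> where "\<phi> = (\<lambda>z. if z = p then deriv d p else (d z - d p) / (z - p))"
      define \<psi> where "\<psi> = (\<lambda>z. if z = p then deriv E p else (E z - E p) / (z - p))"
      have h: "\<phi> holomorphic_on UNIV" "\<psi> holomorphic_on UNIV"
        unfolding \<phi>_def \<psi>_def by (intro pole_lemma_open hol holE open_UNIV)+
      have "\<psi> p \<noteq> 0" using DERIV_imp_deriv[OF derE[of p]] by (simp add: \<psi>_def)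
      have eq: "g z = \<phi> z / \<psi> z" if "z \<in> ball p 1" for z
      proof (cases "z = p")
        case True then show ?thesis using \<open>E p = 0\<close> by (simp add: g_def \<phi>_def \<psi>_def)
      next
        case False
        have "E z \<noteq> 0"
        proof
          assume "E z = 0"
          then have "z - p \<in> \<int>" using \<open>E p = 0\<close> E0 Ints_diff[of "z - z0" "p - z0"] by simp
          then obtain k where k: "z - p = of_int k" by (elim Ints_cases)
          have "norm (z - p) < 1" using that by (simp add: dist_norm norm_minus_commute)
          then have "k = 0" using k by simp
          then show False using k False by simp
        qed
        then show ?thesis using False True d0[OF True] by (simp add: g_def \<phi>_def \<psi>_def)
      qed
      have "\<forall>\<^sub>F z in nhds p. z \<in> ball p 1" by (rule eventually_nhds_in_open) auto
      then have ev: "\<forall>\<^sub>F z in nhds p. g z = \<phi> z / \<psi> z" by eventually_elim (rule eq)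
      from DERIV_divide[OF entire_deriv[OF h(1)] entire_deriv[OF h(2)] \<open>\<psi> p \<noteq> 0\<close>]
      show ?thesis by (metis DERIV_cong_ev[OF refl ev refl])
    qed
    then show ?thesis by (simp add: holomorphic_on_open)
  qed
  have Eper: "E (z + 1) = E z" for z
    using e2pi_of_int[of 1] by (simp add: E_def e2pi_add e2pi_diff)
  have derper: "deriv f (z + 1) = deriv f z" if "f holomorphic_on UNIV" "\<And>z. f (z + 1) = f z" for f z
  proof -
    have "(f has_field_derivative deriv f (z + 1)) (at (z + 1))"
      by (rule entire_deriv[OF that(1)])
    then have "((\<lambda>x. f (x + 1)) has_field_derivative deriv f (z + 1)) (at z)"
      by (simp add: DERIV_shift)
    then show ?thesis using that(2) DERIV_imp_deriv by (simp add: DERIV_imp_deriv)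
  qed
  have gper: "g (z + 1) = g z" for z
    unfolding g_def Eper per using derper[OF hol per] derper[OF holE Eper] by simp
  have "\<exists>G. \<forall>z. (G has_field_derivative g z * e2pi (- of_int n * z)) (at z)" for n :: int
    using holg by (intro entire_primitive holomorphic_intros)
  then obtain G where G: "\<And>n z. (G n has_field_derivative g z * e2pi (- of_int n * z)) (at z)"
    by metis
  \<comment> \<open>The n-th Fourier coefficient of g, written as the increment of a primitive over
    a period instead of an integral.\<close>
  define A where "A = (\<lambda>n. G n 1 - G n 0)"
  have Gper: "G n (z + 1) - G n z = A n" for n z
  proof -
    have "((\<lambda>z. G n (z + 1) - G n z) has_field_derivative 0) (at z)" for z
    proof -
      have "((\<lambda>z. G n (z + 1)) has_field_derivative g (z + 1) * e2pi (- of_int n * (z + 1))) (at z)"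
        using G[of n "z + 1"] by (simp add: DERIV_shift)
      from DERIV_diff[OF this G[of n z]] show ?thesis
        using e2pi_of_int[of "- n"] by (simp add: gper ring_distribs e2pi_add e2pi_diff e2pi_minus del: e2pi_of_int)
    qed
    from const_of_zero_deriv[OF this, of z 0] show ?thesis by (simp add: A_def)
  qed
  \<comment> \<open>The period may be taken at any height y. There e(-n z) has modulus exp(2 pi n
    y), so a bound of g on one segment controls all coefficients.\<close>
  have Alim: "\<exists>B. \<forall>n. norm (A n) \<le> B * exp (2 * pi * of_int n * y)" for y :: real
  proof -
    define S where "S = closed_segment (Complex 0 y) (Complex 0 y + 1)"
    have "compact (g ` S)" unfolding S_def
      using holg by (intro compact_continuous_image) (auto intro: holomorphic_on_imp_continuous_on holomorphic_on_subset)
    then have "bounded (g ` S)" by (rule compact_imp_bounded)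
    then obtain B where B: "\<forall>w\<in>S. norm (g w) \<le> B" unfolding bounded_iff by auto
    have ImS: "Im w = y" if "w \<in> S" for w
      using that by (auto simp: S_def closed_segment_def algebra_simps)
    have "norm (A n) \<le> B * exp (2 * pi * of_int n * y)" for n
    proof -
      have "norm (G n (Complex 0 y + 1) - G n (Complex 0 y)) \<le> B * exp (2 * pi * of_int n * y) * norm (Complex 0 y + 1 - Complex 0 y)"
      proof (rule field_differentiable_bound[where S = S])
        show "convex S" by (simp add: S_def)
        show "(G n has_field_derivative g w * e2pi (- of_int n * w)) (at w within S)" for w
          using G has_field_derivative_at_within by blast
        show "norm (g w * e2pi (- of_int n * w)) \<le> B * exp (2 * pi * of_int n * y)" if "w \<in> S" for w
          using B ImS that by (simp add: norm_mult norm_e2pi mult.assoc mult_right_mono)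
      qed (auto simp: S_def)
      then show ?thesis by (simp add: Gper)
    qed
    then show ?thesis by blast
  qed
  \<comment> \<open>Comparison of coefficients in g E = d - c. Those of d vanish by hypothesis, so
    the constant c is the only inhomogeneity, at n = 0.\<close>
  have rec: "e2pi (- z0) * A (n - 1) - A n = (if n = 0 then - c else 0)" for n
  proof -
    obtain H where H: "\<And>z. (H has_field_derivative d z * e2pi (- of_int n * z)) (at z)" "H 1 = H 0"
      using coeff by blast
    define K where "K = (\<lambda>z. if n = 0 then z else e2pi (- of_int n * z) / (- (2 * of_real pi * \<i> * of_int n)))"
    have K: "(K has_field_derivative e2pi (- of_int n * z)) (at z)" for z
    proof (cases "n = 0")
      case True then show ?thesis by (simp add: K_def)
    next
      case False
      have "((\<lambda>z. e2pi (- of_int n * z) / (- (2 * of_real pi * \<i> * of_int n))) has_field_derivative e2pi (- of_int n * z)) (at z)"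
        using False unfolding e2pi_def by (auto intro!: derivative_eq_intros)
      then show ?thesis using False by (simp add: K_def)
    qed
    define P where "P = (\<lambda>z. e2pi (- z0) * G (n - 1) z - G n z - H z + c * K z)"
    have "(P has_field_derivative 0) (at z)" for z
    proof -
      have "(P has_field_derivative e2pi (- z0) * (g z * e2pi (- of_int (n - 1) * z)) - g z * e2pi (- of_int n * z)
          - d z * e2pi (- of_int n * z) + c * e2pi (- of_int n * z)) (at z)"
        unfolding P_def by (intro DERIV_add DERIV_diff DERIV_cmult G H K)
      also have "e2pi (- z0) * (g z * e2pi (- of_int (n - 1) * z)) - g z * e2pi (- of_int n * z)
          - d z * e2pi (- of_int n * z) + c * e2pi (- of_int n * z) = (g z * E z - (d z - c)) * e2pi (- of_int n * z)"
      proof -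
        define X where "X = e2pi (- of_int n * z)"
        have 1: "e2pi (- of_int (n - 1) * z) = X * e2pi z"
          by (simp add: X_def e2pi_add[symmetric] algebra_simps)
        have 2: "e2pi (- z0) * e2pi z = E z + 1" by (simp add: E_def e2pi_add[symmetric])
        have "e2pi (- z0) * (g z * (X * e2pi z)) - g z * X - d z * X + c * X
            = (g z * (e2pi (- z0) * e2pi z) - g z - (d z - c)) * X"
          by algebra
        then show ?thesis unfolding 1 X_def[symmetric] unfolding 2 by (simp add: algebra_simps)
      qed
      finally show ?thesis by (simp add: gE)
    qed
    from const_of_zero_deriv[OF this, of 1 0]
    have "e2pi (- z0) * A (n - 1) - A n + c * (K 1 - K 0) = 0"
      using H(2) by (simp add: P_def A_def algebra_simps)
    moreover have "K 1 - K 0 = (if n = 0 then 1 else 0)"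
      using e2pi_of_int[of "- n"] by (simp add: K_def del: e2pi_of_int)
    ultimately show ?thesis by (auto simp: algebra_simps add_eq_0_iff2 split: if_splits)
  qed
  define r where "r = 2 * pi * Im z0"
  have nrec: "norm (A n) = exp r * norm (A (n - 1))" if "n \<noteq> 0" for n
  proof -
    have "A n = e2pi (- z0) * A (n - 1)" using rec[of n] that by simp
    then show ?thesis by (simp add: norm_mult norm_e2pi r_def)
  qed
  have up: "norm (A (int k)) = exp (real k * r) * norm (A 0)" for k
  proof (induction k)
    case (Suc k)
    then show ?case using nrec[of "int (Suc k)"] by (simp add: algebra_simps exp_add)
  qed simp
  have down: "norm (A (- 1 - int k)) = exp (- real k * r) * norm (A (- 1))" for k
  proof (induction k)
    case (Suc k)
    have "norm (A (- 1 - int (Suc k))) = exp (- r) * norm (A (- 1 - int k))"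
      using nrec[of "- 1 - int k"] by (simp add: exp_minus field_simps)
    also have "\<dots> = exp (- r + - real k * r) * norm (A (- 1))"
      unfolding Suc exp_add by simp
    also have "- r + - real k * r = - real (Suc k) * r" by (simp add: algebra_simps)
    finally show ?case .
  qed simp
  have lim0: "x = 0" if "\<And>k::nat. x \<le> B * exp (- (2 * pi * real k))" "x \<ge> 0" for x B :: real
  proof -
    have "(\<lambda>k. B * exp (- (2 * pi * real k))) \<longlonglongrightarrow> B * 0"
    proof (intro tendsto_mult_left)
      show "(\<lambda>k. exp (- (2 * pi * real k))) \<longlonglongrightarrow> 0"
      proof -
        have "(\<lambda>k. exp (- (2 * pi)) ^ k) \<longlonglongrightarrow> 0"
          by (rule LIMSEQ_power_zero) simp
        then show ?thesis by (simp add: exp_of_nat_mult[symmetric] mult.commute)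
      qed
    qed
    then have "x \<le> B * 0" by (rule LIMSEQ_le_const) (use that in auto)
    then show ?thesis using that(2) by simp
  qed
  \<comment> \<open>By the recursion |A n| is exp(n r) |A 0| for n >= 0, with r = 2 pi Im z0; the
    bound at height Im z0 - 1 is smaller by a factor exp(-2 pi n), which forces A 0 = 0. Height Im
    z0 + 1 does the same for negative n.\<close>
  have A0: "A 0 = 0"
  proof -
    obtain B where B: "\<And>n. norm (A n) \<le> B * exp (2 * pi * of_int n * (Im z0 - 1))" using Alim by blast
    have "norm (A 0) \<le> B * exp (- (2 * pi * real k))" for k
    proof -
      have "exp (real k * r) * norm (A 0) \<le> exp (real k * r) * (B * exp (- (2 * pi * real k)))"
        using B[of "int k"] unfolding up by (simp add: r_def algebra_simps exp_add[symmetric] exp_diff exp_minus field_simps)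
      then show ?thesis by simp
    qed
    from lim0[OF this] show ?thesis by simp
  qed
  have A1: "A (- 1) = 0"
  proof -
    obtain B where B: "\<And>n. norm (A n) \<le> B * exp (2 * pi * of_int n * (Im z0 + 1))" using Alim by blast
    define B' where "B' = B * exp (- (2 * pi * (Im z0 + 1)))"
    have "norm (A (- 1)) \<le> B' * exp (- (2 * pi * real k))" for k
    proof -
      have "exp (- real k * r) * norm (A (- 1)) \<le> B * exp (2 * pi * of_int (- 1 - int k) * (Im z0 + 1))"
        using B[of "- 1 - int k"] unfolding down .
      also have "\<dots> = exp (- real k * r) * (B' * exp (- (2 * pi * real k)))"
      proof -
        have "2 * pi * of_int (- 1 - int k) * (Im z0 + 1) = - real k * r + (- (2 * pi * (Im z0 + 1)) + - (2 * pi * real k))"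
          by (simp add: r_def algebra_simps)
        then show ?thesis unfolding B'_def by (simp only: exp_add mult_ac)
      qed
      finally show ?thesis by simp
    qed
    from lim0[OF this] show ?thesis by simp
  qed
  \<comment> \<open>At n = 0 the recursion now reads 0 = - c.\<close>
  show ?thesis using rec[of 0] A0 A1 by (simp add: c_def)
qed

text \<open>Functions with these two periods form a line: translating a period by tau links the
  Fourier coefficients A n and A (n + 1) by a nonzero factor, so all of them vanish with A 0. The
  primitive H expresses that A 0 is zero.\<close>

lemma theta_unique:
  assumes hol: "d holomorphic_on UNIV" and per: "\<And>z. d (z + 1) = d z"
    and quasi: "\<And>z. d (z + \<tau>) = e2pi (- \<tau> / 2 - z) * d z"
    and H0: "\<And>z. (H has_field_derivative d z) (at z)" "H 1 = H 0"
  shows "d z = 0"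
proof (rule entire_periodic_eq_0[OF hol per])
  fix n :: int
  have "\<exists>H. \<forall>z. (H has_field_derivative d z * e2pi (- of_int n * z)) (at z)" for n :: int
    using hol by (intro entire_primitive holomorphic_intros)
  then obtain G where G: "\<And>n z. (G n has_field_derivative d z * e2pi (- of_int n * z)) (at z)"
    by metis
  define A where "A = (\<lambda>n. G n 1 - G n 0)"
  have Gper: "G n (z + 1) - G n z = A n" for n z
  proof -
    have "((\<lambda>z. G n (z + 1) - G n z) has_field_derivative 0) (at z)" for z
    proof -
      have "((\<lambda>z. G n (z + 1)) has_field_derivative d (z + 1) * e2pi (- of_int n * (z + 1))) (at z)"
        using G[of n "z + 1"] by (simp add: DERIV_shift)
      from DERIV_diff[OF this G[of n z]] show ?thesis
        using e2pi_of_int[of "- n"] by (simp add: per ring_distribs e2pi_add e2pi_diff e2pi_minus del: e2pi_of_int)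
    qed
    from const_of_zero_deriv[OF this, of z 0] show ?thesis by (simp add: A_def)
  qed
  have A0: "A 0 = 0"
  proof -
    have "((\<lambda>z. G 0 z - H z) has_field_derivative 0) (at z)" for z
      using DERIV_diff[OF G[of 0 z] H0(1)[of z]] by simp
    from const_of_zero_deriv[OF this, of 1 0] H0(2) show ?thesis by (simp add: A_def)
  qed
  have rec: "A n = e2pi (- \<tau> / 2 - of_int n * \<tau>) * A (n + 1)" for n
  proof -
    define C where "C = e2pi (- \<tau> / 2 - of_int n * \<tau>)"
    have "((\<lambda>z. G n (z + \<tau>) - C * G (n + 1) z) has_field_derivative 0) (at z)" for z
    proof -
      have 1: "((\<lambda>z. G n (z + \<tau>)) has_field_derivative d (z + \<tau>) * e2pi (- of_int n * (z + \<tau>))) (at z)"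
        using G[of n "z + \<tau>"] by (simp add: DERIV_shift)
      have "e2pi (- \<tau> / 2 - z) * e2pi (- of_int n * (z + \<tau>)) = C * e2pi (- of_int (n + 1) * z)"
        unfolding C_def e2pi_add[symmetric] by (rule arg_cong[of _ _ e2pi]) (simp add: algebra_simps)
      then have eq: "d (z + \<tau>) * e2pi (- of_int n * (z + \<tau>)) = C * (d z * e2pi (- of_int (n + 1) * z))"
        unfolding quasi by (simp add: mult_ac)
      from DERIV_diff[OF 1 DERIV_cmult[OF G[of "n + 1" z], of C]] show ?thesis unfolding eq by simp
    qed
    from const_of_zero_deriv[OF this, of 1 0]
    have "G n (\<tau> + 1) - G n \<tau> = C * (G (n + 1) 1 - G (n + 1) 0)"
      by (simp add: algebra_simps)
    then show ?thesis using Gper[of n \<tau>] by (simp add: A_def C_def)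
  qed
  have "A n = 0"
  proof (induction n rule: int_induct[where k = 0])
    case (step1 i) then show ?case using rec[of i] by simp
  next
    case (step2 i) then show ?case using rec[of "i - 1"] by simp
  qed (rule A0)
  then show "\<exists>H. (\<forall>z. (H has_field_derivative d z * e2pi (- of_int n * z)) (at z)) \<and> H 1 = H 0"
    using G[of n] by (intro exI[of _ "G n"]) (auto simp: A_def)
qed

text \<open>All summands are positive reals; this makes the theta values on the imaginary axis
  available as denominators.\<close>

lemma qs_real:
  assumes "t > 0"
  shows "\<exists>x. x > 0 \<and> qs (\<i> * of_real t) 0 0 = of_real x"
proof -
  define f where "f = (\<lambda>n::int. exp (- 2 * pi * t * real_of_int n ^ 2))"
  have eq: "e2pi (of_int n ^ 2 * (\<i> * of_real t) + of_int n * 0 + 0) = of_real (f n)" for n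
  proof -
    have "2 * of_real pi * \<i> * (of_int n ^ 2 * (\<i> * of_real t)) = of_real (- 2 * pi * t * real_of_int n ^ 2)"
      by (simp add: algebra_simps)
    then show ?thesis
      unfolding e2pi_def f_def by (simp only: add_0_right mult_zero_right exp_of_real)
  qed
  have Im: "Im (\<i> * of_real t) > 0" using assms by simp
  have "((\<lambda>n. of_real (f n)) has_sum qs (\<i> * of_real t) 0 0) UNIV"
    using qs_has_sum[OF Im, of 0 0] unfolding eq .
  moreover have s: "f summable_on UNIV"
    using abs_summable_quad[OF Im, of 0 0] unfolding eq by (simp add: f_def)
  ultimately have q: "qs (\<i> * of_real t) 0 0 = of_real (infsum f UNIV)"
    by (metis has_sum_infsum has_sum_of_real has_sum_unique)
  have "infsum f {0} \<le> infsum f UNIV"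
    by (rule infsum_mono_neutral) (use s in \<open>auto simp: f_def\<close>)
  then have "infsum f UNIV > 0" by (simp add: f_def)
  with q show ?thesis by blast
qed

text \<open>As functions of z both sides have the same periodicity in the directions 1 and tau = i
  t, so by \<open>theta_unique\<close> they are proportional. The factor is the quotient of the two
  zeroth Fourier coefficients; its value is determined afterwards.\<close>

lemma theta_inversion_imag:
  assumes "t > 0"
  shows "\<exists>c. \<forall>z. qs (\<i> / (2 * of_real t)) (\<i> * z / of_real t) (\<i> * z\<^sup>2 / (2 * of_real t))
     = c * qs (\<i> * of_real t / 2) z 0"
proof -
  define \<tau> where "\<tau> = \<i> * of_real t"
  have \<tau>: "\<tau> \<noteq> 0" "Im (\<tau> / 2) > 0" "Im (- 1 / (2 * \<tau>)) > 0"
    using assms by (auto simp: \<tau>_def Im_divide power2_eq_square)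
  define f where "f = (\<lambda>z. qs (- 1 / (2 * \<tau>)) (- z / \<tau>) (- z\<^sup>2 / (2 * \<tau>)))"
  define h where "h = (\<lambda>z. qs (\<tau> / 2) z 0)"
  have fper: "f (z + 1) = f z" for z
    unfolding f_def using \<tau>
    by (subst qs_shift[of _ "- z / \<tau>" 1 "- z\<^sup>2 / (2 * \<tau>)", symmetric], intro arg_cong2[of _ _ _ _ "qs (- 1 / (2 * \<tau>))"])
       (simp_all add: field_simps power2_eq_square)
  have fq: "f (z + \<tau>) = e2pi (- \<tau> / 2 - z) * f z" for z
  proof -
    have "f (z + \<tau>) = qs (- 1 / (2 * \<tau>)) (- z / \<tau> + of_int (- 1)) (- z\<^sup>2 / (2 * \<tau>) + (- \<tau> / 2 - z))"
      unfolding f_def using \<tau> by (intro arg_cong2[of _ _ _ _ "qs (- 1 / (2 * \<tau>))"]) (simp_all add: field_simps power2_eq_square)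
    also have "\<dots> = e2pi (- z\<^sup>2 / (2 * \<tau>) + (- \<tau> / 2 - z)) * qs (- 1 / (2 * \<tau>)) (- z / \<tau>) 0"
      unfolding qs_add_int by (rule qs_const)
    also have "\<dots> = e2pi (- \<tau> / 2 - z) * (e2pi (- z\<^sup>2 / (2 * \<tau>)) * qs (- 1 / (2 * \<tau>)) (- z / \<tau>) 0)"
      by (simp only: e2pi_add mult_ac)
    finally show ?thesis unfolding f_def qs_const[of _ _ "- z\<^sup>2 / (2 * \<tau>)"] .
  qed
  have hper: "h (z + 1) = h z" for z unfolding h_def using qs_add_int[of _ z 1] by simp
  have hq: "h (z + \<tau>) = e2pi (- \<tau> / 2 - z) * h z" for z
  proof -
    have "h z = qs (\<tau> / 2) (z + \<tau>) (\<tau> / 2 + z)"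
      unfolding h_def using qs_shift[of "\<tau> / 2" z 1 0] by simp
    then have "h z = e2pi (\<tau> / 2 + z) * h (z + \<tau>)" unfolding h_def by (subst (asm) qs_const) simp
    moreover have "e2pi (- \<tau> / 2 - z) = inverse (e2pi (\<tau> / 2 + z))"
      unfolding e2pi_minus[symmetric] by (rule arg_cong[of _ _ e2pi]) simp
    ultimately show ?thesis by simp
  qed
  have hol: "f holomorphic_on UNIV" "h holomorphic_on UNIV"
    unfolding f_def h_def using \<tau> by (intro holomorphic_qs holomorphic_intros; simp)+
  obtain Hf where Hf: "\<And>z. (Hf has_field_derivative f z) (at z)"
    using entire_primitive hol by blast
  obtain Hh where Hh: "\<And>z. (Hh has_field_derivative h z) (at z)"
    using entire_primitive hol by blast
  have "h 0 \<noteq> 0"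
    using qs_real[of "t / 2"] assms by (auto simp: h_def \<tau>_def)
  have nz: "Hh 1 - Hh 0 \<noteq> 0"
    using theta_unique[OF hol(2) hper hq Hh, of 0] \<open>h 0 \<noteq> 0\<close> by auto
  define c where "c = (Hf 1 - Hf 0) / (Hh 1 - Hh 0)"
  have "f z - c * h z = 0" for z
  proof (rule theta_unique[of "\<lambda>z. f z - c * h z" \<tau> "\<lambda>z. Hf z - c * Hh z"])
    show "(\<lambda>z. f z - c * h z) holomorphic_on UNIV" by (intro holomorphic_intros hol)
    show "((\<lambda>z. Hf z - c * Hh z) has_field_derivative f z - c * h z) (at z)" for z
      by (intro DERIV_diff DERIV_cmult Hf Hh)
    show "Hf 1 - c * Hh 1 = Hf 0 - c * Hh 0"
      using nz by (simp add: c_def field_simps)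
  qed (simp_all add: fper hper fq hq algebra_simps)
  then have "\<forall>z. f z = c * h z" by simp
  moreover have "f z = qs (\<i> / (2 * of_real t)) (\<i> * z / of_real t) (\<i> * z\<^sup>2 / (2 * of_real t))" for z
  proof -
    have "- 1 / (2 * \<tau>) = \<i> / (2 * of_real t)" "- z / \<tau> = \<i> * z / of_real t" "- z\<^sup>2 / (2 * \<tau>) = \<i> * z\<^sup>2 / (2 * of_real t)"
      using assms by (simp_all add: \<tau>_def field_simps)
    then show ?thesis by (simp add: f_def)
  qed
  ultimately show ?thesis unfolding h_def \<tau>_def by auto
qed

lemma has_sum_finite_sum:
  fixes f :: "'i \<Rightarrow> 'a \<Rightarrow> 'b :: {comm_monoid_add, topological_comm_monoid_add, t2_space}"
  assumes "finite I" "\<And>i. i \<in> I \<Longrightarrow> (f i has_sum s i) A"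
  shows "((\<lambda>x. \<Sum>i\<in>I. f i x) has_sum (\<Sum>i\<in>I. s i)) A"
  using assms by (induction I rule: finite_induct) (auto intro!: has_sum_add)

lemma sum_roots_of_unity:
  assumes "n > 0"
  shows "(\<Sum>j<n. e2pi (of_int k * of_nat j / of_nat n)) = (if int n dvd k then of_nat n else 0)"
proof -
  define x where "x = e2pi (of_int k / of_nat n)"
  have p: "e2pi (of_int k * of_nat j / of_nat n) = x ^ j" for j
    unfolding x_def e2pi_power by (simp add: mult.commute)
  have xn: "x ^ n = 1"
    using assms by (simp add: x_def e2pi_power)
  have x1: "x = 1 \<longleftrightarrow> int n dvd k"
  proof
    assume "x = 1"
    then obtain m where "of_int k / of_nat n = (of_int m :: complex)"
      unfolding x_def e2pi_eq_1_iff by (elim Ints_cases)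
    then have "(of_int k :: complex) = of_int (int n * m)"
      using assms by (simp add: field_simps)
    then show "int n dvd k" by (metis dvd_triv_left of_int_eq_iff)
  next
    assume "int n dvd k"
    then obtain m where "k = int n * m" by (elim dvdE)
    then show "x = 1" using assms by (simp add: x_def)
  qed
  show ?thesis
  proof (cases "x = 1")
    case True then show ?thesis unfolding p using x1 by simp
  next
    case False then show ?thesis unfolding p using x1 xn by (simp add: geometric_sum)
  qed
qed

text \<open>The inversion factor at tau = i t, read off at z = 0. Its true value is the square root
  of t; \<open>theta_mult_rat\<close> finds it at rational squares.\<close>

definition theta_mult :: "real \<Rightarrow> complex" where
  "theta_mult t = qs (\<i> / (2 * of_real t)) 0 0 / qs (\<i> * of_real t / 2) 0 0"

lemma qs_imag_nonzero: "t > 0 \<Longrightarrow> qs (\<i> * of_real t / 2) 0 0 \<noteq> 0"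
  using qs_real[of "t / 2"] by auto

lemma theta_mult_eq:
  assumes "t > 0"
  shows "qs (\<i> / (2 * of_real t)) (\<i> * z / of_real t) (\<i> * z\<^sup>2 / (2 * of_real t))
     = theta_mult t * qs (\<i> * of_real t / 2) z 0"
proof -
  obtain c where c: "\<And>z. qs (\<i> / (2 * of_real t)) (\<i> * z / of_real t) (\<i> * z\<^sup>2 / (2 * of_real t))
     = c * qs (\<i> * of_real t / 2) z 0"
    using theta_inversion_imag[OF assms] by blast
  from c[of 0] have "c = theta_mult t"
    using qs_imag_nonzero[OF assms] by (simp add: theta_mult_def)
  with c show ?thesis by simp
qed

lemma theta_mult_1: "theta_mult 1 = 1"
  using qs_imag_nonzero[of 1] by (simp add: theta_mult_def)

text \<open>Splitting the series modulo n turns it into a sum of transformed series at the points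
  j/n; after inversion, the sum over j filters out the indices divisible by n and leaves n times the
  theta series at n^2 t.\<close>

lemma theta_mult_scale:
  assumes t: "t > 0" and n: "n > 0"
  shows "theta_mult (real n ^ 2 * t) = of_nat n * theta_mult t"
proof -
  have nz: "of_nat n \<noteq> (0::complex)" "of_real t \<noteq> (0::complex)" using assms by auto
  have Im: "Im (\<i> * of_real t / 2) > 0" "Im (\<i> / (2 * of_real (real n ^ 2 * t))) > 0"
    using assms by (auto simp: Im_divide power2_eq_square)
  have "qs (\<i> / (2 * of_real (real n ^ 2 * t))) 0 0
      = (\<Sum>j<n. \<Sum>\<^sub>\<infinity>m::int. e2pi (of_int (int n * m + int j) ^ 2 * (\<i> / (2 * of_real (real n ^ 2 * t))) + of_int (int n * m + int j) * 0 + 0))"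
    unfolding qs_def
    by (rule infsum_int_split[OF n]) (use qs_has_sum[OF Im(2)] in \<open>rule has_sum_imp_summable\<close>)
  also have "\<dots> = (\<Sum>j<n. qs (\<i> / (2 * of_real t)) (\<i> * (of_nat j / of_nat n) / of_real t) (\<i> * (of_nat j / of_nat n)\<^sup>2 / (2 * of_real t)))"
    unfolding qs_def
    by (intro sum.cong refl infsum_cong arg_cong[of _ _ e2pi])
       (use nz in \<open>simp add: field_simps power2_eq_square\<close>)
  also have "\<dots> = theta_mult t * (\<Sum>j<n. qs (\<i> * of_real t / 2) (of_nat j / of_nat n) 0)"
    unfolding theta_mult_eq[OF t] by (simp add: sum_distrib_left)
  also have "(\<Sum>j<n. qs (\<i> * of_real t / 2) (of_nat j / of_nat n) 0)
      = (\<Sum>\<^sub>\<infinity>k::int. e2pi (of_int k ^ 2 * (\<i> * of_real t / 2)) * (if int n dvd k then of_nat n else 0))"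
  proof -
    have "((\<lambda>k::int. \<Sum>j<n. e2pi (of_int k ^ 2 * (\<i> * of_real t / 2) + of_int k * (of_nat j / of_nat n) + 0))
        has_sum (\<Sum>j<n. qs (\<i> * of_real t / 2) (of_nat j / of_nat n) 0)) UNIV"
      by (intro has_sum_finite_sum qs_has_sum Im finite_lessThan)
    moreover have "(\<Sum>j<n. e2pi (of_int k ^ 2 * (\<i> * of_real t / 2) + of_int k * (of_nat j / of_nat n) + 0))
        = e2pi (of_int k ^ 2 * (\<i> * of_real t / 2)) * (if int n dvd k then of_nat n else 0)" for k :: int
      using sum_roots_of_unity[OF n, of k] by (simp add: e2pi_add sum_distrib_left[symmetric])
    ultimately show ?thesis by (simp add: has_sum_iff)
  qed
  also have "\<dots> = (\<Sum>j<n. \<Sum>\<^sub>\<infinity>m::int. e2pi (of_int (int n * m + int j) ^ 2 * (\<i> * of_real t / 2)) * (if int n dvd int n * m + int j then of_nat n else 0))"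
  proof (rule infsum_int_split[OF n])
    have "(\<lambda>k::int. norm (e2pi (of_int k ^ 2 * (\<i> * of_real t / 2)) * (if int n dvd k then of_nat n else 0))) summable_on UNIV"
    proof (rule summable_on_comparison_test)
      show "(\<lambda>k::int. real n * norm (e2pi (of_int k ^ 2 * (\<i> * of_real t / 2) + of_int k * 0 + 0))) summable_on UNIV"
        by (intro summable_on_cmult_right abs_summable_quad Im)
    qed (auto simp: norm_mult)
    then show "(\<lambda>k::int. e2pi (of_int k ^ 2 * (\<i> * of_real t / 2)) * (if int n dvd k then of_nat n else 0)) summable_on UNIV"
      by (rule abs_summable_summable)
  qed
  also have "\<dots> = (\<Sum>j<n. if j = 0 then of_nat n * qs (\<i> * of_real (real n ^ 2 * t) / 2) 0 0 else 0)"
  proof (intro sum.cong refl)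
    fix j assume "j \<in> {..<n}"
    then have d: "int n dvd int n * m + int j \<longleftrightarrow> j = 0" for m
      by (auto simp: dvd_add_right_iff zdvd_not_zless)
    have "e2pi ((of_int (int n * m))\<^sup>2 * (\<i> * of_real t / 2)) = e2pi (of_int m ^ 2 * (\<i> * of_real (real n ^ 2 * t) / 2) + of_int m * 0 + 0)" for m
      by (rule arg_cong[of _ _ e2pi]) (simp add: power2_eq_square)
    then show "(\<Sum>\<^sub>\<infinity>m::int. e2pi (of_int (int n * m + int j) ^ 2 * (\<i> * of_real t / 2)) * (if int n dvd int n * m + int j then of_nat n else 0))
      = (if j = 0 then of_nat n * qs (\<i> * of_real (real n ^ 2 * t) / 2) 0 0 else 0)"
      unfolding d qs_def by (simp add: infsum_cmult_right'[symmetric] mult.commute)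
  qed
  also have "\<dots> = of_nat n * qs (\<i> * of_real (real n ^ 2 * t) / 2) 0 0"
    using n by (subst sum.delta) auto
  finally show ?thesis
    using qs_imag_nonzero[of "real n ^ 2 * t"] assms unfolding theta_mult_def[of "real n ^ 2 * t"]
    by (simp add: field_simps)
qed

lemma theta_mult_rat:
  assumes "m > 0" "n > 0"
  shows "theta_mult ((real m / real n) ^ 2) = of_nat m / of_nat n"
proof -
  have "theta_mult (real n ^ 2 * (real m / real n)\<^sup>2) = of_nat n * theta_mult ((real m / real n)\<^sup>2)"
    by (rule theta_mult_scale) (use assms in auto)
  moreover have "real n ^ 2 * (real m / real n)\<^sup>2 = real m ^ 2 * 1"
    using assms by (simp add: power_divide)
  moreover have "theta_mult (real m ^ 2 * 1) = of_nat m * theta_mult 1"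
    by (rule theta_mult_scale) (use assms in auto)
  ultimately show ?thesis using assms theta_mult_1 by (simp add: field_simps)
qed

lemma open_upper_half: "open upper_half"
  unfolding upper_half_def by (rule open_halfspace_Im_gt)

lemma convex_upper_half: "convex upper_half"
  unfolding upper_half_def by (rule convex_halfspace_Im_gt)

lemma Im_neg_inverse: "Im (- 1 / \<tau>) = Im \<tau> / (cmod \<tau>)\<^sup>2"
  by (simp add: Im_divide cmod_power2)

lemma neg_inverse_upper_half: "\<tau> \<in> upper_half \<Longrightarrow> - 1 / \<tau> \<in> upper_half"
  unfolding upper_half_def mem_Collect_eq Im_neg_inverse
  by (intro divide_pos_pos zero_less_power) auto

text \<open>The difference of the two sides is holomorphic in tau and vanishes at i r^2 for r = (n +
  2)/(n + 1). These points accumulate at i, so it vanishes on the whole upper half-plane.\<close>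

lemma theta_inversion:
  assumes "\<tau> \<in> upper_half"
  shows "qs (- 1 / (2 * \<tau>)) (- of_real a / \<tau>) (- (of_real a)\<^sup>2 / (2 * \<tau>)) = csqrt (- \<i> * \<tau>) * qs (\<tau> / 2) (of_real a) 0"
proof -
  define L where "L = (\<lambda>\<tau>. qs (- 1 / (2 * \<tau>)) (- of_real a / \<tau>) (- (of_real a)\<^sup>2 / (2 * \<tau>)) - csqrt (- \<i> * \<tau>) * qs (\<tau> / 2) (of_real a) 0)"
  define r where "r = (\<lambda>n::nat. real (n + 2) / real (n + 1))"
  define U where "U = range (\<lambda>n. \<i> * of_real (r n ^ 2))"
  have rpos: "r n > 0" for n by (simp add: r_def)
  have "L \<tau> = 0"
  proof (rule analytic_continuation[of L upper_half U \<i>])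
    have nz: "z \<noteq> 0" if "z \<in> upper_half" for z using that by (auto simp: upper_half_def)
    have csq: "- \<i> * z \<notin> \<real>\<^sub>\<le>\<^sub>0" if "z \<in> upper_half" for z
      using that by (auto simp: upper_half_def complex_nonpos_Reals_iff)
    have Im1: "Im (- 1 / (2 * z)) > 0" if "z \<in> upper_half" for z
    proof -
      have "- 1 / (2 * z) = of_real (1 / 2) * (- 1 / z)" by simp
      then have "Im (- 1 / (2 * z)) = Im (- 1 / z) / 2" by (simp only: Im_complex_of_real Re_complex_of_real times_complex.sel)
      then show ?thesis using neg_inverse_upper_half[OF that] by (simp add: upper_half_def)
    qed
    show "L holomorphic_on upper_half"
      unfolding L_def using nz csq Im1
      by (intro holomorphic_intros holomorphic_qs open_upper_half) (auto simp: upper_half_def)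
    show "connected upper_half" by (intro convex_connected convex_upper_half)
    show "U \<subseteq> upper_half" using rpos less_imp_neq[OF rpos] by (auto simp: U_def upper_half_def)
    show "\<i> \<in> upper_half" by (simp add: upper_half_def)
    show "\<i> islimpt U"
      unfolding islimpt_sequential
    proof (intro exI[of _ "\<lambda>n. \<i> * of_real (r n ^ 2)"] conjI allI)
      fix n
      have "r n > 1" by (simp add: r_def)
      then have "r n ^ 2 \<noteq> 1" by (simp add: power2_eq_1_iff)
      then have "\<i> * of_real (r n ^ 2) \<noteq> \<i>"
        by (metis Im_i_times Re_complex_of_real imaginary_unit.sel(2))
      then show "\<i> * of_real (r n ^ 2) \<in> U - {\<i>}" by (auto simp: U_def)
    next
      have "(\<lambda>n. 1 + 1 / real (n + 1)) \<longlonglongrightarrow> 1 + 0"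
        by (intro tendsto_add tendsto_const LIMSEQ_Suc[OF lim_1_over_n, simplified]) (use LIMSEQ_Suc[OF lim_1_over_n] in simp)
      moreover have "r = (\<lambda>n. 1 + 1 / real (n + 1))" by (simp add: r_def fun_eq_iff field_simps)
      ultimately have "r \<longlonglongrightarrow> 1" by simp
      then have "(\<lambda>n. \<i> * of_real (r n ^ 2)) \<longlonglongrightarrow> \<i> * of_real (1 ^ 2)"
        by (intro tendsto_intros)
      then show "(\<lambda>n. \<i> * of_real (r n ^ 2)) \<longlonglongrightarrow> \<i>" by simp
    qed
    show "L z = 0" if "z \<in> U" for z
    proof -
      obtain n where z: "z = \<i> * of_real (r n ^ 2)" using \<open>z \<in> U\<close> by (auto simp: U_def)
      have 1: "- 1 / (2 * z) = \<i> / (2 * of_real (r n ^ 2))" "- of_real a / z = \<i> * of_real a / of_real (r n ^ 2)"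
          "- (of_real a)\<^sup>2 / (2 * z) = \<i> * (of_real a)\<^sup>2 / (2 * of_real (r n ^ 2))"
        using rpos[of n] by (simp_all add: z field_simps)
      have 2: "csqrt (- \<i> * z) = of_real (r n)"
      proof -
        have "- \<i> * z = of_real (r n ^ 2)" by (simp add: z)
        then show ?thesis using rpos[of n] by (simp add: csqrt_of_real_nonneg del: of_real_power)
      qed
      have 3: "theta_mult (r n ^ 2) = of_real (r n)"
        unfolding r_def using theta_mult_rat[of "n + 2" "n + 1"] by simp
      show ?thesis
        unfolding L_def 1 2 using theta_mult_eq[of "r n ^ 2" "of_real a"] rpos[of n] 3 by (simp add: z)
    qed
  qed (use assms open_upper_half in auto)
  then show ?thesis by (simp add: L_def)
qed

lemma csqrt_of_real_mult: "c > 0 \<Longrightarrow> csqrt (of_real c * z) = of_real (sqrt c) * csqrt z"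
  using Arg_bounded[of z] by (subst csqrt_mult) (auto simp: Arg_of_real csqrt_of_real_nonneg)

section \<open>Unary theta series\<close>

text \<open>The unary theta series of index N: the sum of q^(m^2/(4N)) over all integers m congruent
  to j modulo 2N.\<close>

definition V :: "nat \<Rightarrow> int \<Rightarrow> complex \<Rightarrow> complex" where
  "V N j \<tau> = qs (of_nat N * \<tau>) (of_int j * \<tau>) ((of_int j)\<^sup>2 / (4 * of_nat N) * \<tau>)"

lemma V_has_sum:
  assumes "N > 0" "\<tau> \<in> upper_half"
  shows "((\<lambda>n::int. e2pi (of_real (real_of_int (2 * int N * n + j) ^ 2 / (4 * real N)) * \<tau>)) has_sum V N j \<tau>) UNIV"
proof -
  have "of_int n ^ 2 * (of_nat N * \<tau>) + of_int n * (of_int j * \<tau>) + (of_int j)\<^sup>2 / (4 * of_nat N) * \<tau>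
      = of_real (real_of_int (2 * int N * n + j) ^ 2 / (4 * real N)) * \<tau>" for n :: int
    using assms(1) by (simp add: field_simps power2_eq_square)
  then show ?thesis
    unfolding V_def using qs_has_sum[of "of_nat N * \<tau>" "of_int j * \<tau>" "(of_int j)\<^sup>2 / (4 * of_nat N) * \<tau>"] assms
    by (simp add: upper_half_def)
qed

lemma V_holomorphic [holomorphic_intros]: "N > 0 \<Longrightarrow> V N j holomorphic_on upper_half"
  unfolding V_def by (intro holomorphic_qs holomorphic_intros open_upper_half) (auto simp: upper_half_def)

lemma V_T:
  assumes "N > 0"
  shows "V N j (\<tau> + 1) = e2pi ((of_int j)\<^sup>2 / (4 * of_nat N)) * V N j \<tau>"
proof -
  have "V N j (\<tau> + 1) = (\<Sum>\<^sub>\<infinity>n::int. e2pi ((of_int j)\<^sup>2 / (4 * of_nat N)) *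
     e2pi (of_int n ^ 2 * (of_nat N * \<tau>) + of_int n * (of_int j * \<tau>) + (of_int j)\<^sup>2 / (4 * of_nat N) * \<tau>))"
    unfolding V_def qs_def
  proof (intro infsum_cong)
    fix n :: int
    have "of_int n ^ 2 * (of_nat N * (\<tau> + 1)) + of_int n * (of_int j * (\<tau> + 1)) + (of_int j)\<^sup>2 / (4 * of_nat N) * (\<tau> + 1)
      = of_int (n ^ 2 * int N + n * j) + ((of_int j)\<^sup>2 / (4 * of_nat N) + (of_int n ^ 2 * (of_nat N * \<tau>) + of_int n * (of_int j * \<tau>) + (of_int j)\<^sup>2 / (4 * of_nat N) * \<tau>))"
      by (simp add: algebra_simps add_divide_distrib)
    then show "e2pi (of_int n ^ 2 * (of_nat N * (\<tau> + 1)) + of_int n * (of_int j * (\<tau> + 1)) + (of_int j)\<^sup>2 / (4 * of_nat N) * (\<tau> + 1))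
      = e2pi ((of_int j)\<^sup>2 / (4 * of_nat N)) *
     e2pi (of_int n ^ 2 * (of_nat N * \<tau>) + of_int n * (of_int j * \<tau>) + (of_int j)\<^sup>2 / (4 * of_nat N) * \<tau>)"
      by (simp only: e2pi_add e2pi_of_int mult_1_left)
  qed
  then show ?thesis unfolding V_def qs_def by (simp add: infsum_cmult_right')
qed

lemma V_uminus: "V N (- j) \<tau> = V N j \<tau>"
  unfolding V_def using qs_reflect[of _ "of_int j * \<tau>"] by simp

lemma V_period: "N > 0 \<Longrightarrow> V N (j + 2 * int N) \<tau> = V N j \<tau>"
  unfolding V_def
  by (subst (2) qs_shift[of _ _ 1, symmetric], intro arg_cong2[of _ _ _ _ "qs (of_nat N * \<tau>)"])
     (simp_all add: field_simps power2_eq_square)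

text \<open>Theta inversion at tau/(2N) with shift j/(2N). Sorting the dual series by residues
  modulo 2N turns the shift into the additive characters.\<close>

lemma V_S:
  assumes N: "N > 0" and \<tau>: "\<tau> \<in> upper_half"
  shows "V N j (- 1 / \<tau>) = csqrt (- \<i> * \<tau>) / of_real (sqrt (2 * real N)) *
    (\<Sum>l<2 * N. e2pi (of_int j * of_nat l / of_nat (2 * N)) * V N (int l) \<tau>)"
proof -
  define \<sigma> where "\<sigma> = \<tau> / (2 * of_nat N)"
  have \<tau>0: "\<tau> \<noteq> 0" using \<tau> by (auto simp: upper_half_def)
  have \<sigma>: "\<sigma> \<in> upper_half" using \<tau> N
    by (auto simp: upper_half_def \<sigma>_def Im_divide power2_eq_square divide_simps)
  have c: "csqrt (- \<i> * \<sigma>) = csqrt (- \<i> * \<tau>) / of_real (sqrt (2 * real N))"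
  proof -
    have "- \<i> * \<sigma> = of_real (1 / (2 * real N)) * (- \<i> * \<tau>)" by (simp add: \<sigma>_def)
    then have "csqrt (- \<i> * \<sigma>) = of_real (sqrt (1 / (2 * real N))) * csqrt (- \<i> * \<tau>)"
      using csqrt_of_real_mult[of "1 / (2 * real N)" "- \<i> * \<tau>"] N by simp
    then show ?thesis by (simp add: real_sqrt_divide)
  qed
  have Im: "Im (\<sigma> / 2) > 0" using \<sigma> by (simp add: upper_half_def)
  have "V N j (- 1 / \<tau>) = qs (- 1 / (2 * \<sigma>)) (- of_real (of_int j / (2 * real N)) / \<sigma>) (- (of_real (of_int j / (2 * real N)))\<^sup>2 / (2 * \<sigma>))"
  proof -
    have "of_nat N * (- 1 / \<tau>) = - 1 / (2 * \<sigma>)" "of_int j * (- 1 / \<tau>) = - of_real (of_int j / (2 * real N)) / \<sigma>"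
      "(of_int j)\<^sup>2 / (4 * of_nat N) * (- 1 / \<tau>) = - (of_real (of_int j / (2 * real N)))\<^sup>2 / (2 * \<sigma>)"
      using N \<tau>0 by (simp_all add: \<sigma>_def field_simps power2_eq_square)
    then show ?thesis unfolding V_def by (simp only:)
  qed
  also have "\<dots> = csqrt (- \<i> * \<sigma>) * qs (\<sigma> / 2) (of_real (of_int j / (2 * real N))) 0"
    by (rule theta_inversion[OF \<sigma>])
  also have "qs (\<sigma> / 2) (of_real (of_int j / (2 * real N))) 0 =
     (\<Sum>l<2 * N. \<Sum>\<^sub>\<infinity>m::int. e2pi (of_int (int (2 * N) * m + int l) ^ 2 * (\<sigma> / 2) + of_int (int (2 * N) * m + int l) * of_real (of_int j / (2 * real N)) + 0))"
    unfolding qs_def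
    by (rule infsum_int_split) (use N in simp, use qs_has_sum[OF Im] in \<open>rule has_sum_imp_summable\<close>)
  also have "\<dots> = (\<Sum>l<2 * N. e2pi (of_int j * of_nat l / of_nat (2 * N)) * V N (int l) \<tau>)"
  proof (intro sum.cong refl)
    fix l
    have "e2pi (of_int (int (2 * N) * m + int l) ^ 2 * (\<sigma> / 2) + of_int (int (2 * N) * m + int l) * of_real (of_int j / (2 * real N)) + 0)
      = e2pi (of_int j * of_nat l / of_nat (2 * N)) *
        e2pi (of_int m ^ 2 * (of_nat N * \<tau>) + of_int m * (of_int (int l) * \<tau>) + (of_int (int l))\<^sup>2 / (4 * of_nat N) * \<tau>)" for m
    proof -
      have "of_int (int (2 * N) * m + int l) ^ 2 * (\<sigma> / 2) + of_int (int (2 * N) * m + int l) * of_real (of_int j / (2 * real N)) + 0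
        = of_int (m * j) + (of_int j * of_nat l / of_nat (2 * N) + (of_int m ^ 2 * (of_nat N * \<tau>) + of_int m * (of_int (int l) * \<tau>) + (of_int (int l))\<^sup>2 / (4 * of_nat N) * \<tau>))"
        using N by (simp add: \<sigma>_def field_simps power2_eq_square)
      then show ?thesis by (simp only: e2pi_add e2pi_of_int mult_1_left)
    qed
    then show "(\<Sum>\<^sub>\<infinity>m::int. e2pi (of_int (int (2 * N) * m + int l) ^ 2 * (\<sigma> / 2) + of_int (int (2 * N) * m + int l) * of_real (of_int j / (2 * real N)) + 0))
      = e2pi (of_int j * of_nat l / of_nat (2 * N)) * V N (int l) \<tau>"
      unfolding V_def qs_def by (simp only: infsum_cmult_right')
  qed
  finally show ?thesis by (simp only: c)
qed

section \<open>The eta function\<close>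

text \<open>Euler's series with exponents (6n + 1)^2/24 and signs (-1)^n: even n gives the residue 1
  modulo 12, odd n the residue 7.\<close>

definition eta :: "complex \<Rightarrow> complex" where
  "eta \<tau> = V 6 1 \<tau> - V 6 7 \<tau>"

text \<open>Shanks' finite form of Euler's pentagonal number theorem, with \<open>x = y\<^sup>2\<close> so that all
  exponents are integers without division.\<close>

lemma Shanks_aux:
  fixes y :: complex
  defines "P \<equiv> \<lambda>m. \<Prod>k=1..m. (1 - y ^ (2 * k))"
  assumes y: "\<And>k. k > 0 \<Longrightarrow> y ^ (2 * k) \<noteq> 1"
  shows "(\<Sum>s\<le>m. (-1) ^ s * (P n / P s) * y ^ (2 * s * n + s * (s + 1)) * (y ^ (2 * s) * (1 - y ^ (2 * (n + 1))) - 1))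
     = - ((-1) ^ m * (P n / P m) * y ^ (2 * m * n + m * (m + 1) + 2 * m + 2 * (n + 1)))"
proof (induction m)
  case 0
  show ?case by (simp add: P_def)
next
  case (Suc m)
  have P: "P (Suc m) = P m * (1 - y ^ (2 * (m + 1)))" by (simp add: P_def)
  have nz: "1 - y ^ (2 * (m + 1)) \<noteq> 0" using y[of "m + 1"] by simp
  have Pm: "P m \<noteq> 0" using y by (auto simp: P_def)
  define a where "a = (-1) ^ m * (P n / P m) * y ^ (2 * m * n + m * (m + 1) + 2 * m + 2 * (n + 1))"
  have e: "2 * Suc m * n + Suc m * (Suc m + 1) = 2 * m * n + m * (m + 1) + 2 * m + 2 * (n + 1)"
    by (simp add: algebra_simps)
  define b where "b = (-1) ^ Suc m * (P n / P (Suc m)) * y ^ (2 * Suc m * n + Suc m * (Suc m + 1))"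
  have ab: "- a = b * (1 - y ^ (2 * (m + 1)))"
    unfolding a_def b_def e P using nz Pm by (simp add: field_simps)
  have c: "(-1) ^ Suc m * (P n / P (Suc m)) * y ^ (2 * Suc m * n + Suc m * (Suc m + 1) + 2 * Suc m + 2 * (n + 1))
     = b * y ^ (2 * Suc m) * y ^ (2 * (n + 1))"
    unfolding b_def by (simp only: power_add mult.assoc)
  show ?case
    unfolding sum.atMost_Suc Suc.IH c unfolding a_def[symmetric] b_def[symmetric] unfolding ab
    by (simp add: algebra_simps)
qed

lemma Shanks:
  fixes y :: complex
  defines "P \<equiv> \<lambda>m. \<Prod>k=1..m. (1 - y ^ (2 * k))"
  assumes y: "\<And>k. k > 0 \<Longrightarrow> y ^ (2 * k) \<noteq> 1"
  shows "(\<Sum>s\<le>n. (-1) ^ s * (P n / P s) * y ^ (2 * s * n + s * (s + 1)))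
     = 1 + (\<Sum>s=1..n. (-1) ^ s * (y ^ (s * (3 * s - 1)) + y ^ (s * (3 * s + 1))))"
proof (induction n)
  case 0
  show ?case by (simp add: P_def)
next
  case (Suc n)
  define T where "T = (\<lambda>s. (-1) ^ s * (P n / P s) * y ^ (2 * s * n + s * (s + 1)))"
  have nzP: "P m \<noteq> 0" for m using y by (auto simp: P_def)
  have P: "P (Suc n) = P n * (1 - y ^ (2 * (n + 1)))" by (simp add: P_def)
  \<comment> \<open>Raising n by one changes each summand by T s times a bracket; the sum of these
    changes is what \<open>Shanks_aux\<close> evaluates.\<close>
  have 1: "(-1) ^ s * (P (Suc n) / P s) * y ^ (2 * s * Suc n + s * (s + 1))
      = T s + T s * (y ^ (2 * s) * (1 - y ^ (2 * (n + 1))) - 1)" for s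
  proof -
    define Z where "Z = P n / P s"
    have e: "2 * s * Suc n + s * (s + 1) = (2 * s * n + s * (s + 1)) + 2 * s" by simp
    have h: "P (Suc n) / P s = Z * (1 - y ^ (2 * (n + 1)))" by (simp add: P Z_def)
    show ?thesis unfolding T_def e power_add[of y _ "2 * s"] Z_def[symmetric] h by algebra
  qed
  have "(\<Sum>s\<le>Suc n. (-1) ^ s * (P (Suc n) / P s) * y ^ (2 * s * Suc n + s * (s + 1)))
     = (\<Sum>s\<le>n. T s) + (\<Sum>s\<le>n. T s * (y ^ (2 * s) * (1 - y ^ (2 * (n + 1))) - 1))
        + (-1) ^ Suc n * (P (Suc n) / P (Suc n)) * y ^ (2 * Suc n * Suc n + Suc n * (Suc n + 1))"
    unfolding sum.atMost_Suc 1 sum.distrib by simp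
  also have "(\<Sum>s\<le>n. T s * (y ^ (2 * s) * (1 - y ^ (2 * (n + 1))) - 1))
      = - ((-1) ^ n * y ^ (2 * n * n + n * (n + 1) + 2 * n + 2 * (n + 1)))"
    using Shanks_aux[of y n n] y nzP[of n] unfolding T_def P_def by simp
  also have "2 * n * n + n * (n + 1) + 2 * n + 2 * (n + 1) = Suc n * (3 * Suc n - 1)"
    by (simp add: algebra_simps)
  also have "2 * Suc n * Suc n + Suc n * (Suc n + 1) = Suc n * (3 * Suc n + 1)"
    by (simp add: algebra_simps)
  finally show ?case
    using Suc.IH nzP[of "Suc n"] unfolding T_def by (simp add: algebra_simps)
qed

text \<open>The term s = 0 of Shanks' sum is the finite product P n, which tends to a nonzero
  infinite product; the other terms together are at most a constant times n |y|^n.\<close>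

lemma Euler_pentagonal:
  fixes y :: complex
  assumes y: "norm y < 1"
  shows "\<exists>Q. Q \<noteq> 0 \<and> (\<lambda>n. 1 + (\<Sum>s=1..n. (-1) ^ s * (y ^ (s * (3 * s - 1)) + y ^ (s * (3 * s + 1))))) \<longlonglongrightarrow> Q"
proof -
  define P where "P = (\<lambda>m. \<Prod>k=1..m. (1 - y ^ (2 * k)))"
  have y1: "y ^ (2 * k) \<noteq> 1" if "k > 0" for k
  proof -
    have "norm (y ^ (2 * k)) < 1" using y that by (simp add: norm_power power_less_one_iff)
    then show ?thesis by auto
  qed
  have nzP: "P m \<noteq> 0" for m using y1 by (auto simp: P_def)
  have nz: "1 - y ^ (2 * (i + 1)) \<noteq> 0" for i
    using y1[of "i + 1"] by simp
  have "convergent_prod (\<lambda>k. 1 - y ^ (2 * (k + 1)))"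
  proof (rule abs_convergent_prod_imp_convergent_prod, rule summable_imp_abs_convergent_prod)
    have "summable (\<lambda>k. norm y ^ 2 * (norm y ^ 2) ^ k)"
      using y by (intro summable_mult summable_geometric) (simp add: power_less_one_iff abs_square_less_1)
    then show "summable (\<lambda>k. norm (1 - y ^ (2 * (k + 1)) - 1))"
      by (simp add: norm_power norm_mult power_mult power2_eq_square)
  qed
  then obtain Q where Q: "(\<lambda>n. \<Prod>k\<le>n. 1 - y ^ (2 * (k + 1))) \<longlonglongrightarrow> Q" "Q \<noteq> 0"
    using convergent_prod_iff_nz_lim[of "\<lambda>k. 1 - y ^ (2 * (k + 1))", OF nz] by blast
  have PQ: "P \<longlonglongrightarrow> Q"
  proof -
    have "P (Suc n) = (\<Prod>k\<le>n. 1 - y ^ (2 * (k + 1)))" for n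
      by (induction n) (auto simp: P_def)
    then show ?thesis using Q(1) by (simp add: LIMSEQ_imp_Suc)
  qed
  have "Bseq P" "Bseq (\<lambda>n. inverse (P n))"
    using PQ tendsto_inverse[OF PQ Q(2)] by (auto intro!: convergent_imp_Bseq simp: convergent_def)
  then obtain K L where KL: "K > 0" "\<And>n. norm (P n) \<le> K" "L > 0" "\<And>n. norm (inverse (P n)) \<le> L"
    unfolding Bseq_def by auto
  have lim: "(\<lambda>n. \<Sum>s\<le>n. (-1) ^ s * (P n / P s) * y ^ (2 * s * n + s * (s + 1))) \<longlonglongrightarrow> Q"
  proof -
    have split: "(\<Sum>s\<le>n. (-1) ^ s * (P n / P s) * y ^ (2 * s * n + s * (s + 1)))
      = P n + (\<Sum>s=1..n. (-1) ^ s * (P n / P s) * y ^ (2 * s * n + s * (s + 1)))" for n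
    proof -
      have "{..n} = insert 0 {1..n}" by auto
      then show ?thesis by (simp add: P_def)
    qed
    have bnd: "norm (\<Sum>s=1..n. (-1) ^ s * (P n / P s) * y ^ (2 * s * n + s * (s + 1))) \<le> K * L * (real n * norm y ^ n)" for n
    proof -
      have "norm (\<Sum>s=1..n. (-1) ^ s * (P n / P s) * y ^ (2 * s * n + s * (s + 1))) \<le> (\<Sum>s=1..n. K * L * norm y ^ n)"
      proof (rule sum_norm_le)
        fix s assume s: "s \<in> {1..n}"
        have e: "n \<le> 2 * s * n + s * (s + 1)"
        proof -
          from s obtain k where "s = Suc k" by (cases s) auto
          then show ?thesis by (simp add: algebra_simps)
        qed
        have 1: "norm y ^ (2 * s * n + s * (s + 1)) \<le> norm y ^ n"
          using y by (intro power_decreasing e) auto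
        have 2: "norm (P n / P s) \<le> K * L"
          using KL(2)[of n] KL(4)[of s] KL(1) by (simp add: norm_mult divide_inverse mult_mono)
        have "norm (P n / P s) * norm y ^ (2 * s * n + s * (s + 1)) \<le> (K * L) * norm y ^ n"
          by (rule mult_mono[OF 2 1]) (use KL(1,3) in \<open>simp_all add: less_imp_le\<close>)
        moreover have "norm ((-1) ^ s * (P n / P s) * y ^ (2 * s * n + s * (s + 1))) = norm (P n / P s) * norm y ^ (2 * s * n + s * (s + 1))"
          by (simp only: norm_mult norm_power norm_minus_cancel norm_one power_one mult_1_left)
        ultimately show "norm ((-1) ^ s * (P n / P s) * y ^ (2 * s * n + s * (s + 1))) \<le> K * L * norm y ^ n"
          by linarith
      qed
      then show ?thesis by (simp add: mult_ac)
    qed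
    have "(\<lambda>n. K * L * (real n * norm y ^ n)) \<longlonglongrightarrow> K * L * 0"
      using y powser_times_n_limit_0[of "norm y"] by (intro tendsto_mult_left) simp
    then have lim0: "(\<lambda>n. K * L * (real n * norm y ^ n)) \<longlonglongrightarrow> 0" by simp
    have "(\<lambda>n. \<Sum>s=1..n. (-1) ^ s * (P n / P s) * y ^ (2 * s * n + s * (s + 1))) \<longlonglongrightarrow> 0"
      by (rule Lim_null_comparison[OF always_eventually[OF allI[OF bnd]] lim0])
    from tendsto_add[OF PQ this] show ?thesis unfolding split by simp
  qed
  moreover have "(\<Sum>s\<le>n. (-1) ^ s * (P n / P s) * y ^ (2 * s * n + s * (s + 1)))
     = 1 + (\<Sum>s=1..n. (-1) ^ s * (y ^ (s * (3 * s - 1)) + y ^ (s * (3 * s + 1))))" for n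
    unfolding P_def by (rule Shanks[of y n]) (rule y1)
  ultimately have "(\<lambda>n. 1 + (\<Sum>s=1..n. (-1) ^ s * (y ^ (s * (3 * s - 1)) + y ^ (s * (3 * s + 1))))) \<longlonglongrightarrow> Q"
    by (simp only:)
  with Q(2) show ?thesis by blast
qed

text \<open>Summation over symmetric intervals pairs -s with s, the order in which Euler's partial
  sums arise.\<close>

lemma has_sum_int_symmetric:
  fixes f :: "int \<Rightarrow> complex"
  assumes "(f has_sum S) UNIV"
  shows "(\<lambda>n. f 0 + (\<Sum>s=1..n. f (- int s) + f (int s))) \<longlonglongrightarrow> S"
proof -
  have "filterlim (\<lambda>n. {- int n..int n}) (finite_subsets_at_top UNIV) sequentially"
    unfolding filterlim_finite_subsets_at_top
  proof (intro allI impI)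
    fix X :: "int set" assume "finite X \<and> X \<subseteq> UNIV"
    then obtain B where B: "\<And>x. x \<in> X \<Longrightarrow> nat \<bar>x\<bar> \<le> B"
      using finite_nat_set_iff_bounded_le[of "(\<lambda>x. nat \<bar>x\<bar>) ` X"] by auto
    show "\<forall>\<^sub>F n in sequentially. finite {- int n..int n} \<and> X \<subseteq> {- int n..int n} \<and> {- int n..int n} \<subseteq> UNIV"
      by (rule eventually_sequentiallyI[of B]) (use B in fastforce)
  qed
  from filterlim_compose[OF assms[unfolded has_sum_def] this]
  have "(\<lambda>n. sum f {- int n..int n}) \<longlonglongrightarrow> S" by simp
  moreover have "sum f {- int n..int n} = f 0 + (\<Sum>s=1..n. f (- int s) + f (int s))" for n
  proof (induction n)
    case (Suc n)
    have "{- int (Suc n)..int (Suc n)} = insert (- int (Suc n)) (insert (int (Suc n)) {- int n..int n})"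
      by auto
    then show ?case using Suc by (simp add: algebra_simps)
  qed simp
  ultimately show ?thesis by simp
qed

definition eta_sign :: "int \<Rightarrow> complex" where
  "eta_sign n = (if even n then 1 else - 1)"

lemma eta_has_sum:
  assumes "\<tau> \<in> upper_half"
  shows "((\<lambda>n::int. eta_sign n * e2pi (of_real (real_of_int (6 * n + 1) ^ 2 / 24) * \<tau>)) has_sum eta \<tau>) UNIV"
proof -
  define f where "f = (\<lambda>n::int. eta_sign n * e2pi (of_real (real_of_int (6 * n + 1) ^ 2 / 24) * \<tau>))"
  have 1: "(f has_sum V 6 1 \<tau>) (range (\<lambda>n. 2 * n))"
    by (subst has_sum_reindex) (use V_has_sum[OF _ assms, of 6 1] in \<open>auto simp: inj_on_def o_def f_def eta_sign_def\<close>)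
  have 2: "(f has_sum (- V 6 7 \<tau>)) (range (\<lambda>n. 2 * n + 1))"
  proof (subst has_sum_reindex)
    have "(real_of_int (6 * (2 * n + 1) + 1))\<^sup>2 = (real_of_int (2 * int 6 * n + 7))\<^sup>2" for n
      by (simp add: algebra_simps)
    then show "(f \<circ> (\<lambda>n. 2 * n + 1) has_sum - V 6 7 \<tau>) UNIV"
      using V_has_sum[OF _ assms, of 6 7] by (simp add: o_def f_def eta_sign_def has_sum_uminus algebra_simps)
  qed (auto simp: inj_on_def)
  have "(f has_sum (V 6 1 \<tau> + - V 6 7 \<tau>)) (range (\<lambda>n. 2 * n) \<union> range (\<lambda>n. 2 * n + 1))"
    by (rule has_sum_Un_disjoint[OF 1 2]) (auto simp: image_iff, presburger)
  moreover have "range (\<lambda>n::int. 2 * n) \<union> range (\<lambda>n. 2 * n + 1) = UNIV"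
  proof -
    have "z \<in> range (\<lambda>n::int. 2 * n) \<union> range (\<lambda>n. 2 * n + 1)" for z
      by (cases "even z") (auto elim!: evenE oddE)
    then show ?thesis by blast
  qed
  ultimately show ?thesis by (simp add: f_def eta_def)
qed

text \<open>Serves the division by a power of \<open>eta\<close> in
  \<open>pairing_weight_10\<close>. With y = e(tau/2), y^2 is the usual q.\<close>

lemma eta_nonzero:
  assumes "\<tau> \<in> upper_half"
  shows "eta \<tau> \<noteq> 0"
proof -
  define y where "y = e2pi (\<tau> / 2)"
  have "norm y < 1" using assms by (simp add: y_def norm_e2pi upper_half_def)
  then obtain Q where Q: "Q \<noteq> 0"
    "(\<lambda>n. 1 + (\<Sum>s=1..n. (-1) ^ s * (y ^ (s * (3 * s - 1)) + y ^ (s * (3 * s + 1))))) \<longlonglongrightarrow> Q"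
    using Euler_pentagonal by blast
  define f where "f = (\<lambda>n::int. eta_sign n * e2pi (of_real (real_of_int (6 * n + 1) ^ 2 / 24) * \<tau>))"
  have f0: "f 0 = e2pi (\<tau> / 24)" by (simp add: f_def eta_sign_def)
  have sg: "eta_sign (int s) = (-1) ^ s" "eta_sign (- int s) = (-1) ^ s" for s
    by (auto simp: eta_sign_def)
  have fs: "f (int s) = e2pi (\<tau> / 24) * ((-1) ^ s * y ^ (s * (3 * s + 1)))" for s
  proof -
    have "of_real (real_of_int (6 * int s + 1) ^ 2 / 24) * \<tau> = \<tau> / 24 + of_nat (s * (3 * s + 1)) * (\<tau> / 2)"
      by (simp add: field_simps power2_eq_square)
    then show ?thesis unfolding f_def sg y_def e2pi_power by (simp only: e2pi_add mult_ac)
  qed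
  have fm: "f (- int s) = e2pi (\<tau> / 24) * ((-1) ^ s * y ^ (s * (3 * s - 1)))" if "s \<ge> 1" for s
  proof -
    have "of_real (real_of_int (6 * (- int s) + 1) ^ 2 / 24) * \<tau> = \<tau> / 24 + of_nat (s * (3 * s - 1)) * (\<tau> / 2)"
      using that by (simp add: field_simps power2_eq_square of_nat_diff)
    then show ?thesis unfolding f_def sg y_def e2pi_power by (simp only: e2pi_add mult_ac)
  qed
  have "(\<lambda>n. f 0 + (\<Sum>s=1..n. f (- int s) + f (int s))) \<longlonglongrightarrow> eta \<tau>"
    by (rule has_sum_int_symmetric) (use eta_has_sum[OF assms] in \<open>simp add: f_def\<close>)
  also have "(\<lambda>n. f 0 + (\<Sum>s=1..n. f (- int s) + f (int s)))
    = (\<lambda>n. e2pi (\<tau> / 24) * (1 + (\<Sum>s=1..n. (-1) ^ s * (y ^ (s * (3 * s - 1)) + y ^ (s * (3 * s + 1))))))"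
  proof
    fix n
    have "(\<Sum>s=1..n. f (- int s) + f (int s)) = (\<Sum>s=1..n. e2pi (\<tau> / 24) * ((-1) ^ s * (y ^ (s * (3 * s - 1)) + y ^ (s * (3 * s + 1)))))"
      by (intro sum.cong refl) (simp add: fs fm ring_distribs)
    then show "f 0 + (\<Sum>s=1..n. f (- int s) + f (int s))
      = e2pi (\<tau> / 24) * (1 + (\<Sum>s=1..n. (-1) ^ s * (y ^ (s * (3 * s - 1)) + y ^ (s * (3 * s + 1)))))"
      by (simp add: f0 distrib_left sum_distrib_left)
  qed
  finally have "(\<lambda>n. e2pi (\<tau> / 24) * (1 + (\<Sum>s=1..n. (-1) ^ s * (y ^ (s * (3 * s - 1)) + y ^ (s * (3 * s + 1)))))) \<longlonglongrightarrow> eta \<tau>" .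
  moreover have "(\<lambda>n. e2pi (\<tau> / 24) * (1 + (\<Sum>s=1..n. (-1) ^ s * (y ^ (s * (3 * s - 1)) + y ^ (s * (3 * s + 1)))))) \<longlonglongrightarrow> e2pi (\<tau> / 24) * Q"
    by (intro tendsto_mult_left Q)
  ultimately have "eta \<tau> = e2pi (\<tau> / 24) * Q" by (rule LIMSEQ_unique)
  with Q(1) show ?thesis by simp
qed

lemma eta_holomorphic [holomorphic_intros]: "eta holomorphic_on upper_half"
  unfolding eta_def by (intro holomorphic_intros) auto

lemma eta_T: "eta (\<tau> + 1) = e2pi (1 / 24) * eta \<tau>"
proof -
  have "e2pi (49 / 24) = e2pi (1 / 24 + of_int 2)" by simp
  also have "\<dots> = e2pi (1 / 24)" by (simp only: e2pi_add e2pi_of_int mult_1_right)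
  finally show ?thesis by (simp add: eta_def V_T right_diff_distrib)
qed

text \<open>Of the twelve residues, the even ones cancel between the two theta series, and 3 and 9
  cancel because cos(pi/2) = 0. The rest carries 2 cos(pi/6) = sqrt 3 with opposite signs on the
  residues 1 and 5.\<close>

lemma eta_S:
  assumes "\<tau> \<in> upper_half"
  shows "eta (- 1 / \<tau>) = csqrt (- \<i> * \<tau>) * eta \<tau>"
proof -
  have cis: "e2pi (of_real x) = cis (2 * pi * x)" for x
    by (simp add: e2pi_def cis_conv_exp mult_ac)
  have cis2: "cis (2 * pi - x) = cnj (cis x)" "cis (pi - x) = - cnj (cis x)" "cis (pi + x) = - cis x" for x
    by (simp_all add: complex_eq_iff cos_diff sin_diff)
  define W where "W = (\<lambda>l. V 6 l \<tau>)"
  have sym: "W (12 - l) = W l" for l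
    using V_period[of 6 "- l" \<tau>] V_uminus[of 6 l \<tau>] by (simp add: W_def algebra_simps)
  define c where "c = (\<lambda>l::nat. e2pi (of_real (real l / 12)))"
  have c6: "e2pi (of_int 7 * of_nat l / of_nat (2 * 6)) = (-1) ^ l * c l" for l
  proof -
    have "of_int 7 * of_nat l / of_nat (2 * 6) = of_nat l * (1 / 2) + (of_real (real l / 12) :: complex)"
      by (simp add: field_simps)
    moreover have "e2pi (1 / 2) = - 1" by (simp add: e2pi_def)
    ultimately show ?thesis unfolding c_def by (simp only: e2pi_add e2pi_power[symmetric])
  qed
  have c1: "e2pi (of_int 1 * of_nat l / of_nat (2 * 6)) = c l" for l
    by (simp add: c_def)
  have "eta (- 1 / \<tau>) = csqrt (- \<i> * \<tau>) / of_real (sqrt 12) * (\<Sum>l<12. (1 - (-1) ^ l) * c l * W (int l))"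
    unfolding eta_def V_S[OF zero_less_numeral assms] c1 c6 right_diff_distrib[symmetric] sum_subtractf[symmetric]
    by (simp add: W_def algebra_simps)
  also have "(\<Sum>l<12. (1 - (-1) ^ l) * c l * W (int l))
     = 2 * ((c 1 + c 11) * W 1 + (c 3 + c 9) * W 3 + (c 5 + c 7) * W 5)"
    using sym[of 1] sym[of 3] sym[of 5] by (simp add: numeral_eq_Suc lessThan_Suc algebra_simps)
  also have "c 1 + c 11 = of_real (sqrt 3)"
  proof -
    have a: "2 * pi * (real 1 / 12) = pi / 6" "2 * pi * (real 11 / 12) = 2 * pi - pi / 6" by simp_all
    show ?thesis unfolding c_def cis a cis2
      by (simp add: complex_eq_iff cos_30 sin_30)
  qed
  also have "c 3 + c 9 = 0"
  proof -
    have a: "2 * pi * (real 3 / 12) = pi / 2" "2 * pi * (real 9 / 12) = 2 * pi - pi / 2" by simp_all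
    show ?thesis unfolding c_def cis a cis2 by (simp add: complex_eq_iff)
  qed
  also have "c 5 + c 7 = - of_real (sqrt 3)"
  proof -
    have a: "2 * pi * (real 5 / 12) = pi - pi / 6" "2 * pi * (real 7 / 12) = pi + pi / 6" by simp_all
    show ?thesis unfolding c_def cis a cis2
      by (simp add: complex_eq_iff cos_30 sin_30)
  qed
  also have "W 5 = V 6 7 \<tau>" using sym[of 5] by (simp add: W_def)
  also have "sqrt 12 = 2 * sqrt 3"
    using real_sqrt_mult[of 4 3] by simp
  finally show ?thesis by (simp add: W_def eta_def right_diff_distrib)
qed

section \<open>Growth and vanishing of modular forms\<close>

text \<open>Dividing by \<open>1 - \<i> \<epsilon> w\<close> makes the function small on large half circles.\<close>

lemma half_plane_maximum_aux:
  assumes hol: "\<phi> holomorphic_on upper_half" and y1: "y1 > 0"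
    and bd: "\<And>z. Im z \<ge> y1 \<Longrightarrow> norm (\<phi> z) \<le> B"
    and line: "\<And>z. Im z = y1 \<Longrightarrow> norm (\<phi> z) \<le> A"
    and A: "A > 0" and \<tau>: "Im \<tau> \<ge> y1" and \<epsilon>: "\<epsilon> > 0"
  shows "norm (\<phi> \<tau>) \<le> A * (1 + \<epsilon> * norm (\<tau> - Complex 0 y1))"
proof -
  define p where "p = Complex 0 y1"
  define D where "D = (\<lambda>z. 1 - \<i> * of_real \<epsilon> * (z - p))"
  have B: "B \<ge> 0" using bd[OF \<tau>] norm_ge_zero[of "\<phi> \<tau>"] by linarith
  have D1: "norm (D z) \<ge> 1" "norm (D z) \<ge> \<epsilon> * norm (z - p)" if "Im z \<ge> y1" for z
  proof -
    have "Re (D z) = 1 + \<epsilon> * (Im z - y1)" by (simp add: D_def p_def)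
    then have "1 \<le> \<bar>Re (D z)\<bar>" using that \<epsilon> by simp
    then show "norm (D z) \<ge> 1" using abs_Re_le_cmod[of "D z"] by linarith
    have Im: "Im (D z) = - \<epsilon> * Re (z - p)" by (simp add: D_def p_def)
    have "(\<epsilon> * norm (z - p))\<^sup>2 = (\<epsilon> * (Im z - y1))\<^sup>2 + (\<epsilon> * Re (z - p))\<^sup>2"
      unfolding power_mult_distrib cmod_power2 by (simp add: p_def distrib_left)
    also have "\<dots> \<le> (norm (D z))\<^sup>2"
      unfolding cmod_power2 \<open>Re (D z) = _\<close> Im using that \<epsilon> by (simp add: power_mono)
    finally show "norm (D z) \<ge> \<epsilon> * norm (z - p)" by (rule power2_le_imp_le) simp
  qed
  have Dnz: "D z \<noteq> 0" if "Im z \<ge> y1" for z using D1(1)[OF that] by auto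
  \<comment> \<open>Large enough to enclose tau, and to push the quotient below A on the circular
    part of the boundary, where |D| is at least epsilon R.\<close>
  define R where "R = max (norm (\<tau> - p)) (B / (\<epsilon> * A)) + 1"
  have R: "R > 0" "norm (\<tau> - p) < R" "B \<le> A * (\<epsilon> * R)"
  proof -
    show "R > 0" unfolding R_def by (smt (verit) norm_ge_zero)
    show "norm (\<tau> - p) < R" unfolding R_def by simp
    have "B / (\<epsilon> * A) \<le> R" unfolding R_def by simp
    then show "B \<le> A * (\<epsilon> * R)" using \<epsilon> A by (simp add: field_simps)
  qed
  define S where "S = {z. Im z \<ge> y1} \<inter> cball p R"
  have SH: "S \<subseteq> upper_half" using y1 by (auto simp: S_def upper_half_def)
  have cl: "closed S" unfolding S_def by (intro closed_Int closed_halfspace_Im_ge closed_cball)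
  have hol': "(\<lambda>z. \<phi> z / D z) holomorphic_on {z. Im z \<ge> y1}"
    using hol y1 Dnz unfolding D_def
    by (intro holomorphic_intros) (auto intro: holomorphic_on_subset simp: upper_half_def)
  have "norm (\<phi> \<tau> / D \<tau>) \<le> A"
  proof (rule maximum_modulus_frontier[of "\<lambda>z. \<phi> z / D z" S A \<tau>])
    show "(\<lambda>z. \<phi> z / D z) holomorphic_on interior S"
      by (rule holomorphic_on_subset[OF hol'], rule subset_trans[OF interior_subset]) (auto simp: S_def)
    show "continuous_on (closure S) (\<lambda>z. \<phi> z / D z)"
      using cl by (intro holomorphic_on_imp_continuous_on holomorphic_on_subset[OF hol']) (auto simp: S_def)
    show "bounded S" unfolding S_def by (intro bounded_Int) auto
    show "\<tau> \<in> S" using \<tau> R(2) by (auto simp: S_def dist_norm norm_minus_commute)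
    fix z assume z: "z \<in> frontier S"
    have zS: "z \<in> S" using z cl frontier_subset_closed by blast
    then have Imz: "Im z \<ge> y1" by (simp add: S_def)
    show "norm (\<phi> z / D z) \<le> A"
    proof (cases "Im z = y1")
      case True
      have "norm (\<phi> z) / norm (D z) \<le> A / 1"
        using line[OF True] D1(1)[OF Imz] A by (intro frac_le) auto
      then show ?thesis by (simp add: norm_divide)
    next
      case False
      have "norm (z - p) = R"
      proof (rule ccontr)
        assume "norm (z - p) \<noteq> R"
        then have "z \<in> {z. Im z > y1} \<inter> ball p R" using zS False by (auto simp: S_def dist_norm norm_minus_commute)
        moreover have "open ({z. Im z > y1} \<inter> ball p R)" by (intro open_Int open_halfspace_Im_gt open_ball)
        moreover have "{z. Im z > y1} \<inter> ball p R \<subseteq> S" by (auto simp: S_def)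
        ultimately have "z \<in> interior S" by (meson interiorI)
        then show False using z by (simp add: frontier_def)
      qed
      then have "norm (D z) \<ge> \<epsilon> * R" using D1(2)[OF Imz] by simp
      then have "norm (\<phi> z) / norm (D z) \<le> B / (\<epsilon> * R)"
        using bd[OF Imz] B \<epsilon> R(1) by (intro frac_le) auto
      also have "\<dots> \<le> A" using R \<epsilon> by (simp add: field_simps)
      finally show ?thesis by (simp add: norm_divide)
    qed
  qed
  then have "norm (\<phi> \<tau>) \<le> A * norm (D \<tau>)" using Dnz[OF \<tau>] by (simp add: norm_divide field_simps)
  also have "norm (D \<tau>) \<le> 1 + \<epsilon> * norm (\<tau> - p)"
    unfolding D_def using norm_triangle_ineq4[of 1 "\<i> * of_real \<epsilon> * (\<tau> - p)"] \<epsilon> by (simp add: norm_mult)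
  finally show ?thesis using A by (simp add: p_def)
qed

lemma half_plane_maximum:
  assumes hol: "\<phi> holomorphic_on upper_half" and y1: "y1 > 0"
    and bd: "\<And>z. Im z \<ge> y1 \<Longrightarrow> norm (\<phi> z) \<le> B"
    and line: "\<And>z. Im z = y1 \<Longrightarrow> norm (\<phi> z) \<le> A"
    and \<tau>: "Im \<tau> \<ge> y1"
  shows "norm (\<phi> \<tau>) \<le> A"
proof (rule field_le_epsilon)
  fix d :: real assume d: "d > 0"
  define m where "m = norm (\<tau> - Complex 0 y1)"
  have A0: "A \<ge> 0" using line[of "Complex 0 y1"] norm_ge_zero[of "\<phi> (Complex 0 y1)"] by (simp only: complex.sel) linarith
  \<comment> \<open>A + d/2 replaces A because the auxiliary bound requires a positive constant;
    epsilon is chosen so that its excess stays below d/2.\<close>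
  have "norm (\<phi> \<tau>) \<le> (A + d / 2) * (1 + d / (2 * (A + d / 2) * (m + 1)) * m)"
    unfolding m_def
  proof (rule half_plane_maximum_aux[OF hol y1 bd _ _ \<tau>])
    show "norm (\<phi> z) \<le> A + d / 2" if "Im z = y1" for z using line[OF that] d by simp
    show "0 < A + d / 2" using A0 d by simp
    then show "0 < d / (2 * (A + d / 2) * (cmod (\<tau> - Complex 0 y1) + 1))"
      using d by (intro divide_pos_pos mult_pos_pos) (auto intro: add_nonneg_pos)
  qed
  also have "\<dots> = A + d / 2 + d / 2 * (m / (m + 1))"
  proof -
    define u where "u = A + d / 2"
    have "m \<ge> 0" by (simp add: m_def)
    then have "u \<noteq> 0" "m + 1 \<noteq> 0" using A0 d by (auto simp: u_def)
    then have "u * (d / (2 * u * (m + 1)) * m) = d / 2 * (m / (m + 1))" by simp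
    then show ?thesis unfolding u_def[symmetric] by (simp only: distrib_left mult_1_right)
  qed
  also have "m / (m + 1) \<le> 1"
  proof -
    have "m \<ge> 0" by (simp add: m_def)
    then show ?thesis by simp
  qed
  finally show "norm (\<phi> \<tau>) \<le> A + d" using d by (simp add: mult_left_mono)
qed

lemma shift_invariant_int:
  assumes T: "\<And>\<tau>. \<tau> \<in> upper_half \<Longrightarrow> N (\<tau> + 1) = N \<tau>" and \<tau>: "\<tau> \<in> upper_half"
  shows "N (\<tau> + of_int k) = N \<tau>"
proof -
  have nat: "N (z + of_nat m) = N z" if "z \<in> upper_half" for z m
  proof (induction m)
    case (Suc m)
    have "z + of_nat m \<in> upper_half" using that by (simp add: upper_half_def)
    from T[OF this] Suc show ?case by (simp add: add_ac)
  qed simp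
  show ?thesis
  proof (cases k rule: int_cases2)
    case (nonneg m) then show ?thesis using nat[OF \<tau>] by simp
  next
    case (nonpos m)
    have "\<tau> - of_nat m \<in> upper_half" using \<tau> by (simp add: upper_half_def)
    from nat[OF this, of m] nonpos show ?thesis by simp
  qed
qed

text \<open>A coarse form of the reduction to the fundamental domain. Below height 4/5 a translate
  satisfies |tau|^2 <= 1/4 + 16/25 < 9/10, so inversion raises the height by a factor of at least
  10/9.\<close>

lemma reduction_to_large_Im:
  assumes T: "\<And>\<tau>. \<tau> \<in> upper_half \<Longrightarrow> N (\<tau> + 1) = N \<tau>"
    and S: "\<And>\<tau>. \<tau> \<in> upper_half \<Longrightarrow> N (- 1 / \<tau>) = N \<tau>"
    and \<tau>: "\<tau> \<in> upper_half"
  shows "\<exists>\<tau>'. Im \<tau>' \<ge> 4 / 5 \<and> N \<tau>' = N \<tau>"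
proof -
  have ind: "\<exists>\<tau>'. Im \<tau>' \<ge> 4 / 5 \<and> N \<tau>' = N \<tau>" if "\<tau> \<in> upper_half" "Im \<tau> \<ge> 4 / 5 * (9 / 10) ^ n" for n \<tau>
    using that
  proof (induction n arbitrary: \<tau>)
    case 0 then show ?case by auto
  next
    case (Suc n)
    show ?case
    proof (cases "Im \<tau> \<ge> 4 / 5")
      case False
      define \<sigma> where "\<sigma> = \<tau> + of_int (- round (Re \<tau>))"
      have \<sigma>: "\<sigma> \<in> upper_half" "Im \<sigma> = Im \<tau>" using Suc.prems by (auto simp: \<sigma>_def upper_half_def)
      have "\<bar>Re \<sigma>\<bar> \<le> 1 / 2"
        using of_int_round_abs_le[of "Re \<tau>"] by (simp add: \<sigma>_def abs_minus_commute)
      then have "(Re \<sigma>)\<^sup>2 \<le> (1 / 2)\<^sup>2" using power_mono[of "\<bar>Re \<sigma>\<bar>" "1/2" 2] by simp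
      moreover have "(Im \<sigma>)\<^sup>2 \<le> (4 / 5)\<^sup>2" using False \<sigma> by (intro power_mono) (auto simp: upper_half_def)
      ultimately have c: "(cmod \<sigma>)\<^sup>2 \<le> 9 / 10" unfolding cmod_power2 by (simp add: power_divide)
      have c0: "(cmod \<sigma>)\<^sup>2 > 0" using \<sigma> by (auto simp: upper_half_def)
      have "Im \<tau> / (9 / 10) \<le> Im (- 1 / \<sigma>)"
        unfolding Im_neg_inverse \<sigma>(2) using c c0 Suc.prems by (intro divide_left_mono) (auto simp: upper_half_def)
      then have "4 / 5 * (9 / 10) ^ n \<le> Im (- 1 / \<sigma>)" using Suc.prems by simp
      from Suc.IH[OF neg_inverse_upper_half[OF \<sigma>(1)] this] S[OF \<sigma>(1)]
        shift_invariant_int[of N, OF T Suc.prems(1), of "- round (Re \<tau>)"]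
      show ?thesis by (simp add: \<sigma>_def)
    qed auto
  qed
  have "Im \<tau> > 0" using \<tau> by (simp add: upper_half_def)
  then obtain n where "(9 / 10) ^ n < Im \<tau>" using real_arch_pow_inv[of "Im \<tau>" "9 / 10"] by auto
  moreover have "4 / 5 * (9 / 10) ^ n \<le> ((9 / 10) ^ n :: real)" by simp
  ultimately have "4 / 5 * (9 / 10) ^ n \<le> Im \<tau>" by linarith
  then show ?thesis by (rule ind[OF \<tau>])
qed

text \<open>If all exponents are at least \<open>e\<^sub>0\<close>, the maximum principle on the half plane \<open>Im w \<ge> 9/10 Im \<tau>\<close>
  shows that the invariant norm at \<open>\<tau>\<close> is at most a constant \<open>< 1\<close> times its supremum.\<close>

lemma modular_vanishing:
  fixes F :: "'i \<Rightarrow> complex \<Rightarrow> complex" and I :: "'i set" and k e0 :: real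
  defines "N \<equiv> \<lambda>\<tau>. Im \<tau> powr k * (\<Sum>i\<in>I. (norm (F i \<tau>))\<^sup>2)"
  assumes fin: "finite I" and hol: "\<And>i. i \<in> I \<Longrightarrow> F i holomorphic_on upper_half"
    and T: "\<And>\<tau>. \<tau> \<in> upper_half \<Longrightarrow> N (\<tau> + 1) = N \<tau>"
    and S: "\<And>\<tau>. \<tau> \<in> upper_half \<Longrightarrow> N (- 1 / \<tau>) = N \<tau>"
    and bd: "\<And>i. i \<in> I \<Longrightarrow> \<exists>B. \<forall>\<tau>. Im \<tau> \<ge> 1 / 2 \<longrightarrow> norm (F i \<tau>) \<le> B * exp (- 2 * pi * e0 * Im \<tau>)"
    and k: "k > 0" and e0: "e0 > 0" and c: "k / 2 * ln (10 / 9) < 2 * pi * e0 * (8 / 100)"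
    and "i \<in> I" "\<tau> \<in> upper_half"
  shows "F i \<tau> = 0"
proof -
  define G where "G = (\<lambda>\<tau>. sqrt (\<Sum>i\<in>I. (norm (F i \<tau>))\<^sup>2))"
  have G0: "G \<tau> \<ge> 0" for \<tau> by (simp add: G_def sum_nonneg)
  have G2: "(G \<tau>)\<^sup>2 = (\<Sum>i\<in>I. (norm (F i \<tau>))\<^sup>2)" for \<tau> by (simp add: G_def sum_nonneg)
  have NG: "N \<tau> = Im \<tau> powr k * (G \<tau>)\<^sup>2" for \<tau> by (simp add: N_def G2)
  have N0: "N \<tau> \<ge> 0" for \<tau> unfolding NG by simp
  obtain B where B: "\<And>i \<tau>. i \<in> I \<Longrightarrow> Im \<tau> \<ge> 1 / 2 \<Longrightarrow> norm (F i \<tau>) \<le> B i * exp (- 2 * pi * e0 * Im \<tau>)"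
    using bd by metis
  have B0: "B i \<ge> 0" if "i \<in> I" for i
  proof -
    have "0 \<le> B i * exp (- 2 * pi * e0 * Im \<i>)" using B[OF that, of \<i>] norm_ge_zero[of "F i \<i>"] by (simp del: norm_ge_zero)
    then show ?thesis by (simp add: zero_le_mult_iff)
  qed
  define b where "b = sqrt (\<Sum>i\<in>I. (B i)\<^sup>2)"
  have b0: "b \<ge> 0" by (simp add: b_def sum_nonneg)
  have Gb: "G \<tau> \<le> b * exp (- 2 * pi * e0 * Im \<tau>)" if "Im \<tau> \<ge> 1 / 2" for \<tau>
  proof (rule power2_le_imp_le)
    have "(G \<tau>)\<^sup>2 \<le> (\<Sum>i\<in>I. (B i * exp (- 2 * pi * e0 * Im \<tau>))\<^sup>2)"
      unfolding G2 using B that by (intro sum_mono power_mono) auto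
    also have "\<dots> = (b * exp (- 2 * pi * e0 * Im \<tau>))\<^sup>2"
      by (simp add: power_mult_distrib sum_distrib_right[symmetric] b_def sum_nonneg)
    finally show "(G \<tau>)\<^sup>2 \<le> (b * exp (- 2 * pi * e0 * Im \<tau>))\<^sup>2" .
  qed (use b0 in simp)
  define C where "C = (k / (4 * pi * e0)) powr k * b\<^sup>2"
  have NC: "N \<tau> \<le> C" if "Im \<tau> \<ge> 4 / 5" for \<tau>
  proof -
    define y where "y = Im \<tau>"
    have y: "y > 0" using that by (simp add: y_def)
    \<comment> \<open>x <= exp x at this point bounds y^k by a multiple of exp(4 pi e0 y), which the
      decay of G^2 compensates exactly.\<close>
    have "4 * pi * e0 / k * y \<le> exp (4 * pi * e0 / k * y)" using exp_ge_add_one_self[of "4 * pi * e0 / k * y"] by linarith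
    then have "y \<le> k / (4 * pi * e0) * exp (4 * pi * e0 / k * y)" using k e0 by (simp add: field_simps)
    then have "y powr k \<le> (k / (4 * pi * e0) * exp (4 * pi * e0 / k * y)) powr k" using y k by (intro powr_mono2) auto
    also have "\<dots> = (k / (4 * pi * e0)) powr k * exp (4 * pi * e0 * y)"
      using k e0 by (subst powr_mult) (auto simp: exp_powr_real)
    finally have 1: "y powr k \<le> (k / (4 * pi * e0)) powr k * exp (4 * pi * e0 * y)" .
    have "(G \<tau>)\<^sup>2 \<le> (b * exp (- 2 * pi * e0 * y))\<^sup>2"
      unfolding y_def using that by (intro power_mono Gb G0) auto
    also have "\<dots> = b\<^sup>2 * exp (- 4 * pi * e0 * y)"
      by (simp add: power_mult_distrib power2_eq_square exp_add[symmetric])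
    finally have 2: "(G \<tau>)\<^sup>2 \<le> b\<^sup>2 * exp (- 4 * pi * e0 * y)" .
    have "N \<tau> \<le> ((k / (4 * pi * e0)) powr k * exp (4 * pi * e0 * y)) * (b\<^sup>2 * exp (- 4 * pi * e0 * y))"
      unfolding NG y_def[symmetric] by (intro mult_mono 1 2) auto
    then show ?thesis by (simp add: C_def exp_minus field_simps)
  qed
  have bdd: "bdd_above (N ` upper_half)"
  proof (rule bdd_aboveI2)
    fix \<tau> assume "\<tau> \<in> upper_half"
    then obtain \<tau>' where "Im \<tau>' \<ge> 4 / 5" "N \<tau>' = N \<tau>" using reduction_to_large_Im[OF T S] by blast
    then show "N \<tau> \<le> C" using NC[of \<tau>'] by simp
  qed
  define M where "M = (SUP \<tau>\<in>upper_half. N \<tau>)"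
  have NM: "N \<tau> \<le> M" if "\<tau> \<in> upper_half" for \<tau> unfolding M_def by (rule cSUP_upper[OF that bdd])
  have iH: "\<i> \<in> upper_half" by (simp add: upper_half_def)
  have M0: "M \<ge> 0" using NM[OF iH] N0[of \<i>] by linarith
  \<comment> \<open>Descending from height y to 9y/10 costs (10/9)^k through the weight and gains
    exp(-4 pi e0 y/10), where y >= 4/5. Hypothesis \<open>c\<close> says that the gain wins; it
    amounts to e0 above roughly 0.105 k, compared with the sharp threshold k/12.\<close>
  define q where "q = exp (k * ln (10 / 9) - 4 * pi * e0 * (8 / 100))"
  have q: "q < 1" "q > 0" using c by (auto simp: q_def)
  have main: "N \<tau> \<le> q * M" if \<tau>: "Im \<tau> \<ge> 4 / 5" for \<tau>
  proof -
    define y where "y = Im \<tau>"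
    have y: "y \<ge> 4 / 5" "y > 0" using \<tau> by (simp_all add: y_def)
    \<comment> \<open>Pairing with the fixed vector F(tau) gives a scalar holomorphic function equal
      to G(tau)^2 at w = tau and bounded by G(tau) G(w). The twist by e(-e0 w) in the next line
      makes it bounded at the cusp.\<close>
    define f where "f = (\<lambda>w. \<Sum>i\<in>I. cnj (F i \<tau>) * F i w)"
    define \<phi> where "\<phi> = (\<lambda>w. f w * e2pi (- of_real e0 * w))"
    have fG: "norm (f w) \<le> G \<tau> * G w" for w
    proof -
      have "norm (f w) \<le> (\<Sum>i\<in>I. \<bar>norm (F i \<tau>)\<bar> * \<bar>norm (F i w)\<bar>)"
        unfolding f_def by (rule order.trans[OF norm_sum]) (simp add: norm_mult)
      also have "\<dots> \<le> L2_set (\<lambda>i. norm (F i \<tau>)) I * L2_set (\<lambda>i. norm (F i w)) I"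
        by (rule L2_set_mult_ineq)
      finally show ?thesis by (simp add: L2_set_def G_def)
    qed
    have n: "norm (e2pi (- of_real e0 * w)) = exp (2 * pi * e0 * Im w)" for w by (simp add: norm_e2pi)
    have line: "norm (\<phi> w) \<le> G \<tau> * sqrt (M * (9 / 10 * y) powr (- k)) * exp (2 * pi * e0 * (9 / 10 * y))" if "Im w = 9 / 10 * y" for w
    proof -
      have w: "w \<in> upper_half" using that y by (simp add: upper_half_def)
      have "(G w)\<^sup>2 = N w * Im w powr (- k)" using w by (simp add: NG powr_minus upper_half_def field_simps)
      also have "\<dots> \<le> M * Im w powr (- k)" by (intro mult_right_mono NM w) simp
      finally have "G w \<le> sqrt (M * (9 / 10 * y) powr (- k))" unfolding that by (rule real_le_rsqrt)
      then have "norm (f w) \<le> G \<tau> * sqrt (M * (9 / 10 * y) powr (- k))"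
        using fG[of w] G0[of \<tau>] by (meson mult_left_mono order.trans)
      then show ?thesis unfolding \<phi>_def norm_mult n that by (intro mult_right_mono) auto
    qed
    have "norm (\<phi> \<tau>) \<le> G \<tau> * sqrt (M * (9 / 10 * y) powr (- k)) * exp (2 * pi * e0 * (9 / 10 * y))"
    proof (rule half_plane_maximum[of \<phi> "9 / 10 * y" "G \<tau> * b"])
      show "\<phi> holomorphic_on upper_half" unfolding \<phi>_def f_def by (intro holomorphic_intros hol)
      show "norm (\<phi> z) \<le> G \<tau> * b" if "Im z \<ge> 9 / 10 * y" for z
      proof -
        have "Im z \<ge> 1 / 2" using that y by simp
        from mult_left_mono[OF Gb[OF this] G0[of \<tau>]] have "norm (f z) \<le> G \<tau> * (b * exp (- 2 * pi * e0 * Im z))"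
          using fG[of z] by linarith
        then have "norm (f z) * exp (2 * pi * e0 * Im z) \<le> G \<tau> * (b * exp (- 2 * pi * e0 * Im z)) * exp (2 * pi * e0 * Im z)"
          by (intro mult_right_mono) auto
        then show ?thesis unfolding \<phi>_def norm_mult n by (simp add: exp_minus field_simps)
      qed
    qed (use line y in \<open>auto simp: y_def\<close>)
    moreover have "f \<tau> = of_real ((G \<tau>)\<^sup>2)"
      unfolding f_def G2 of_real_sum by (intro sum.cong refl) (simp only: complex_norm_square mult.commute)
    ultimately have "(G \<tau>)\<^sup>2 * exp (2 * pi * e0 * y) \<le> G \<tau> * sqrt (M * (9 / 10 * y) powr (- k)) * exp (2 * pi * e0 * (9 / 10 * y))"
      unfolding \<phi>_def norm_mult n by (simp add: y_def norm_power)
    then have "G \<tau> * (G \<tau> * exp (2 * pi * e0 * y)) \<le> G \<tau> * (sqrt (M * (9 / 10 * y) powr (- k)) * exp (2 * pi * e0 * (9 / 10 * y)))"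
      by (simp add: power2_eq_square mult_ac)
    then have "G \<tau> * exp (2 * pi * e0 * y) \<le> sqrt (M * (9 / 10 * y) powr (- k)) * exp (2 * pi * e0 * (9 / 10 * y))"
      using G0[of \<tau>] M0 by (cases "G \<tau> = 0") (auto simp: mult_le_cancel_left)
    then have "G \<tau> \<le> sqrt (M * (9 / 10 * y) powr (- k)) * exp (2 * pi * e0 * (9 / 10 * y)) / exp (2 * pi * e0 * y)"
      by (simp add: field_simps)
    also have "\<dots> = sqrt (M * (9 / 10 * y) powr (- k)) * exp (- (2 * pi * e0 * (y / 10)))"
    proof -
      have "2 * pi * e0 * (9 / 10 * y) - 2 * pi * e0 * y = - (2 * pi * e0 * (y / 10))" by (simp add: field_simps)
      then show ?thesis unfolding times_divide_eq_right[symmetric] exp_diff[symmetric] by simp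
    qed
    finally have "(G \<tau>)\<^sup>2 \<le> (sqrt (M * (9 / 10 * y) powr (- k)) * exp (- (2 * pi * e0 * (y / 10))))\<^sup>2"
      using G0 by (intro power_mono) auto
    also have "\<dots> = M * (9 / 10 * y) powr (- k) * exp (- (4 * pi * e0 * (y / 10)))"
      using M0 by (simp add: power_mult_distrib power2_eq_square[of "exp _"] exp_add[symmetric])
    also have "\<dots> \<le> M * (9 / 10 * y) powr (- k) * exp (- (4 * pi * e0 * (8 / 100)))"
      using M0 y e0 by (intro mult_left_mono) auto
    finally have "N \<tau> \<le> y powr k * (M * (9 / 10 * y) powr (- k) * exp (- (4 * pi * e0 * (8 / 100))))"
      unfolding NG y_def[symmetric] by (intro mult_left_mono) auto
    also have "\<dots> = q * M"
    proof -
      have 0: "(9 / 10 * y) powr (- k) = exp (k * ln (10 / 9)) * y powr (- k)"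
      proof -
        have "ln (9 / 10 :: real) = - ln (10 / 9)" by (simp add: ln_div)
        then have "(9 / 10) powr (- k) = exp (k * ln (10 / 9))" by (simp add: powr_def)
        then show ?thesis using y by (subst powr_mult) auto
      qed
      have 1: "y powr k * y powr (- k) = 1" using y by (simp add: powr_minus)
      have 2: "q = exp (k * ln (10 / 9)) * exp (- (4 * pi * e0 * (8 / 100)))"
        unfolding q_def exp_add[symmetric] by simp
      have "y powr k * (M * (9 / 10 * y) powr (- k) * exp (- (4 * pi * e0 * (8 / 100))))
        = (y powr k * y powr (- k)) * (q * M)"
        unfolding 0 2 by (simp only: mult_ac)
      then show ?thesis unfolding 1 by simp
    qed
    finally show ?thesis .
  qed
  have "N \<tau> \<le> q * M" if "\<tau> \<in> upper_half" for \<tau>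
    using reduction_to_large_Im[OF T S that] main by metis
  then have "M \<le> q * M" unfolding M_def by (intro cSUP_least) (use iH in auto)
  then have "M = 0" using q M0 by (smt (verit) mult_less_cancel_right2)
  then have "N \<tau> = 0" using NM[OF \<open>\<tau> \<in> upper_half\<close>] N0[of \<tau>] by simp
  then have "(\<Sum>i\<in>I. (norm (F i \<tau>))\<^sup>2) = 0" using \<open>\<tau> \<in> upper_half\<close> by (simp add: N_def upper_half_def)
  then show ?thesis using fin \<open>i \<in> I\<close> by (simp add: sum_nonneg_eq_0_iff)
qed

section \<open>The cusp at infinity and the constant term of a form of weight 2\<close>

abbreviation i_inf :: "complex filter" where
  "i_inf \<equiv> filtercomap Im at_top"

lemma eventually_i_inf: "eventually P i_inf \<longleftrightarrow> (\<exists>Y. \<forall>\<tau>. Im \<tau> \<ge> Y \<longrightarrow> P \<tau>)"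
  unfolding eventually_filtercomap eventually_at_top_linorder by auto

lemma i_inf_neq_bot: "i_inf \<noteq> bot"
proof
  assume "i_inf = bot"
  then have "eventually (\<lambda>_. False) i_inf" by simp
  then obtain Y where "\<And>\<tau>. Im \<tau> \<ge> Y \<Longrightarrow> False" unfolding eventually_i_inf by blast
  from this[of "Complex 0 Y"] show False by simp
qed

lemma eventually_upper_half_i_inf: "eventually (\<lambda>\<tau>. \<tau> \<in> upper_half) i_inf"
  unfolding eventually_i_inf by (rule exI[of _ 1]) (auto simp: upper_half_def)

text \<open>The abelianization of the modular group has no characters with values in the additive group of
  the complex numbers, so a primitive of a form of weight 2 is invariant.\<close>

lemma weight_2_constant_term:
  assumes hol: "g holomorphic_on upper_half"
    and T: "\<And>\<tau>. \<tau> \<in> upper_half \<Longrightarrow> g (\<tau> + 1) = g \<tau>"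
    and S: "\<And>\<tau>. \<tau> \<in> upper_half \<Longrightarrow> g (- 1 / \<tau>) = \<tau>\<^sup>2 * g \<tau>"
    and lim: "(g \<longlongrightarrow> L) i_inf"
  shows "L = 0"
proof -
  obtain G where "\<And>\<tau>. \<tau> \<in> upper_half \<Longrightarrow> (G has_field_derivative g \<tau>) (at \<tau> within upper_half)"
    using holomorphic_convex_primitive'[OF convex_upper_half open_upper_half hol] by blast
  then have G: "(G has_field_derivative g \<tau>) (at \<tau>)" if "\<tau> \<in> upper_half" for \<tau>
    using that at_within_open[OF that open_upper_half] by metis
  have const: "P x = P y" if "\<And>z. z \<in> upper_half \<Longrightarrow> (P has_field_derivative 0) (at z)" "x \<in> upper_half" "y \<in> upper_half"
    for P :: "complex \<Rightarrow> complex" and x y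
    using has_field_derivative_zero_constant[OF convex_upper_half, of P] that
    by (metis has_field_derivative_at_within)
  have iH: "\<i> \<in> upper_half" by (simp add: upper_half_def)
  have inv: "G (- 1 / \<tau>) = G \<tau>" if \<tau>: "\<tau> \<in> upper_half" for \<tau>
  proof -
    have "((\<lambda>z. G (- 1 / z) - G z) has_field_derivative 0) (at z)" if z: "z \<in> upper_half" for z
    proof -
      have z0: "z \<noteq> 0" using z by (auto simp: upper_half_def)
      have "((\<lambda>z. - 1 / z) has_field_derivative 1 / z\<^sup>2) (at z)"
        using z0 by (auto intro!: derivative_eq_intros simp: power2_eq_square)
      from DERIV_chain2[OF G[OF neg_inverse_upper_half[OF z]] this]
      have "((\<lambda>z. G (- 1 / z)) has_field_derivative g (- 1 / z) * (1 / z\<^sup>2)) (at z)" .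
      from DERIV_diff[OF this G[OF z]] show ?thesis using z0 S[OF z] by simp
    qed
    from const[OF this \<tau> iH] show ?thesis by simp
  qed
  define c where "c = G (\<i> + 1) - G \<i>"
  have c: "G (\<tau> + 1) - G \<tau> = c" if \<tau>: "\<tau> \<in> upper_half" for \<tau>
  proof -
    have "((\<lambda>z. G (z + 1) - G z) has_field_derivative 0) (at z)" if z: "z \<in> upper_half" for z
    proof -
      have "z + 1 \<in> upper_half" using z by (simp add: upper_half_def)
      from G[OF this] have "((\<lambda>z. G (z + 1)) has_field_derivative g (z + 1)) (at z)" by (simp add: DERIV_shift)
      from DERIV_diff[OF this G[OF z]] show ?thesis by (simp add: T[OF z])
    qed
    from const[OF this \<tau> iH] show ?thesis by (simp add: c_def)
  qed
  \<comment> \<open>The primitive third root of unity, at which S and T agree: -1/omega = omega + 1.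
    Invariance of G under S therefore gives c = 0.\<close>
  define \<omega> where "\<omega> = Complex (- 1 / 2) (sqrt 3 / 2)"
  have \<omega>: "\<omega> \<in> upper_half" by (simp add: \<omega>_def upper_half_def)
  have "- 1 / \<omega> = \<omega> + 1"
  proof -
    have "\<omega> * (\<omega> + 1) = - 1" by (simp add: \<omega>_def complex_eq_iff)
    moreover have "\<omega> \<noteq> 0" using \<omega> by (auto simp: upper_half_def)
    ultimately show ?thesis by (simp add: field_simps)
  qed
  then have c0: "c = 0" using inv[OF \<omega>] c[OF \<omega>] by simp
  have "norm L \<le> \<epsilon>" if "\<epsilon> > 0" for \<epsilon>
  proof -
    have "\<forall>\<^sub>F \<tau> in i_inf. dist (g \<tau>) L < \<epsilon>" using lim that by (rule tendstoD)
    then obtain Y where Y: "\<And>\<tau>. Im \<tau> \<ge> Y \<Longrightarrow> dist (g \<tau>) L < \<epsilon>" unfolding eventually_i_inf by blast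
    define p where "p = Complex 0 (max Y 1)"
    have p: "p \<in> upper_half" "Im p \<ge> Y" by (auto simp: p_def upper_half_def)
    have Im: "Im z = Im p" if "z \<in> closed_segment p (p + 1)" for z
      using that by (auto simp: closed_segment_def algebra_simps)
    \<comment> \<open>On a horizontal unit segment high up, g is within epsilon of L, so the
      increment of G, which is c = 0, is within epsilon of L.\<close>
    have "norm ((G (p + 1) - L * (p + 1)) - (G p - L * p)) \<le> \<epsilon> * norm (p + 1 - p)"
    proof (rule field_differentiable_bound[where S = "closed_segment p (p + 1)"])
      fix z assume z: "z \<in> closed_segment p (p + 1)"
      have "z \<in> upper_half" using Im[OF z] p by (simp add: upper_half_def)
      from G[OF this] have "((\<lambda>z. G z - L * z) has_field_derivative g z - L) (at z)"
        by (auto intro!: derivative_eq_intros)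
      then show "((\<lambda>z. G z - L * z) has_field_derivative g z - L) (at z within closed_segment p (p + 1))"
        by (rule has_field_derivative_at_within)
      show "norm (g z - L) \<le> \<epsilon>" using Y[of z] Im[OF z] p by (simp add: dist_norm)
    qed auto
    then show ?thesis using c[OF p(1)] c0 by (simp add: algebra_simps)
  qed
  then show ?thesis by (metis dense norm_le_zero_iff not_less)
qed

section \<open>Generalized q-series\<close>

text \<open>Absolute convergence at height y0 controls all greater heights, since each nonzero term
  decays at least like exp(-2 pi e0 (Im tau - y0)).\<close>

lemma qseries_bound:
  fixes s :: "'i \<Rightarrow> complex" and e :: "'i \<Rightarrow> real"
  assumes sum: "\<And>\<tau>. \<tau> \<in> upper_half \<Longrightarrow> ((\<lambda>i. s i * e2pi (of_real (e i) * \<tau>)) has_sum f \<tau>) I"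
    and e0: "\<And>i. i \<in> I \<Longrightarrow> s i \<noteq> 0 \<Longrightarrow> e i \<ge> e0" and y0: "y0 > 0"
  shows "\<exists>B. \<forall>\<tau>. Im \<tau> \<ge> y0 \<longrightarrow> norm (f \<tau>) \<le> B * exp (- 2 * pi * e0 * Im \<tau>)"
proof -
  define p where "p = Complex 0 y0"
  have "p \<in> upper_half" using y0 by (simp add: p_def upper_half_def)
  from has_sum_imp_summable[OF sum[OF this]]
  have "(\<lambda>i. norm (s i * e2pi (of_real (e i) * p))) summable_on I"
    by (rule summable_on_iff_abs_summable_on_complex[THEN iffD1])
  then have smb: "(\<lambda>i. norm (s i) * exp (- 2 * pi * e i * y0)) summable_on I"
    by (simp add: norm_mult norm_e2pi p_def mult_ac)
  define B where "B = (\<Sum>\<^sub>\<infinity>i\<in>I. norm (s i) * exp (- 2 * pi * e i * y0)) * exp (2 * pi * e0 * y0)"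
  have "norm (f \<tau>) \<le> B * exp (- 2 * pi * e0 * Im \<tau>)" if \<tau>: "Im \<tau> \<ge> y0" for \<tau>
  proof -
    have \<tau>H: "\<tau> \<in> upper_half" using \<tau> y0 by (simp add: upper_half_def)
    have "norm (f \<tau>) \<le> (\<Sum>\<^sub>\<infinity>i\<in>I. exp (- 2 * pi * e0 * (Im \<tau> - y0)) * (norm (s i) * exp (- 2 * pi * e i * y0)))"
    proof (rule norm_infsum_le[OF sum[OF \<tau>H] has_sum_infsum])
      show "(\<lambda>i. exp (- 2 * pi * e0 * (Im \<tau> - y0)) * (norm (s i) * exp (- 2 * pi * e i * y0))) summable_on I"
        by (rule summable_on_cmult_right[OF smb])
      fix i assume i: "i \<in> I"
      show "norm (s i * e2pi (of_real (e i) * \<tau>)) \<le> exp (- 2 * pi * e0 * (Im \<tau> - y0)) * (norm (s i) * exp (- 2 * pi * e i * y0))"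
      proof (cases "s i = 0")
        case False
        have "2 * pi * e0 * (Im \<tau> - y0) \<le> 2 * pi * e i * (Im \<tau> - y0)"
          using e0[OF i False] \<tau> by (intro mult_right_mono mult_left_mono) auto
        then have "- 2 * pi * (e i * Im \<tau>) \<le> - 2 * pi * e0 * (Im \<tau> - y0) + - 2 * pi * e i * y0"
          by (simp add: algebra_simps)
        then have "exp (- 2 * pi * (e i * Im \<tau>)) \<le> exp (- 2 * pi * e0 * (Im \<tau> - y0)) * exp (- 2 * pi * e i * y0)"
          unfolding exp_add[symmetric] by simp
        from mult_left_mono[OF this norm_ge_zero[of "s i"]] show ?thesis
          by (simp add: norm_mult norm_e2pi mult_ac)
      qed simp
    qed
    also have "\<dots> = B * exp (- 2 * pi * e0 * Im \<tau>)"
      unfolding infsum_cmult_right[OF smb] B_def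
      by (simp add: exp_add[symmetric] mult.assoc) (simp add: algebra_simps exp_add[symmetric])
    finally show ?thesis .
  qed
  then show ?thesis by blast
qed

lemma exp_decay_i_inf:
  assumes "d > 0"
  shows "((\<lambda>\<tau>. B * exp (- 2 * pi * d * Im \<tau>)) \<longlongrightarrow> 0) i_inf"
proof -
  have "((\<lambda>x. B * exp (- 2 * pi * d * x)) \<longlongrightarrow> B * 0) at_top"
  proof (intro tendsto_mult_left, rule filterlim_compose[OF exp_at_bot])
    show "filterlim (\<lambda>x. - 2 * pi * d * x) at_bot at_top"
      using assms by (intro filterlim_tendsto_neg_mult_at_bot[OF tendsto_const _ filterlim_ident]) auto
  qed
  then show ?thesis using filterlim_compose[OF _ filterlim_filtercomap[of Im at_top]] by fastforce
qed

text \<open>J collects the terms of exponent exactly e0; the gap d makes the remainder tend to 0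
  after multiplication by e(-e0 tau).\<close>

lemma qseries_limit:
  fixes s :: "'i \<Rightarrow> complex" and e :: "'i \<Rightarrow> real"
  assumes sum: "\<And>\<tau>. \<tau> \<in> upper_half \<Longrightarrow> ((\<lambda>i. s i * e2pi (of_real (e i) * \<tau>)) has_sum f \<tau>) I"
    and J: "finite J" "J \<subseteq> I" "\<And>i. i \<in> J \<Longrightarrow> e i = e0"
    and d: "d > 0" "\<And>i. i \<in> I - J \<Longrightarrow> s i \<noteq> 0 \<Longrightarrow> e i \<ge> e0 + d"
  shows "((\<lambda>\<tau>. f \<tau> * e2pi (- of_real e0 * \<tau>)) \<longlongrightarrow> (\<Sum>i\<in>J. s i)) i_inf"
proof -
  define g where "g = (\<lambda>\<tau>. f \<tau> - (\<Sum>i\<in>J. s i * e2pi (of_real (e i) * \<tau>)))"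
  have "((\<lambda>i. s i * e2pi (of_real (e i) * \<tau>)) has_sum g \<tau>) (I - J)" if "\<tau> \<in> upper_half" for \<tau>
  proof -
    have "((\<lambda>i. s i * e2pi (of_real (e i) * \<tau>)) has_sum (\<Sum>i\<in>J. s i * e2pi (of_real (e i) * \<tau>))) J"
      using J(1) by (rule has_sum_finite)
    then show ?thesis unfolding g_def by (intro has_sum_Diff sum that J(2))
  qed
  from qseries_bound[OF this d(2), of 1] obtain B where
    B: "\<And>\<tau>. Im \<tau> \<ge> 1 \<Longrightarrow> norm (g \<tau>) \<le> B * exp (- 2 * pi * (e0 + d) * Im \<tau>)" by auto
  have "((\<lambda>\<tau>. g \<tau> * e2pi (- of_real e0 * \<tau>)) \<longlongrightarrow> 0) i_inf"
  proof (rule Lim_null_comparison[OF _ exp_decay_i_inf[OF d(1), of B]])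
    show "\<forall>\<^sub>F \<tau> in i_inf. norm (g \<tau> * e2pi (- of_real e0 * \<tau>)) \<le> B * exp (- 2 * pi * d * Im \<tau>)"
      unfolding eventually_i_inf
    proof (intro exI allI impI)
      fix \<tau> assume "Im \<tau> \<ge> 1"
      have "norm (g \<tau> * e2pi (- of_real e0 * \<tau>)) \<le> B * exp (- 2 * pi * (e0 + d) * Im \<tau>) * exp (2 * pi * e0 * Im \<tau>)"
      proof -
        have "norm (e2pi (- of_real e0 * \<tau>)) = exp (2 * pi * e0 * Im \<tau>)" by (simp add: norm_e2pi)
        then show ?thesis unfolding norm_mult using B[OF \<open>Im \<tau> \<ge> 1\<close>] by (simp only: mult_right_mono exp_ge_zero)
      qed
      also have "\<dots> = B * exp (- 2 * pi * d * Im \<tau>)"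
        by (simp add: mult.assoc exp_add[symmetric]) (simp add: algebra_simps)
      finally show "norm (g \<tau> * e2pi (- of_real e0 * \<tau>)) \<le> B * exp (- 2 * pi * d * Im \<tau>)" .
    qed
  qed
  moreover have "g \<tau> * e2pi (- of_real e0 * \<tau>) = f \<tau> * e2pi (- of_real e0 * \<tau>) - (\<Sum>i\<in>J. s i)" for \<tau>
  proof -
    have "(\<Sum>i\<in>J. s i * e2pi (of_real (e i) * \<tau>)) * e2pi (- of_real e0 * \<tau>) = (\<Sum>i\<in>J. s i)"
      unfolding sum_distrib_right
      by (intro sum.cong refl) (simp add: J(3) e2pi_minus)
    then show ?thesis by (simp add: g_def left_diff_distrib)
  qed
  ultimately show ?thesis by (simp add: LIM_zero_iff)
qed

text \<open>Regroups a series over an arbitrary index set into one term per exponent, the shape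
  demanded by \<open>fourier_expansion\<close>. The coefficients are kept as \<open>infsum\<close>
  over the fibres.\<close>

lemma qseries_collect:
  fixes s :: "'i \<Rightarrow> complex" and e :: "'i \<Rightarrow> real"
  assumes sum: "((\<lambda>i. s i * e2pi (of_real (e i) * \<tau>)) has_sum f) I"
    and X: "\<And>i. i \<in> I \<Longrightarrow> e i \<in> X"
  shows "((\<lambda>x. (\<Sum>\<^sub>\<infinity>i\<in>{i \<in> I. e i = x}. s i) * e2pi (of_real x * \<tau>)) has_sum f) X"
proof -
  have bij: "bij_betw snd (Sigma X (\<lambda>x. {i \<in> I. e i = x})) I"
    by (rule bij_betw_byWitness[where f' = "\<lambda>i. (e i, i)"]) (use X in auto)
  have 1: "((\<lambda>p. s (snd p) * e2pi (of_real (e (snd p)) * \<tau>)) has_sum f) (Sigma X (\<lambda>x. {i \<in> I. e i = x}))"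
    using has_sum_reindex_bij_betw[OF bij, of "\<lambda>i. s i * e2pi (of_real (e i) * \<tau>)" f] sum by simp
  show ?thesis
  proof (rule has_sum_SigmaD[OF 1])
    fix x assume "x \<in> X"
    have "(\<lambda>i. s i * e2pi (of_real (e i) * \<tau>)) summable_on {i \<in> I. e i = x}"
      by (rule summable_on_subset_banach[OF has_sum_imp_summable[OF sum]]) auto
    then have "(\<lambda>i. s i * e2pi (of_real x * \<tau>)) summable_on {i \<in> I. e i = x}"
      by (rule summable_on_cong[THEN iffD1, rotated]) auto
    then have "((\<lambda>i. s i * e2pi (of_real x * \<tau>)) has_sum (\<Sum>\<^sub>\<infinity>i\<in>{i \<in> I. e i = x}. s i) * e2pi (of_real x * \<tau>)) {i \<in> I. e i = x}"
      by (simp add: has_sum_infsum infsum_cmult_left'[symmetric])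
    then show "((\<lambda>y. s (snd (x, y)) * e2pi (of_real (e (snd (x, y))) * \<tau>)) has_sum (\<Sum>\<^sub>\<infinity>i\<in>{i \<in> I. e i = x}. s i) * e2pi (of_real x * \<tau>)) {i \<in> I. e i = x}"
      by (rule has_sum_cong[THEN iffD1, rotated]) auto
  qed
qed

text \<open>Integration over x from 0 to 1 at height 1 extracts the coefficient of e0, because all
  exponents differ from e0 by integers; absolute summability at the point i justifies the exchange
  of sum and integral.\<close>

lemma e2pi_Fourier_unique:
  assumes a: "\<And>\<tau>. \<tau> \<in> upper_half \<Longrightarrow> ((\<lambda>e. a e * e2pi (of_real e * \<tau>)) has_sum 0) {e. e - q \<in> \<int>}"
    and "e0 - q \<in> \<int>"
  shows "a e0 = 0"
proof -
  define X where "X = {e. e - q \<in> \<int>}"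
  have iH: "\<i> \<in> upper_half" by (simp add: upper_half_def)
  have "(\<lambda>e. norm (a e * e2pi (of_real e * \<i>))) summable_on X"
    unfolding X_def by (rule summable_on_iff_abs_summable_on_complex[THEN iffD1], rule has_sum_imp_summable[OF a[OF iH]])
  define f where "f = (\<lambda>e x. a e * e2pi (of_real e * (\<i> + of_real x)) * e2pi (- of_real e0 * of_real x))"
  have nf: "norm (f e x) = norm (a e * e2pi (of_real e * \<i>))" for e x
    by (simp add: f_def norm_mult norm_e2pi)
  have fs: "((\<lambda>e. f e x) has_sum 0) X" for x
  proof -
    have "\<i> + of_real x \<in> upper_half" by (simp add: upper_half_def)
    from has_sum_cmult_left[OF a[OF this], of "e2pi (- of_real e0 * of_real x)"]
    show ?thesis by (simp add: f_def X_def)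
  qed
  have ul: "uniform_limit {0..1} (\<lambda>Y x. \<Sum>e\<in>Y. f e x) (\<lambda>x. 0) (finite_subsets_at_top X)"
    by (rule Weierstrass_m_test_general'[where M = "\<lambda>e. norm (a e * e2pi (of_real e * \<i>))"])
       (use nf fs \<open>_ summable_on X\<close> in auto)
  have int: "((\<lambda>x. f e x) has_integral (if e = e0 then a e * e2pi (of_real e * \<i>) else 0)) {0..1}" if e: "e \<in> X" for e
  proof (cases "e = e0")
    case True
    have "f e x = a e * e2pi (of_real e * \<i>)" for x
      unfolding f_def True mult.assoc e2pi_add[symmetric] by (simp add: algebra_simps)
    then show ?thesis using True has_integral_const_real[of "a e * e2pi (of_real e * \<i>)" 0 1] by simp
  next
    case False
    have "e - e0 \<in> \<int>" using e \<open>e0 - q \<in> \<int>\<close> Ints_diff[of "e - q" "e0 - q"] by (simp add: X_def)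
    then obtain k where k: "e - e0 = of_int k" by (elim Ints_cases)
    have k0: "k \<noteq> 0" using k False by auto
    define c where "c = a e * e2pi (of_real e * \<i>)"
    have f: "f e x = c * e2pi (of_int k * of_real x)" for x
    proof -
      have "of_real e * (\<i> + of_real x) + - of_real e0 * of_real x = of_real e * \<i> + of_real (e - e0) * of_real x"
        by (simp add: algebra_simps)
      then have "e2pi (of_real e * (\<i> + of_real x)) * e2pi (- of_real e0 * of_real x) = e2pi (of_real e * \<i>) * e2pi (of_int k * of_real x)"
        unfolding e2pi_add[symmetric] k by (simp add: of_real_of_int_eq)
      then show ?thesis by (simp add: f_def c_def)
    qed
    define K where "K = (\<lambda>x::real. c * e2pi (of_int k * of_real x) / (2 * of_real pi * \<i> * of_int k))"
    have "((\<lambda>x. f e x) has_integral (K 1 - K 0)) {0..1}"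
    proof (rule fundamental_theorem_of_calculus)
      fix x :: real
      have "((\<lambda>z. c * e2pi (of_int k * z) / (2 * of_real pi * \<i> * of_int k)) has_field_derivative c * e2pi (of_int k * of_real x)) (at (of_real x))"
        using k0 unfolding e2pi_def by (auto intro!: derivative_eq_intros)
      from has_vector_derivative_real_field[OF this, of "{0..1}"]
      show "(K has_vector_derivative f e x) (at x within {0..1})" unfolding K_def f by simp
    qed simp
    moreover have "K 1 - K 0 = 0" using e2pi_of_int[of k] by (simp add: K_def)
    ultimately show ?thesis using False by simp
  qed
  have cont: "continuous_on {0..1} (\<lambda>x. \<Sum>e\<in>Y. f e x)" for Y
    unfolding f_def e2pi_def by (intro continuous_intros)
  obtain I J where IJ: "\<And>Y. ((\<lambda>x. \<Sum>e\<in>Y. f e x) has_integral I Y) {0..1}" "((\<lambda>x::real. 0::complex) has_integral J) {0..1}"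
    "(I \<longlongrightarrow> J) (finite_subsets_at_top X)"
  proof (rule uniform_limit_integral[OF ul cont finite_subsets_at_top_neq_bot])
  qed (rule that; assumption)
  have J0: "J = 0" by (rule has_integral_unique[OF IJ(2) has_integral_0])
  have IY: "I Y = (if e0 \<in> Y then a e0 * e2pi (of_real e0 * \<i>) else 0)" if Y: "finite Y" "Y \<subseteq> X" for Y
  proof -
    have "((\<lambda>x. \<Sum>e\<in>Y. f e x) has_integral (\<Sum>e\<in>Y. if e = e0 then a e * e2pi (of_real e * \<i>) else 0)) {0..1}"
      by (intro has_integral_sum int) (use Y in auto)
    then have "I Y = (\<Sum>e\<in>Y. if e = e0 then a e * e2pi (of_real e * \<i>) else 0)"
      using has_integral_unique IJ(1) by blast
    then show ?thesis using Y by simp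
  qed
  have ev: "\<forall>\<^sub>F Y in finite_subsets_at_top X. I Y = a e0 * e2pi (of_real e0 * \<i>)"
    unfolding eventually_finite_subsets_at_top
    by (rule exI[of _ "{e0}"]) (use assms(2) IY in \<open>auto simp: X_def\<close>)
  have "(I \<longlongrightarrow> a e0 * e2pi (of_real e0 * \<i>)) (finite_subsets_at_top X)"
    by (rule tendsto_eventually[OF ev])
  from tendsto_unique[OF finite_subsets_at_top_neq_bot this IJ(3)]
  have "a e0 * e2pi (of_real e0 * \<i>) = 0" using J0 by simp
  then show ?thesis by simp
qed

section \<open>The discriminant group\<close>

lemma vec3_eq_iff: "(a :: real^3) = b \<longleftrightarrow> a $ 1 = b $ 1 \<and> a $ 2 = b $ 2 \<and> a $ 3 = b $ 3"
  by (simp add: vec_eq_iff forall_3)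

lemma L4_iff: "w \<in> L4 \<longleftrightarrow> w $ 1 \<in> \<int> \<and> w $ 2 \<in> \<int> \<and> w $ 3 \<in> \<int>"
  by (simp add: L4_def forall_3)

lemma G4_mult:
  "(G4 *v w) $ 1 = 4 * w $ 1 - 6 * w $ 3"
  "(G4 *v w) $ 2 = 6 * w $ 2 - 6 * w $ 3"
  "(G4 *v w) $ 3 = - 6 * w $ 1 - 6 * w $ 2 + 12 * w $ 3"
  by (simp_all add: G4_def matrix_vector_mult_def sum_3)

lemma bil_eq: "bil a b = a $ 1 * (4 * b $ 1 - 6 * b $ 3) + a $ 2 * (6 * b $ 2 - 6 * b $ 3) + a $ 3 * (- 6 * b $ 1 - 6 * b $ 2 + 12 * b $ 3)"
  by (simp add: bil_def inner_vec_def sum_3 G4_mult)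

lemma dual_L4_iff: "w \<in> dual_L4 \<longleftrightarrow> (G4 *v w) $ 1 \<in> \<int> \<and> (G4 *v w) $ 2 \<in> \<int> \<and> (G4 *v w) $ 3 \<in> \<int>"
proof
  assume w: "w \<in> dual_L4"
  have "bil w (vector [1, 0, 0]) \<in> \<int>" "bil w (vector [0, 1, 0]) \<in> \<int>" "bil w (vector [0, 0, 1]) \<in> \<int>"
    using w by (auto simp: dual_L4_def L4_iff)
  then show "(G4 *v w) $ 1 \<in> \<int> \<and> (G4 *v w) $ 2 \<in> \<int> \<and> (G4 *v w) $ 3 \<in> \<int>"
    by (simp add: bil_eq G4_mult algebra_simps)
next
  assume w: "(G4 *v w) $ 1 \<in> \<int> \<and> (G4 *v w) $ 2 \<in> \<int> \<and> (G4 *v w) $ 3 \<in> \<int>"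
  have "bil w y = y $ 1 * (G4 *v w) $ 1 + y $ 2 * (G4 *v w) $ 2 + y $ 3 * (G4 *v w) $ 3" for y
    by (simp add: bil_eq G4_mult algebra_simps)
  then show "w \<in> dual_L4"
    using w by (auto simp: dual_L4_def L4_iff)
qed

definition coset_of :: "real^3 \<Rightarrow> coset" where
  "coset_of a = {w. w - a \<in> L4}"

lemma L4_add: "a \<in> L4 \<Longrightarrow> b \<in> L4 \<Longrightarrow> a + b \<in> L4"
  by (simp add: L4_iff)

lemma L4_diff: "a \<in> L4 \<Longrightarrow> b \<in> L4 \<Longrightarrow> a - b \<in> L4"
  by (simp add: L4_iff)

lemma coset_of_eq_iff: "coset_of a = coset_of b \<longleftrightarrow> a - b \<in> L4"
proof
  assume "coset_of a = coset_of b"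
  moreover have "a \<in> coset_of a" by (simp add: coset_of_def L4_iff)
  ultimately show "a - b \<in> L4" by (simp add: coset_of_def)
next
  assume ab: "a - b \<in> L4"
  have "w - a \<in> L4 \<longleftrightarrow> w - b \<in> L4" for w
    using L4_add[OF _ ab, of "w - a"] L4_diff[OF _ ab, of "w - b"] by auto
  then show "coset_of a = coset_of b" by (simp add: coset_of_def)
qed

lemma Disc_eq: "Disc = coset_of ` dual_L4"
proof -
  have "L4 #>\<^bsub>dual_group\<^esub> a = coset_of a" for a
  proof -
    have "w \<in> L4 #>\<^bsub>dual_group\<^esub> a \<longleftrightarrow> w - a \<in> L4" for w
      unfolding r_coset_def dual_group_def by (auto intro!: bexI[of _ "w - a"])
    then show ?thesis by (auto simp: coset_of_def)
  qed
  then show ?thesis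
    unfolding disc_group_def FactGroup_def RCOSETS_def by (auto simp: dual_group_def)
qed

lemma disc_mult: "coset_of a \<otimes>\<^bsub>disc_group\<^esub> coset_of b = coset_of (a + b)"
proof -
  have "w \<in> coset_of a <#>\<^bsub>dual_group\<^esub> coset_of b \<longleftrightarrow> w \<in> coset_of (a + b)" for w
  proof
    assume "w \<in> coset_of a <#>\<^bsub>dual_group\<^esub> coset_of b"
    then obtain h k where "w = h + k" "h - a \<in> L4" "k - b \<in> L4"
      unfolding set_mult_def dual_group_def coset_of_def by auto
    then show "w \<in> coset_of (a + b)"
      using L4_add[of "h - a" "k - b"] by (simp add: coset_of_def algebra_simps)
  next
    assume "w \<in> coset_of (a + b)"
    then have "w - b \<in> coset_of a" "b \<in> coset_of b" by (auto simp: coset_of_def L4_iff algebra_simps)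
    moreover have "w = (w - b) + b" by simp
    ultimately show "w \<in> coset_of a <#>\<^bsub>dual_group\<^esub> coset_of b"
      unfolding set_mult_def dual_group_def by force
  qed
  then show ?thesis unfolding disc_group_def FactGroup_def by auto
qed

lemma frac_eqI: "x - y \<in> \<int> \<Longrightarrow> frac x = frac (y :: real)"
proof -
  assume "x - y \<in> \<int>"
  then obtain k where "x - y = of_int k" by (elim Ints_cases)
  then have "x = y + of_int k" by simp
  then show ?thesis by (simp add: frac_def)
qed

lemma bil_add: "bil (a + b) (c + d) = bil a c + bil a d + bil b c + bil b d"
  by (simp add: bil_eq algebra_simps)

lemma bil_sym: "bil a b = bil b a"
  by (simp add: bil_eq algebra_simps)

lemma bil_even: "l \<in> L4 \<Longrightarrow> bil l l / 2 \<in> \<int>"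
proof -
  assume l: "l \<in> L4"
  have "bil l l / 2 = l $ 1 * (2 * l $ 1 - 6 * l $ 3) + 3 * l $ 2 * l $ 2 - 6 * l $ 2 * l $ 3 + 6 * l $ 3 * l $ 3"
    by (simp add: bil_eq field_simps)
  also have "\<dots> \<in> \<int>" using l by (simp add: L4_iff)
  finally show ?thesis .
qed

lemma dual_bil: "a \<in> dual_L4 \<Longrightarrow> l \<in> L4 \<Longrightarrow> bil a l \<in> \<int>"
  by (simp add: dual_L4_def)

lemma L4_dual: "l \<in> L4 \<Longrightarrow> l \<in> dual_L4"
  by (simp add: dual_L4_iff L4_iff G4_mult)

lemma some_coset: "(SOME v. v \<in> coset_of a) - a \<in> L4"
proof -
  have "a \<in> coset_of a" by (simp add: coset_of_def L4_iff)
  then have "(SOME v. v \<in> coset_of a) \<in> coset_of a" by (rule someI)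
  then show ?thesis by (simp add: coset_of_def)
qed

lemma disc_q_coset: 
  assumes "a \<in> dual_L4"
  shows "disc_q (coset_of a) = frac (bil a a / 2)"
proof -
  define l where "l = (SOME v. v \<in> coset_of a) - a"
  have l: "l \<in> L4" unfolding l_def by (rule some_coset)
  have "bil (a + l) (a + l) / 2 - bil a a / 2 = bil a l + bil l l / 2"
    unfolding bil_add using bil_sym[of a l] by (simp add: field_simps)
  also have "\<dots> \<in> \<int>" by (intro Ints_add bil_even dual_bil assms l)
  finally have "frac (bil (a + l) (a + l) / 2) = frac (bil a a / 2)" by (rule frac_eqI)
  then show ?thesis by (simp add: disc_q_def l_def)
qed

lemma disc_b_coset:
  assumes "a \<in> dual_L4" "b \<in> dual_L4"
  shows "disc_b (coset_of a) (coset_of b) = frac (bil a b)"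
proof -
  define l where "l = (SOME v. v \<in> coset_of a) - a"
  define m where "m = (SOME v. v \<in> coset_of b) - b"
  have l: "l \<in> L4" "m \<in> L4" unfolding l_def m_def by (rule some_coset)+
  have "bil (a + l) (b + m) - bil a b = bil a m + bil b l + bil l m"
    unfolding bil_add using bil_sym[of b l] by simp
  also have "\<dots> \<in> \<int>" by (intro Ints_add dual_bil assms l L4_dual)
  finally have "frac (bil (a + l) (b + m)) = frac (bil a b)" by (rule frac_eqI)
  then show ?thesis by (simp add: disc_b_def l_def m_def)
qed

text \<open>The discriminant group is the orthogonal sum of three groups of order 2 and two groups of
  order 3; \<open>cl\<close> is the class with the given coordinates.\<close>

type_synonym idx = "int \<times> int \<times> int \<times> int \<times> int"

definition rv :: "idx \<Rightarrow> real^3" where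
  "rv = (\<lambda>(x, y, z, u, v). vector [of_int y / 2, of_int (x + y + z) / 2 + of_int (u + v) / 3, of_int (y + z) / 2 + of_int u / 3])"

definition cl :: "idx \<Rightarrow> coset" where
  "cl k = coset_of (rv k)"

lemma rv_sel [simp]:
  "rv (x, y, z, u, v) $ 1 = of_int y / 2"
  "rv (x, y, z, u, v) $ 2 = of_int (x + y + z) / 2 + of_int (u + v) / 3"
  "rv (x, y, z, u, v) $ 3 = of_int (y + z) / 2 + of_int u / 3"
  by (simp_all add: rv_def)

lemma G4_rv:
  "(G4 *v rv (x, y, z, u, v)) $ 1 = of_int (- y - 3 * z - 2 * u)"
  "(G4 *v rv (x, y, z, u, v)) $ 2 = of_int (3 * x + 2 * v)"
  "(G4 *v rv (x, y, z, u, v)) $ 3 = of_int (- 3 * x + 3 * z + 2 * u - 2 * v)"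
  by (simp_all add: G4_mult field_simps)

lemma rv_dual: "rv k \<in> dual_L4"
  by (cases k) (simp only: dual_L4_iff G4_rv Ints_of_int simp_thms)

lemma of_int_div_Ints_iff: "n > 0 \<Longrightarrow> (of_int k / of_int n :: real) \<in> \<int> \<longleftrightarrow> n dvd k"
proof
  assume n: "n > 0" and "(of_int k / of_int n :: real) \<in> \<int>"
  then obtain m where "(of_int k / of_int n :: real) = of_int m" by (elim Ints_cases)
  then have "(of_int k :: real) = of_int (n * m)" using n by (simp add: field_simps)
  then have "k = n * m" by (simp only: of_int_eq_iff)
  then show "n dvd k" by simp
next
  assume "n > 0" "n dvd k"
  then obtain m where "k = n * m" by (elim dvdE)
  then show "(of_int k / of_int n :: real) \<in> \<int>" using \<open>n > 0\<close> by simp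
qed

lemma six_dvd_iff: "6 dvd 3 * s + 2 * t \<longleftrightarrow> 2 dvd s \<and> 3 dvd t" for s t :: int
  by presburger

lemma cl_eq_iff:
  "cl (x, y, z, u, v) = cl (x', y', z', u', v') \<longleftrightarrow>
    x mod 2 = x' mod 2 \<and> y mod 2 = y' mod 2 \<and> z mod 2 = z' mod 2 \<and> u mod 3 = u' mod 3 \<and> v mod 3 = v' mod 3"
proof -
  have "rv (x, y, z, u, v) $ 1 - rv (x', y', z', u', v') $ 1 = of_int (y - y') / of_int 2"
    "rv (x, y, z, u, v) $ 2 - rv (x', y', z', u', v') $ 2 = of_int (3 * (x + y + z - x' - y' - z') + 2 * (u + v - u' - v')) / of_int 6"
    "rv (x, y, z, u, v) $ 3 - rv (x', y', z', u', v') $ 3 = of_int (3 * (y + z - y' - z') + 2 * (u - u')) / of_int 6"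
    by (simp_all add: field_simps)
  then have "cl (x, y, z, u, v) = cl (x', y', z', u', v') \<longleftrightarrow> 2 dvd y - y' \<and>
    6 dvd 3 * (x + y + z - x' - y' - z') + 2 * (u + v - u' - v') \<and> 6 dvd 3 * (y + z - y' - z') + 2 * (u - u')"
    unfolding cl_def coset_of_eq_iff L4_iff vector_minus_component by (simp only: of_int_div_Ints_iff zero_less_numeral)
  also have "\<dots> \<longleftrightarrow> 2 dvd x - x' \<and> 2 dvd y - y' \<and> 2 dvd z - z' \<and> 3 dvd u - u' \<and> 3 dvd v - v'"
  proof -
    have "3 dvd u + v - u' - v' \<longleftrightarrow> 3 dvd v - v'" if "3 dvd u - u'"
      using that dvd_add_right_iff[OF that, of "v - v'"] by (simp add: algebra_simps)
    then show ?thesis unfolding six_dvd_iff by auto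
  qed
  also have "\<dots> \<longleftrightarrow> x mod 2 = x' mod 2 \<and> y mod 2 = y' mod 2 \<and> z mod 2 = z' mod 2 \<and> u mod 3 = u' mod 3 \<and> v mod 3 = v' mod 3"
    by (simp only: mod_eq_dvd_iff)
  finally show ?thesis .
qed

lemma cl_in_Disc [simp]: "cl k \<in> Disc"
  unfolding Disc_eq cl_def by (intro imageI rv_dual)

lemma Disc_cl: 
  assumes "\<gamma> \<in> Disc"
  obtains k where "\<gamma> = cl k"
proof -
  obtain w where w: "w \<in> dual_L4" "\<gamma> = coset_of w" using assms by (auto simp: Disc_eq)
  obtain a b c where abc: "(G4 *v w) $ 1 = of_int a" "(G4 *v w) $ 2 = of_int b" "(G4 *v w) $ 3 = of_int c"
    using w(1) unfolding dual_L4_iff by (auto elim!: Ints_cases)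
  have w': "w $ 1 = - of_int (a + b + c) / 2" "w $ 2 = - of_int (3 * a + b + 2 * c) / 6" "w $ 3 = - of_int (3 * a + 2 * b + 2 * c) / 6"
    using abc unfolding G4_mult by (simp_all add: field_simps)
  \<comment> \<open>The witness solves the coordinate congruences for G4 w = (a, b, c); the
    representatives are chosen so that all three differences equal the integer -a.\<close>
  have "w - rv (b, a - b - c, b + c, - (b + c), - b) \<in> L4"
  proof -
    have "w $ 1 - rv (b, a - b - c, b + c, - (b + c), - b) $ 1 = of_int (- a)"
      "w $ 2 - rv (b, a - b - c, b + c, - (b + c), - b) $ 2 = of_int (- a)"
      "w $ 3 - rv (b, a - b - c, b + c, - (b + c), - b) $ 3 = of_int (- a)"
      unfolding w' by (simp_all add: field_simps)
    then show ?thesis unfolding L4_iff vector_minus_component by (simp only: Ints_of_int simp_thms)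
  qed
  then have "\<gamma> = cl (b, a - b - c, b + c, - (b + c), - b)"
    unfolding cl_def w(2) coset_of_eq_iff .
  then show ?thesis by (rule that)
qed

definition KK :: "idx set" where
  "KK = {0, 1} \<times> {0, 1} \<times> {0, 1} \<times> {0, 1, 2} \<times> {0, 1, 2}"

lemma mod_in_KK: "(x mod 2, y mod 2, z mod 2, u mod 3, v mod 3) \<in> KK"
proof -
  have "n mod 2 = 0 \<or> n mod 2 = 1" "n mod 3 = 0 \<or> n mod 3 = 1 \<or> n mod 3 = 2" for n :: int by presburger+
  then show ?thesis by (simp only: KK_def mem_Times_iff fst_conv snd_conv insert_iff empty_iff simp_thms)
qed

lemma bij_cl: "bij_betw cl KK Disc"
  unfolding bij_betw_def
proof
  show "inj_on cl KK"
  proof (rule inj_onI)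
    fix k k' assume "k \<in> KK" "k' \<in> KK" "cl k = cl k'"
    moreover obtain x y z u v where k: "k = (x, y, z, u, v)" by (cases k)
    moreover obtain x' y' z' u' v' where k': "k' = (x', y', z', u', v')" by (cases k')
    moreover have m: "n mod 2 = n" if "n \<in> {0, 1}" for n :: int using that by auto
    moreover have "n mod 3 = n" if "n \<in> {0, 1, 2}" for n :: int using that by auto
    ultimately show "k = k'" unfolding k k' KK_def cl_eq_iff mem_Times_iff fst_conv snd_conv by metis
  qed
  show "cl ` KK = Disc"
  proof
    show "Disc \<subseteq> cl ` KK"
    proof
      fix \<gamma> assume "\<gamma> \<in> Disc"
      then obtain k where "\<gamma> = cl k" by (rule Disc_cl)
      moreover obtain x y z u v where "k = (x, y, z, u, v)" by (cases k)
      ultimately have "\<gamma> = cl (x mod 2, y mod 2, z mod 2, u mod 3, v mod 3)" by (simp add: cl_eq_iff)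
      moreover have "(x mod 2, y mod 2, z mod 2, u mod 3, v mod 3) \<in> KK"
        by (rule mod_in_KK)
      ultimately show "\<gamma> \<in> cl ` KK" by blast
    qed
  qed auto
qed

definition ix :: "coset \<Rightarrow> idx" where
  "ix = inv_into KK cl"

lemma ix_cl: "ix (cl (x, y, z, u, v)) = (x mod 2, y mod 2, z mod 2, u mod 3, v mod 3)"
proof -
  have "(x mod 2, y mod 2, z mod 2, u mod 3, v mod 3) \<in> KK" by (rule mod_in_KK)
  moreover have "cl (x, y, z, u, v) = cl (x mod 2, y mod 2, z mod 2, u mod 3, v mod 3)" by (simp add: cl_eq_iff)
  ultimately show ?thesis
    unfolding ix_def using bij_cl by (simp add: bij_betw_def inv_into_f_f)
qed

lemma cl_ix: "\<gamma> \<in> Disc \<Longrightarrow> cl (ix \<gamma>) = \<gamma>"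
  unfolding ix_def using bij_cl by (simp add: bij_betw_def f_inv_into_f)

lemma finite_Disc: "finite Disc"
  using bij_betw_finite[OF bij_cl] by (simp add: KK_def)

lemma sum_Disc:
  "(\<Sum>\<gamma>\<in>Disc. f \<gamma>) = (\<Sum>x\<in>{0, 1}. \<Sum>y\<in>{0, 1}. \<Sum>z\<in>{0, 1}. \<Sum>u\<in>{0, 1, 2}. \<Sum>v\<in>{0, 1, 2}. f (cl (x, y, z, u, v)))"
proof -
  have "(\<Sum>\<gamma>\<in>Disc. f \<gamma>) = (\<Sum>k\<in>KK. f (cl k))"
    using sum.reindex_bij_betw[OF bij_cl, of f] by simp
  then show ?thesis by (simp only: KK_def sum.cartesian_product split_def prod.collapse)
qed

lemma cl_mult: "cl (x, y, z, u, v) \<otimes>\<^bsub>disc_group\<^esub> cl (x', y', z', u', v') = cl (x + x', y + y', z + z', u + u', v + v')"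
proof -
  have "rv (x, y, z, u, v) + rv (x', y', z', u', v') = rv (x + x', y + y', z + z', u + u', v + v')"
    by (simp add: vec3_eq_iff add_divide_distrib)
  then show ?thesis unfolding cl_def disc_mult by simp
qed

definition qk :: "idx \<Rightarrow> real" where
  "qk = (\<lambda>(x, y, z, u, v). of_int (- 3 * (x\<^sup>2 + y\<^sup>2 + z\<^sup>2) + 4 * (u\<^sup>2 + v\<^sup>2)) / 12)"

lemma disc_q_cl: "disc_q (cl k) = frac (qk k)"
proof -
  obtain x y z u v where k: "k = (x, y, z, u, v)" by (cases k)
  have "bil (rv k) (rv k) / 2 - qk k = of_int (x\<^sup>2 + z\<^sup>2 + x * v + z * u)"
    by (simp add: k bil_eq qk_def field_simps power2_eq_square)
  then have "frac (bil (rv k) (rv k) / 2) = frac (qk k)" by (intro frac_eqI) (simp only: Ints_of_int)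
  then show ?thesis unfolding cl_def by (simp add: disc_q_coset rv_dual)
qed

lemma disc_b_cl:
  "disc_b (cl (x, y, z, u, v)) (cl (x', y', z', u', v')) = frac (of_int (- 3 * (x * x' + y * y' + z * z') + 4 * (u * u' + v * v')) / 6)"
proof -
  have "bil (rv (x, y, z, u, v)) (rv (x', y', z', u', v')) - of_int (- 3 * (x * x' + y * y' + z * z') + 4 * (u * u' + v * v')) / 6
    = of_int (2 * x * x' + 2 * z * z' + x * v' + x' * v + z * u' + z' * u)"
    by (simp add: bil_eq field_simps)
  then have "frac (bil (rv (x, y, z, u, v)) (rv (x', y', z', u', v'))) = frac (of_int (- 3 * (x * x' + y * y' + z * z') + 4 * (u * u' + v * v')) / 6)"
    by (intro frac_eqI) (simp only: Ints_of_int)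
  then show ?thesis unfolding cl_def by (simp add: disc_b_coset rv_dual)
qed

text \<open>Lets \<open>chi_O_disc\<close> deduce invariance of the bilinear form from invariance of
  the quadratic form.\<close>

lemma disc_b_polar:
  assumes "\<gamma> \<in> Disc" "\<delta> \<in> Disc"
  shows "disc_b \<gamma> \<delta> = frac (disc_q (\<gamma> \<otimes>\<^bsub>disc_group\<^esub> \<delta>) - disc_q \<gamma> - disc_q \<delta>)"
proof -
  obtain k k' where "\<gamma> = cl k" "\<delta> = cl k'" using assms by (meson Disc_cl)
  moreover obtain x y z u v where k: "k = (x, y, z, u, v)" by (cases k)
  moreover obtain x' y' z' u' v' where k': "k' = (x', y', z', u', v')" by (cases k')
  ultimately have c: "\<gamma> = cl (x, y, z, u, v)" "\<delta> = cl (x', y', z', u', v')" by auto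
  define s where "s = (x + x', y + y', z + z', u + u', v + v')"
  have 1: "of_int (- 3 * (x * x' + y * y' + z * z') + 4 * (u * u' + v * v')) / 6 = qk s - qk k - qk k'"
    by (simp add: s_def k k' qk_def field_simps power2_eq_square)
  have "of_int (- 3 * (x * x' + y * y' + z * z') + 4 * (u * u' + v * v')) / 6 - (frac (qk s) - frac (qk k) - frac (qk k'))
     = of_int (\<lfloor>qk s\<rfloor> - \<lfloor>qk k\<rfloor> - \<lfloor>qk k'\<rfloor>)"
    unfolding 1 by (simp add: frac_def)
  then show ?thesis unfolding c cl_mult disc_b_cl unfolding disc_q_cl s_def[symmetric] k[symmetric] k'[symmetric]
    by (intro frac_eqI) (simp only: Ints_of_int)
qed

section \<open>The order of the discriminant group\<close>

text \<open>The least label of a class: by \<open>labels_cl\<close> the labels of a class are all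
  triples in fixed residue classes modulo 2, 6 and 6.\<close>

definition lab :: "idx \<Rightarrow> nat \<times> nat \<times> nat" where
  "lab = (\<lambda>(x, y, z, u, v). (nat ((y + z) mod 2), nat ((3 * x + 2 * v) mod 6), nat ((3 * x + 3 * z + 2 * u + 4 * v) mod 6)))"

definition lex3 :: "((nat \<times> nat \<times> nat) \<times> (nat \<times> nat \<times> nat)) set" where
  "lex3 = less_than <*lex*> less_than <*lex*> less_than"

lemma labels_cl: "labels (cl k) = {(a, b, c). (a mod 2, b mod 6, c mod 6) = lab k}"
proof -
  obtain x y z u v where k: "k = (x, y, z, u, v)" by (cases k)
  have "(\<exists>w\<in>cl k. G4 *v w = vector [real a, real b, real c]) \<longleftrightarrow> (a mod 2, b mod 6, c mod 6) = lab k" (is "?L \<longleftrightarrow> ?R") for a b c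
  proof -
    define n1 n2 n3 where "n1 = int a" and "n2 = int b" and "n3 = int c"
    define w :: "real^3" where "w = vector [- of_int (n1 + n2 + n3) / 2, - of_int (3 * n1 + n2 + 2 * n3) / 6, - of_int (3 * n1 + 2 * n2 + 2 * n3) / 6]"
    have G: "G4 *v w' = vector [real a, real b, real c] \<longleftrightarrow> w' = w" for w'
      unfolding vec3_eq_iff G4_mult by (auto simp: w_def n1_def n2_def n3_def field_simps)
    have "?L \<longleftrightarrow> w - rv k \<in> L4" unfolding G by (simp add: cl_def coset_of_def)
    also have "\<dots> \<longleftrightarrow> 2 dvd (- (n1 + n2 + n3) - y) \<and> 6 dvd (- (3 * n1 + n2 + 2 * n3) - 3 * (x + y + z) - 2 * (u + v)) \<and> 6 dvd (- (3 * n1 + 2 * n2 + 2 * n3) - 3 * (y + z) - 2 * u)"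
    proof -
      have "w $ 1 - rv k $ 1 = of_int (- (n1 + n2 + n3) - y) / of_int 2"
        "w $ 2 - rv k $ 2 = of_int (- (3 * n1 + n2 + 2 * n3) - 3 * (x + y + z) - 2 * (u + v)) / of_int 6"
        "w $ 3 - rv k $ 3 = of_int (- (3 * n1 + 2 * n2 + 2 * n3) - 3 * (y + z) - 2 * u) / of_int 6"
        by (simp_all add: w_def k field_simps)
      then show ?thesis unfolding L4_iff vector_minus_component by (simp only: of_int_div_Ints_iff zero_less_numeral)
    qed
    also have "\<dots> \<longleftrightarrow> n1 mod 2 = (y + z) mod 2 \<and> n2 mod 6 = (3 * x + 2 * v) mod 6 \<and> n3 mod 6 = (3 * x + 3 * z + 2 * u + 4 * v) mod 6"
    proof -
      have 1: "- (3 * n1 + n2 + 2 * n3) - 3 * (x + y + z) - 2 * (u + v) = 3 * - (n1 + n2 + x + y + z) + 2 * - (n3 - n2 + u + v)"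
        "- (3 * n1 + 2 * n2 + 2 * n3) - 3 * (y + z) - 2 * u = 3 * - (n1 + y + z) + 2 * - (n2 + n3 + u)"
        "n2 - (3 * x + 2 * v) = 3 * (n2 - x) + 2 * - (n2 + v)"
        "n3 - (3 * x + 3 * z + 2 * u + 4 * v) = 3 * (n3 - x - z) + 2 * - (n3 + u + 2 * v)"
        by simp_all
      have 3: "3 dvd n3 - n2 + u + v \<and> 3 dvd n2 + n3 + u \<longleftrightarrow> 3 dvd n2 + v \<and> 3 dvd n3 + u + 2 * v"
      proof -
        have "3 dvd p - n2 + v \<and> 3 dvd n2 + p \<longleftrightarrow> 3 dvd n2 + v \<and> 3 dvd p + 2 * v" for p by presburger
        from this[of "n3 + u"] show ?thesis by (simp add: algebra_simps)
      qed
      have 2: "even (- (n1 + n2 + n3) - y) \<and> even (n1 + n2 + x + y + z) \<and> even (n1 + y + z)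
        \<longleftrightarrow> even (n1 - (y + z)) \<and> even (n2 - x) \<and> even (n3 - x - z)"
        by (auto simp: even_diff)
      show ?thesis
        unfolding mod_eq_dvd_iff 1 six_dvd_iff dvd_minus_iff using 2 3 by blast
    qed
    also have "\<dots> \<longleftrightarrow> ?R"
      unfolding lab_def k n1_def n2_def n3_def by (auto simp: nat_eq_iff2 zmod_int)
    finally show ?thesis .
  qed
  then show ?thesis by (simp add: labels_def)
qed

lemma lab_less: "lab (x, y, z, u, v) = (a, b, c) \<Longrightarrow> a < 2 \<and> b < 6 \<and> c < 6"
  by (auto simp: lab_def nat_less_iff)

text \<open>The label set is a full product of residue classes, so \<open>lab\<close> lies below
  every label in each component, and comparing two classes means comparing their least
  labels.\<close>

lemma disc_less_cl: "disc_less (cl k) (cl k') \<longleftrightarrow> (lab k, lab k') \<in> lex3"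
proof -
  obtain a b c where l: "lab k = (a, b, c)" by (cases "lab k")
  obtain a' b' c' where l': "lab k' = (a', b', c')" by (cases "lab k'")
  have lt: "a < 2" "b < 6" "c < 6" "a' < 2" "b' < 6" "c' < 6"
    using lab_less l l' by (metis prod_cases5)+
  show ?thesis
  proof
    assume "disc_less (cl k) (cl k')"
    then obtain m1 m2 m3 where m: "(m1 mod 2, m2 mod 6, m3 mod 6) = lab k"
      "\<forall>n\<in>labels (cl k'). ((m1, m2, m3), n) \<in> lex3"
      unfolding disc_less_def labels_cl lex3_def by auto
    have "(a', b', c') \<in> labels (cl k')" using lt by (simp add: labels_cl l')
    with m(2) have 1: "((m1, m2, m3), (a', b', c')) \<in> lex3" by blast
    have 2: "a \<le> m1" "b \<le> m2" "c \<le> m3" using m(1) unfolding l by auto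
    show "(lab k, lab k') \<in> lex3" using 1 2 unfolding l l' lex3_def by auto
  next
    assume *: "(lab k, lab k') \<in> lex3"
    show "disc_less (cl k) (cl k')"
      unfolding disc_less_def lex3_def[symmetric]
    proof (rule bexI[of _ "(a, b, c)"], intro ballI)
      show "(a, b, c) \<in> labels (cl k)" using lt by (simp add: labels_cl l)
      fix n assume "n \<in> labels (cl k')"
      then obtain n1 n2 n3 where n: "n = (n1, n2, n3)" "(n1 mod 2, n2 mod 6, n3 mod 6) = lab k'"
        by (cases n) (auto simp: labels_cl)
      have 2: "a' \<le> n1" "b' \<le> n2" "c' \<le> n3" using n(2) unfolding l' by auto
      show "((a, b, c), n) \<in> lex3" using * 2 unfolding l l' n(1) lex3_def by auto
    qed
  qed
qed

lemma lab_eq_iff: "lab k = lab k' \<longleftrightarrow> cl k = cl k'"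
proof -
  obtain x y z u v where k: "k = (x, y, z, u, v)" by (cases k)
  obtain x' y' z' u' v' where k': "k' = (x', y', z', u', v')" by (cases k')
  have "lab k = lab k' \<longleftrightarrow> (y + z) mod 2 = (y' + z') mod 2 \<and> (3 * x + 2 * v) mod 6 = (3 * x' + 2 * v') mod 6 \<and>
     (3 * x + 3 * z + 2 * u + 4 * v) mod 6 = (3 * x' + 3 * z' + 2 * u' + 4 * v') mod 6"
    by (simp add: k k' lab_def nat_eq_iff)
  also have "\<dots> \<longleftrightarrow> cl k = cl k'" unfolding k k' cl_eq_iff mod_eq_dvd_iff
  proof -
    have 1: "3 * x + 2 * v - (3 * x' + 2 * v') = 3 * (x - x') + 2 * (v - v')"
      "3 * x + 3 * z + 2 * u + 4 * v - (3 * x' + 3 * z' + 2 * u' + 4 * v') = 3 * (x + z - x' - z') + 2 * ((u - u') + 2 * (v - v'))"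
      by simp_all
    have 2: "even (y + z - (y' + z')) \<and> even (x - x') \<and> even (x + z - x' - z') \<longleftrightarrow> even (x - x') \<and> even (y - y') \<and> even (z - z')"
      by auto
    have 3: "3 dvd q \<and> 3 dvd p + 2 * q \<longleftrightarrow> 3 dvd p \<and> 3 dvd q" for p q :: int by presburger
    show "even (y + z - (y' + z')) \<and> 6 dvd 3 * x + 2 * v - (3 * x' + 2 * v') \<and> 6 dvd 3 * x + 3 * z + 2 * u + 4 * v - (3 * x' + 3 * z' + 2 * u' + 4 * v')
      \<longleftrightarrow> even (x - x') \<and> even (y - y') \<and> even (z - z') \<and> 3 dvd u - u' \<and> 3 dvd v - v'"
      unfolding 1 six_dvd_iff using 2 3[of "v - v'" "u - u'"] by blast
  qed
  finally show ?thesis .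
qed

lemma lex3_trans: "(a, b) \<in> lex3 \<Longrightarrow> (b, c) \<in> lex3 \<Longrightarrow> (a, c) \<in> lex3"
  by (cases a; cases b; cases c) (auto simp: lex3_def)

lemma lex3_irrefl: "(a, a) \<notin> lex3"
  by (cases a) (auto simp: lex3_def)

lemma lex3_total: "a \<noteq> b \<Longrightarrow> (a, b) \<in> lex3 \<or> (b, a) \<in> lex3"
  by (cases a; cases b) (auto simp: lex3_def)

text \<open>Linearity of the order on Fourier indices is what forces the pivots in
  \<open>echelon_unique\<close>.\<close>

lemma findex_less_linear:
  assumes "s \<in> findices" "s' \<in> findices" "s'' \<in> findices"
  shows "\<not> findex_less s s" "findex_less s s' \<Longrightarrow> findex_less s' s'' \<Longrightarrow> findex_less s s''"
    "s \<noteq> s' \<Longrightarrow> findex_less s s' \<or> findex_less s' s"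
proof -
  have ex: "\<exists>k. fst t = cl k" if "t \<in> findices" for t
  proof -
    have "fst t \<in> Disc" using that by (auto simp: findices_def)
    then show ?thesis by (rule Disc_cl) blast
  qed
  obtain k k' k'' where k: "fst s = cl k" "fst s' = cl k'" "fst s'' = cl k''"
    using ex[OF assms(1)] ex[OF assms(2)] ex[OF assms(3)] by blast
  show "\<not> findex_less s s" unfolding findex_less_def k disc_less_cl using lex3_irrefl by auto
  show "findex_less s s' \<Longrightarrow> findex_less s' s'' \<Longrightarrow> findex_less s s''"
    unfolding findex_less_def k disc_less_cl using lex3_trans[of "lab k" "lab k'" "lab k''"] by auto
  show "findex_less s s' \<or> findex_less s' s" if "s \<noteq> s'"
  proof (cases "snd s = snd s'")
    case True
    with that have "fst s \<noteq> fst s'" by (simp add: prod_eq_iff)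
    then have "lab k \<noteq> lab k'" unfolding k lab_eq_iff .
    from lex3_total[OF this] show ?thesis unfolding findex_less_def k disc_less_cl using True by auto
  next
    case False
    then show ?thesis unfolding findex_less_def by linarith
  qed
qed

lemma uminus_cl: "uminus ` cl (x, y, z, u, v) = cl (- x, - y, - z, - u, - v)"
proof -
  have m: "- rv (x, y, z, u, v) = rv (- x, - y, - z, - u, - v)"
    by (simp add: vec3_eq_iff field_simps)
  have "w \<in> uminus ` cl (x, y, z, u, v) \<longleftrightarrow> w \<in> cl (- x, - y, - z, - u, - v)" for w
  proof -
    have "w \<in> uminus ` cl (x, y, z, u, v) \<longleftrightarrow> - w - rv (x, y, z, u, v) \<in> L4"
      unfolding cl_def coset_of_def by (auto intro!: image_eqI[of _ _ "- w"])
    also have "\<dots> \<longleftrightarrow> w - - rv (x, y, z, u, v) \<in> L4"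
    proof -
      have "- a - b \<in> \<int> \<longleftrightarrow> a - (- b) \<in> \<int>" for a b :: real
        using minus_in_Ints_iff[of "a + b"] by simp
      then show ?thesis unfolding L4_iff vector_minus_component vector_uminus_component by (simp only:)
    qed
    finally show ?thesis unfolding m by (simp add: cl_def coset_of_def)
  qed
  then show ?thesis by blast
qed

lemma deck_mult:
  "(deck *v w) $ 1 = 46 * w $ 1 + 69 * w $ 2 - 75 * w $ 3"
  "(deck *v w) $ 2 = 30 * w $ 1 + 43 * w $ 2 - 48 * w $ 3"
  "(deck *v w) $ 3 = 55 * w $ 1 + 81 * w $ 2 - 89 * w $ 3"
  by (simp_all add: deck_def matrix_vector_mult_def sum_3)

text \<open>On generators the matrix rotates the three summands of order 2 and fixes those of order
  3, up to lattice vectors. Since its cube is the identity, its square supplies preimages for the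
  reverse inclusion.\<close>

lemma deck_cl: "(*v) deck ` cl (x, y, z, u, v) = cl (z, x, y, u, v)"
proof -
  have cube: "deck *v (deck *v (deck *v w)) = w" for w
    by (simp add: vec3_eq_iff deck_mult)
  have L: "deck *v l \<in> L4" if "l \<in> L4" for l
    using that by (simp add: L4_iff deck_mult)
  have "deck *v rv (x, y, z, u, v) - rv (z, x, y, u, v) \<in> L4"
  proof -
    have "(deck *v rv (x, y, z, u, v)) $ 1 - rv (z, x, y, u, v) $ 1 = of_int (34 * x + 20 * y - 3 * z - 2 * u + 23 * v)"
      "(deck *v rv (x, y, z, u, v)) $ 2 - rv (z, x, y, u, v) $ 2 = of_int (21 * x + 12 * y - 3 * z - 2 * u + 14 * v)"
      "(deck *v rv (x, y, z, u, v)) $ 3 - rv (z, x, y, u, v) $ 3 = of_int (40 * x + 23 * y - 4 * z - 3 * u + 27 * v)"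
      unfolding deck_mult by (simp_all add: field_simps)
    then show ?thesis unfolding L4_iff vector_minus_component by (simp only: Ints_of_int simp_thms)
  qed
  then have c: "cl (z, x, y, u, v) = coset_of (deck *v rv (x, y, z, u, v))"
    unfolding cl_def by (simp add: coset_of_eq_iff[symmetric])
  have "w \<in> (*v) deck ` coset_of a \<longleftrightarrow> w \<in> coset_of (deck *v a)" for w a
  proof
    assume "w \<in> (*v) deck ` coset_of a"
    then obtain w' where "w = deck *v w'" "w' - a \<in> L4" by (auto simp: coset_of_def)
    then show "w \<in> coset_of (deck *v a)"
      using L[of "w' - a"] by (simp add: coset_of_def matrix_vector_mult_diff_distrib)
  next
    assume w: "w \<in> coset_of (deck *v a)"
    have "deck *v (deck *v (w - deck *v a)) \<in> L4" using w by (intro L) (simp add: coset_of_def)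
    then have "deck *v (deck *v w) \<in> coset_of a"
      by (simp add: matrix_vector_mult_diff_distrib cube coset_of_def)
    then show "w \<in> (*v) deck ` coset_of a" by (rule rev_image_eqI) (simp add: cube)
  qed
  then show ?thesis unfolding c by (auto simp: cl_def)
qed

section \<open>The Weil representation in coordinates\<close>

definition sgnp :: "int \<Rightarrow> complex" where
  "sgnp s = (if even s then 1 else - 1)"

definition om :: "int \<Rightarrow> complex" where
  "om t = e2pi (of_int t / 3)"

lemma sgnp_add: "sgnp (s + t) = sgnp s * sgnp t"
  by (simp add: sgnp_def)

lemma om_add: "om (s + t) = om s * om t"
  by (simp add: om_def add_divide_distrib e2pi_add)

lemma om_mod: "om t = om (t mod 3)"
proof -
  have "om (3 * (t div 3) + t mod 3) = om (t mod 3)"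
    unfolding om_add by (simp add: om_def)
  then show ?thesis by simp
qed

lemma om_0 [simp]: "om 0 = 1" by (simp add: om_def)

lemma om_1: "om 1 = Complex (- 1 / 2) (sqrt 3 / 2)"
proof -
  have "om 1 = cis (2 * pi / 3)" by (simp add: om_def e2pi_def cis_conv_exp mult_ac)
  then show ?thesis by (simp add: complex_eq_iff cos_120 sin_120)
qed

lemma om_2: "om 2 = Complex (- 1 / 2) (- sqrt 3 / 2)"
proof -
  have "om 2 = om 1 * om 1" by (simp add: om_add[symmetric])
  then show ?thesis by (simp add: om_1 complex_eq_iff)
qed

lemma om_4 [simp]: "om 4 = om 1" using om_mod[of 4] by simp

definition chi :: "coset \<Rightarrow> coset \<Rightarrow> complex" where
  "chi \<gamma> \<delta> = e2pi (- of_real (disc_b \<gamma> \<delta>))"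

lemma e2pi_of_real_frac: "e2pi (of_real (frac r)) = e2pi (of_real r)"
proof -
  have "of_real r = of_real (frac r) + (of_int \<lfloor>r\<rfloor> :: complex)" by (simp add: frac_def)
  then show ?thesis by (simp only: e2pi_add e2pi_of_int mult_1_right)
qed

lemma chi_cl: "chi (cl (x, y, z, u, v)) (cl (x', y', z', u', v'))
   = sgnp (x * x') * sgnp (y * y') * sgnp (z * z') * om (u * u') * om (v * v')"
proof -
  define s where "s = x * x' + y * y' + z * z'"
  define t where "t = u * u' + v * v'"
  have "chi (cl (x, y, z, u, v)) (cl (x', y', z', u', v')) = inverse (e2pi (of_real (of_int (- 3 * s + 4 * t) / 6)))"
    unfolding chi_def disc_b_cl e2pi_minus e2pi_of_real_frac s_def t_def ..
  \<comment> \<open>The exponent s/2 - 2t/3 is replaced by s/2 + t/3, which differs from it by the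
    integer t.\<close>
  also have "\<dots> = e2pi (of_int s / 2 + (of_int t / 3 + of_int (- t)))"
    unfolding e2pi_minus[symmetric] by (rule arg_cong[of _ _ e2pi]) (simp add: field_simps)
  also have "\<dots> = e2pi (of_int s / 2) * om t"
    by (simp only: e2pi_add e2pi_of_int om_def mult_1_right)
  also have "e2pi (of_int s / 2) = sgnp s"
  proof (cases "even s")
    case True
    then obtain m where "s = 2 * m" by (elim evenE)
    then show ?thesis by (simp add: sgnp_def)
  next
    case False
    then obtain m where m: "s = 2 * m + 1" by (elim oddE)
    have "of_int s / 2 = of_int m + (1 / 2 :: complex)" by (simp add: m field_simps)
    then have "e2pi (of_int s / 2) = e2pi (1 / 2)" by (simp only: e2pi_add e2pi_of_int mult_1_left)
    also have "\<dots> = - 1" by (simp add: e2pi_def)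
    finally show ?thesis using False by (simp add: sgnp_def)
  qed
  finally show ?thesis by (simp add: s_def t_def sgnp_add om_add)
qed

lemma sum5_prod:
  fixes f g h m n :: "'a \<Rightarrow> 'b :: comm_semiring_0"
  shows "(\<Sum>x\<in>A. \<Sum>y\<in>B. \<Sum>z\<in>C. \<Sum>u\<in>D. \<Sum>v\<in>E. f x * g y * h z * m u * n v)
    = sum f A * sum g B * sum h C * sum m D * sum n E"
  by (simp only: sum_distrib_left[symmetric] sum_distrib_right[symmetric])

lemma cnj_sgnp [simp]: "cnj (sgnp s) = sgnp s" by (simp add: sgnp_def)

lemma cnj_om: "cnj (om t) = om (- t)"
  by (simp add: om_def e2pi_def exp_cnj)

lemma chi_orthogonal:
  assumes "\<gamma> \<in> Disc" "\<gamma>' \<in> Disc"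
  shows "(\<Sum>\<delta>\<in>Disc. chi \<gamma> \<delta> * cnj (chi \<gamma>' \<delta>)) = (if \<gamma> = \<gamma>' then 72 else 0)"
proof -
  obtain k k' where "\<gamma> = cl k" "\<gamma>' = cl k'" using assms by (meson Disc_cl)
  moreover obtain x y z u v where "k = (x, y, z, u, v)" by (cases k)
  moreover obtain x' y' z' u' v' where "k' = (x', y', z', u', v')" by (cases k')
  ultimately have c: "\<gamma> = cl (x, y, z, u, v)" "\<gamma>' = cl (x', y', z', u', v')" by auto
  have "chi \<gamma> (cl (a, b, c, d, e)) * cnj (chi \<gamma>' (cl (a, b, c, d, e)))
    = sgnp ((x - x') * a) * sgnp ((y - y') * b) * sgnp ((z - z') * c) * om ((u - u') * d) * om ((v - v') * e)" for a b c d e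
  proof -
    have s: "sgnp ((p - p') * q) = sgnp (p * q) * sgnp (p' * q)" for p p' q by (simp add: sgnp_def)
    have o: "om ((p - p') * q) = om (p * q) * om (- (p' * q))" for p p' q
      unfolding om_add[symmetric] by (simp add: algebra_simps)
    show ?thesis unfolding c chi_cl s o by (simp add: cnj_om)
  qed
  then have A: "(\<Sum>\<delta>\<in>Disc. chi \<gamma> \<delta> * cnj (chi \<gamma>' \<delta>))
    = (\<Sum>a\<in>{0, 1}. sgnp ((x - x') * a)) * (\<Sum>a\<in>{0, 1}. sgnp ((y - y') * a)) * (\<Sum>a\<in>{0, 1}. sgnp ((z - z') * a))
      * (\<Sum>a\<in>{0, 1, 2}. om ((u - u') * a)) * (\<Sum>a\<in>{0, 1, 2}. om ((v - v') * a))"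
    unfolding sum_Disc by (simp only: sum5_prod)
  have B: "(\<Sum>a\<in>{0, 1}. sgnp ((p - p') * a)) = (if p mod 2 = p' mod 2 then 2 else 0)" for p p' :: int
    by (auto simp: sgnp_def mod_eq_dvd_iff)
  have C: "(\<Sum>a\<in>{0, 1, 2}. om ((p - p') * a)) = (if p mod 3 = p' mod 3 then 3 else 0)" for p p' :: int
  proof -
    define d where "d = (p - p') mod 3"
    have eq: "om ((p - p') * a) = om (d * a)" for a
      unfolding om_mod[of "(p - p') * a"] om_mod[of "d * a"] by (simp add: d_def mod_mult_left_eq)
    have "(\<Sum>a\<in>{0, 1, 2}. om ((p - p') * a)) = (\<Sum>a\<in>{0, 1, 2}. om (d * a))"
      by (intro sum.cong refl eq)
    moreover have "d = 0 \<or> d = 1 \<or> d = 2" unfolding d_def by presburger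
    moreover have "p mod 3 = p' mod 3 \<longleftrightarrow> d = 0" unfolding d_def by (simp add: mod_eq_dvd_iff dvd_eq_mod_eq_0)
    ultimately show ?thesis by (auto simp: om_1 om_2 complex_eq_iff)
  qed
  have "(if P then 2 else 0) * (if Q then 2 else 0) * (if R then 2 else 0) * (if S then 3 else 0) * (if U then 3 else 0)
    = (if P \<and> Q \<and> R \<and> S \<and> U then 72 else (0 :: complex))" for P Q R S U
    by auto
  then show ?thesis unfolding A B C unfolding c cl_eq_iff .
qed

text \<open>Unitarity of the finite Fourier transform up to the factor 72, behind the behaviour of
  the invariant norm under S.\<close>

lemma Parseval_disc:
  "(\<Sum>\<delta>\<in>Disc. (norm (\<Sum>\<gamma>\<in>Disc. chi \<gamma> \<delta> * f \<gamma>))\<^sup>2) = 72 * (\<Sum>\<gamma>\<in>Disc. (norm (f \<gamma>))\<^sup>2)"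
proof -
  have "of_real (\<Sum>\<delta>\<in>Disc. (norm (\<Sum>\<gamma>\<in>Disc. chi \<gamma> \<delta> * f \<gamma>))\<^sup>2)
    = (\<Sum>\<delta>\<in>Disc. (\<Sum>\<gamma>\<in>Disc. chi \<gamma> \<delta> * f \<gamma>) * (\<Sum>\<gamma>'\<in>Disc. cnj (chi \<gamma>' \<delta>) * cnj (f \<gamma>')))"
    unfolding of_real_sum by (intro sum.cong refl) (simp only: complex_norm_square cnj_sum complex_cnj_mult)
  also have "\<dots> = (\<Sum>\<delta>\<in>Disc. \<Sum>\<gamma>\<in>Disc. \<Sum>\<gamma>'\<in>Disc. f \<gamma> * cnj (f \<gamma>') * (chi \<gamma> \<delta> * cnj (chi \<gamma>' \<delta>)))"
    unfolding sum_product by (intro sum.cong refl) (simp only: mult_ac)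
  also have "\<dots> = (\<Sum>\<gamma>\<in>Disc. \<Sum>\<delta>\<in>Disc. \<Sum>\<gamma>'\<in>Disc. f \<gamma> * cnj (f \<gamma>') * (chi \<gamma> \<delta> * cnj (chi \<gamma>' \<delta>)))"
    by (rule sum.swap)
  also have "\<dots> = (\<Sum>\<gamma>\<in>Disc. \<Sum>\<gamma>'\<in>Disc. \<Sum>\<delta>\<in>Disc. f \<gamma> * cnj (f \<gamma>') * (chi \<gamma> \<delta> * cnj (chi \<gamma>' \<delta>)))"
    by (intro sum.cong refl sum.swap)
  also have "\<dots> = (\<Sum>\<gamma>\<in>Disc. \<Sum>\<gamma>'\<in>Disc. if \<gamma> = \<gamma>' then 72 * (f \<gamma> * cnj (f \<gamma>')) else 0)"
    by (intro sum.cong refl) (simp add: sum_distrib_left[symmetric] chi_orthogonal)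
  also have "\<dots> = (\<Sum>\<gamma>\<in>Disc. 72 * (f \<gamma> * cnj (f \<gamma>)))"
    using finite_Disc by simp
  also have "\<dots> = of_real (72 * (\<Sum>\<gamma>\<in>Disc. (norm (f \<gamma>))\<^sup>2))"
    unfolding sum_distrib_left of_real_sum of_real_mult complex_norm_square by simp
  finally show ?thesis by (simp only: of_real_eq_iff)
qed

lemma weil_S_eq: "\<delta> \<in> Disc \<Longrightarrow> weil_S v \<delta> = e2pi (- 1 / 8) / of_real (sqrt 72) * (\<Sum>\<gamma>\<in>Disc. chi \<gamma> \<delta> * v \<gamma>)"
  by (simp add: weil_S_def chi_def)

text \<open>Theta inversion uses the root of -i tau, which has positive real part, while the Weil
  action uses the root of tau. Changing from one to the other turns the constant e(-1/8) of
  \<open>weil_S\<close> into e(3/8 - 1/8) = i.\<close>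

lemma csqrt_eq: 
  assumes "\<tau> \<in> upper_half"
  shows "csqrt \<tau> = e2pi (1 / 8) * csqrt (- \<i> * \<tau>)"
proof -
  have Re: "Re (- \<i> * \<tau>) > 0" using assms by (simp add: upper_half_def)
  then have "\<bar>Arg (- \<i> * \<tau>)\<bar> < pi / 2" unfolding Arg_Re_pos by simp
  then have 1: "csqrt (\<i> * (- \<i> * \<tau>)) = csqrt \<i> * csqrt (- \<i> * \<tau>)"
    by (intro csqrt_mult) auto
  have 2: "csqrt \<i> = e2pi (1 / 8)"
  proof -
    have "e2pi (1 / 8) = cis (pi / 4)" by (simp add: e2pi_def cis_conv_exp)
    moreover have "1 / sqrt 2 = sqrt 2 / (2 :: real)" by (simp add: field_simps)
    ultimately show ?thesis by (simp add: complex_eq_iff cos_45 sin_45)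
  qed
  have "\<i> * (- \<i> * \<tau>) = \<tau>" by simp
  then show ?thesis using 1 unfolding 2 by (simp only:)
qed

lemma weil_S_factor:
  assumes "\<tau> \<in> upper_half" "\<delta> \<in> Disc"
  shows "csqrt \<tau> ^ 3 * weil_S v \<delta> = \<i> * csqrt (- \<i> * \<tau>) ^ 3 / of_real (sqrt 72) * (\<Sum>\<gamma>\<in>Disc. chi \<gamma> \<delta> * v \<gamma>)"
proof -
  have "e2pi (1 / 8) ^ 3 * e2pi (- 1 / 8) = e2pi (1 / 4)"
    unfolding e2pi_power e2pi_add[symmetric] by simp
  also have "\<dots> = \<i>"
  proof -
    have "e2pi (1 / 4) = cis (pi / 2)" by (simp add: e2pi_def cis_conv_exp)
    then show ?thesis by (simp only: cis_pi_half)
  qed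
  finally have 1: "e2pi (1 / 8) ^ 3 * e2pi (- 1 / 8) = \<i>" .
  have "csqrt \<tau> ^ 3 * weil_S v \<delta> = (e2pi (1 / 8) ^ 3 * e2pi (- 1 / 8)) * csqrt (- \<i> * \<tau>) ^ 3 / of_real (sqrt 72) * (\<Sum>\<gamma>\<in>Disc. chi \<gamma> \<delta> * v \<gamma>)"
    unfolding csqrt_eq[OF assms(1)] weil_S_eq[OF assms(2)] power_mult_distrib by simp
  then show ?thesis unfolding 1 .
qed

section \<open>Cusp forms of weight 3/2\<close>

lemma moebius_T: "moebius (fst mp2_T) \<tau> = \<tau> + 1"
  by (simp add: moebius_def mp2_T_def)

lemma moebius_S: "moebius (fst mp2_S) \<tau> = - 1 / \<tau>"
  by (simp add: moebius_def mp2_S_def)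

lemma S32_T:
  assumes "F \<in> S32" "\<tau> \<in> upper_half" "\<gamma> \<in> Disc"
  shows "F (\<tau> + 1) \<gamma> = e2pi (of_real (disc_q \<gamma>)) * F \<tau> \<gamma>"
proof -
  have "weil_rep (fst mp2_T, \<lambda>\<tau>. 1) weil_T" using weil_rep.T by (simp add: mp2_T_def)
  then have "F (moebius (fst mp2_T) \<tau>) \<gamma> = 1 ^ 3 * weil_T (F \<tau>) \<gamma>"
    using assms unfolding S32_def by fastforce
  then show ?thesis unfolding moebius_T using assms by (simp add: weil_T_def)
qed

lemma S32_S:
  assumes "F \<in> S32" "\<tau> \<in> upper_half" "\<gamma> \<in> Disc"
  shows "F (- 1 / \<tau>) \<gamma> = \<i> * csqrt (- \<i> * \<tau>) ^ 3 / of_real (sqrt 72) * (\<Sum>\<delta>\<in>Disc. chi \<delta> \<gamma> * F \<tau> \<delta>)"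
proof -
  have "weil_rep (fst mp2_S, csqrt) weil_S" using weil_rep.S by (simp add: mp2_S_def)
  then have "F (moebius (fst mp2_S) \<tau>) \<gamma> = csqrt \<tau> ^ 3 * weil_S (F \<tau>) \<gamma>"
    using assms unfolding S32_def by blast
  then show ?thesis unfolding moebius_S using weil_S_factor assms by simp
qed

lemma S32_hol: "F \<in> S32 \<Longrightarrow> \<gamma> \<in> Disc \<Longrightarrow> (\<lambda>\<tau>. F \<tau> \<gamma>) holomorphic_on upper_half"
  by (simp add: S32_def)

lemma S32_zero: "F \<in> S32 \<Longrightarrow> \<tau> \<notin> upper_half \<or> \<gamma> \<notin> Disc \<Longrightarrow> F \<tau> \<gamma> = 0"
  by (simp add: S32_def)

lemma fourier_expansion_unique:
  assumes "fourier_expansion F c" "fourier_expansion F c'"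
  shows "c = c'"
proof (intro ext)
  fix \<gamma> e
  show "c \<gamma> e = c' \<gamma> e"
  proof (cases "\<gamma> \<in> Disc \<and> e - disc_q \<gamma> \<in> \<int>")
    case False
    then show ?thesis using assms unfolding fourier_expansion_def by metis
  next
    case True
    have "c \<gamma> e - c' \<gamma> e = 0"
    proof (rule e2pi_Fourier_unique[of "\<lambda>e. c \<gamma> e - c' \<gamma> e" "disc_q \<gamma>"])
      fix \<tau> assume \<tau>: "\<tau> \<in> upper_half"
      have 1: "((\<lambda>e. c \<gamma> e * e2pi (of_real e * \<tau>)) has_sum F \<tau> \<gamma>) {e. e - disc_q \<gamma> \<in> \<int>}"
        "((\<lambda>e. c' \<gamma> e * e2pi (of_real e * \<tau>)) has_sum F \<tau> \<gamma>) {e. e - disc_q \<gamma> \<in> \<int>}"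
        using assms True \<tau> unfolding fourier_expansion_def by blast+
      then have "((\<lambda>e. - (c' \<gamma> e * e2pi (of_real e * \<tau>))) has_sum - F \<tau> \<gamma>) {e. e - disc_q \<gamma> \<in> \<int>}"
        by (simp add: has_sum_uminus)
      from has_sum_add[OF 1(1) this] show "((\<lambda>e. (c \<gamma> e - c' \<gamma> e) * e2pi (of_real e * \<tau>)) has_sum 0) {e. e - disc_q \<gamma> \<in> \<int>}"
        by (simp add: left_diff_distrib)
    qed (use True in auto)
    then show ?thesis by simp
  qed
qed

lemma fourier_coeff_eqI: "fourier_expansion F c \<Longrightarrow> fourier_coeff F = c"
  unfolding fourier_coeff_def using fourier_expansion_unique by blast

lemma S32_expansion:
  assumes "F \<in> S32"
  shows "fourier_expansion F (fourier_coeff F)" "e \<le> 0 \<Longrightarrow> fourier_coeff F \<gamma> e = 0"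
proof -
  obtain c where "fourier_expansion F c" "\<forall>\<gamma> e. e \<le> 0 \<longrightarrow> c \<gamma> e = 0"
    using assms by (auto simp: S32_def)
  moreover from this have "fourier_coeff F = c" by (intro fourier_coeff_eqI)
  ultimately show "fourier_expansion F (fourier_coeff F)" "e \<le> 0 \<Longrightarrow> fourier_coeff F \<gamma> e = 0" by auto
qed

lemma S32_has_sum:
  assumes "F \<in> S32" "\<gamma> \<in> Disc" "\<tau> \<in> upper_half"
  shows "((\<lambda>e. fourier_coeff F \<gamma> e * e2pi (of_real e * \<tau>)) has_sum F \<tau> \<gamma>) {e. e - disc_q \<gamma> \<in> \<int>}"
  using S32_expansion(1)[OF assms(1)] assms unfolding fourier_expansion_def by blast

lemma norm_e2pi_real [simp]: "norm (e2pi (of_real r)) = 1"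
  by (simp add: norm_e2pi)

lemma S32_norm_T:
  assumes "F \<in> S32" "\<tau> \<in> upper_half"
  shows "(\<Sum>\<gamma>\<in>Disc. (norm (F (\<tau> + 1) \<gamma>))\<^sup>2) = (\<Sum>\<gamma>\<in>Disc. (norm (F \<tau> \<gamma>))\<^sup>2)"
  using assms by (intro sum.cong refl) (simp add: S32_T norm_mult)

lemma S32_norm_S:
  assumes "F \<in> S32" "\<tau> \<in> upper_half"
  shows "(\<Sum>\<gamma>\<in>Disc. (norm (F (- 1 / \<tau>) \<gamma>))\<^sup>2) = cmod \<tau> ^ 3 * (\<Sum>\<gamma>\<in>Disc. (norm (F \<tau> \<gamma>))\<^sup>2)"
proof -
  define K where "K = \<i> * csqrt (- \<i> * \<tau>) ^ 3 / of_real (sqrt 72)"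
  have "sqrt (cmod \<tau>) ^ 6 = ((sqrt (cmod \<tau>))\<^sup>2) ^ 3" by (simp only: power_mult[symmetric]) simp
  then have "(norm K)\<^sup>2 = cmod \<tau> ^ 3 / 72"
    by (simp add: K_def norm_divide norm_mult norm_power power_divide power_mult[symmetric] mult.commute)
  moreover have "(\<Sum>\<gamma>\<in>Disc. (norm (F (- 1 / \<tau>) \<gamma>))\<^sup>2) = (\<Sum>\<gamma>\<in>Disc. (norm K)\<^sup>2 * (norm (\<Sum>\<delta>\<in>Disc. chi \<delta> \<gamma> * F \<tau> \<delta>))\<^sup>2)"
    by (intro sum.cong refl) (simp only: S32_S[OF assms] K_def[symmetric] norm_mult power_mult_distrib)
  ultimately show ?thesis
    unfolding sum_distrib_left[symmetric] Parseval_disc by simp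
qed

lemma Im_powr_S:
  assumes "\<tau> \<in> upper_half"
  shows "Im (- 1 / \<tau>) powr k = Im \<tau> powr k / cmod \<tau> powr (2 * k)"
proof -
  have "cmod \<tau> > 0" using assms by (auto simp: upper_half_def)
  then have "((cmod \<tau>)\<^sup>2) powr k = cmod \<tau> powr (2 * k)"
    by (simp add: powr_powr[symmetric] powr_realpow)
  then show ?thesis using assms unfolding Im_neg_inverse upper_half_def by (subst powr_divide) auto
qed

text \<open>Once pi is bounded below by 3, both applications of \<open>modular_vanishing\<close>
  (weight 3/2 with order 1/6, weight at most 6 with order 2/3) ask for ln(10/9) < 8/75 = 0.10666...;
  the bound 0.1066 fits just below.\<close>

lemma ln_10_9: "ln (10 / 9 :: real) \<le> 1066 / 10000"
proof -
  have "1 + 1066 / 10000 + (1066 / 10000)\<^sup>2 / 2 \<le> exp (1066 / 10000 :: real)"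
    by (rule exp_lower_Taylor_quadratic) simp
  then have "10 / 9 \<le> exp (1066 / 10000 :: real)" by (simp add: power2_eq_square)
  then have "ln (10 / 9) \<le> ln (exp (1066 / 10000 :: real))" by (subst ln_le_cancel_iff) auto
  then show ?thesis by simp
qed

lemma disc_q_cases: "\<gamma> \<in> Disc \<Longrightarrow> e - disc_q \<gamma> \<in> \<int> \<Longrightarrow> \<exists>n::int. e = of_int n / 12"
proof -
  assume "\<gamma> \<in> Disc" and e: "e - disc_q \<gamma> \<in> \<int>"
  then obtain k where "\<gamma> = cl k" by (rule_tac Disc_cl)
  moreover obtain x y z u v where "k = (x, y, z, u, v)" by (cases k)
  ultimately have "disc_q \<gamma> = frac (of_int (- 3 * (x\<^sup>2 + y\<^sup>2 + z\<^sup>2) + 4 * (u\<^sup>2 + v\<^sup>2)) / 12)"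
    by (simp add: disc_q_cl qk_def)
  moreover define m where "m = - 3 * (x\<^sup>2 + y\<^sup>2 + z\<^sup>2) + 4 * (u\<^sup>2 + v\<^sup>2)"
  ultimately have "disc_q \<gamma> = of_int m / 12 - of_int \<lfloor>of_int m / 12 :: real\<rfloor>" by (simp add: frac_def)
  moreover obtain j where "e - disc_q \<gamma> = of_int j" using e by (elim Ints_cases)
  ultimately have "e = of_int (m + 12 * j - 12 * \<lfloor>of_int m / 12 :: real\<rfloor>) / 12" by (simp add: field_simps)
  then show ?thesis by blast
qed

lemma S32_coeff_nonzero:
  assumes "F \<in> S32" "\<gamma> \<in> Disc" "e - disc_q \<gamma> \<in> \<int>" "fourier_coeff F \<gamma> e \<noteq> 0"
  shows "e \<ge> 1 / 12"
proof -
  obtain n :: int where n: "e = of_int n / 12" using disc_q_cases assms by blast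
  have "e > 0" using S32_expansion(2)[OF assms(1)] assms(4) not_less by blast
  then show ?thesis using n by simp
qed

lemma S32_bound:
  assumes F: "F \<in> S32" and \<gamma>: "\<gamma> \<in> Disc"
    and e0: "\<And>e. e - disc_q \<gamma> \<in> \<int> \<Longrightarrow> fourier_coeff F \<gamma> e \<noteq> 0 \<Longrightarrow> e \<ge> e0"
  shows "\<exists>B. \<forall>\<tau>. Im \<tau> \<ge> 1 / 2 \<longrightarrow> norm (F \<tau> \<gamma>) \<le> B * exp (- 2 * pi * e0 * Im \<tau>)"
  by (rule qseries_bound[where f = "\<lambda>\<tau>. F \<tau> \<gamma>", OF S32_has_sum[OF F \<gamma>]]) (use e0 in auto)

text \<open>A cusp form is determined by its coefficients with exponent \<open>1/12\<close>, the only possible exponent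
  below the bound \<open>3/2 / 12 = 1/8\<close> of the valence formula.\<close>

theorem S32_eq_0:
  assumes F: "F \<in> S32" and c: "\<And>\<gamma>. \<gamma> \<in> Disc \<Longrightarrow> fourier_coeff F \<gamma> (1 / 12) = 0"
  shows "F = (\<lambda>_ _. 0)"
proof (intro ext)
  fix \<tau> \<gamma>
  show "F \<tau> \<gamma> = 0"
  proof (cases "\<tau> \<in> upper_half \<and> \<gamma> \<in> Disc")
    case False then show ?thesis using S32_zero[OF F] by blast
  next
    case True
    show ?thesis
    proof (rule modular_vanishing[where F = "\<lambda>\<gamma> \<tau>. F \<tau> \<gamma>" and I = Disc and k = "3 / 2" and ?e0.0 = "1 / 6"])
      fix \<tau> assume \<tau>: "\<tau> \<in> upper_half"
      show "Im (\<tau> + 1) powr (3 / 2) * (\<Sum>\<gamma>\<in>Disc. (norm (F (\<tau> + 1) \<gamma>))\<^sup>2) = Im \<tau> powr (3 / 2) * (\<Sum>\<gamma>\<in>Disc. (norm (F \<tau> \<gamma>))\<^sup>2)"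
        using S32_norm_T[OF F \<tau>] by simp
      have "cmod \<tau> > 0" using \<tau> by (auto simp: upper_half_def)
      then have "cmod \<tau> powr (2 * (3 / 2)) = cmod \<tau> ^ 3" by (simp add: powr_numeral)
      then show "Im (- 1 / \<tau>) powr (3 / 2) * (\<Sum>\<gamma>\<in>Disc. (norm (F (- 1 / \<tau>) \<gamma>))\<^sup>2) = Im \<tau> powr (3 / 2) * (\<Sum>\<gamma>\<in>Disc. (norm (F \<tau> \<gamma>))\<^sup>2)"
        unfolding S32_norm_S[OF F \<tau>] Im_powr_S[OF \<tau>] using \<open>cmod \<tau> > 0\<close> by simp
    next
      show "3 / 2 / 2 * ln (10 / 9) < 2 * pi * (1 / 6) * (8 / 100 :: real)"
        using ln_10_9 pi_gt3 by simp
      show "\<exists>B. \<forall>\<tau>. 1 / 2 \<le> Im \<tau> \<longrightarrow> norm (F \<tau> \<gamma>) \<le> B * exp (- 2 * pi * (1 / 6) * Im \<tau>)" if \<gamma>: "\<gamma> \<in> Disc" for \<gamma>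
      proof (rule S32_bound[OF F \<gamma>])
        fix e assume e: "e - disc_q \<gamma> \<in> \<int>" "fourier_coeff F \<gamma> e \<noteq> 0"
        obtain n :: int where n: "e = of_int n / 12" using disc_q_cases \<gamma> e(1) by blast
        have "e \<ge> 1 / 12" using S32_coeff_nonzero[OF F \<gamma> e] .
        moreover have "e \<noteq> 1 / 12"
        proof
          assume "e = 1 / 12"
          with e(2) have "fourier_coeff F \<gamma> (1 / 12) \<noteq> 0" by (simp only: simp_thms)
          then show False using c[OF \<gamma>] by (simp only: simp_thms)
        qed
        ultimately have "n \<ge> 2" using n by simp
        then show "e \<ge> 1 / 6" using n by simp
      qed
    qed (use True finite_Disc S32_hol[OF F] in auto)
  qed
qed

section \<open>Leading terms\<close>

text \<open>Holomorphy, a bound of order q^e above height 1/2, and the (possibly zero) coefficient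
  of q^e. This package is stable under sums and products, so leading terms are computed without
  multiplying series.\<close>

definition lead :: "(complex \<Rightarrow> complex) \<Rightarrow> real \<Rightarrow> complex \<Rightarrow> bool" where
  "lead f e c \<longleftrightarrow> f holomorphic_on upper_half \<and>
     (\<exists>B. \<forall>\<tau>. Im \<tau> \<ge> 1 / 2 \<longrightarrow> norm (f \<tau>) \<le> B * exp (- 2 * pi * e * Im \<tau>)) \<and>
     ((\<lambda>\<tau>. f \<tau> * e2pi (- of_real e * \<tau>)) \<longlongrightarrow> c) i_inf"

lemma lead_mult:
  assumes "lead f d a" "lead g e b"
  shows "lead (\<lambda>\<tau>. f \<tau> * g \<tau>) (d + e) (a * b)"
proof -
  obtain A B where AB: "\<And>\<tau>. Im \<tau> \<ge> 1 / 2 \<Longrightarrow> norm (f \<tau>) \<le> A * exp (- 2 * pi * d * Im \<tau>)"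
    "\<And>\<tau>. Im \<tau> \<ge> 1 / 2 \<Longrightarrow> norm (g \<tau>) \<le> B * exp (- 2 * pi * e * Im \<tau>)"
    using assms unfolding lead_def by blast
  have "norm (f \<tau> * g \<tau>) \<le> (A * B) * exp (- 2 * pi * (d + e) * Im \<tau>)" if "Im \<tau> \<ge> 1 / 2" for \<tau>
  proof -
    have "norm (f \<tau>) * norm (g \<tau>) \<le> (A * exp (- 2 * pi * d * Im \<tau>)) * (B * exp (- 2 * pi * e * Im \<tau>))"
      using AB[OF that] by (intro mult_mono) (auto intro: order.trans[OF norm_ge_zero])
    also have "\<dots> = (A * B) * (exp (- 2 * pi * d * Im \<tau>) * exp (- 2 * pi * e * Im \<tau>))" by (simp only: mult_ac)
    also have "\<dots> = (A * B) * exp (- 2 * pi * (d + e) * Im \<tau>)"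
      unfolding exp_add[symmetric] by (simp add: algebra_simps)
    finally show ?thesis by (simp add: norm_mult)
  qed
  moreover have "((\<lambda>\<tau>. f \<tau> * g \<tau> * e2pi (- of_real (d + e) * \<tau>)) \<longlongrightarrow> a * b) i_inf"
  proof -
    have "((\<lambda>\<tau>. (f \<tau> * e2pi (- of_real d * \<tau>)) * (g \<tau> * e2pi (- of_real e * \<tau>))) \<longlongrightarrow> a * b) i_inf"
      using assms unfolding lead_def by (intro tendsto_mult) auto
    moreover have "(f \<tau> * e2pi (- of_real d * \<tau>)) * (g \<tau> * e2pi (- of_real e * \<tau>)) = f \<tau> * g \<tau> * e2pi (- of_real (d + e) * \<tau>)" for \<tau>
    proof -
      have "- of_real (d + e) * \<tau> = - of_real d * \<tau> + - of_real e * \<tau>" by (simp add: algebra_simps)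
      then show ?thesis by (simp only: e2pi_add mult_ac)
    qed
    ultimately show ?thesis by (simp only:)
  qed
  ultimately show ?thesis using assms unfolding lead_def by (blast intro: holomorphic_on_mult)
qed

lemma lead_add:
  assumes "lead f e a" "lead g e b"
  shows "lead (\<lambda>\<tau>. f \<tau> + g \<tau>) e (a + b)"
proof -
  obtain A B where AB: "\<And>\<tau>. Im \<tau> \<ge> 1 / 2 \<Longrightarrow> norm (f \<tau>) \<le> A * exp (- 2 * pi * e * Im \<tau>)"
    "\<And>\<tau>. Im \<tau> \<ge> 1 / 2 \<Longrightarrow> norm (g \<tau>) \<le> B * exp (- 2 * pi * e * Im \<tau>)"
    using assms unfolding lead_def by blast
  have "norm (f \<tau> + g \<tau>) \<le> (A + B) * exp (- 2 * pi * e * Im \<tau>)" if "Im \<tau> \<ge> 1 / 2" for \<tau>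
    using AB[OF that] norm_triangle_ineq[of "f \<tau>" "g \<tau>"] unfolding distrib_right by linarith
  moreover have "((\<lambda>\<tau>. (f \<tau> + g \<tau>) * e2pi (- of_real e * \<tau>)) \<longlongrightarrow> a + b) i_inf"
    using assms unfolding lead_def distrib_right by (intro tendsto_add) auto
  ultimately show ?thesis using assms unfolding lead_def by (blast intro: holomorphic_on_add)
qed

lemma lead_const: "lead (\<lambda>_. c) 0 c"
  unfolding lead_def by (auto intro!: exI[of _ "norm c"])

lemma lead_zero: "lead (\<lambda>_. 0) e 0"
  unfolding lead_def by (auto intro!: exI[of _ 0])

lemma lead_cmult: "lead f e a \<Longrightarrow> lead (\<lambda>\<tau>. c * f \<tau>) e (c * a)"
  using lead_mult[OF lead_const, of f e a c] by simp

lemma lead_diff: "lead f e a \<Longrightarrow> lead g e b \<Longrightarrow> lead (\<lambda>\<tau>. f \<tau> - g \<tau>) e (a - b)"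
  using lead_add[OF _ lead_cmult[of g e b "- 1"], of f a] by simp

lemma lead_power: "lead f e a \<Longrightarrow> lead (\<lambda>\<tau>. f \<tau> ^ n) (of_nat n * e) (a ^ n)"
proof (induction n)
  case (Suc n)
  from lead_mult[OF Suc.prems Suc.IH[OF Suc.prems]] show ?case by (simp add: algebra_simps)
qed (simp add: lead_const)

lemma lead_weaken:
  assumes "lead f e a" "e > d"
  shows "lead f d 0"
proof -
  obtain A where A: "\<And>\<tau>. Im \<tau> \<ge> 1 / 2 \<Longrightarrow> norm (f \<tau>) \<le> A * exp (- 2 * pi * e * Im \<tau>)"
    using assms unfolding lead_def by blast
  have A0: "A \<ge> 0"
  proof -
    have "0 \<le> A * exp (- 2 * pi * e * Im \<i>)" using A[of \<i>] by (intro order.trans[OF norm_ge_zero]) auto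
    then show ?thesis by (simp add: zero_le_mult_iff)
  qed
  have "norm (f \<tau>) \<le> A * exp (- 2 * pi * d * Im \<tau>)" if "Im \<tau> \<ge> 1 / 2" for \<tau>
  proof -
    have "A * exp (- 2 * pi * e * Im \<tau>) \<le> A * exp (- 2 * pi * d * Im \<tau>)"
      using A0 assms(2) that by (intro mult_left_mono) auto
    then show ?thesis using A[OF that] by linarith
  qed
  moreover have "((\<lambda>\<tau>. f \<tau> * e2pi (- of_real d * \<tau>)) \<longlongrightarrow> 0) i_inf"
  proof (rule Lim_null_comparison[OF _ exp_decay_i_inf[of "e - d" A]])
    show "\<forall>\<^sub>F \<tau> in i_inf. norm (f \<tau> * e2pi (- of_real d * \<tau>)) \<le> A * exp (- 2 * pi * (e - d) * Im \<tau>)"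
      unfolding eventually_i_inf
    proof (intro exI allI impI)
      fix \<tau> assume "Im \<tau> \<ge> 1 / 2"
      have n: "norm (e2pi (- of_real d * \<tau>)) = exp (2 * pi * d * Im \<tau>)" by (simp add: norm_e2pi)
      have "norm (f \<tau> * e2pi (- of_real d * \<tau>)) \<le> A * exp (- 2 * pi * e * Im \<tau>) * exp (2 * pi * d * Im \<tau>)"
        unfolding norm_mult n by (intro mult_right_mono A \<open>Im \<tau> \<ge> 1 / 2\<close>) simp
      also have "\<dots> = A * (exp (- 2 * pi * e * Im \<tau>) * exp (2 * pi * d * Im \<tau>))" by simp
      also have "\<dots> = A * exp (- 2 * pi * (e - d) * Im \<tau>)"
        unfolding exp_add[symmetric] by (simp add: algebra_simps)
      finally show "norm (f \<tau> * e2pi (- of_real d * \<tau>)) \<le> A * exp (- 2 * pi * (e - d) * Im \<tau>)" .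
    qed
  qed (use assms(2) in simp)
  ultimately show ?thesis using assms unfolding lead_def by blast
qed

lemma lead_sum:
  assumes "finite I" "\<And>i. i \<in> I \<Longrightarrow> lead (f i) e (a i)"
  shows "lead (\<lambda>\<tau>. \<Sum>i\<in>I. f i \<tau>) e (\<Sum>i\<in>I. a i)"
  using assms by (induction I rule: finite_induct) (auto intro: lead_add lead_zero)

lemma lead_unique:
  assumes "lead f e a" "lead g e b" "\<And>\<tau>. \<tau> \<in> upper_half \<Longrightarrow> f \<tau> = g \<tau>"
  shows "a = b"
proof (rule tendsto_unique[OF i_inf_neq_bot])
  show "((\<lambda>\<tau>. f \<tau> * e2pi (- of_real e * \<tau>)) \<longlongrightarrow> a) i_inf" using assms by (simp add: lead_def)
  have "((\<lambda>\<tau>. g \<tau> * e2pi (- of_real e * \<tau>)) \<longlongrightarrow> b) i_inf" using assms by (simp add: lead_def)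
  then show "((\<lambda>\<tau>. f \<tau> * e2pi (- of_real e * \<tau>)) \<longlongrightarrow> b) i_inf"
    by (rule Lim_transform_eventually) (use eventually_upper_half_i_inf in \<open>eventually_elim, simp add: assms(3)\<close>)
qed

lemma lead_qseries:
  fixes s :: "'i \<Rightarrow> complex" and e :: "'i \<Rightarrow> real"
  assumes hol: "f holomorphic_on upper_half"
    and sum: "\<And>\<tau>. \<tau> \<in> upper_half \<Longrightarrow> ((\<lambda>i. s i * e2pi (of_real (e i) * \<tau>)) has_sum f \<tau>) I"
    and J: "finite J" "J \<subseteq> I" "\<And>i. i \<in> J \<Longrightarrow> e i = e0"
    and d: "d > 0" "\<And>i. i \<in> I - J \<Longrightarrow> s i \<noteq> 0 \<Longrightarrow> e i \<ge> e0 + d"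
  shows "lead f e0 (\<Sum>i\<in>J. s i)"
proof -
  have "e i \<ge> e0" if "i \<in> I" "s i \<noteq> 0" for i
    using d(2)[of i] J(3)[of i] that d(1) by (cases "i \<in> J") auto
  then show ?thesis
    unfolding lead_def using qseries_bound[OF sum, of e0 "1 / 2"] qseries_limit[OF sum J d] hol by auto
qed

text \<open>For 0 <= j <= N the square (2Nn + j)^2 is minimal at n = 0, and also at n = -1 exactly
  when j = N, which accounts for the coefficient 2.\<close>

lemma V_lead:
  assumes N: "N > 0" and j: "0 \<le> j" "j \<le> int N"
  shows "lead (V N j) (of_int (j\<^sup>2) / (4 * real N)) (if j = int N then 2 else 1)"
proof -
  define J where "J = (if j = int N then {0, - 1} else {0 :: int})"
  have sq: "(2 * int N * n + j)\<^sup>2 = j\<^sup>2 + 4 * int N * (n * (int N * n + j))" for n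
    by (simp add: power2_eq_square algebra_simps)
  have "lead (V N j) (of_int (j\<^sup>2) / (4 * real N)) (\<Sum>i\<in>J. 1)"
  proof (rule lead_qseries[where s = "\<lambda>_. 1" and I = UNIV and d = "1 / (4 * real N)" and e = "\<lambda>n. real_of_int (2 * int N * n + j) ^ 2 / (4 * real N)"])
    show "V N j holomorphic_on upper_half" by (rule V_holomorphic[OF N])
    show "((\<lambda>n. 1 * e2pi (of_real (real_of_int (2 * int N * n + j) ^ 2 / (4 * real N)) * \<tau>)) has_sum V N j \<tau>) UNIV"
      if "\<tau> \<in> upper_half" for \<tau> using V_has_sum[OF N that] by simp
    show "real_of_int (2 * int N * i + j) ^ 2 / (4 * real N) = of_int (j\<^sup>2) / (4 * real N)" if "i \<in> J" for i
    proof -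
      have "(2 * int N * i + j)\<^sup>2 = j\<^sup>2" unfolding sq using that by (auto simp: J_def split: if_splits)
      then show ?thesis by (simp only: of_int_power[symmetric])
    qed
    show "real_of_int (2 * int N * i + j) ^ 2 / (4 * real N) \<ge> of_int (j\<^sup>2) / (4 * real N) + 1 / (4 * real N)" if "i \<in> UNIV - J" for i
    proof -
      have "i * (int N * i + j) \<ge> 1"
      proof (cases "i \<ge> 1")
        case True
        have "1 * 1 \<le> int N * i" using True N by (intro mult_mono) auto
        then have "1 * 1 \<le> i * (int N * i + j)" using True j by (intro mult_mono) auto
        then show ?thesis by simp
      next
        case False
        moreover have "i \<noteq> 0" using that by (auto simp: J_def split: if_splits)
        ultimately have i: "i \<le> - 1" by simp
        have "int N * i + j \<le> - 1"
        proof (cases "i = - 1")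
          case True
          then show ?thesis using that j by (auto simp: J_def split: if_splits)
        next
          case False
          then have "int N * i \<le> int N * (- 2)" using i by (intro mult_left_mono) auto
          then show ?thesis using j N by simp
        qed
        then have "1 * 1 \<le> (- i) * (- (int N * i + j))" using i by (intro mult_mono) auto
        then show ?thesis by (simp only: minus_mult_minus mult_1_right)
      qed
      then have "4 * int N * 1 \<le> 4 * int N * (i * (int N * i + j))" using N by (intro mult_left_mono) auto
      then have "j\<^sup>2 + 1 \<le> (2 * int N * i + j)\<^sup>2" unfolding sq using N by linarith
      then have "real_of_int (j\<^sup>2 + 1) \<le> real_of_int ((2 * int N * i + j)\<^sup>2)" by (simp only: of_int_le_iff)
      then have "real_of_int (j\<^sup>2 + 1) / (4 * real N) \<le> real_of_int ((2 * int N * i + j)\<^sup>2) / (4 * real N)"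
        by (rule divide_right_mono) simp
      then show ?thesis by (simp add: add_divide_distrib)
    qed
  qed (use N in \<open>auto simp: J_def\<close>)
  then show ?thesis by (simp add: J_def split: if_splits)
qed

lemma V_lead':
  assumes "N > 0" "0 \<le> j" "j \<le> int N" "e = of_int (j\<^sup>2) / (4 * real N)" "c = (if j = int N then 2 else 1)"
  shows "lead (V N j) e c"
  using V_lead[OF assms(1-3)] assms(4,5) by simp

lemma eta_lead: "lead eta (1 / 24) 1"
proof -
  have eq: "V 6 7 = V 6 5"
    using V_period[of 6 "- 5"] V_uminus[of 6 5] by (simp add: fun_eq_iff)
  have "lead (V 6 5) (1 / 24) 0" by (rule lead_weaken[OF V_lead'[of 6 5 "25 / 24" 1]]) auto
  from lead_diff[OF V_lead'[of 6 1 "1 / 24" 1] this] show ?thesis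
    unfolding eta_def[abs_def] eq by simp
qed

text \<open>An exponent in (0, 1] is the least positive one of its class modulo 1, so cuspidality
  makes it the first that can occur.\<close>

lemma S32_lead:
  assumes F: "F \<in> S32" and \<gamma>: "\<gamma> \<in> Disc" and e: "e0 - disc_q \<gamma> \<in> \<int>" "0 < e0" "e0 \<le> 1"
  shows "lead (\<lambda>\<tau>. F \<tau> \<gamma>) e0 (fourier_coeff F \<gamma> e0)"
proof -
  have "lead (\<lambda>\<tau>. F \<tau> \<gamma>) e0 (\<Sum>e\<in>{e0}. fourier_coeff F \<gamma> e)"
  proof (rule lead_qseries[OF S32_hol[OF F \<gamma>] S32_has_sum[OF F \<gamma>], where d = 1])
    fix i assume i: "i \<in> {e. e - disc_q \<gamma> \<in> \<int>} - {e0}" "fourier_coeff F \<gamma> i \<noteq> 0"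
    have "i > 0" using i S32_expansion(2)[OF F] not_less by blast
    have "i - e0 \<in> \<int>" using i(1) e(1) Ints_diff[of "i - disc_q \<gamma>" "e0 - disc_q \<gamma>"] by simp
    then obtain n where n: "i - e0 = of_int n" by (elim Ints_cases)
    have "real_of_int n > - 1" using n \<open>i > 0\<close> e(3) by linarith
    then have "n \<ge> 0" by linarith
    moreover have "n \<noteq> 0" using n i(1) by auto
    ultimately have "n \<ge> 1" by simp
    then have "real_of_int n \<ge> 1" by simp
    then show "i \<ge> e0 + 1" using n by linarith
  qed (use e in auto)
  then show ?thesis by simp
qed

section \<open>Pairing with theta series\<close>

text \<open>The odd character modulo 3. It spans the odd functions on a 3-part and is an eigenvector
  of the finite Fourier transform there.\<close>

definition sg :: "int \<Rightarrow> complex" where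
  "sg u = (if u mod 3 = 1 then 1 else if u mod 3 = 2 then - 1 else 0)"

lemma sg_simps [simp]: "sg 0 = 0" "sg 1 = 1" "sg 2 = - 1"
  by (simp_all add: sg_def)

text \<open>A form of weight p/2 for the dual Weil representation of a summand of order 2, up to a
  sign \<open>\<epsilon>\<close> under S. The component at 0 is normalised to start with 1, and a is
  the leading coefficient of the other one.\<close>

definition two_form :: "(int \<Rightarrow> complex \<Rightarrow> complex) \<Rightarrow> nat \<Rightarrow> complex \<Rightarrow> complex \<Rightarrow> bool" where
  "two_form A p \<epsilon> a \<longleftrightarrow> lead (A 0) 0 1 \<and> lead (A 1) (1 / 4) a \<and>
     (\<forall>\<tau>\<in>upper_half. A 0 (\<tau> + 1) = A 0 \<tau> \<and> A 1 (\<tau> + 1) = e2pi (1 / 4) * A 1 \<tau> \<and>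
       A 0 (- 1 / \<tau>) = \<epsilon> * csqrt (- \<i> * \<tau>) ^ p / of_real (sqrt 2) * (A 0 \<tau> + A 1 \<tau>) \<and>
       A 1 (- 1 / \<tau>) = \<epsilon> * csqrt (- \<i> * \<tau>) ^ p / of_real (sqrt 2) * (A 0 \<tau> - A 1 \<tau>))"

text \<open>The analogue for the even part of the Weil representation of a summand of order 3: X 1
  stands for both nonzero classes, hence the factor 2.\<close>

definition three_form :: "(int \<Rightarrow> complex \<Rightarrow> complex) \<Rightarrow> nat \<Rightarrow> complex \<Rightarrow> complex \<Rightarrow> bool" where
  "three_form X p \<epsilon> t \<longleftrightarrow> lead (X 0) 0 1 \<and> lead (X 1) (1 / 3) t \<and>
     (\<forall>\<tau>\<in>upper_half. X 0 (\<tau> + 1) = X 0 \<tau> \<and> X 1 (\<tau> + 1) = e2pi (1 / 3) * X 1 \<tau> \<and>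
       X 0 (- 1 / \<tau>) = \<epsilon> * csqrt (- \<i> * \<tau>) ^ p / of_real (sqrt 3) * (X 0 \<tau> + 2 * X 1 \<tau>) \<and>
       X 1 (- 1 / \<tau>) = \<epsilon> * csqrt (- \<i> * \<tau>) ^ p / of_real (sqrt 3) * (X 0 \<tau> - X 1 \<tau>))"

definition theta2 :: "int \<Rightarrow> complex \<Rightarrow> complex" where
  "theta2 x = V 1 x"

text \<open>The gradient of the invariant \<open>X Y (X\<^sup>4 - Y\<^sup>4)\<close> of the octahedral group, rotated by 90 degrees.\<close>

definition theta2' :: "int \<Rightarrow> complex \<Rightarrow> complex" where
  "theta2' x \<tau> = (if x = 0 then V 1 0 \<tau> ^ 5 - 5 * (V 1 0 \<tau> * V 1 1 \<tau> ^ 4)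
     else V 1 1 \<tau> ^ 5 - 5 * (V 1 0 \<tau> ^ 4 * V 1 1 \<tau>))"

text \<open>The theta series of the root lattice A2 and of its nontrivial dual coset, split along
  the orthogonal sublattice with Gram matrix diag(2, 6).\<close>

definition theta3 :: "int \<Rightarrow> complex \<Rightarrow> complex" where
  "theta3 x \<tau> = (if x = 0 then V 1 0 \<tau> * V 3 0 \<tau> + V 1 1 \<tau> * V 3 3 \<tau>
     else V 1 0 \<tau> * V 3 2 \<tau> + V 1 1 \<tau> * V 3 1 \<tau>)"

text \<open>The gradient of the invariant \<open>Y (X\<^sup>3 - Y\<^sup>3)\<close> of the tetrahedral group, rotated by 90 degrees.\<close>

definition theta3' :: "int \<Rightarrow> complex \<Rightarrow> complex" where
  "theta3' x \<tau> = (if x = 0 then theta3 0 \<tau> ^ 3 - 4 * theta3 1 \<tau> ^ 3 else - 3 * (theta3 0 \<tau> ^ 2 * theta3 1 \<tau>))"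

lemma e2pi_half: "e2pi (1 / 2) = - 1"
  by (simp add: e2pi_def)

lemma V1_S:
  assumes "\<tau> \<in> upper_half"
  shows "V 1 0 (- 1 / \<tau>) = csqrt (- \<i> * \<tau>) / of_real (sqrt 2) * (V 1 0 \<tau> + V 1 1 \<tau>)"
    "V 1 1 (- 1 / \<tau>) = csqrt (- \<i> * \<tau>) / of_real (sqrt 2) * (V 1 0 \<tau> - V 1 1 \<tau>)"
  unfolding V_S[OF zero_less_one assms] by (simp_all add: numeral_2_eq_2 e2pi_half[simplified])

lemma V3_S_aux:
  "(\<Sum>l<6. e2pi (of_int j * of_nat l / 6) * V 3 (int l) \<tau>)
    = V 3 0 \<tau> + (om (- j) * sgnp j + om j * sgnp j) * V 3 1 \<tau> + (om j + om (- j)) * V 3 2 \<tau> + sgnp j * V 3 3 \<tau>"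
proof -
  \<comment> \<open>1/6 = 1/2 - 1/3 splits each sixth root of unity into a sign and a cube root of
    unity.\<close>
  have e: "e2pi (of_int j * of_nat l / 6) = om (- j * int l) * sgnp (j * int l)" for l
  proof -
    have h: "e2pi (of_int m / 2) = sgnp m" for m
    proof (cases "even m")
      case True
      then obtain n where "m = 2 * n" by (elim evenE)
      then show ?thesis by (simp add: sgnp_def)
    next
      case False
      then obtain n where m: "m = 2 * n + 1" by (elim oddE)
      have "of_int m / 2 = of_int n + (1 / 2 :: complex)" by (simp add: m field_simps)
      then have "e2pi (of_int m / 2) = e2pi (1 / 2)" by (simp only: e2pi_add e2pi_of_int mult_1_left)
      then show ?thesis using False by (simp add: sgnp_def e2pi_half)
    qed
    have "of_int j * of_nat l / 6 = of_int (- j * int l) / 3 + (of_int (j * int l) / 2 :: complex)" by (simp add: field_simps)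
    then show ?thesis by (simp only: e2pi_add h om_def)
  qed
  have V45: "V 3 4 \<tau> = V 3 2 \<tau>" "V 3 5 \<tau> = V 3 1 \<tau>"
    using V_period[of 3 "- 2" \<tau>] V_period[of 3 "- 1" \<tau>] V_uminus[of 3 2 \<tau>] V_uminus[of 3 1 \<tau>] by simp_all
  have o: "om (- (j * 2)) = om j" "om (- (j * 3)) = 1" "om (- (j * 4)) = om (- j)" "om (- (j * 5)) = om j"
    by (subst om_mod, subst (2) om_mod, rule arg_cong[of _ _ om], presburger | subst om_mod, simp)+
  have s: "sgnp (j * 2) = 1" "sgnp (j * 3) = sgnp j" "sgnp (j * 4) = 1" "sgnp (j * 5) = sgnp j"
    by (auto simp: sgnp_def)
  have s6: "(\<Sum>l<6. f l) = f 0 + f 1 + f 2 + f 3 + f 4 + f (5 :: nat)" for f :: "nat \<Rightarrow> complex"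
    by (simp add: eval_nat_numeral)
  show ?thesis unfolding e s6 by (simp add: V45 o s sgnp_def[of 0] algebra_simps)
qed

lemma V3_S:
  assumes "\<tau> \<in> upper_half"
  shows "V 3 j (- 1 / \<tau>) = csqrt (- \<i> * \<tau>) / of_real (sqrt 6) *
    (V 3 0 \<tau> + (om (- j) * sgnp j + om j * sgnp j) * V 3 1 \<tau> + (om j + om (- j)) * V 3 2 \<tau> + sgnp j * V 3 3 \<tau>)"
  using V_S[of 3 \<tau> j] assms V3_S_aux[of j \<tau>] by simp

lemma theta2_form: "two_form theta2 1 1 2"
proof -
  have "V 1 0 (\<tau> + 1) = V 1 0 \<tau>" "V 1 1 (\<tau> + 1) = e2pi (1 / 4) * V 1 1 \<tau>" for \<tau>
    using V_T[of 1 0 \<tau>] V_T[of 1 1 \<tau>] by simp_all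
  moreover have "lead (V 1 0) 0 1" "lead (V 1 1) (1 / 4) 2"
    by (rule V_lead'; simp)+
  ultimately show ?thesis unfolding two_form_def theta2_def using V1_S by auto
qed

text \<open>If a substitution A multiplies an invariant by m, then the gradient rotated by 90
  degrees transforms by (m / det A) A. Here A sends (X, Y) to (X + Y, X - Y), with m = 8 and det A =
  -2, which gives the factor -4 and thus the sign -1.\<close>

lemma theta2'_form: "two_form theta2' 5 (- 1) (- 10)"
proof -
  have l: "lead (V 1 0) 0 1" "lead (V 1 1) (1 / 4) 2"
    by (rule V_lead'; simp)+
  have "lead (theta2' 0) 0 1"
  proof -
    have 1: "lead (\<lambda>\<tau>. V 1 0 \<tau> ^ 5) 0 1" using lead_power[OF l(1), of 5] by simp
    have "lead (\<lambda>\<tau>. V 1 0 \<tau> * V 1 1 \<tau> ^ 4) 1 16" using lead_mult[OF l(1) lead_power[OF l(2), of 4]] by simp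
    then have "lead (\<lambda>\<tau>. V 1 0 \<tau> * V 1 1 \<tau> ^ 4) 0 0" by (rule lead_weaken) simp
    from lead_diff[OF 1 lead_cmult[OF this, of 5]] show ?thesis by (simp add: theta2'_def[abs_def])
  qed
  moreover have "lead (theta2' 1) (1 / 4) (- 10)"
  proof -
    have "lead (\<lambda>\<tau>. V 1 1 \<tau> ^ 5) (5 / 4) 32" using lead_power[OF l(2), of 5] by simp
    then have 1: "lead (\<lambda>\<tau>. V 1 1 \<tau> ^ 5) (1 / 4) 0" by (rule lead_weaken) simp
    have "lead (\<lambda>\<tau>. V 1 0 \<tau> ^ 4 * V 1 1 \<tau>) (1 / 4) 2" using lead_mult[OF lead_power[OF l(1), of 4] l(2)] by simp
    from lead_diff[OF 1 lead_cmult[OF this, of 5]] show ?thesis by (simp add: theta2'_def[abs_def])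
  qed
  moreover have "theta2' 0 (\<tau> + 1) = theta2' 0 \<tau>" "theta2' 1 (\<tau> + 1) = e2pi (1 / 4) * theta2' 1 \<tau>" for \<tau>
  proof -
    have T: "V 1 0 (\<tau> + 1) = V 1 0 \<tau>" "V 1 1 (\<tau> + 1) = e2pi (1 / 4) * V 1 1 \<tau>" for \<tau>
      using V_T[of 1 0 \<tau>] V_T[of 1 1 \<tau>] by simp_all
    have 4: "e2pi (1 / 4) ^ 4 = 1" using e2pi_of_int[of 1] unfolding e2pi_power by simp
    have 5: "e2pi (1 / 4) ^ 5 = e2pi (1 / 4)" using 4 by (simp add: eval_nat_numeral)
    show "theta2' 0 (\<tau> + 1) = theta2' 0 \<tau>" unfolding theta2'_def T power_mult_distrib 4 by simp
    show "theta2' 1 (\<tau> + 1) = e2pi (1 / 4) * theta2' 1 \<tau>" unfolding theta2'_def T power_mult_distrib 5 by (simp add: algebra_simps)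
  qed
  moreover have "theta2' 0 (- 1 / \<tau>) = - 1 * csqrt (- \<i> * \<tau>) ^ 5 / of_real (sqrt 2) * (theta2' 0 \<tau> + theta2' 1 \<tau>)"
    "theta2' 1 (- 1 / \<tau>) = - 1 * csqrt (- \<i> * \<tau>) ^ 5 / of_real (sqrt 2) * (theta2' 0 \<tau> - theta2' 1 \<tau>)"
    if \<tau>: "\<tau> \<in> upper_half" for \<tau>
  proof -
    define r where "r = csqrt (- \<i> * \<tau>) / of_real (sqrt 2)"
    define a b where "a = V 1 0 \<tau>" and "b = V 1 1 \<tau>"
    have "(of_real (sqrt 2) :: complex)\<^sup>2 = 2" by (simp flip: of_real_power)
    then have r2: "(of_real (sqrt 2) :: complex) ^ 4 = 4" using power_mult[of "of_real (sqrt 2) :: complex" 2 2] by simp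
    have r5: "csqrt (- \<i> * \<tau>) ^ 5 / of_real (sqrt 2) = 4 * r ^ 5"
    proof -
      have "(of_real (sqrt 2) :: complex) ^ 5 = 4 * of_real (sqrt 2)" using r2 by (simp add: eval_nat_numeral)
      then show ?thesis by (simp add: r_def power_divide)
    qed
    have "theta2' 0 (- 1 / \<tau>) = (r * (a + b)) ^ 5 - 5 * ((r * (a + b)) * (r * (a - b)) ^ 4)"
      "theta2' 1 (- 1 / \<tau>) = (r * (a - b)) ^ 5 - 5 * ((r * (a + b)) ^ 4 * (r * (a - b)))"
      unfolding theta2'_def V1_S[OF \<tau>] r_def a_def b_def by simp_all
    moreover have "theta2' 0 \<tau> = a ^ 5 - 5 * (a * b ^ 4)" "theta2' 1 \<tau> = b ^ 5 - 5 * (a ^ 4 * b)"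
      by (simp_all add: theta2'_def a_def b_def)
    moreover have "(r * (a + b)) ^ 5 - 5 * ((r * (a + b)) * (r * (a - b)) ^ 4) = - (4 * r ^ 5) * ((a ^ 5 - 5 * (a * b ^ 4)) + (b ^ 5 - 5 * (a ^ 4 * b)))"
      "(r * (a - b)) ^ 5 - 5 * ((r * (a + b)) ^ 4 * (r * (a - b))) = - (4 * r ^ 5) * ((a ^ 5 - 5 * (a * b ^ 4)) - (b ^ 5 - 5 * (a ^ 4 * b)))"
      by algebra+
    ultimately show "theta2' 0 (- 1 / \<tau>) = - 1 * csqrt (- \<i> * \<tau>) ^ 5 / of_real (sqrt 2) * (theta2' 0 \<tau> + theta2' 1 \<tau>)"
      "theta2' 1 (- 1 / \<tau>) = - 1 * csqrt (- \<i> * \<tau>) ^ 5 / of_real (sqrt 2) * (theta2' 0 \<tau> - theta2' 1 \<tau>)"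
      unfolding times_divide_eq_right[symmetric] r5 by simp_all
  qed
  ultimately show ?thesis unfolding two_form_def by blast
qed

lemma theta3_form: "three_form theta3 2 1 3"
proof -
  have l: "lead (V 1 0) 0 1" "lead (V 1 1) (1 / 4) 2" "lead (V 3 0) 0 1" "lead (V 3 1) (1 / 12) 1"
     "lead (V 3 2) (1 / 3) 1" "lead (V 3 3) (3 / 4) 2"
    by (rule V_lead'; simp)+
  have "lead (theta3 0) 0 1"
  proof -
    have "lead (\<lambda>\<tau>. V 1 1 \<tau> * V 3 3 \<tau>) 1 4" using lead_mult[OF l(2) l(6)] by simp
    then have "lead (\<lambda>\<tau>. V 1 1 \<tau> * V 3 3 \<tau>) 0 0" by (rule lead_weaken) simp
    from lead_add[OF _ this] lead_mult[OF l(1) l(3)] show ?thesis by (fastforce simp: theta3_def[abs_def])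
  qed
  moreover have "lead (theta3 1) (1 / 3) 3"
    using lead_add[of "\<lambda>\<tau>. V 1 0 \<tau> * V 3 2 \<tau>" "1 / 3" 1 "\<lambda>\<tau>. V 1 1 \<tau> * V 3 1 \<tau>" 2]
      lead_mult[OF l(1) l(5)] lead_mult[OF l(2) l(4)] by (simp add: theta3_def[abs_def])
  moreover have "theta3 0 (\<tau> + 1) = theta3 0 \<tau>" "theta3 1 (\<tau> + 1) = e2pi (1 / 3) * theta3 1 \<tau>" for \<tau>
  proof -
    have T: "V 1 0 (\<tau> + 1) = V 1 0 \<tau>" "V 1 1 (\<tau> + 1) = e2pi (1 / 4) * V 1 1 \<tau>"
      "V 3 0 (\<tau> + 1) = V 3 0 \<tau>" "V 3 1 (\<tau> + 1) = e2pi (1 / 12) * V 3 1 \<tau>" "V 3 2 (\<tau> + 1) = e2pi (1 / 3) * V 3 2 \<tau>"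
      "V 3 3 (\<tau> + 1) = e2pi (3 / 4) * V 3 3 \<tau>" for \<tau>
      using V_T[of 1 0 \<tau>] V_T[of 1 1 \<tau>] V_T[of 3 0 \<tau>] V_T[of 3 1 \<tau>] V_T[of 3 2 \<tau>] V_T[of 3 3 \<tau>] by simp_all
    have e: "e2pi (1 / 4) * e2pi (3 / 4) = 1" "e2pi (1 / 4) * e2pi (1 / 12) = e2pi (1 / 3)"
      using e2pi_of_int[of 1] unfolding e2pi_add[symmetric] by simp_all
    have "(e2pi (1 / 4) * b) * (e2pi (3 / 4) * c) = b * c" "(e2pi (1 / 4) * b) * (e2pi (1 / 12) * c) = e2pi (1 / 3) * (b * c)" for b c
    proof -
      have "(e2pi (1 / 4) * b) * (e2pi (3 / 4) * c) = (e2pi (1 / 4) * e2pi (3 / 4)) * (b * c)"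
        "(e2pi (1 / 4) * b) * (e2pi (1 / 12) * c) = (e2pi (1 / 4) * e2pi (1 / 12)) * (b * c)" by (simp_all only: mult_ac)
      then show "(e2pi (1 / 4) * b) * (e2pi (3 / 4) * c) = b * c" "(e2pi (1 / 4) * b) * (e2pi (1 / 12) * c) = e2pi (1 / 3) * (b * c)"
        unfolding e by simp_all
    qed
    then show "theta3 0 (\<tau> + 1) = theta3 0 \<tau>" "theta3 1 (\<tau> + 1) = e2pi (1 / 3) * theta3 1 \<tau>"
      unfolding theta3_def T by (simp_all add: distrib_left mult.left_commute)
  qed
  moreover have "theta3 0 (- 1 / \<tau>) = 1 * csqrt (- \<i> * \<tau>) ^ 2 / of_real (sqrt 3) * (theta3 0 \<tau> + 2 * theta3 1 \<tau>)"
    "theta3 1 (- 1 / \<tau>) = 1 * csqrt (- \<i> * \<tau>) ^ 2 / of_real (sqrt 3) * (theta3 0 \<tau> - theta3 1 \<tau>)"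
    if \<tau>: "\<tau> \<in> upper_half" for \<tau>
  proof -
    define s where "s = csqrt (- \<i> * \<tau>)"
    have m: "om (- 1) = om 2" "om (- 2) = om 1" "om 3 = 1" "om (- 3) = 1"
      using om_mod[of "- 1"] om_mod[of "- 2"] om_mod[of "- 3"] om_mod[of 3] by simp_all
    have o: "om 1 + om 2 = - 1" "om 2 + om 1 = - 1" by (simp_all add: om_1 om_2 complex_eq_iff)
    have sg: "sgnp 0 = 1" "sgnp 1 = - 1" "sgnp 2 = 1" "sgnp 3 = - 1" by (simp_all add: sgnp_def)
    have o': "om 1 * 1 + om 2 * 1 = - 1" "om 2 * - 1 + om 1 * - 1 = 1" by (simp_all add: om_1 om_2 complex_eq_iff)
    have S: "V 3 0 (- 1 / \<tau>) = s / of_real (sqrt 6) * (V 3 0 \<tau> + 2 * V 3 1 \<tau> + 2 * V 3 2 \<tau> + V 3 3 \<tau>)"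
      "V 3 1 (- 1 / \<tau>) = s / of_real (sqrt 6) * (V 3 0 \<tau> + V 3 1 \<tau> - V 3 2 \<tau> - V 3 3 \<tau>)"
      "V 3 2 (- 1 / \<tau>) = s / of_real (sqrt 6) * (V 3 0 \<tau> - V 3 1 \<tau> - V 3 2 \<tau> + V 3 3 \<tau>)"
      "V 3 3 (- 1 / \<tau>) = s / of_real (sqrt 6) * (V 3 0 \<tau> - 2 * V 3 1 \<tau> + 2 * V 3 2 \<tau> - V 3 3 \<tau>)"
      unfolding V3_S[OF \<tau>] s_def[symmetric] sg m o o' by (simp_all add: om_0)
    have q: "1 / of_real (sqrt 2) * (1 / of_real (sqrt 6)) * 2 = (1 / of_real (sqrt 3) :: complex)"
    proof -
      have "sqrt 2 * sqrt 6 = 2 * sqrt 3" using real_sqrt_mult[of 4 3] by (simp flip: real_sqrt_mult)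
      then have "complex_of_real (sqrt 2 * sqrt 6) = complex_of_real (2 * sqrt 3)" by (simp only:)
      then have "(of_real (sqrt 2) * of_real (sqrt 6) :: complex) = 2 * of_real (sqrt 3)" by simp
      then show ?thesis by (simp add: field_simps)
    qed
    have e: "(s / of_real (sqrt 2) * A) * (s / of_real (sqrt 6) * B) + (s / of_real (sqrt 2) * A') * (s / of_real (sqrt 6) * B')
      = s\<^sup>2 / of_real (sqrt 3) * C" if "A * B + A' * B' = 2 * C" for A B A' B' C
    proof -
      have "(s / of_real (sqrt 2) * A) * (s / of_real (sqrt 6) * B) + (s / of_real (sqrt 2) * A') * (s / of_real (sqrt 6) * B')
        = s\<^sup>2 * (1 / of_real (sqrt 2) * (1 / of_real (sqrt 6))) * (A * B + A' * B')"
        by (simp add: divide_inverse power2_eq_square distrib_left mult_ac)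
      also have "\<dots> = s\<^sup>2 * (1 / of_real (sqrt 2) * (1 / of_real (sqrt 6)) * 2) * C" unfolding that by simp
      finally show ?thesis unfolding q by simp
    qed
    have t: "theta3 0 \<sigma> = V 1 0 \<sigma> * V 3 0 \<sigma> + V 1 1 \<sigma> * V 3 3 \<sigma>"
      "theta3 1 \<sigma> = V 1 0 \<sigma> * V 3 2 \<sigma> + V 1 1 \<sigma> * V 3 1 \<sigma>" for \<sigma>
      by (simp_all add: theta3_def)
    show "theta3 0 (- 1 / \<tau>) = 1 * csqrt (- \<i> * \<tau>) ^ 2 / of_real (sqrt 3) * (theta3 0 \<tau> + 2 * theta3 1 \<tau>)"
      "theta3 1 (- 1 / \<tau>) = 1 * csqrt (- \<i> * \<tau>) ^ 2 / of_real (sqrt 3) * (theta3 0 \<tau> - theta3 1 \<tau>)"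
      unfolding t V1_S[OF \<tau>] s_def[symmetric] S mult_1_left
      by (rule e, algebra)+
  qed
  ultimately show ?thesis unfolding three_form_def by blast
qed

text \<open>The same mechanism as for \<open>theta2'_form\<close>: (X + 2Y, X - Y) has determinant
  -3 and multiplies Y (X^3 - Y^3) by 9, whence the factor -3.\<close>

lemma theta3'_form: "three_form theta3' 6 (- 1) (- 9)"
proof -
  have l: "lead (theta3 0) 0 1" "lead (theta3 1) (1 / 3) 3" using theta3_form by (auto simp: three_form_def)
  have T: "theta3 0 (\<tau> + 1) = theta3 0 \<tau>" "theta3 1 (\<tau> + 1) = e2pi (1 / 3) * theta3 1 \<tau>" if "\<tau> \<in> upper_half" for \<tau>
    using theta3_form that by (auto simp: three_form_def)
  have "lead (theta3' 0) 0 1"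
  proof -
    have "lead (\<lambda>\<tau>. theta3 1 \<tau> ^ 3) 1 27" using lead_power[OF l(2), of 3] by simp
    then have "lead (\<lambda>\<tau>. theta3 1 \<tau> ^ 3) 0 0" by (rule lead_weaken) simp
    from lead_diff[OF lead_power[OF l(1), of 3] ] lead_cmult[OF this, of 4] show ?thesis by (fastforce simp: theta3'_def[abs_def])
  qed
  moreover have "lead (theta3' 1) (1 / 3) (- 9)"
    using lead_cmult[OF lead_mult[OF lead_power[OF l(1), of 2] l(2)], of "- 3"] by (simp add: theta3'_def[abs_def])
  moreover have "theta3' 0 (\<tau> + 1) = theta3' 0 \<tau>" "theta3' 1 (\<tau> + 1) = e2pi (1 / 3) * theta3' 1 \<tau>" if "\<tau> \<in> upper_half" for \<tau>
  proof -
    have 3: "e2pi (1 / 3) ^ 3 = 1" using e2pi_of_int[of 1] unfolding e2pi_power by simp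
    show "theta3' 0 (\<tau> + 1) = theta3' 0 \<tau>" "theta3' 1 (\<tau> + 1) = e2pi (1 / 3) * theta3' 1 \<tau>"
      by (simp_all add: theta3'_def T[OF that] power_mult_distrib 3)
  qed
  moreover have "theta3' 0 (- 1 / \<tau>) = - 1 * csqrt (- \<i> * \<tau>) ^ 6 / of_real (sqrt 3) * (theta3' 0 \<tau> + 2 * theta3' 1 \<tau>)"
    "theta3' 1 (- 1 / \<tau>) = - 1 * csqrt (- \<i> * \<tau>) ^ 6 / of_real (sqrt 3) * (theta3' 0 \<tau> - theta3' 1 \<tau>)"
    if \<tau>: "\<tau> \<in> upper_half" for \<tau>
  proof -
    define cs where "cs = csqrt (- \<i> * \<tau>)"
    define r where "r = cs ^ 2 / of_real (sqrt 3)"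
    define a b where "a = theta3 0 \<tau>" and "b = theta3 1 \<tau>"
    have S: "theta3 0 (- 1 / \<tau>) = r * (a + 2 * b)" "theta3 1 (- 1 / \<tau>) = r * (a - b)"
      using theta3_form \<tau> unfolding three_form_def a_def b_def r_def cs_def by auto
    have r6: "cs ^ 6 / of_real (sqrt 3) = 3 * r ^ 3"
    proof -
      have "(of_real (sqrt 3) :: complex)\<^sup>2 = 3" by (simp flip: of_real_power)
      then have "(of_real (sqrt 3) :: complex) ^ 3 = 3 * of_real (sqrt 3)" by (simp add: eval_nat_numeral)
      then show ?thesis by (simp add: r_def power_divide power_mult[symmetric])
    qed
    have "theta3' 0 (- 1 / \<tau>) = (r * (a + 2 * b)) ^ 3 - 4 * (r * (a - b)) ^ 3"
      "theta3' 1 (- 1 / \<tau>) = - 3 * ((r * (a + 2 * b)) ^ 2 * (r * (a - b)))"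
      unfolding theta3'_def S by simp_all
    moreover have "theta3' 0 \<tau> = a ^ 3 - 4 * b ^ 3" "theta3' 1 \<tau> = - 3 * (a ^ 2 * b)"
      by (simp_all add: theta3'_def a_def b_def)
    moreover have "(r * (a + 2 * b)) ^ 3 - 4 * (r * (a - b)) ^ 3 = - (3 * r ^ 3) * ((a ^ 3 - 4 * b ^ 3) + 2 * (- 3 * (a ^ 2 * b)))"
      "- 3 * ((r * (a + 2 * b)) ^ 2 * (r * (a - b))) = - (3 * r ^ 3) * ((a ^ 3 - 4 * b ^ 3) - (- 3 * (a ^ 2 * b)))"
      by algebra+
    ultimately show "theta3' 0 (- 1 / \<tau>) = - 1 * csqrt (- \<i> * \<tau>) ^ 6 / of_real (sqrt 3) * (theta3' 0 \<tau> + 2 * theta3' 1 \<tau>)"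
      "theta3' 1 (- 1 / \<tau>) = - 1 * csqrt (- \<i> * \<tau>) ^ 6 / of_real (sqrt 3) * (theta3' 0 \<tau> - theta3' 1 \<tau>)"
      unfolding cs_def[symmetric] times_divide_eq_right[symmetric] r6 by simp_all
  qed
  ultimately show ?thesis unfolding three_form_def by blast
qed

text \<open>A two-dimensional representation is dual to itself up to its determinant, by a rotation
  through 90 degrees; the 1/2 compensates the two classes sharing the value X 1. The determinant
  takes the value e(1/3) at T.\<close>

definition dual3 :: "(int \<Rightarrow> complex \<Rightarrow> complex) \<Rightarrow> int \<Rightarrow> complex \<Rightarrow> complex" where
  "dual3 X v \<tau> = (if v = 0 then X 1 \<tau> else - X 0 \<tau> / 2)"

text \<open>A tensor product of dual type: one factor for each 2-part, the odd character in u, and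
  an even vector in v. Pairing with it detects the part of a cusp form odd in u and even in
  v.\<close>

definition weight_vec :: "(int \<Rightarrow> complex \<Rightarrow> complex) \<Rightarrow> (int \<Rightarrow> complex \<Rightarrow> complex) \<Rightarrow> (int \<Rightarrow> complex \<Rightarrow> complex) \<Rightarrow>
    (int \<Rightarrow> complex \<Rightarrow> complex) \<Rightarrow> idx \<Rightarrow> complex \<Rightarrow> complex" where
  "weight_vec A B C X = (\<lambda>(x, y, z, u, v) \<tau>. A x \<tau> * B y \<tau> * C z \<tau> * sg u * dual3 X v \<tau>)"

definition pairing where
  "pairing F A B C X \<tau> = (\<Sum>\<gamma>\<in>Disc. F \<tau> \<gamma> * weight_vec A B C X (ix \<gamma>) \<tau>)"

lemma KK_cases:
  assumes "k \<in> KK"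
  obtains x y z u v where "k = (x, y, z, u, v)" "x \<in> {0, 1}" "y \<in> {0, 1}" "z \<in> {0, 1}" "u \<in> {0, 1, 2}" "v \<in> {0, 1, 2}"
  using assms by (auto simp: KK_def)

lemma ix_in_KK: "\<gamma> \<in> Disc \<Longrightarrow> ix \<gamma> \<in> KK"
  unfolding ix_def using bij_cl by (simp add: bij_betw_def inv_into_into)

lemma ix_cl_KK: "k \<in> KK \<Longrightarrow> ix (cl k) = k"
  unfolding ix_def using bij_cl by (simp add: bij_betw_def inv_into_f_f)

lemma disc_sum_KK: "(\<Sum>\<gamma>\<in>Disc. f \<gamma>) = (\<Sum>k\<in>KK. f (cl k))"
  using sum.reindex_bij_betw[OF bij_cl, of f] by simp

text \<open>Each tensor factor is reproduced by its finite Fourier transform up to an automorphy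
  factor and a constant. The constants sqrt 2 (three times) and sqrt 3 (twice) cancel sqrt 72, and
  the two factors i cancel the minus sign of \<open>three\<close>.\<close>

lemma pairing_S:
  assumes F: "F \<in> S32" and A: "two_form A p1 \<epsilon>1 a1" and B: "two_form B p2 \<epsilon>2 a2" and C: "two_form C p3 \<epsilon>3 a3"
    and X: "three_form X p4 \<epsilon>4 t" and \<tau>: "\<tau> \<in> upper_half"
  shows "pairing F A B C X (- 1 / \<tau>) = (\<epsilon>1 * \<epsilon>2 * \<epsilon>3 * \<epsilon>4) * csqrt (- \<i> * \<tau>) ^ (3 + p1 + p2 + p3 + p4) * pairing F A B C X \<tau>"
proof -
  define s where "s = csqrt (- \<i> * \<tau>)"
  define K where "K = \<i> * s ^ 3 / of_real (sqrt 72)"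
  define W where "W = (\<lambda>\<gamma>. weight_vec A B C X (ix \<gamma>) (- 1 / \<tau>))"
  define E where "E = (\<epsilon>1 * \<epsilon>2 * \<epsilon>3 * \<epsilon>4) * s ^ (p1 + p2 + p3 + p4)"
  have two: "(\<Sum>b\<in>{0, 1}. sgnp (x * b) * A b (- 1 / \<tau>)) = \<epsilon> * s ^ p * of_real (sqrt 2) * A x \<tau>"
    if "two_form A p \<epsilon> a" "x \<in> {0, 1}" for A p \<epsilon> a x
  proof -
    have AS: "A 0 (- 1 / \<tau>) = \<epsilon> * s ^ p / of_real (sqrt 2) * (A 0 \<tau> + A 1 \<tau>)"
      "A 1 (- 1 / \<tau>) = \<epsilon> * s ^ p / of_real (sqrt 2) * (A 0 \<tau> - A 1 \<tau>)"
      using that(1) \<tau> unfolding two_form_def s_def by blast+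
    have q: "(2 :: complex) = of_real (sqrt 2) * of_real (sqrt 2)" by (simp flip: of_real_mult)
    have eq: "(\<Sum>b\<in>{0, 1}. sgnp (x * b) * A b \<sigma>) = A 0 \<sigma> + sgnp x * A 1 \<sigma>" for \<sigma>
      by (simp add: sgnp_def)
    have "(\<Sum>b\<in>{0, 1}. sgnp (x * b) * A b (- 1 / \<tau>)) = A 0 (- 1 / \<tau>) + sgnp x * A 1 (- 1 / \<tau>)"
      by (rule eq)
    also have "\<dots> = \<epsilon> * s ^ p / of_real (sqrt 2) * (2 * A x \<tau>)"
    proof -
      define D where "D = \<epsilon> * s ^ p / of_real (sqrt 2)"
      show ?thesis unfolding AS D_def[symmetric] using that(2) by (auto simp: sgnp_def algebra_simps)
    qed
    also have "\<dots> = \<epsilon> * s ^ p * of_real (sqrt 2) * A x \<tau>" unfolding q by simp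
    finally show ?thesis .
  qed
  have sgs: "(\<Sum>b\<in>{0, 1, 2}. om (u * b) * sg b) = \<i> * of_real (sqrt 3) * sg u" if "u \<in> {0, 1, 2}" for u
    using that by (auto simp: om_1 om_2 complex_eq_iff)
  have three: "(\<Sum>b\<in>{0, 1, 2}. om (v * b) * dual3 X b (- 1 / \<tau>)) = - (\<epsilon>4 * s ^ p4 * of_real (sqrt 3) * dual3 X v \<tau>)"
    if "v \<in> {0, 1, 2}" for v
  proof -
    have XS: "X 0 (- 1 / \<tau>) = \<epsilon>4 * s ^ p4 / of_real (sqrt 3) * (X 0 \<tau> + 2 * X 1 \<tau>)"
      "X 1 (- 1 / \<tau>) = \<epsilon>4 * s ^ p4 / of_real (sqrt 3) * (X 0 \<tau> - X 1 \<tau>)"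
      using X \<tau> unfolding three_form_def s_def by blast+
    have q: "(3 :: complex) = of_real (sqrt 3) * of_real (sqrt 3)" by (simp flip: of_real_mult)
    have o: "om 1 + om 2 = - 1" "om 2 + om 1 = - 1" by (simp_all add: om_1 om_2 complex_eq_iff)
    have "(\<Sum>b\<in>{0, 1, 2}. om (v * b) * dual3 X b (- 1 / \<tau>)) = X 1 (- 1 / \<tau>) - (om v + om (v * 2)) * X 0 (- 1 / \<tau>) / 2"
      by (simp add: dual3_def algebra_simps add_divide_distrib)
    also have "\<dots> = \<epsilon>4 * s ^ p4 / of_real (sqrt 3) * (- 3 * dual3 X v \<tau>)"
    proof -
      define D where "D = \<epsilon>4 * s ^ p4 / of_real (sqrt 3)"
      have "om v + om (v * 2) = (if v = 0 then 2 else - 1)" using that by (auto simp: o)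
      then show ?thesis unfolding XS D_def[symmetric] by (simp add: dual3_def field_simps)
    qed
    also have "\<dots> = - (\<epsilon>4 * s ^ p4 * of_real (sqrt 3) * dual3 X v \<tau>)" unfolding q by simp
    finally show ?thesis .
  qed
  have inner: "K * (\<Sum>\<delta>\<in>Disc. chi (cl k) \<delta> * W \<delta>) = E * s ^ 3 * weight_vec A B C X k \<tau>" if "k \<in> KK" for k
  proof -
    obtain x y z u v where k: "k = (x, y, z, u, v)" "x \<in> {0, 1}" "y \<in> {0, 1}" "z \<in> {0, 1}" "u \<in> {0, 1, 2}" "v \<in> {0, 1, 2}"
      by (rule KK_cases[OF \<open>k \<in> KK\<close>])
    have "(\<Sum>\<delta>\<in>Disc. chi (cl k) \<delta> * W \<delta>) = (\<Sum>x'\<in>{0, 1}. \<Sum>y'\<in>{0, 1}. \<Sum>z'\<in>{0, 1}. \<Sum>u'\<in>{0, 1, 2}. \<Sum>v'\<in>{0, 1, 2}.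
       (sgnp (x * x') * A x' (- 1 / \<tau>)) * (sgnp (y * y') * B y' (- 1 / \<tau>)) * (sgnp (z * z') * C z' (- 1 / \<tau>))
        * (om (u * u') * sg u') * (om (v * v') * dual3 X v' (- 1 / \<tau>)))"
      unfolding sum_Disc
    proof (intro sum.cong refl)
      fix x' y' z' u' v' :: int
      assume "x' \<in> {0, 1}" "y' \<in> {0, 1}" "z' \<in> {0, 1}" "u' \<in> {0, 1, 2}" "v' \<in> {0, 1, 2}"
      then have "(x', y', z', u', v') \<in> KK" by (simp only: KK_def mem_Times_iff fst_conv snd_conv simp_thms)
      from ix_cl_KK[OF this] show "chi (cl k) (cl (x', y', z', u', v')) * W (cl (x', y', z', u', v'))
       = (sgnp (x * x') * A x' (- 1 / \<tau>)) * (sgnp (y * y') * B y' (- 1 / \<tau>)) * (sgnp (z * z') * C z' (- 1 / \<tau>))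
        * (om (u * u') * sg u') * (om (v * v') * dual3 X v' (- 1 / \<tau>))"
        unfolding k(1) chi_cl W_def weight_vec_def by (simp only: prod.case mult_ac)
    qed
    also have "\<dots> = (\<epsilon>1 * s ^ p1 * of_real (sqrt 2) * A x \<tau>) * (\<epsilon>2 * s ^ p2 * of_real (sqrt 2) * B y \<tau>) * (\<epsilon>3 * s ^ p3 * of_real (sqrt 2) * C z \<tau>)
       * (\<i> * of_real (sqrt 3) * sg u) * (- (\<epsilon>4 * s ^ p4 * of_real (sqrt 3) * dual3 X v \<tau>))"
      unfolding sum5_prod two[OF A k(2)] two[OF B k(3)] two[OF C k(4)] sgs[OF k(5)] three[OF k(6)] ..
    finally have eq: "(\<Sum>\<delta>\<in>Disc. chi (cl k) \<delta> * W \<delta>)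
      = (\<epsilon>1 * s ^ p1 * of_real (sqrt 2) * A x \<tau>) * (\<epsilon>2 * s ^ p2 * of_real (sqrt 2) * B y \<tau>) * (\<epsilon>3 * s ^ p3 * of_real (sqrt 2) * C z \<tau>)
       * (\<i> * of_real (sqrt 3) * sg u) * (- (\<epsilon>4 * s ^ p4 * of_real (sqrt 3) * dual3 X v \<tau>))" .
    have "K * (\<Sum>\<delta>\<in>Disc. chi (cl k) \<delta> * W \<delta>)
      = (- (\<i> * \<i>) * (of_real (sqrt 2) * of_real (sqrt 2) * of_real (sqrt 2) * (of_real (sqrt 3) * of_real (sqrt 3))) / of_real (sqrt 72)) * (E * s ^ 3 * weight_vec A B C X k \<tau>)"
      unfolding eq unfolding K_def E_def k(1) weight_vec_def prod.case power_add divide_inverse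
      by (simp only: mult_minus_left mult_minus_right minus_minus mult_ac)
    also have "- (\<i> * \<i>) * (of_real (sqrt 2) * of_real (sqrt 2) * of_real (sqrt 2) * (of_real (sqrt 3) * of_real (sqrt 3))) / of_real (sqrt 72) = (1 :: complex)"
    proof -
      have "sqrt 2 * sqrt 2 * sqrt 2 * (sqrt 3 * sqrt 3) = sqrt 72"
        using real_sqrt_mult[of 36 2] by simp
      then have "(of_real (sqrt 2) * of_real (sqrt 2) * of_real (sqrt 2) * (of_real (sqrt 3) * of_real (sqrt 3)) :: complex) = of_real (sqrt 72)"
        by (metis of_real_mult)
      then show ?thesis by simp
    qed
    finally show ?thesis by simp
  qed
  have "pairing F A B C X (- 1 / \<tau>) = (\<Sum>\<delta>\<in>Disc. \<Sum>\<gamma>\<in>Disc. K * (chi \<gamma> \<delta> * F \<tau> \<gamma>) * W \<delta>)"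
    unfolding pairing_def
  proof (intro sum.cong refl)
    fix \<delta> assume \<delta>: "\<delta> \<in> Disc"
    have "F (- 1 / \<tau>) \<delta> = K * (\<Sum>\<gamma>\<in>Disc. chi \<gamma> \<delta> * F \<tau> \<gamma>)"
      unfolding K_def s_def by (rule S32_S[OF F \<tau> \<delta>])
    then show "F (- 1 / \<tau>) \<delta> * weight_vec A B C X (ix \<delta>) (- 1 / \<tau>) = (\<Sum>\<gamma>\<in>Disc. K * (chi \<gamma> \<delta> * F \<tau> \<gamma>) * W \<delta>)"
      unfolding W_def by (simp only: sum_distrib_left sum_distrib_right)
  qed
  also have "\<dots> = (\<Sum>\<gamma>\<in>Disc. \<Sum>\<delta>\<in>Disc. K * (chi \<gamma> \<delta> * F \<tau> \<gamma>) * W \<delta>)" by (rule sum.swap)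
  also have "\<dots> = (\<Sum>\<gamma>\<in>Disc. F \<tau> \<gamma> * (K * (\<Sum>\<delta>\<in>Disc. chi \<gamma> \<delta> * W \<delta>)))"
    unfolding sum_distrib_left by (intro sum.cong refl) (simp only: mult_ac)
  also have "\<dots> = (\<Sum>\<gamma>\<in>Disc. E * s ^ 3 * (F \<tau> \<gamma> * weight_vec A B C X (ix \<gamma>) \<tau>))"
  proof (intro sum.cong refl)
    fix \<gamma> assume \<gamma>: "\<gamma> \<in> Disc"
    have "K * (\<Sum>\<delta>\<in>Disc. chi \<gamma> \<delta> * W \<delta>) = E * s ^ 3 * weight_vec A B C X (ix \<gamma>) \<tau>"
      using inner[OF ix_in_KK[OF \<gamma>]] unfolding cl_ix[OF \<gamma>] .
    then show "F \<tau> \<gamma> * (K * (\<Sum>\<delta>\<in>Disc. chi \<gamma> \<delta> * W \<delta>)) = E * s ^ 3 * (F \<tau> \<gamma> * weight_vec A B C X (ix \<gamma>) \<tau>)"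
      by (simp only: mult_ac)
  qed
  also have "\<dots> = (\<epsilon>1 * \<epsilon>2 * \<epsilon>3 * \<epsilon>4) * s ^ (3 + p1 + p2 + p3 + p4) * pairing F A B C X \<tau>"
    unfolding pairing_def sum_distrib_left[symmetric] E_def by (simp add: power_add)
  finally show ?thesis unfolding s_def .
qed

text \<open>Classes with u = 0 drop out through \<open>sg\<close>. For the others the exponents add
  up to 2/3 modulo 1: one third from u, one third from the determinant in
  \<open>dual3\<close>.\<close>

lemma pairing_T:
  assumes F: "F \<in> S32" and A: "two_form A p1 \<epsilon>1 a1" and B: "two_form B p2 \<epsilon>2 a2" and C: "two_form C p3 \<epsilon>3 a3"
    and X: "three_form X p4 \<epsilon>4 t" and \<tau>: "\<tau> \<in> upper_half"
  shows "pairing F A B C X (\<tau> + 1) = e2pi (2 / 3) * pairing F A B C X \<tau>"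
proof -
  have two: "A x (\<tau> + 1) = e2pi (of_int x / 4) * A x \<tau>" if "two_form A p \<epsilon> a" "x \<in> {0, 1}" for A p \<epsilon> a x
    using that \<tau> unfolding two_form_def by auto
  have three: "dual3 X v (\<tau> + 1) = e2pi (of_int (if v = 0 then 1 else 0) / 3) * dual3 X v \<tau>" for v
    using X \<tau> unfolding three_form_def dual3_def by auto
  have "F (\<tau> + 1) (cl k) * weight_vec A B C X k (\<tau> + 1) = e2pi (2 / 3) * (F \<tau> (cl k) * weight_vec A B C X k \<tau>)" if "k \<in> KK" for k
  proof -
    obtain x y z u v where k: "k = (x, y, z, u, v)" "x \<in> {0, 1}" "y \<in> {0, 1}" "z \<in> {0, 1}" "u \<in> {0, 1, 2}" "v \<in> {0, 1, 2}"
      by (rule KK_cases[OF \<open>k \<in> KK\<close>])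
    define d :: int where "d = (if v = 0 then 1 else 0)"
    have "weight_vec A B C X k (\<tau> + 1) = e2pi (of_int x / 4 + of_int y / 4 + of_int z / 4 + of_int d / 3) * weight_vec A B C X k \<tau>"
      unfolding k(1) weight_vec_def prod.case two[OF A k(2)] two[OF B k(3)] two[OF C k(4)] three d_def[symmetric] e2pi_add by (simp only: mult_ac)
    moreover have "F (\<tau> + 1) (cl k) = e2pi (of_real (qk k)) * F \<tau> (cl k)"
      using S32_T[OF F \<tau> cl_in_Disc[of k]] unfolding disc_q_cl e2pi_of_real_frac .
    ultimately have "F (\<tau> + 1) (cl k) * weight_vec A B C X k (\<tau> + 1)
      = e2pi (of_real (qk k) + (of_int x / 4 + of_int y / 4 + of_int z / 4 + of_int d / 3)) * (F \<tau> (cl k) * weight_vec A B C X k \<tau>)"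
      unfolding e2pi_add[of "of_real (qk k)"] by (simp only: mult_ac)
    moreover have "e2pi (of_real (qk k) + (of_int x / 4 + of_int y / 4 + of_int z / 4 + of_int d / 3)) = e2pi (2 / 3)" if "u \<noteq> 0"
    proof -
      have sq: "x\<^sup>2 = x" "y\<^sup>2 = y" "z\<^sup>2 = z" using k by auto
      have "u\<^sup>2 + v\<^sup>2 + d - 2 \<in> {0, 3, 6}" using k that by (auto simp: d_def)
      then obtain m where m: "u\<^sup>2 + v\<^sup>2 + d - 2 = 3 * m" by (auto intro: that[of 0] that[of 1] that[of 2])
      have "of_real (qk k) + (of_int x / 4 + of_int y / 4 + of_int z / 4 + of_int d / 3) = of_int (u\<^sup>2 + v\<^sup>2 + d - 2) / 3 + (2 / 3 :: complex)"
        unfolding k(1) qk_def prod.case sq by (simp add: field_simps)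
      also have "\<dots> = of_int m + 2 / 3" unfolding m by simp
      finally show ?thesis by (simp only: e2pi_add e2pi_of_int mult_1_left)
    qed
    moreover have "weight_vec A B C X k \<tau> = 0" if "u = 0" using that by (simp add: k(1) weight_vec_def)
    ultimately show ?thesis by (cases "u = 0") auto
  qed
  then show ?thesis
    unfolding pairing_def disc_sum_KK sum_distrib_left by (intro sum.cong refl) (simp add: ix_cl_KK)
qed

text \<open>The contribution of one class at q^(2/3). In the excluded cases the exponent left for
  the cusp form would be negative, so its first coefficient enters only at q^(5/3).\<close>

definition lead_coeff_at :: "form \<Rightarrow> complex \<Rightarrow> complex \<Rightarrow> complex \<Rightarrow> complex \<Rightarrow> idx \<Rightarrow> complex" where
  "lead_coeff_at F a1 a2 a3 t = (\<lambda>(x, y, z, u, v).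
     if (v = 0 \<and> x + y + z \<ge> 2) \<or> x + y + z = 3 then 0
     else fourier_coeff F (cl (x, y, z, u, v)) ((if v = 0 then 1 / 3 else 2 / 3) - of_int (x + y + z) / 4) *
       ((if x = 0 then 1 else a1) * (if y = 0 then 1 else a2) * (if z = 0 then 1 else a3) * sg u * (if v = 0 then t else - 1 / 2)))"

lemma pairing_lead:
  assumes F: "F \<in> S32" and A: "two_form A p1 \<epsilon>1 a1" and B: "two_form B p2 \<epsilon>2 a2" and C: "two_form C p3 \<epsilon>3 a3"
    and X: "three_form X p4 \<epsilon>4 t"
  shows "lead (pairing F A B C X) (2 / 3) (\<Sum>k\<in>KK. lead_coeff_at F a1 a2 a3 t k)"
proof -
  have two: "lead (A x) (of_int x / 4) (if x = 0 then 1 else a)" if "two_form A p \<epsilon> a" "x \<in> {0, 1}" for A p \<epsilon> a x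
    using that unfolding two_form_def by auto
  have three: "lead (dual3 X v) (if v = 0 then 1 / 3 else 0) (if v = 0 then t else - 1 / 2)" for v
  proof (cases "v = 0")
    case True then show ?thesis using X by (simp add: three_form_def dual3_def[abs_def])
  next
    case False
    have "lead (\<lambda>\<tau>. (- 1 / 2) * X 0 \<tau>) 0 ((- 1 / 2) * 1)" using X by (intro lead_cmult) (simp add: three_form_def)
    then show ?thesis using False by (simp add: dual3_def[abs_def])
  qed
  have trm: "lead (\<lambda>\<tau>. F \<tau> (cl k) * weight_vec A B C X k \<tau>) (2 / 3) (lead_coeff_at F a1 a2 a3 t k)" if "k \<in> KK" for k
  proof -
    obtain x y z u v where k: "k = (x, y, z, u, v)" "x \<in> {0, 1}" "y \<in> {0, 1}" "z \<in> {0, 1}" "u \<in> {0, 1, 2}" "v \<in> {0, 1, 2}"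
      by (rule KK_cases[OF \<open>k \<in> KK\<close>])
    show ?thesis
    proof (cases "u = 0")
      case True
      then show ?thesis by (simp add: k(1) weight_vec_def lead_coeff_at_def lead_zero)
    next
      case False
      define w where "w = x + y + z"
      \<comment> \<open>Adding 1 when the complementary exponent is negative moves e into (0, 1], as
        \<open>S32_lead\<close> requires.\<close>
      define b :: real where "b = (if v = 0 \<and> w \<ge> 2 \<or> w = 3 then 1 else 0)"
      define e where "e = (if v = 0 then 1 / 3 else 2 / 3) - of_int w / 4 + b"
      define P where "P = (if x = 0 then 1 else a1) * (if y = 0 then 1 else a2) * (if z = 0 then 1 else a3) * sg u * (if v = 0 then t else - 1 / 2)"
      have w: "0 \<le> w" "w \<le> 3" using k by (auto simp: w_def)
      have "w = 0 \<or> w = 1 \<or> w = 2 \<or> w = 3" using w by auto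
      then have e1: "0 < e" "e \<le> 1" by (auto simp: e_def b_def)
      have "e - disc_q (cl k) \<in> \<int>"
      proof -
        have sq: "x\<^sup>2 = x" "y\<^sup>2 = y" "z\<^sup>2 = z" using k by auto
        define d :: int where "d = (if v = 0 then 1 else 2)"
        have "u\<^sup>2 + v\<^sup>2 - d \<in> {0, 3, 6}" using k False by (auto simp: d_def)
        then obtain m where m: "u\<^sup>2 + v\<^sup>2 - d = 3 * m" by (auto intro: that[of 0] that[of 1] that[of 2])
        have "qk k = - of_int w / 4 + of_int (u\<^sup>2 + v\<^sup>2 - d) / 3 + of_int d / 3"
          unfolding k(1) qk_def prod.case sq w_def by (simp add: field_simps)
        then have q: "qk k = - of_int w / 4 + of_int m + of_int d / 3" unfolding m by simp
        have "e - frac (qk k) = of_int (\<lfloor>qk k\<rfloor> - m + (if v = 0 \<and> w \<ge> 2 \<or> w = 3 then 1 else 0))"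
          unfolding frac_def by (simp add: e_def q b_def d_def)
        then show ?thesis unfolding disc_q_cl by (simp only: Ints_of_int)
      qed
      from S32_lead[OF F cl_in_Disc this e1]
      have Fl: "lead (\<lambda>\<tau>. F \<tau> (cl k)) e (fourier_coeff F (cl k) e)" .
      have "lead (\<lambda>\<tau>. F \<tau> (cl k) * (A x \<tau> * B y \<tau> * C z \<tau> * sg u * dual3 X v \<tau>))
        (e + (of_int x / 4 + of_int y / 4 + of_int z / 4 + 0 + (if v = 0 then 1 / 3 else 0))) (fourier_coeff F (cl k) e * P)"
        unfolding P_def by (intro lead_mult Fl two[OF A k(2)] two[OF B k(3)] two[OF C k(4)] three lead_const)
      moreover have "e + (of_int x / 4 + of_int y / 4 + of_int z / 4 + 0 + (if v = 0 then 1 / 3 else 0)) = 2 / 3 + b"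
        by (simp add: e_def w_def field_simps)
      ultimately have L: "lead (\<lambda>\<tau>. F \<tau> (cl k) * weight_vec A B C X k \<tau>) (2 / 3 + b) (fourier_coeff F (cl k) e * P)"
        by (simp add: k(1) weight_vec_def)
      show ?thesis
      proof (cases "v = 0 \<and> w \<ge> 2 \<or> w = 3")
        case True
        then have "lead_coeff_at F a1 a2 a3 t k = 0" by (auto simp: k(1) lead_coeff_at_def w_def)
        moreover have "b = 1" using True by (simp add: b_def)
        ultimately show ?thesis using lead_weaken[OF L, of "2 / 3"] by simp
      next
        case False
        then have "b = 0" by (simp add: b_def)
        moreover have "lead_coeff_at F a1 a2 a3 t k = fourier_coeff F (cl k) e * P"
          using False \<open>b = 0\<close> unfolding k(1) lead_coeff_at_def P_def e_def w_def by auto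
        ultimately show ?thesis using L by simp
      qed
    qed
  qed
  have "pairing F A B C X = (\<lambda>\<tau>. \<Sum>k\<in>KK. F \<tau> (cl k) * weight_vec A B C X k \<tau>)"
    unfolding pairing_def disc_sum_KK by (intro ext sum.cong refl) (simp add: ix_cl_KK)
  moreover have "finite KK" by (simp add: KK_def)
  ultimately show ?thesis using lead_sum[OF _ trm] by simp
qed

text \<open>The pairing has weight at most 6, hence k/12 <= 1/2, but vanishes at the cusp to order
  2/3; so it is identically zero and its leading coefficient is 0.\<close>

lemma pairing_low_weight:
  assumes F: "F \<in> S32" and A: "two_form A p1 \<epsilon>1 a1" and B: "two_form B p2 \<epsilon>2 a2" and C: "two_form C p3 \<epsilon>3 a3"
    and X: "three_form X p4 \<epsilon>4 t"
    and w: "3 + p1 + p2 + p3 + p4 \<le> 12" and \<epsilon>: "norm (\<epsilon>1 * \<epsilon>2 * \<epsilon>3 * \<epsilon>4) = 1"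
  shows "(\<Sum>k\<in>KK. lead_coeff_at F a1 a2 a3 t k) = 0"
proof -
  define n where "n = 3 + p1 + p2 + p3 + p4"
  define k where "k = real n / 2"
  let ?P = "pairing F A B C X"
  have L: "lead ?P (2 / 3) (\<Sum>k\<in>KK. lead_coeff_at F a1 a2 a3 t k)" by (rule pairing_lead[OF F A B C X])
  have "?P \<tau> = 0" if "\<tau> \<in> upper_half" for \<tau>
  proof (rule modular_vanishing[where F = "\<lambda>_::unit. ?P" and I = UNIV and k = k and ?e0.0 = "2 / 3"])
    fix \<tau> assume \<tau>: "\<tau> \<in> upper_half"
    show "Im (\<tau> + 1) powr k * (\<Sum>i\<in>(UNIV::unit set). (norm (?P (\<tau> + 1)))\<^sup>2) = Im \<tau> powr k * (\<Sum>i\<in>(UNIV::unit set). (norm (?P \<tau>))\<^sup>2)"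
      unfolding pairing_T[OF F A B C X \<tau>] using norm_e2pi_real[of "2 / 3"] by (simp add: norm_mult)
    have c0: "cmod \<tau> > 0" using \<tau> by (auto simp: upper_half_def)
    have "norm (?P (- 1 / \<tau>)) = sqrt (cmod \<tau>) ^ n * norm (?P \<tau>)"
      unfolding pairing_S[OF F A B C X \<tau>] norm_mult[of _ "?P \<tau>"] n_def[symmetric] norm_mult[of _ "csqrt _ ^ n"] \<epsilon>
      by (simp add: norm_power norm_mult)
    moreover have "(sqrt (cmod \<tau>) ^ n)\<^sup>2 = cmod \<tau> powr (2 * k)"
    proof -
      have "(sqrt (cmod \<tau>) ^ n)\<^sup>2 = ((sqrt (cmod \<tau>))\<^sup>2) ^ n" by (simp only: power_mult[symmetric] mult.commute)
      then show ?thesis using c0 by (simp add: k_def powr_realpow)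
    qed
    ultimately show "Im (- 1 / \<tau>) powr k * (\<Sum>i\<in>(UNIV::unit set). (norm (?P (- 1 / \<tau>)))\<^sup>2) = Im \<tau> powr k * (\<Sum>i\<in>(UNIV::unit set). (norm (?P \<tau>))\<^sup>2)"
      unfolding Im_powr_S[OF \<tau>] using c0 by (simp add: power_mult_distrib)
  next
    have "k \<le> 6" using w by (simp add: k_def n_def)
    then have "k / 2 * ln (10 / 9) \<le> 3 * (1066 / 10000)" using ln_10_9 by (intro mult_mono) auto
    then show "k / 2 * ln (10 / 9) < 2 * pi * (2 / 3) * (8 / 100)" using pi_gt3 by simp
    show "k > 0" by (simp add: k_def n_def)
  qed (use L that in \<open>auto simp: lead_def\<close>)
  from lead_unique[OF L lead_zero this] show ?thesis .
qed

text \<open>\<open>eta\<close>^16 has weight 8 and the same character and leading exponent as the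
  pairing, so the quotient is a form of weight 2 with the same leading coefficient. The sign -1
  cancels the one in csqrt(-i tau)^4 = -tau^2.\<close>

lemma pairing_weight_10:
  assumes F: "F \<in> S32" and A: "two_form A p1 \<epsilon>1 a1" and B: "two_form B p2 \<epsilon>2 a2" and C: "two_form C p3 \<epsilon>3 a3"
    and X: "three_form X p4 \<epsilon>4 t"
    and w: "3 + p1 + p2 + p3 + p4 = 20" and \<epsilon>: "\<epsilon>1 * \<epsilon>2 * \<epsilon>3 * \<epsilon>4 = - 1"
  shows "(\<Sum>k\<in>KK. lead_coeff_at F a1 a2 a3 t k) = 0"
proof -
  let ?P = "pairing F A B C X"
  define L where "L = (\<Sum>k\<in>KK. lead_coeff_at F a1 a2 a3 t k)"
  have P: "lead ?P (2 / 3) L" unfolding L_def by (rule pairing_lead[OF F A B C X])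
  have E: "lead (\<lambda>\<tau>. eta \<tau> ^ 16) (2 / 3) 1" using lead_power[OF eta_lead, of 16] by simp
  have "L = 0"
  proof (rule weight_2_constant_term[of "\<lambda>\<tau>. ?P \<tau> / eta \<tau> ^ 16"])
    show "(\<lambda>\<tau>. ?P \<tau> / eta \<tau> ^ 16) holomorphic_on upper_half"
      using P E eta_nonzero by (intro holomorphic_on_divide) (auto simp: lead_def)
    fix \<tau> assume \<tau>: "\<tau> \<in> upper_half"
    have "e2pi (1 / 24) ^ 16 = e2pi (2 / 3)" unfolding e2pi_power by simp
    then show "?P (\<tau> + 1) / eta (\<tau> + 1) ^ 16 = ?P \<tau> / eta \<tau> ^ 16"
      unfolding pairing_T[OF F A B C X \<tau>] eta_T by (simp add: power_mult_distrib)
    define s where "s = csqrt (- \<i> * \<tau>)"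
    have s0: "s \<noteq> 0" using \<tau> by (auto simp: s_def upper_half_def)
    have s2: "s\<^sup>2 = - \<i> * \<tau>" by (simp add: s_def)
    have "s ^ 4 = (s\<^sup>2)\<^sup>2" by (simp flip: power_mult)
    then have s4: "s ^ 4 = - (\<tau>\<^sup>2)" unfolding s2 by (simp add: power_mult_distrib)
    have "s ^ 20 = s ^ 16 * s ^ 4" by (simp flip: power_add)
    then have "?P (- 1 / \<tau>) / eta (- 1 / \<tau>) ^ 16 = - 1 * (s ^ 16 * s ^ 4) * ?P \<tau> / (s ^ 16 * eta \<tau> ^ 16)"
      unfolding pairing_S[OF F A B C X \<tau>] eta_S[OF \<tau>] w \<epsilon> s_def[symmetric] by (simp add: power_mult_distrib)
    also have "\<dots> = \<tau>\<^sup>2 * (?P \<tau> / eta \<tau> ^ 16)" unfolding s4 using s0 by simp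
    finally show "?P (- 1 / \<tau>) / eta (- 1 / \<tau>) ^ 16 = \<tau>\<^sup>2 * (?P \<tau> / eta \<tau> ^ 16)" .
  next
    have "((\<lambda>\<tau>. (?P \<tau> * e2pi (- of_real (2 / 3) * \<tau>)) / (eta \<tau> ^ 16 * e2pi (- of_real (2 / 3) * \<tau>))) \<longlongrightarrow> L / 1) i_inf"
      using P E unfolding lead_def by (intro tendsto_divide) auto
    then show "((\<lambda>\<tau>. ?P \<tau> / eta \<tau> ^ 16) \<longlongrightarrow> L) i_inf" by simp
  qed
  then show ?thesis by (simp add: L_def)
qed

lemma sum_KK: "(\<Sum>k\<in>KK. f k) = (\<Sum>x\<in>{0, 1}. \<Sum>y\<in>{0, 1}. \<Sum>z\<in>{0, 1}. \<Sum>u\<in>{0, 1, 2}. \<Sum>v\<in>{0, 1, 2}. f (x, y, z, u, v))"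
  by (simp only: KK_def sum.cartesian_product split_def prod.collapse)

text \<open>Every pairing gives an equation in the same Fourier coefficients, with weights 2 or -10
  for each 2-part and 3 or -9 for the 3-part. The nine choices used have weight 4 or 6, or have
  weight 10 and total sign -1.\<close>

theorem S32_coeff_relation:
  assumes F: "F \<in> S32"
  defines "c \<equiv> \<lambda>k. fourier_coeff F (cl k) (1 / 12)"
  shows "(c (1, 0, 0, 1, 0) - c (1, 0, 0, 2, 0)) + (c (0, 1, 0, 1, 0) - c (0, 1, 0, 2, 0)) + (c (0, 0, 1, 1, 0) - c (0, 0, 1, 2, 0)) = 0"
proof -
  define S where "S = (\<lambda>x y z. fourier_coeff F (cl (x, y, z, 1, 0)) (1 / 3 - of_int (x + y + z) / 4) - fourier_coeff F (cl (x, y, z, 2, 0)) (1 / 3 - of_int (x + y + z) / 4))"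
  define T where "T = (\<lambda>x y z. (fourier_coeff F (cl (x, y, z, 1, 1)) (2 / 3 - of_int (x + y + z) / 4) - fourier_coeff F (cl (x, y, z, 2, 1)) (2 / 3 - of_int (x + y + z) / 4)
     + fourier_coeff F (cl (x, y, z, 1, 2)) (2 / 3 - of_int (x + y + z) / 4) - fourier_coeff F (cl (x, y, z, 2, 2)) (2 / 3 - of_int (x + y + z) / 4)) / 2)"
  have sum: "(\<Sum>k\<in>KK. lead_coeff_at F a1 a2 a3 t k) = t * (S 0 0 0 + a1 * S 1 0 0 + a2 * S 0 1 0 + a3 * S 0 0 1)
     - (T 0 0 0 + a1 * T 1 0 0 + a2 * T 0 1 0 + a3 * T 0 0 1 + a1 * a2 * T 1 1 0 + a1 * a3 * T 1 0 1 + a2 * a3 * T 0 1 1)" for a1 a2 a3 t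
    unfolding sum_KK lead_coeff_at_def S_def T_def
    by (simp add: field_simps)
  note lw = pairing_low_weight[OF F] and hw = pairing_weight_10[OF F]
  note f = theta2_form theta2'_form theta3_form theta3'_form
  have 1: "3 * (S 0 0 0 + 2 * S 1 0 0 + 2 * S 0 1 0 + 2 * S 0 0 1)
     - (T 0 0 0 + 2 * T 1 0 0 + 2 * T 0 1 0 + 2 * T 0 0 1 + 4 * T 1 1 0 + 4 * T 1 0 1 + 4 * T 0 1 1) = 0"
    using lw[OF f(1) f(1) f(1) f(3)] unfolding sum by simp
  have 2: "3 * (S 0 0 0 + 2 * S 1 0 0 + 2 * S 0 1 0 + (- 10) * S 0 0 1)
     - (T 0 0 0 + 2 * T 1 0 0 + 2 * T 0 1 0 + (- 10) * T 0 0 1 + 4 * T 1 1 0 + (- 20) * T 1 0 1 + (- 20) * T 0 1 1) = 0"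
    using lw[OF f(1) f(1) f(2) f(3)] unfolding sum by simp
  have 3: "3 * (S 0 0 0 + 2 * S 1 0 0 + (- 10) * S 0 1 0 + 2 * S 0 0 1)
     - (T 0 0 0 + 2 * T 1 0 0 + (- 10) * T 0 1 0 + 2 * T 0 0 1 + (- 20) * T 1 1 0 + 4 * T 1 0 1 + (- 20) * T 0 1 1) = 0"
    using lw[OF f(1) f(2) f(1) f(3)] unfolding sum by simp
  have 4: "3 * (S 0 0 0 + (- 10) * S 1 0 0 + 2 * S 0 1 0 + 2 * S 0 0 1)
     - (T 0 0 0 + (- 10) * T 1 0 0 + 2 * T 0 1 0 + 2 * T 0 0 1 + (- 20) * T 1 1 0 + (- 20) * T 1 0 1 + 4 * T 0 1 1) = 0"
    using lw[OF f(2) f(1) f(1) f(3)] unfolding sum by simp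
  have 5: "(- 9) * (S 0 0 0 + 2 * S 1 0 0 + 2 * S 0 1 0 + 2 * S 0 0 1)
     - (T 0 0 0 + 2 * T 1 0 0 + 2 * T 0 1 0 + 2 * T 0 0 1 + 4 * T 1 1 0 + 4 * T 1 0 1 + 4 * T 0 1 1) = 0"
    using lw[OF f(1) f(1) f(1) f(4)] unfolding sum by simp
  have 6: "3 * (S 0 0 0 + (- 10) * S 1 0 0 + (- 10) * S 0 1 0 + (- 10) * S 0 0 1)
     - (T 0 0 0 + (- 10) * T 1 0 0 + (- 10) * T 0 1 0 + (- 10) * T 0 0 1 + 100 * T 1 1 0 + 100 * T 1 0 1 + 100 * T 0 1 1) = 0"
    using hw[OF f(2) f(2) f(2) f(3)] unfolding sum by simp
  have 7: "(- 9) * (S 0 0 0 + 2 * S 1 0 0 + (- 10) * S 0 1 0 + (- 10) * S 0 0 1)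
     - (T 0 0 0 + 2 * T 1 0 0 + (- 10) * T 0 1 0 + (- 10) * T 0 0 1 + (- 20) * T 1 1 0 + (- 20) * T 1 0 1 + 100 * T 0 1 1) = 0"
    using hw[OF f(1) f(2) f(2) f(4)] unfolding sum by simp
  have 8: "(- 9) * (S 0 0 0 + (- 10) * S 1 0 0 + 2 * S 0 1 0 + (- 10) * S 0 0 1)
     - (T 0 0 0 + (- 10) * T 1 0 0 + 2 * T 0 1 0 + (- 10) * T 0 0 1 + (- 20) * T 1 1 0 + 100 * T 1 0 1 + (- 20) * T 0 1 1) = 0"
    using hw[OF f(2) f(1) f(2) f(4)] unfolding sum by simp
  have 9: "(- 9) * (S 0 0 0 + (- 10) * S 1 0 0 + (- 10) * S 0 1 0 + 2 * S 0 0 1)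
     - (T 0 0 0 + (- 10) * T 1 0 0 + (- 10) * T 0 1 0 + 2 * T 0 0 1 + 100 * T 1 1 0 + (- 20) * T 1 0 1 + (- 20) * T 0 1 1) = 0"
    using hw[OF f(2) f(2) f(1) f(4)] unfolding sum by simp
  have "S 1 0 0 + S 0 1 0 + S 0 0 1 = 0"
  proof -
    \<comment> \<open>Adding the equations over the positions of the exceptional 2-part leaves five
      equations in the five unknowns S 0 0 0, T 0 0 0, \<open>\<alpha>\<close>,
      \<open>\<beta>1\<close> and \<open>\<beta>2\<close>. The system is nonsingular.\<close>
    define \<alpha> where "\<alpha> = S 1 0 0 + S 0 1 0 + S 0 0 1"
    define \<beta>1 where "\<beta>1 = T 1 0 0 + T 0 1 0 + T 0 0 1"
    define \<beta>2 where "\<beta>2 = T 1 1 0 + T 1 0 1 + T 0 1 1"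
    have r1: "3 * S 0 0 0 + 6 * \<alpha> - T 0 0 0 - 2 * \<beta>1 - 4 * \<beta>2 = 0" using 1 unfolding \<alpha>_def \<beta>1_def \<beta>2_def by algebra
    have r2: "9 * S 0 0 0 - 18 * \<alpha> - 3 * T 0 0 0 + 6 * \<beta>1 + 36 * \<beta>2 = 0" using 2 3 4 unfolding \<alpha>_def \<beta>1_def \<beta>2_def by algebra
    have r3: "- 9 * S 0 0 0 - 18 * \<alpha> - T 0 0 0 - 2 * \<beta>1 - 4 * \<beta>2 = 0" using 5 unfolding \<alpha>_def \<beta>1_def \<beta>2_def by algebra
    have r4: "3 * S 0 0 0 - 30 * \<alpha> - T 0 0 0 + 10 * \<beta>1 - 100 * \<beta>2 = 0" using 6 unfolding \<alpha>_def \<beta>1_def \<beta>2_def by algebra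
    have r5: "- 27 * S 0 0 0 + 162 * \<alpha> - 3 * T 0 0 0 + 18 * \<beta>1 - 60 * \<beta>2 = 0" using 7 8 9 unfolding \<alpha>_def \<beta>1_def \<beta>2_def by algebra
    have "\<alpha> = 0" using r1 r2 r3 r4 r5 by algebra
    then show ?thesis by (simp add: \<alpha>_def)
  qed
  then show ?thesis by (simp add: S_def c_def)
qed

section \<open>The action of the orthogonal group of the discriminant form\<close>

lemma O_discD:
  assumes "\<sigma> \<in> O_disc"
  shows "bij_betw \<sigma> Disc Disc" "\<sigma> \<in> extensional Disc"
    "\<gamma> \<in> Disc \<Longrightarrow> \<sigma> \<gamma> \<in> Disc" "\<gamma> \<in> Disc \<Longrightarrow> disc_q (\<sigma> \<gamma>) = disc_q \<gamma>"
    "\<gamma> \<in> Disc \<Longrightarrow> \<delta> \<in> Disc \<Longrightarrow> \<sigma> (\<gamma> \<otimes>\<^bsub>disc_group\<^esub> \<delta>) = \<sigma> \<gamma> \<otimes>\<^bsub>disc_group\<^esub> \<sigma> \<delta>"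
  using assms by (auto simp: O_disc_def auto_def Bij_def hom_def bij_betw_def)

lemma inv_Disc:
  assumes "\<sigma> \<in> O_disc" "\<gamma> \<in> Disc"
  shows "inv_into Disc \<sigma> \<gamma> \<in> Disc" "\<sigma> (inv_into Disc \<sigma> \<gamma>) = \<gamma>" "inv_into Disc \<sigma> (\<sigma> \<gamma>) = \<gamma>"
    "disc_q (inv_into Disc \<sigma> \<gamma>) = disc_q \<gamma>"
proof -
  have b: "bij_betw \<sigma> Disc Disc" by (rule O_discD(1)[OF assms(1)])
  show 1: "inv_into Disc \<sigma> \<gamma> \<in> Disc" using b assms(2) by (auto simp: bij_betw_def intro: inv_into_into)
  show 2: "\<sigma> (inv_into Disc \<sigma> \<gamma>) = \<gamma>" using b assms(2) by (simp add: bij_betw_def f_inv_into_f)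
  show "inv_into Disc \<sigma> (\<sigma> \<gamma>) = \<gamma>" using b assms(2) by (simp add: bij_betw_def inv_into_f_f)
  show "disc_q (inv_into Disc \<sigma> \<gamma>) = disc_q \<gamma>" using O_discD(4)[OF assms(1) 1] by (simp add: 2)
qed

lemma bij_inv_Disc: "\<sigma> \<in> O_disc \<Longrightarrow> bij_betw (inv_into Disc \<sigma>) Disc Disc"
  using O_discD(1) by (rule bij_betw_inv_into)

lemma chi_O_disc:
  assumes "\<sigma> \<in> O_disc" "\<gamma> \<in> Disc" "\<delta> \<in> Disc"
  shows "chi (\<sigma> \<gamma>) (\<sigma> \<delta>) = chi \<gamma> \<delta>"
proof -
  have "\<gamma> \<otimes>\<^bsub>disc_group\<^esub> \<delta> \<in> Disc"
  proof -
    obtain k k' where "\<gamma> = cl k" "\<delta> = cl k'" by (meson Disc_cl assms(2,3))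
    moreover obtain x y z u v where "k = (x, y, z, u, v)" by (cases k)
    moreover obtain x' y' z' u' v' where "k' = (x', y', z', u', v')" by (cases k')
    ultimately show ?thesis by (simp only: cl_mult cl_in_Disc)
  qed
  then show ?thesis
    unfolding chi_def using assms
    by (simp only: disc_b_polar O_discD(3)[OF assms(1)] O_discD(5)[OF assms(1), symmetric] O_discD(4)[OF assms(1)])
qed

definition permute :: "(coset \<Rightarrow> coset) \<Rightarrow> disc_vec \<Rightarrow> disc_vec" where
  "permute \<sigma> v = (\<lambda>\<gamma>. if \<gamma> \<in> Disc then v (inv_into Disc \<sigma> \<gamma>) else 0)"

lemma act_permute: "act \<sigma> F \<tau> = permute \<sigma> (F \<tau>)"
  by (simp add: act_def permute_def)

text \<open>Isometries preserve q, hence commute with T; they preserve the characters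
  \<open>chi\<close>, hence commute with S after reindexing. Products inherit this.\<close>

lemma weil_rep_permute:
  assumes "weil_rep g M" and \<sigma>: "\<sigma> \<in> O_disc"
  shows "M (permute \<sigma> v) = permute \<sigma> (M v)"
  using assms(1)
proof (induction arbitrary: v rule: weil_rep.induct)
  case T
  show ?case by (auto simp: fun_eq_iff weil_T_def permute_def inv_Disc[OF \<sigma>])
next
  case S
  show ?case
  proof
    fix \<delta>
    show "weil_S (permute \<sigma> v) \<delta> = permute \<sigma> (weil_S v) \<delta>"
    proof (cases "\<delta> \<in> Disc")
      case True
      have "(\<Sum>\<gamma>\<in>Disc. chi \<gamma> \<delta> * permute \<sigma> v \<gamma>) = (\<Sum>\<gamma>\<in>Disc. chi (\<sigma> \<gamma>) \<delta> * permute \<sigma> v (\<sigma> \<gamma>))"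
        using sum.reindex_bij_betw[OF O_discD(1)[OF \<sigma>], of "\<lambda>\<gamma>. chi \<gamma> \<delta> * permute \<sigma> v \<gamma>"] by simp
      also have "\<dots> = (\<Sum>\<gamma>\<in>Disc. chi \<gamma> (inv_into Disc \<sigma> \<delta>) * v \<gamma>)"
      proof (intro sum.cong refl)
        fix \<gamma> assume \<gamma>: "\<gamma> \<in> Disc"
        have "chi (\<sigma> \<gamma>) \<delta> = chi \<gamma> (inv_into Disc \<sigma> \<delta>)"
          using chi_O_disc[OF \<sigma> \<gamma> inv_Disc(1)[OF \<sigma> True]] inv_Disc(2)[OF \<sigma> True] by simp
        then show "chi (\<sigma> \<gamma>) \<delta> * permute \<sigma> v (\<sigma> \<gamma>) = chi \<gamma> (inv_into Disc \<sigma> \<delta>) * v \<gamma>"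
          using \<gamma> by (simp add: permute_def inv_Disc[OF \<sigma>] O_discD[OF \<sigma>])
      qed
      finally show ?thesis using True by (simp add: weil_S_eq permute_def inv_Disc[OF \<sigma>])
    next
      case False
      then show ?thesis by (simp add: weil_S_def permute_def)
    qed
  qed
next
  case (mult g M h N)
  then show ?case by simp
qed

lemma act_expansion:
  assumes "fourier_expansion F c" "\<sigma> \<in> O_disc"
  shows "fourier_expansion (act \<sigma> F) (\<lambda>\<gamma> e. if \<gamma> \<in> Disc then c (inv_into Disc \<sigma> \<gamma>) e else 0)"
  unfolding fourier_expansion_def
proof (intro conjI allI ballI impI)
  fix \<gamma> e assume "\<gamma> \<notin> Disc \<or> e - disc_q \<gamma> \<notin> \<int>"
  then show "(if \<gamma> \<in> Disc then c (inv_into Disc \<sigma> \<gamma>) e else 0) = 0"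
    using assms(1) inv_Disc(4)[OF assms(2), of \<gamma>] unfolding fourier_expansion_def by simp
next
  fix \<gamma> \<tau> assume g: "\<gamma> \<in> Disc" and "\<tau> \<in> upper_half"
  then have "((\<lambda>e. c (inv_into Disc \<sigma> \<gamma>) e * e2pi (of_real e * \<tau>)) has_sum F \<tau> (inv_into Disc \<sigma> \<gamma>))
      {e. e - disc_q (inv_into Disc \<sigma> \<gamma>) \<in> \<int>}"
    using assms(1) inv_Disc(1)[OF assms(2) g] unfolding fourier_expansion_def by blast
  then show "((\<lambda>e. (if \<gamma> \<in> Disc then c (inv_into Disc \<sigma> \<gamma>) e else 0) * e2pi (of_real e * \<tau>)) has_sum act \<sigma> F \<tau> \<gamma>)
      {e. e - disc_q \<gamma> \<in> \<int>}"
    unfolding inv_Disc(4)[OF assms(2) g] using g by (simp add: act_def)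
qed

lemma act_S32:
  assumes F: "F \<in> S32" and \<sigma>: "\<sigma> \<in> O_disc"
  shows "act \<sigma> F \<in> S32"
  unfolding S32_def
proof (intro CollectI conjI allI impI ballI)
  fix \<tau> \<gamma> assume "\<tau> \<notin> upper_half \<or> \<gamma> \<notin> Disc"
  then show "act \<sigma> F \<tau> \<gamma> = 0" using S32_zero[OF F] by (auto simp: act_def)
next
  fix \<gamma> assume "\<gamma> \<in> Disc"
  then show "(\<lambda>\<tau>. act \<sigma> F \<tau> \<gamma>) holomorphic_on upper_half"
    using S32_hol[OF F inv_Disc(1)[OF \<sigma>]] by (simp add: act_def)
next
  fix A \<phi> M \<tau> \<gamma> assume M: "weil_rep (A, \<phi>) M" and \<tau>: "\<tau> \<in> upper_half" and \<gamma>: "\<gamma> \<in> Disc"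
  have "\<forall>\<gamma>\<in>Disc. F (moebius A \<tau>) \<gamma> = \<phi> \<tau> ^ 3 * M (F \<tau>) \<gamma>"
    using F M \<tau> unfolding S32_def by blast
  then show "act \<sigma> F (moebius A \<tau>) \<gamma> = \<phi> \<tau> ^ 3 * M (act \<sigma> F \<tau>) \<gamma>"
    unfolding act_permute weil_rep_permute[OF M \<sigma>] using \<gamma> inv_Disc(1)[OF \<sigma> \<gamma>] by (simp add: permute_def)
next
  show "\<exists>c. fourier_expansion (act \<sigma> F) c \<and> (\<forall>\<gamma> e. e \<le> 0 \<longrightarrow> c \<gamma> e = 0)"
    using act_expansion[OF S32_expansion(1)[OF F] \<sigma>] S32_expansion(2)[OF F] by fastforce
qed

lemma act_coeff:
  assumes "F \<in> S32" "\<sigma> \<in> O_disc" "\<gamma> \<in> Disc"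
  shows "fourier_coeff (act \<sigma> F) \<gamma> e = fourier_coeff F (inv_into Disc \<sigma> \<gamma>) e"
  using fourier_coeff_eqI[OF act_expansion[OF S32_expansion(1)[OF assms(1)] assms(2)]] assms(3) by simp

text \<open>Since \<open>S\<^sup>2\<close> maps \<open>e\<^sub>\<gamma>\<close> to a multiple of \<open>e\<^sub>-\<^sub>\<gamma>\<close>, all forms are odd.\<close>

lemma S32_odd:
  assumes F: "F \<in> S32" and \<tau>: "\<tau> \<in> upper_half"
  shows "F \<tau> (cl (- x, - y, - z, - u, - v)) = - F \<tau> (cl (x, y, z, u, v))"
proof -
  define \<gamma> where "\<gamma> = cl (- x, - y, - z, - u, - v)"
  define \<gamma>' where "\<gamma>' = cl (x, y, z, u, v)"
  have g: "\<gamma> \<in> Disc" "\<gamma>' \<in> Disc" by (simp_all add: \<gamma>_def \<gamma>'_def)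
  define s where "s = csqrt (- \<i> * \<tau>)"
  define s' where "s' = csqrt (- \<i> * (- 1 / \<tau>))"
  have \<tau>0: "\<tau> \<noteq> 0" using \<tau> by (auto simp: upper_half_def)
  have ss: "s * s' = 1"
  proof -
    have w: "Re (- \<i> * \<tau>) > 0" using \<tau> by (simp add: upper_half_def)
    then have a: "\<bar>Arg (- \<i> * \<tau>)\<bar> < pi / 2" unfolding Arg_Re_pos by simp
    have "Re (- \<i> * c) = Im c" for c by simp
    from this[of "- 1 / \<tau>"] have "Re (- \<i> * (- 1 / \<tau>)) > 0"
      using neg_inverse_upper_half[OF \<tau>] unfolding upper_half_def mem_Collect_eq by (simp only:)
    then have b: "\<bar>Arg (- \<i> * (- 1 / \<tau>))\<bar> < pi / 2" unfolding Arg_Re_pos by simp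
    have "csqrt ((- \<i> * \<tau>) * (- \<i> * (- 1 / \<tau>))) = s * s'"
      unfolding s_def s'_def using a b by (intro csqrt_mult) (simp only: greaterThanAtMost_iff; linarith)
    moreover have "(- \<i> * \<tau>) * (- \<i> * (- 1 / \<tau>)) = 1" using \<tau>0 by simp
    ultimately show ?thesis by (metis csqrt_1)
  qed
  have r72: "of_real (sqrt 72) * of_real (sqrt 72) = (72 :: complex)" by (simp flip: of_real_mult)
  have cn: "chi \<delta> \<gamma> = cnj (chi \<gamma>' \<delta>)" if "\<delta> \<in> Disc" for \<delta>
  proof -
    obtain k where "\<delta> = cl k" by (rule Disc_cl[OF \<open>\<delta> \<in> Disc\<close>])
    moreover obtain a b c d e where "k = (a, b, c, d, e)" by (cases k)
    ultimately show ?thesis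
      by (simp add: \<gamma>_def \<gamma>'_def chi_cl cnj_om mult.commute sgnp_def)
  qed
  have "- 1 / (- 1 / \<tau>) = \<tau>" by simp
  then have "F \<tau> \<gamma> = \<i> * s' ^ 3 / of_real (sqrt 72) * (\<Sum>\<delta>\<in>Disc. chi \<delta> \<gamma> * F (- 1 / \<tau>) \<delta>)"
    using S32_S[OF F neg_inverse_upper_half[OF \<tau>] g(1)] unfolding s'_def by (simp only:)
  also have "(\<Sum>\<delta>\<in>Disc. chi \<delta> \<gamma> * F (- 1 / \<tau>) \<delta>) = (\<Sum>\<delta>\<in>Disc. chi \<delta> \<gamma> * (\<i> * s ^ 3 / of_real (sqrt 72) * (\<Sum>\<epsilon>\<in>Disc. chi \<epsilon> \<delta> * F \<tau> \<epsilon>)))"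
    using S32_S[OF F \<tau>] unfolding s_def by (intro sum.cong refl) (simp only:)
  also have "\<dots> = (\<Sum>\<delta>\<in>Disc. \<Sum>\<epsilon>\<in>Disc. \<i> * s ^ 3 / of_real (sqrt 72) * F \<tau> \<epsilon> * (chi \<epsilon> \<delta> * cnj (chi \<gamma>' \<delta>)))"
    unfolding sum_distrib_left by (intro sum.cong refl) (simp only: cn mult_ac)
  also have "\<dots> = (\<Sum>\<epsilon>\<in>Disc. \<Sum>\<delta>\<in>Disc. \<i> * s ^ 3 / of_real (sqrt 72) * F \<tau> \<epsilon> * (chi \<epsilon> \<delta> * cnj (chi \<gamma>' \<delta>)))"
    by (rule sum.swap)
  also have "\<dots> = (\<Sum>\<epsilon>\<in>Disc. if \<epsilon> = \<gamma>' then \<i> * s ^ 3 / of_real (sqrt 72) * F \<tau> \<epsilon> * 72 else 0)"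
    unfolding sum_distrib_left[symmetric] using g by (intro sum.cong refl) (simp add: chi_orthogonal)
  also have "\<dots> = \<i> * s ^ 3 / of_real (sqrt 72) * F \<tau> \<gamma>' * 72" using g finite_Disc by simp
  finally have "F \<tau> \<gamma> = (\<i> * \<i>) * (s * s') ^ 3 * (72 / (of_real (sqrt 72) * of_real (sqrt 72))) * F \<tau> \<gamma>'"
    by (simp only: power_mult_distrib divide_inverse mult_ac inverse_mult_distrib)
  then show ?thesis unfolding ss r72 \<gamma>_def \<gamma>'_def by simp
qed

lemma S32_coeff_odd:
  assumes F: "F \<in> S32" and m: "m - disc_q (cl (x, y, z, u, v)) \<in> \<int>" "0 < m" "m \<le> 1"
  shows "fourier_coeff F (cl (- x, - y, - z, - u, - v)) m = - fourier_coeff F (cl (x, y, z, u, v)) m"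
proof -
  have "disc_q (cl (- x, - y, - z, - u, - v)) = disc_q (cl (x, y, z, u, v))" by (simp add: disc_q_cl qk_def)
  then have "m - disc_q (cl (- x, - y, - z, - u, - v)) \<in> \<int>" using m by simp
  from S32_lead[OF F cl_in_Disc this m(2,3)]
  have 1: "lead (\<lambda>\<tau>. F \<tau> (cl (- x, - y, - z, - u, - v))) m (fourier_coeff F (cl (- x, - y, - z, - u, - v)) m)" .
  from lead_cmult[OF S32_lead[OF F cl_in_Disc m], of "- 1"]
  have 2: "lead (\<lambda>\<tau>. - 1 * F \<tau> (cl (x, y, z, u, v))) m (- 1 * fourier_coeff F (cl (x, y, z, u, v)) m)" .
  from lead_unique[OF 1 2] S32_odd[OF F] show ?thesis by simp
qed

section \<open>Isometries as coordinate permutations with signs\<close>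

fun sel :: "int \<times> int \<times> int \<Rightarrow> nat \<Rightarrow> int" where
  "sel (x, y, z) i = (if i = 0 then x else if i = 1 then y else z)"

text \<open>The source positions of the three coordinates of order 2, then a flag for exchanging the
  two coordinates of order 3 and a sign for each: 6 * 8 = 48 symbols in \<open>syms\<close>.\<close>

type_synonym sym = "(nat \<times> nat \<times> nat) \<times> (bool \<times> int \<times> int)"

fun move :: "sym \<Rightarrow> idx \<Rightarrow> idx" where
  "move ((i, j, k), (w, s, t)) (x, y, z, u, v) =
    (sel (x, y, z) i, sel (x, y, z) j, sel (x, y, z) k, s * (if w then v else u), t * (if w then u else v))"

definition syms :: "sym set" where
  "syms = {(0, 1, 2), (1, 0, 2), (2, 1, 0), (0, 2, 1), (1, 2, 0), (2, 0, 1)} \<times> (UNIV \<times> {1, - 1} \<times> {1, - 1})"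

definition sig :: "sym \<Rightarrow> coset \<Rightarrow> coset" where
  "sig g = restrict (\<lambda>\<gamma>. cl (move g (ix \<gamma>))) Disc"

lemma mult_sign_mod3: "s \<in> {1, - 1} \<Longrightarrow> (s * u) mod 3 = (s * u') mod 3 \<longleftrightarrow> u mod 3 = u' mod 3" for s u :: int
  by (auto simp: mod_eq_dvd_iff dvd_diff_commute)

lemma syms_cases:
  assumes "g \<in> syms"
  obtains p w s t where "g = (p, (w, s, t))" "p \<in> {(0, 1, 2), (1, 0, 2), (2, 1, 0), (0, 2, 1), (1, 2, 0), (2, 0, 1)}"
    "s \<in> {1, - 1}" "t \<in> {1, - 1}"
proof -
  obtain p w s t where g: "g = (p, (w, s, t))" by (metis prod.exhaust)
  show ?thesis using assms by (intro that[OF g]) (simp_all only: g syms_def mem_Times_iff fst_conv snd_conv)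
qed

lemma cl_move_eq:
  assumes "g \<in> syms"
  shows "cl (move g (x, y, z, u, v)) = cl (move g (x', y', z', u', v')) \<longleftrightarrow> cl (x, y, z, u, v) = cl (x', y', z', u', v')"
proof -
  obtain p w s t where g: "g = (p, (w, s, t))" "p \<in> {(0, 1, 2), (1, 0, 2), (2, 1, 0), (0, 2, 1), (1, 2, 0), (2, 0, 1)}"
    "s \<in> {1, - 1}" "t \<in> {1, - 1}" by (rule syms_cases[OF assms])
  show ?thesis
    using g(2) unfolding g(1)
    by (cases w; elim insertE emptyE; simp add: cl_eq_iff mult_sign_mod3[OF g(3)] mult_sign_mod3[OF g(4)]; argo)
qed

lemma sig_cl:
  assumes "g \<in> syms"
  shows "sig g (cl (x, y, z, u, v)) = cl (move g (x, y, z, u, v))"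
proof -
  have "cl (x mod 2, y mod 2, z mod 2, u mod 3, v mod 3) = cl (x, y, z, u, v)" by (simp add: cl_eq_iff)
  then show ?thesis unfolding sig_def by (simp add: ix_cl cl_move_eq[OF assms])
qed

lemma qk_move: "g \<in> syms \<Longrightarrow> qk (move g k) = qk k"
proof -
  assume "g \<in> syms"
  then obtain p w s t where g: "g = (p, (w, s, t))" "p \<in> {(0, 1, 2), (1, 0, 2), (2, 1, 0), (0, 2, 1), (1, 2, 0), (2, 0, 1)}"
    "s \<in> {1, - 1}" "t \<in> {1, - 1}" by (rule syms_cases)
  obtain x y z u v where k: "k = (x, y, z, u, v)" by (cases k)
  have sq: "(real_of_int s * a)\<^sup>2 = a\<^sup>2" "(real_of_int t * a)\<^sup>2 = a\<^sup>2" for a using g(3,4) by auto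
  show ?thesis using g(2) unfolding g(1) k by (cases w; elim insertE emptyE) (simp_all add: qk_def sq)
qed

lemma move_add: "move g (x + x', y + y', z + z', u + u', v + v') =
  (case (move g (x, y, z, u, v), move g (x', y', z', u', v')) of ((a, b, c, d, e), (a', b', c', d', e')) \<Rightarrow> (a + a', b + b', c + c', d + d', e + e'))"
  by (cases g) (auto simp: algebra_simps)

lemma Disc_cl5:
  assumes "\<gamma> \<in> Disc"
  obtains x y z u v where "\<gamma> = cl (x, y, z, u, v)"
proof -
  obtain k where "\<gamma> = cl k" by (rule Disc_cl[OF assms])
  then show ?thesis by (cases k) (rule that, simp)
qed

lemma cl_mult_case: "cl k \<otimes>\<^bsub>disc_group\<^esub> cl k' = cl (case (k, k') of ((a, b, c, d, e), (a', b', c', d', e')) \<Rightarrow> (a + a', b + b', c + c', d + d', e + e'))"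
  by (cases k; cases k') (simp add: cl_mult)

lemma sig_O_disc:
  assumes g: "g \<in> syms"
  shows "sig g \<in> O_disc"
proof -
  have inD: "sig g \<gamma> \<in> Disc" if "\<gamma> \<in> Disc" for \<gamma> using that by (simp add: sig_def)
  have "inj_on (sig g) Disc"
  proof (rule inj_onI)
    fix \<gamma> \<delta> assume a: "\<gamma> \<in> Disc" "\<delta> \<in> Disc" "sig g \<gamma> = sig g \<delta>"
    obtain x y z u v where 1: "\<gamma> = cl (x, y, z, u, v)" by (rule Disc_cl5[OF a(1)])
    obtain x' y' z' u' v' where 2: "\<delta> = cl (x', y', z', u', v')" by (rule Disc_cl5[OF a(2)])
    show "\<gamma> = \<delta>" using a(3) unfolding 1 2 sig_cl[OF g] cl_move_eq[OF g] .
  qed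
  moreover have "sig g ` Disc \<subseteq> Disc" using inD by blast
  ultimately have "bij_betw (sig g) Disc Disc" using finite_Disc by (simp add: bij_betw_def endo_inj_surj)
  moreover have "sig g (\<gamma> \<otimes>\<^bsub>disc_group\<^esub> \<delta>) = sig g \<gamma> \<otimes>\<^bsub>disc_group\<^esub> sig g \<delta>" if a: "\<gamma> \<in> Disc" "\<delta> \<in> Disc" for \<gamma> \<delta>
  proof -
    obtain x y z u v where 1: "\<gamma> = cl (x, y, z, u, v)" by (rule Disc_cl5[OF a(1)])
    obtain x' y' z' u' v' where 2: "\<delta> = cl (x', y', z', u', v')" by (rule Disc_cl5[OF a(2)])
    have "sig g (\<gamma> \<otimes>\<^bsub>disc_group\<^esub> \<delta>) = cl (move g (x + x', y + y', z + z', u + u', v + v'))"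
      unfolding 1 2 cl_mult sig_cl[OF g] ..
    also have "\<dots> = sig g \<gamma> \<otimes>\<^bsub>disc_group\<^esub> sig g \<delta>"
      unfolding 1 2 sig_cl[OF g] move_add cl_mult_case ..
    finally show ?thesis .
  qed
  moreover have "disc_q (sig g \<gamma>) = disc_q \<gamma>" if a: "\<gamma> \<in> Disc" for \<gamma>
  proof -
    obtain x y z u v where 1: "\<gamma> = cl (x, y, z, u, v)" by (rule Disc_cl5[OF a(1)])
    show ?thesis unfolding 1 sig_cl[OF g] disc_q_cl qk_move[OF g] ..
  qed
  ultimately show ?thesis using inD
    by (auto simp: O_disc_def auto_def Bij_def hom_def sig_def)
qed

lemma inv_sig:
  assumes "g \<in> syms" "cl (move g (x', y', z', u', v')) = cl k"
  shows "inv_into Disc (sig g) (cl k) = cl (x', y', z', u', v')"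
  using inv_Disc(3)[OF sig_O_disc[OF assms(1)] cl_in_Disc, of "(x', y', z', u', v')"] assms(2)
  unfolding sig_cl[OF assms(1)] by simp

text \<open>An isometry permutes the three elements of order 2 and norm \<open>3/4\<close> and, up to sign, the
  two coordinate vectors of the 3-part.\<close>

lemma O_disc_sig:
  assumes \<sigma>: "\<sigma> \<in> O_disc"
  shows "\<exists>g\<in>syms. \<sigma> = sig g"
proof -
  have hom: "\<sigma> (cl (x + x', y + y', z + z', u + u', v + v')) = \<sigma> (cl (x, y, z, u, v)) \<otimes>\<^bsub>disc_group\<^esub> \<sigma> (cl (x', y', z', u', v'))" for x x' y y' z z' u u' v v'
    unfolding cl_mult[symmetric] by (rule O_discD(5)[OF \<sigma>]) simp_all
  have im: "\<exists>x\<in>{0, 1}. \<exists>y\<in>{0, 1}. \<exists>z\<in>{0, 1}. \<exists>u\<in>{0, 1, 2}. \<exists>v\<in>{0, 1, 2}. \<sigma> (cl k) = cl (x, y, z, u, v)" for k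
  proof -
    have "ix (\<sigma> (cl k)) \<in> KK" using O_discD(3)[OF \<sigma>] by (intro ix_in_KK) simp
    moreover have "\<sigma> (cl k) = cl (ix (\<sigma> (cl k)))" using O_discD(3)[OF \<sigma>] by (simp add: cl_ix)
    ultimately show ?thesis by (elim KK_cases) metis
  qed
  have inj: "\<sigma> (cl k) = \<sigma> (cl k') \<longleftrightarrow> cl k = cl k'" for k k'
    using inj_on_eq_iff[OF bij_betw_imp_inj_on[OF O_discD(1)[OF \<sigma>]], of "cl k" "cl k'"] by simp
  have z0: "\<sigma> (cl (0, 0, 0, 0, 0)) = cl (0, 0, 0, 0, 0)"
  proof -
    obtain x y z u v where k: "\<sigma> (cl (0, 0, 0, 0, 0)) = cl (x, y, z, u, v)" using im by blast
    have "cl (x, y, z, u, v) = cl (x + x, y + y, z + z, u + u, v + v)"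
      using hom[of 0 0 0 0 0 0 0 0 0 0] by (simp add: k cl_mult)
    then have "x mod 2 = 0" "y mod 2 = 0" "z mod 2 = 0" "u mod 3 = 0" "v mod 3 = 0" unfolding cl_eq_iff by presburger+
    then show ?thesis unfolding k cl_eq_iff by simp
  qed
  have two: "\<sigma> (cl (x, y, z, 0, 0)) \<in> {cl (1, 0, 0, 0, 0), cl (0, 1, 0, 0, 0), cl (0, 0, 1, 0, 0)}"
    if e: "(x, y, z) \<in> {(1, 0, 0), (0, 1, 0), (0, 0, 1)}" for x y z
  proof -
    obtain a b c d f where k: "\<sigma> (cl (x, y, z, 0, 0)) = cl (a, b, c, d, f)" "a \<in> {0, 1}" "b \<in> {0, 1}" "c \<in> {0, 1}" "d \<in> {0, 1, 2}" "f \<in> {0, 1, 2}"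
      using im by metis
    have "cl (x + x, y + y, z + z, 0 + 0, 0 + 0) = cl (0, 0, 0, 0, 0)" unfolding cl_eq_iff by simp
    then have "cl (a + a, b + b, c + c, d + d, f + f) = cl (0, 0, 0, 0, 0)"
      using hom[of x x y y z z 0 0 0 0] by (simp only: k(1) cl_mult z0)
    then have df: "d = 0" "f = 0" using k(5,6) unfolding cl_eq_iff by auto
    have "frac (qk (a, b, c, d, f)) = frac (qk (x, y, z, 0, 0))"
      using O_discD(4)[OF \<sigma> cl_in_Disc[of "(x, y, z, 0, 0)"]] unfolding k(1) disc_q_cl .
    also have "\<dots> = 3 / 4" using e by (auto simp: qk_def frac_def)
    finally show ?thesis unfolding k(1) df using k(2-4) by (auto simp: qk_def frac_def)
  qed
  have three: "\<sigma> (cl (0, 0, 0, u, v)) \<in> {cl (0, 0, 0, 1, 0), cl (0, 0, 0, - 1, 0), cl (0, 0, 0, 0, 1), cl (0, 0, 0, 0, - 1)}"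
    if e: "(u, v) \<in> {(1, 0), (0, 1)}" for u v
  proof -
    obtain a b c d f where k: "\<sigma> (cl (0, 0, 0, u, v)) = cl (a, b, c, d, f)" "a \<in> {0, 1}" "b \<in> {0, 1}" "c \<in> {0, 1}" "d \<in> {0, 1, 2}" "f \<in> {0, 1, 2}"
      using im by metis
    have "cl (0 + (0 + 0), 0 + (0 + 0), 0 + (0 + 0), u + (u + u), v + (v + v)) = cl (0, 0, 0, 0, 0)" unfolding cl_eq_iff by simp
    then have "cl (a + (a + a), b + (b + b), c + (c + c), d + (d + d), f + (f + f)) = cl (0, 0, 0, 0, 0)"
      using hom[of 0 "0 + 0" 0 "0 + 0" 0 "0 + 0" u "u + u" v "v + v"] hom[of 0 0 0 0 0 0 u u v v] by (simp only: k(1) cl_mult z0)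
    then have abc: "a = 0" "b = 0" "c = 0" using k(2-4) unfolding cl_eq_iff by auto
    have "frac (qk (a, b, c, d, f)) = frac (qk (0, 0, 0, u, v))"
      using O_discD(4)[OF \<sigma> cl_in_Disc[of "(0, 0, 0, u, v)"]] unfolding k(1) disc_q_cl .
    also have "\<dots> = 1 / 3" using e by (auto simp: qk_def frac_def)
    finally have "(d, f) \<in> {(1, 0), (2, 0), (0, 1), (0, 2)}" using k(5,6) unfolding abc by (auto simp: qk_def frac_def)
    then show ?thesis unfolding k(1) abc by (auto simp: cl_eq_iff)
  qed
  have "\<exists>p\<in>{(0, 1, 2), (1, 0, 2), (2, 1, 0), (0, 2, 1), (1, 2, 0), (2, 0, 1)}.
     \<sigma> (cl (1, 0, 0, 0, 0)) = cl (sel (1, 0, 0) (fst p), sel (1, 0, 0) (fst (snd p)), sel (1, 0, 0) (snd (snd p)), 0, 0) \<and>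
     \<sigma> (cl (0, 1, 0, 0, 0)) = cl (sel (0, 1, 0) (fst p), sel (0, 1, 0) (fst (snd p)), sel (0, 1, 0) (snd (snd p)), 0, 0) \<and>
     \<sigma> (cl (0, 0, 1, 0, 0)) = cl (sel (0, 0, 1) (fst p), sel (0, 0, 1) (fst (snd p)), sel (0, 0, 1) (snd (snd p)), 0, 0)"
  proof -
    have t: "\<sigma> (cl (1, 0, 0, 0, 0)) \<in> {cl (1, 0, 0, 0, 0), cl (0, 1, 0, 0, 0), cl (0, 0, 1, 0, 0)}"
      "\<sigma> (cl (0, 1, 0, 0, 0)) \<in> {cl (1, 0, 0, 0, 0), cl (0, 1, 0, 0, 0), cl (0, 0, 1, 0, 0)}"
      "\<sigma> (cl (0, 0, 1, 0, 0)) \<in> {cl (1, 0, 0, 0, 0), cl (0, 1, 0, 0, 0), cl (0, 0, 1, 0, 0)}"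
      by (rule two, simp)+
    have n: "\<sigma> (cl (1, 0, 0, 0, 0)) \<noteq> \<sigma> (cl (0, 1, 0, 0, 0))" "\<sigma> (cl (1, 0, 0, 0, 0)) \<noteq> \<sigma> (cl (0, 0, 1, 0, 0))"
      "\<sigma> (cl (0, 1, 0, 0, 0)) \<noteq> \<sigma> (cl (0, 0, 1, 0, 0))"
      unfolding inj cl_eq_iff by simp_all
    have gen: "(A, B, C) \<in> {(E1, E2, E3), (E1, E3, E2), (E2, E1, E3), (E2, E3, E1), (E3, E1, E2), (E3, E2, E1)}"
      if "A \<in> {E1, E2, E3}" "B \<in> {E1, E2, E3}" "C \<in> {E1, E2, E3}" "A \<noteq> B" "A \<noteq> C" "B \<noteq> C" for A B C E1 E2 E3 :: coset
      using that by (elim insertE emptyE; simp)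
    have b: "Q p \<Longrightarrow> p \<in> {(0, 1, 2), (1, 0, 2), (2, 1, 0), (0, 2, 1), (1, 2, 0), (2, 0, 1)} \<Longrightarrow>
      \<exists>p\<in>{(0, 1, 2), (1, 0, 2), (2, 1, 0), (0, 2, 1), (1, 2, 0), (2, 0, 1)}. Q p" for Q and p :: "nat \<times> nat \<times> nat" by blast
    show ?thesis using gen[OF t n] unfolding insert_iff prod.inject empty_iff
      apply (elim disjE conjE FalseE)
      subgoal by (rule b[of _ "(0, 1, 2)"]) simp_all
      subgoal by (rule b[of _ "(0, 2, 1)"]) simp_all
      subgoal by (rule b[of _ "(1, 0, 2)"]) simp_all
      subgoal by (rule b[of _ "(2, 0, 1)"]) simp_all
      subgoal by (rule b[of _ "(1, 2, 0)"]) simp_all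
      subgoal by (rule b[of _ "(2, 1, 0)"]) simp_all
      done
  qed
  then obtain p where p: "p \<in> {(0, 1, 2), (1, 0, 2), (2, 1, 0), (0, 2, 1), (1, 2, 0), (2, 0, 1)}"
    "\<sigma> (cl (1, 0, 0, 0, 0)) = cl (sel (1, 0, 0) (fst p), sel (1, 0, 0) (fst (snd p)), sel (1, 0, 0) (snd (snd p)), 0, 0)"
    "\<sigma> (cl (0, 1, 0, 0, 0)) = cl (sel (0, 1, 0) (fst p), sel (0, 1, 0) (fst (snd p)), sel (0, 1, 0) (snd (snd p)), 0, 0)"
    "\<sigma> (cl (0, 0, 1, 0, 0)) = cl (sel (0, 0, 1) (fst p), sel (0, 0, 1) (fst (snd p)), sel (0, 0, 1) (snd (snd p)), 0, 0)"
    by blast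
  have neg: "\<sigma> (cl (0, 0, 0, 0, - 1)) = cl (0, 0, 0, - a, - b)" if "\<sigma> (cl (0, 0, 0, 0, 1)) = cl (0, 0, 0, a, b)" for a b
  proof -
    obtain x' y' z' u' v' where k: "\<sigma> (cl (0, 0, 0, 0, - 1)) = cl (x', y', z', u', v')" using im by blast
    have "cl (x', y', z', u' + a, v' + b) = cl (0, 0, 0, 0, 0)"
      using hom[of 0 0 0 0 0 0 0 0 "- 1" 1] by (simp add: k that cl_mult z0)
    then show ?thesis unfolding k cl_eq_iff mod_eq_dvd_iff by simp
  qed
  have "\<exists>w s t. s \<in> {1, - 1} \<and> t \<in> {1, - 1 :: int} \<and>
     \<sigma> (cl (0, 0, 0, 1, 0)) = cl (0, 0, 0, s * (if w then 0 else 1), t * (if w then 1 else 0)) \<and>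
     \<sigma> (cl (0, 0, 0, 0, 1)) = cl (0, 0, 0, s * (if w then 1 else 0), t * (if w then 0 else 1))"
  proof -
    have i: "\<sigma> (cl (0, 0, 0, 1, 0)) \<noteq> \<sigma> (cl (0, 0, 0, 0, 1))" "\<sigma> (cl (0, 0, 0, 1, 0)) \<noteq> \<sigma> (cl (0, 0, 0, 0, - 1))"
      unfolding inj cl_eq_iff by simp_all
    have th: "\<exists>e. (e = 1 \<or> e = - 1) \<and> (\<sigma> (cl (0, 0, 0, u, v)) = cl (0, 0, 0, e, 0) \<or> \<sigma> (cl (0, 0, 0, u, v)) = cl (0, 0, 0, 0, e))"
      if "(u, v) \<in> {(1, 0), (0, 1)}" for u v
      using three[OF that] unfolding insert_iff empty_iff by metis
    obtain e where e: "e = 1 \<or> e = - 1" "\<sigma> (cl (0, 0, 0, 1, 0)) = cl (0, 0, 0, e, 0) \<or> \<sigma> (cl (0, 0, 0, 1, 0)) = cl (0, 0, 0, 0, e)"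
      using th[of 1 0] by (auto simp only: insert_iff)
    obtain f where f: "f = 1 \<or> f = - 1" "\<sigma> (cl (0, 0, 0, 0, 1)) = cl (0, 0, 0, f, 0) \<or> \<sigma> (cl (0, 0, 0, 0, 1)) = cl (0, 0, 0, 0, f)"
      using th[of 0 1] by (auto simp only: insert_iff)
    have ef: "e = f \<or> e = - f" using e(1) f(1) by linarith
    have se: "e \<in> {1, - 1}" "f \<in> {1, - 1}" using e(1) f(1) by simp_all
    have minus0: "- (0 :: int) = 0" by simp
    show ?thesis
    proof (cases "\<sigma> (cl (0, 0, 0, 1, 0)) = cl (0, 0, 0, e, 0)")
      case True
      have "\<sigma> (cl (0, 0, 0, 0, 1)) \<noteq> cl (0, 0, 0, f, 0)"
      proof
        assume "\<sigma> (cl (0, 0, 0, 0, 1)) = cl (0, 0, 0, f, 0)"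
        from this neg[OF this] i True ef show False unfolding minus0 by metis
      qed
      with f(2) have "\<sigma> (cl (0, 0, 0, 0, 1)) = cl (0, 0, 0, 0, f)" by metis
      with True se show ?thesis by (rule_tac exI[of _ False], rule_tac exI[of _ e], rule_tac exI[of _ f]) simp
    next
      case False
      with e(2) have E: "\<sigma> (cl (0, 0, 0, 1, 0)) = cl (0, 0, 0, 0, e)" by metis
      have "\<sigma> (cl (0, 0, 0, 0, 1)) \<noteq> cl (0, 0, 0, 0, f)"
      proof
        assume "\<sigma> (cl (0, 0, 0, 0, 1)) = cl (0, 0, 0, 0, f)"
        from this neg[OF this] i E ef show False unfolding minus0 by metis
      qed
      with f(2) have "\<sigma> (cl (0, 0, 0, 0, 1)) = cl (0, 0, 0, f, 0)" by metis
      with E se show ?thesis by (rule_tac exI[of _ True], rule_tac exI[of _ f], rule_tac exI[of _ e]) simp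
    qed
  qed
  then obtain w s t where w: "s \<in> {1, - 1}" "t \<in> {1, - 1 :: int}"
    "\<sigma> (cl (0, 0, 0, 1, 0)) = cl (0, 0, 0, s * (if w then 0 else 1), t * (if w then 1 else 0))"
    "\<sigma> (cl (0, 0, 0, 0, 1)) = cl (0, 0, 0, s * (if w then 1 else 0), t * (if w then 0 else 1))" by blast
  define g where "g = (p, (w, s, t))"
  have g: "g \<in> syms" using p(1) w(1,2) by (cases w) (auto simp: g_def syms_def)
  \<comment> \<open>Agreement of the two maps is stable under addition, so it has to be checked only
    on the five coordinate vectors and 0.\<close>
  define P where "P = (\<lambda>x y z u v. \<sigma> (cl (x, y, z, u, v)) = cl (move g (x, y, z, u, v)))"
  have Padd: "P (x + x') (y + y') (z + z') (u + u') (v + v')" if "P x y z u v" "P x' y' z' u' v'" for x x' y y' z z' u u' v v'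
    using that unfolding P_def hom move_add cl_mult_case[symmetric] by (simp only:)
  obtain i j l where pe: "p = (i, j, l)" by (cases p)
  have sel0: "sel (0, 0, 0) n = 0" for n by simp
  have P0: "P 0 0 0 0 0" by (simp add: P_def z0 g_def pe)
  have P1: "P 1 0 0 0 0" "P 0 1 0 0 0" "P 0 0 1 0 0" using p(2-4) unfolding P_def g_def pe by simp_all
  have P2: "P 0 0 0 1 0" "P 0 0 0 0 1" using w(3,4) unfolding P_def g_def pe by simp_all
  have P3: "P 0 0 0 2 0" "P 0 0 0 0 2" using Padd[OF P2(1) P2(1)] Padd[OF P2(2) P2(2)] by simp_all
  have PK: "P x y z u v" if "x \<in> {0, 1}" "y \<in> {0, 1}" "z \<in> {0, 1}" "u \<in> {0, 1, 2}" "v \<in> {0, 1, 2}" for x y z u v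
  proof -
    have "P x 0 0 0 0" "P 0 y 0 0 0" "P 0 0 z 0 0" "P 0 0 0 u 0" "P 0 0 0 0 v" using that P0 P1 P2 P3 by auto
    from Padd[OF Padd[OF Padd[OF Padd[OF this(1,2)] this(3)] this(4)] this(5)] show ?thesis by simp
  qed
  have "\<sigma> \<gamma> = sig g \<gamma>" for \<gamma>
  proof (cases "\<gamma> \<in> Disc")
    case True
    have "ix \<gamma> \<in> KK" by (rule ix_in_KK[OF True])
    then obtain x y z u v where k: "ix \<gamma> = (x, y, z, u, v)" "x \<in> {0, 1}" "y \<in> {0, 1}" "z \<in> {0, 1}" "u \<in> {0, 1, 2}" "v \<in> {0, 1, 2}" by (rule KK_cases)
    have "\<gamma> = cl (x, y, z, u, v)" using cl_ix[OF True] k(1) by simp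
    then show ?thesis using PK[OF k(2-6)] unfolding P_def by (simp only: sig_cl[OF g])
  next
    case False
    then show ?thesis using O_discD(2)[OF \<sigma>] by (simp add: extensional_def sig_def)
  qed
  then have "\<sigma> = sig g" by (rule ext)
  with g show ?thesis by blast
qed

lemma O_disc_eq: "O_disc = sig ` syms"
  using O_disc_sig sig_O_disc by blast

text \<open>Together with \<open>O_disc_eq\<close>, lets sums over the orthogonal group run over the
  48 symbols.\<close>

lemma inj_sig: "inj_on sig syms"
proof (rule inj_onI)
  fix g h assume gh: "g \<in> syms" "h \<in> syms" "sig g = sig h"
  have eq: "cl (move g (x, y, z, u, v)) = cl (move h (x, y, z, u, v))" for x y z u v
    using gh(3) sig_cl[OF gh(1), of x y z u v] sig_cl[OF gh(2), of x y z u v] by simp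
  obtain p w s t where g: "g = (p, (w, s, t))" "p \<in> {(0, 1, 2), (1, 0, 2), (2, 1, 0), (0, 2, 1), (1, 2, 0), (2, 0, 1)}"
    "s \<in> {1, - 1}" "t \<in> {1, - 1}" by (rule syms_cases[OF gh(1)])
  obtain p' w' s' t' where h: "h = (p', (w', s', t'))" "p' \<in> {(0, 1, 2), (1, 0, 2), (2, 1, 0), (0, 2, 1), (1, 2, 0), (2, 0, 1)}"
    "s' \<in> {1, - 1}" "t' \<in> {1, - 1}" by (rule syms_cases[OF gh(2)])
  obtain i j k where p: "p = (i, j, k)" by (cases p)
  obtain i' j' k' where p': "p' = (i', j', k')" by (cases p')
  have r: "i \<in> {0, 1, 2}" "j \<in> {0, 1, 2}" "k \<in> {0, 1, 2}" "i' \<in> {0, 1, 2}" "j' \<in> {0, 1, 2}" "k' \<in> {0, 1, 2}"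
    using g(2) h(2) unfolding p p' by auto
  have sel: "n = n'" if n: "n \<in> {0, 1, 2}" "n' \<in> {0, 1, 2}"
    "sel (1, 0, 0) n mod 2 = sel (1, 0, 0) n' mod 2" "sel (0, 1, 0) n mod 2 = sel (0, 1, 0) n' mod 2" for n n'
    using n(1,2) by (elim insertE emptyE) (use n(3,4) in auto)
  have e: "sel (x, y, z) i mod 2 = sel (x, y, z) i' mod 2" "sel (x, y, z) j mod 2 = sel (x, y, z) j' mod 2"
    "sel (x, y, z) k mod 2 = sel (x, y, z) k' mod 2"
    "(s * (if w then v else u)) mod 3 = (s' * (if w' then v else u)) mod 3"
    "(t * (if w then u else v)) mod 3 = (t' * (if w' then u else v)) mod 3" for x y z u v
    using eq[of x y z u v] unfolding g(1) h(1) p p' move.simps cl_eq_iff by simp_all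
  have "p = p'" unfolding p p' using sel[OF r(1,4) e(1) e(1)] sel[OF r(2,5) e(2) e(2)] sel[OF r(3,6) e(3) e(3)] by simp
  moreover have "(w, s, t) = (w', s', t')"
  proof -
    have m: "s mod 3 \<noteq> 0" "s' mod 3 \<noteq> 0" using g(3) h(3) by (elim insertE emptyE, simp_all)+
    have "w = w'" using e(4)[where u = 0 and v = 1] m by (cases w; cases w'; simp)
    moreover have "s mod 3 = s' mod 3" "t mod 3 = t' mod 3" using e(4,5)[where u = 1 and v = 1] by (simp_all split: if_splits)
    ultimately show ?thesis using g(3,4) h(3,4) by (elim insertE emptyE) simp_all
  qed
  ultimately show "g = h" by (simp add: g(1) h(1))
qed

lemma sum_O_disc: "(\<Sum>\<sigma>\<in>O_disc. f \<sigma>) = (\<Sum>g\<in>syms. f (sig g))"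
  unfolding O_disc_eq by (rule sum.reindex[OF inj_sig, unfolded o_def])

lemma inverse_O_disc:
  assumes \<sigma>: "\<sigma> \<in> O_disc"
  shows "restrict (inv_into Disc \<sigma>) Disc \<in> O_disc"
proof -
  let ?i = "restrict (inv_into Disc \<sigma>) Disc"
  have b: "bij_betw ?i Disc Disc"
    using bij_inv_Disc[OF \<sigma>] by (subst bij_betw_cong[of _ _ "inv_into Disc \<sigma>"]) auto
  have "inv_into Disc \<sigma> (\<gamma> \<otimes>\<^bsub>disc_group\<^esub> \<delta>) = inv_into Disc \<sigma> \<gamma> \<otimes>\<^bsub>disc_group\<^esub> inv_into Disc \<sigma> \<delta>
      \<and> \<gamma> \<otimes>\<^bsub>disc_group\<^esub> \<delta> \<in> Disc" if a: "\<gamma> \<in> Disc" "\<delta> \<in> Disc" for \<gamma> \<delta>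
  proof -
    have m: "\<alpha> \<otimes>\<^bsub>disc_group\<^esub> \<beta> \<in> Disc" if ab: "\<alpha> \<in> Disc" "\<beta> \<in> Disc" for \<alpha> \<beta>
    proof -
      obtain x y z u v where 1: "\<alpha> = cl (x, y, z, u, v)" by (rule Disc_cl5[OF ab(1)])
      obtain x' y' z' u' v' where 2: "\<beta> = cl (x', y', z', u', v')" by (rule Disc_cl5[OF ab(2)])
      show ?thesis unfolding 1 2 cl_mult by simp
    qed
    have i: "inv_into Disc \<sigma> \<gamma> \<in> Disc" "inv_into Disc \<sigma> \<delta> \<in> Disc" using inv_Disc[OF \<sigma>] a by auto
    have "\<sigma> (inv_into Disc \<sigma> \<gamma> \<otimes>\<^bsub>disc_group\<^esub> inv_into Disc \<sigma> \<delta>) = \<gamma> \<otimes>\<^bsub>disc_group\<^esub> \<delta>"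
      unfolding O_discD(5)[OF \<sigma> i] using inv_Disc(2)[OF \<sigma>] a by simp
    then show ?thesis using inv_Disc(3)[OF \<sigma> m[OF i]] m[OF a] by simp
  qed
  then show ?thesis
    using b inv_Disc[OF \<sigma>] by (auto simp: O_disc_def auto_def Bij_def hom_def)
qed

text \<open>\<open>act\<close> involves inverses, and inversion permutes the group. The restriction
  to \<open>Disc\<close> is there because group elements are extensional functions.\<close>

lemma sum_O_disc_inv:
  assumes "\<gamma> \<in> Disc"
  shows "(\<Sum>\<sigma>\<in>O_disc. h (inv_into Disc \<sigma> \<gamma>)) = (\<Sum>\<sigma>\<in>O_disc. h (\<sigma> \<gamma>))"
proof -
  let ?I = "\<lambda>\<sigma>. restrict (inv_into Disc \<sigma>) Disc"
  have inv: "?I (?I \<sigma>) = \<sigma>" if \<sigma>: "\<sigma> \<in> O_disc" for \<sigma>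
  proof
    fix \<delta>
    show "?I (?I \<sigma>) \<delta> = \<sigma> \<delta>"
    proof (cases "\<delta> \<in> Disc")
      case True
      have "inv_into Disc (?I \<sigma>) (?I \<sigma> (\<sigma> \<delta>)) = \<sigma> \<delta>"
        by (rule inv_Disc(3)[OF inverse_O_disc[OF \<sigma>] O_discD(3)[OF \<sigma> True]])
      then show ?thesis using True inv_Disc(3)[OF \<sigma> True] O_discD(3)[OF \<sigma> True] by simp
    next
      case False
      then show ?thesis using O_discD(2)[OF \<sigma>] by (simp add: extensional_def)
    qed
  qed
  have "bij_betw ?I O_disc O_disc"
    by (rule bij_betw_byWitness[where f' = ?I]) (use inv inverse_O_disc in auto)
  from sum.reindex_bij_betw[OF this, of "\<lambda>\<sigma>. h (\<sigma> \<gamma>)"] assms show ?thesis by simp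
qed

section \<open>A theta product in the space of cusp forms\<close>

lemma det_moebius:
  fixes A :: "int^2^2"
  assumes "det A = 1" and \<tau>: "\<tau> \<in> upper_half"
  shows "of_int (A $ 2 $ 1) * \<tau> + of_int (A $ 2 $ 2) \<noteq> 0" "moebius A \<tau> \<in> upper_half"
proof -
  have d: "A $ 1 $ 1 * A $ 2 $ 2 - A $ 1 $ 2 * A $ 2 $ 1 = 1" using assms(1) by (simp add: det_2)
  show nz: "of_int (A $ 2 $ 1) * \<tau> + of_int (A $ 2 $ 2) \<noteq> 0"
  proof
    assume z: "of_int (A $ 2 $ 1) * \<tau> + of_int (A $ 2 $ 2) = 0"
    then have "Im (of_int (A $ 2 $ 1) * \<tau> + of_int (A $ 2 $ 2)) = 0" by simp
    then have "A $ 2 $ 1 = 0" using \<tau> by (simp add: upper_half_def)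
    with z have "A $ 2 $ 2 = 0" by simp
    with \<open>A $ 2 $ 1 = 0\<close> d show False by simp
  qed
  let ?w = "of_int (A $ 2 $ 1) * \<tau> + of_int (A $ 2 $ 2) :: complex"
  have "(Re ?w)\<^sup>2 + (Im ?w)\<^sup>2 > 0" using nz by (metis complex_eq_0 not_sum_power2_lt_zero linorder_neqE_linordered_idom)
  moreover have "Im (moebius A \<tau>) = Im \<tau> * of_int (A $ 1 $ 1 * A $ 2 $ 2 - A $ 1 $ 2 * A $ 2 $ 1) / ((Re ?w)\<^sup>2 + (Im ?w)\<^sup>2)"
    unfolding moebius_def Im_divide by (simp add: algebra_simps)
  ultimately show "moebius A \<tau> \<in> upper_half" using \<tau> unfolding d by (simp add: upper_half_def)
qed

lemma moebius_mult:
  fixes A B :: "int^2^2"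
  assumes "det B = 1" "\<tau> \<in> upper_half"
  shows "moebius (A ** B) \<tau> = moebius A (moebius B \<tau>)"
proof -
  define D where "D = of_int (B $ 2 $ 1) * \<tau> + of_int (B $ 2 $ 2)"
  define N where "N = of_int (B $ 1 $ 1) * \<tau> + of_int (B $ 1 $ 2)"
  have D: "D \<noteq> 0" unfolding D_def by (rule det_moebius(1)[OF assms])
  have "moebius A (N / D) = (of_int (A $ 1 $ 1) * N + of_int (A $ 1 $ 2) * D) / (of_int (A $ 2 $ 1) * N + of_int (A $ 2 $ 2) * D)"
  proof -
    have "of_int a * (N / D) + of_int b = (of_int a * N + of_int b * D) / D" for a b using D by (simp add: field_simps)
    then show ?thesis unfolding moebius_def using D by simp
  qed
  moreover have "moebius B \<tau> = N / D" by (simp add: moebius_def N_def D_def)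
  ultimately show ?thesis
    by (simp add: moebius_def matrix_matrix_mult_def sum_2 N_def D_def algebra_simps)
qed

text \<open>Invariance under the two generators suffices.\<close>

lemma S32_I:
  assumes zero: "\<And>\<tau> \<gamma>. \<tau> \<notin> upper_half \<or> \<gamma> \<notin> Disc \<Longrightarrow> F \<tau> \<gamma> = 0"
    and hol: "\<And>\<gamma>. \<gamma> \<in> Disc \<Longrightarrow> (\<lambda>\<tau>. F \<tau> \<gamma>) holomorphic_on upper_half"
    and tT: "\<And>\<tau> \<gamma>. \<tau> \<in> upper_half \<Longrightarrow> \<gamma> \<in> Disc \<Longrightarrow> F (\<tau> + 1) \<gamma> = e2pi (of_real (disc_q \<gamma>)) * F \<tau> \<gamma>"
    and tS: "\<And>\<tau> \<gamma>. \<tau> \<in> upper_half \<Longrightarrow> \<gamma> \<in> Disc \<Longrightarrow>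
      F (- 1 / \<tau>) \<gamma> = \<i> * csqrt (- \<i> * \<tau>) ^ 3 / of_real (sqrt 72) * (\<Sum>\<delta>\<in>Disc. chi \<delta> \<gamma> * F \<tau> \<delta>)"
    and exp: "fourier_expansion F c" "\<And>\<gamma> e. e \<le> 0 \<Longrightarrow> c \<gamma> e = 0"
  shows "F \<in> S32"
proof -
  \<comment> \<open>The claim is strengthened for the induction: determinant 1 keeps the Moebius map
    inside the upper half-plane, and homogeneity of M lets the automorphy factor of the right factor
    pass through it.\<close>
  have "det (fst g) = 1 \<and> (\<forall>c v. M (\<lambda>\<gamma>. c * v \<gamma>) = (\<lambda>\<gamma>. c * M v \<gamma>)) \<and>
      (\<forall>\<tau>\<in>upper_half. F (moebius (fst g) \<tau>) = (\<lambda>\<gamma>. snd g \<tau> ^ 3 * M (F \<tau>) \<gamma>))" if "weil_rep g M" for g M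
    using that
  proof induction
    case T
    have "weil_T (\<lambda>\<gamma>. c * v \<gamma>) = (\<lambda>\<gamma>. c * weil_T v \<gamma>)" for c v by (auto simp: weil_T_def fun_eq_iff)
    moreover have "F (moebius (fst mp2_T) \<tau>) \<gamma> = snd mp2_T \<tau> ^ 3 * weil_T (F \<tau>) \<gamma>" if "\<tau> \<in> upper_half" for \<tau> \<gamma>
      unfolding moebius_T using tT[OF that] zero by (auto simp: weil_T_def mp2_T_def)
    ultimately show ?case by (auto simp: mp2_T_def det_2)
  next
    case S
    have "weil_S (\<lambda>\<gamma>. c * v \<gamma>) = (\<lambda>\<gamma>. c * weil_S v \<gamma>)" for c v
      by (auto simp: weil_S_def fun_eq_iff sum_distrib_left mult_ac intro!: sum.cong)
    moreover have "F (moebius (fst mp2_S) \<tau>) \<gamma> = snd mp2_S \<tau> ^ 3 * weil_S (F \<tau>) \<gamma>" if "\<tau> \<in> upper_half" for \<tau> \<gamma>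
    proof (cases "\<gamma> \<in> Disc")
      case True
      have "snd mp2_S \<tau> ^ 3 * weil_S (F \<tau>) \<gamma> = csqrt \<tau> ^ 3 * weil_S (F \<tau>) \<gamma>" by (simp add: mp2_S_def)
      then show ?thesis unfolding moebius_S weil_S_factor[OF that True] tS[OF that True] ..
    next
      case False
      then show ?thesis using zero by (simp add: weil_S_def)
    qed
    ultimately show ?case by (auto simp: mp2_S_def det_2)
  next
    case (mult g M h N)
    have "F (moebius (fst g ** fst h) \<tau>) = (\<lambda>\<gamma>. (snd g (moebius (fst h) \<tau>) * snd h \<tau>) ^ 3 * M (N (F \<tau>)) \<gamma>)"
      if \<tau>: "\<tau> \<in> upper_half" for \<tau>
    proof -
      have h: "det (fst h) = 1" using mult.IH(2) by blast
      have "F (moebius (fst g ** fst h) \<tau>) = F (moebius (fst g) (moebius (fst h) \<tau>))"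
        by (simp only: moebius_mult[OF h \<tau>])
      also have "\<dots> = (\<lambda>\<gamma>. snd g (moebius (fst h) \<tau>) ^ 3 * M (F (moebius (fst h) \<tau>)) \<gamma>)"
        using mult.IH(1) det_moebius(2)[OF h \<tau>] by blast
      also have "F (moebius (fst h) \<tau>) = (\<lambda>\<gamma>. snd h \<tau> ^ 3 * N (F \<tau>) \<gamma>)" using mult.IH(2) \<tau> by blast
      finally show ?thesis using mult.IH(1) by (simp add: power_mult_distrib mult.assoc)
    qed
    moreover have "det (fst g ** fst h) = 1" using mult.IH by (simp add: det_mul)
    ultimately show ?case using mult.IH by (simp add: mp2_mult_def)
  qed
  then have "F (moebius A \<tau>) \<gamma> = \<phi> \<tau> ^ 3 * M (F \<tau>) \<gamma>" if "weil_rep (A, \<phi>) M" "\<tau> \<in> upper_half" for A \<phi> M \<tau> \<gamma>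
    using that by (metis fst_conv snd_conv)
  then show ?thesis unfolding S32_def using zero hol exp by blast
qed

lemma has_sum_Times_mult:
  fixes f g :: "_ \<Rightarrow> complex"
  assumes f: "(f has_sum a) A" and g: "(g has_sum b) B"
  shows "((\<lambda>p. f (fst p) * g (snd p)) has_sum a * b) (A \<times> B)"
proof (rule has_sum_SigmaI)
  show "((\<lambda>y. f (fst (x, y)) * g (snd (x, y))) has_sum f x * b) B" for x
    using has_sum_cmult_right[OF g, of "f x"] by simp
  show "((\<lambda>x. f x * b) has_sum a * b) A" by (rule has_sum_cmult_left[OF f])
  have nf: "(\<lambda>x. norm (f x)) summable_on A" and ng: "(\<lambda>x. norm (g x)) summable_on B"
    using has_sum_imp_summable[OF f] has_sum_imp_summable[OF g] by (simp_all only: summable_on_iff_abs_summable_on_complex)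
  have "(\<lambda>p. norm (f (fst p) * g (snd p))) summable_on A \<times> B"
  proof (rule summable_on_SigmaI)
    show "((\<lambda>y. norm (f (fst (x, y)) * g (snd (x, y)))) has_sum norm (f x) * (\<Sum>\<^sub>\<infinity>y\<in>B. norm (g y))) B" for x
      using has_sum_cmult_right[OF has_sum_infsum[OF ng], of "norm (f x)"] by (simp add: norm_mult)
    show "(\<lambda>x. norm (f x) * (\<Sum>\<^sub>\<infinity>y\<in>B. norm (g y))) summable_on A" by (rule summable_on_cmult_left[OF nf])
  qed auto
  then show "(\<lambda>p. f (fst p) * g (snd p)) summable_on A \<times> B" by (rule abs_summable_summable)
qed

lemma V_mod: "V 3 j = V 3 (j mod 6)"
proof -
  have p: "V 3 (i + 6) = V 3 i" for i using V_period[of 3 i] by (simp add: fun_eq_iff)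
  have n: "V 3 (i + 6 * int n) = V 3 i" for i n
  proof (induction n)
    case (Suc n)
    have e: "i + 6 * int (Suc n) = (i + 6 * int n) + 6" by simp
    show ?case unfolding e p using Suc .
  qed simp
  have "V 3 (i + 6 * m) = V 3 i" for i m
    using n[of i "nat m"] n[of "i + 6 * m" "nat (- m)"] by (cases "m \<ge> 0") simp_all
  from this[of "j mod 6" "j div 6"] show ?thesis by simp
qed

text \<open>The tensor product of \<open>eta\<close>^2 with the alternating vector on the first two
  2-parts, the odd vector on the first 3-part and a unary theta series of index 3. The map (z, v) to
  3z + 2v identifies the remaining 2-part and 3-part with the integers modulo 6.\<close>

definition tht :: "idx \<Rightarrow> complex \<Rightarrow> complex" where
  "tht = (\<lambda>(x, y, z, u, v) \<tau>. eta \<tau> ^ 2 * of_int (y mod 2 - x mod 2) * sg u * V 3 (3 * z + 2 * v) \<tau>)"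

definition b2 :: form where
  "b2 \<tau> \<gamma> = (if \<tau> \<in> upper_half \<and> \<gamma> \<in> Disc then tht (ix \<gamma>) \<tau> else 0)"

lemma tht_ix: "tht (ix (cl k)) = tht k"
proof -
  obtain x y z u v where k: "k = (x, y, z, u, v)" by (cases k)
  have "(3 * (z mod 2) + 2 * (v mod 3)) mod 6 = (3 * z + 2 * v) mod 6"
  proof -
    have "3 * (z mod 2) + 2 * (v mod 3) - (3 * z + 2 * v) = 6 * - (z div 2 + v div 3)"
      by (simp add: algebra_simps flip: minus_mult_div_eq_mod)
    then show ?thesis unfolding mod_eq_dvd_iff by (metis dvd_triv_left)
  qed
  then have "V 3 (3 * (z mod 2) + 2 * (v mod 3)) = V 3 (3 * z + 2 * v)" by (metis V_mod)
  then show ?thesis by (simp add: k ix_cl tht_def sg_def)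
qed

lemma b2_cl: "\<tau> \<in> upper_half \<Longrightarrow> b2 \<tau> (cl k) = tht k \<tau>"
  by (simp add: b2_def tht_ix)

text \<open>x \<noteq> y and u \<noteq> 0 contribute -1/4 + 1/3 = 1/12 modulo 1, the leading
  exponent of \<open>eta\<close>^2; the remaining coordinates contribute (3z + 2v)^2/12, the
  exponent of the theta series.\<close>

lemma qk_tri:
  assumes "x \<in> {0, 1}" "y \<in> {0, 1}" "z \<in> {0, 1}" "u \<in> {0, 1, 2}" "v \<in> {0, 1, 2}" "x \<noteq> y" "u \<noteq> 0"
  shows "\<exists>m. qk (x, y, z, u, v) = 1 / 12 + (of_int (3 * z + 2 * v))\<^sup>2 / 12 - of_int m"
  by (rule exI[of _ "if u = 1 then z * z + z * v else z * z + z * v - 1"])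
    (use assms in \<open>elim insertE emptyE; simp add: qk_def power2_eq_square\<close>)

lemma b2_T:
  assumes "\<tau> \<in> upper_half" "\<gamma> \<in> Disc"
  shows "b2 (\<tau> + 1) \<gamma> = e2pi (of_real (disc_q \<gamma>)) * b2 \<tau> \<gamma>"
proof -
  have "ix \<gamma> \<in> KK" by (rule ix_in_KK[OF assms(2)])
  then obtain x y z u v where k: "ix \<gamma> = (x, y, z, u, v)" "x \<in> {0, 1}" "y \<in> {0, 1}" "z \<in> {0, 1}" "u \<in> {0, 1, 2}" "v \<in> {0, 1, 2}" by (rule KK_cases)
  have g: "\<gamma> = cl (x, y, z, u, v)" using cl_ix[OF assms(2)] k(1) by simp
  have t1: "\<tau> + 1 \<in> upper_half" using assms(1) by (simp add: upper_half_def)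
  define j where "j = 3 * z + 2 * v"
  have e: "e2pi (1 / 24) ^ 2 * e2pi ((of_int j)\<^sup>2 / 12) = e2pi (of_real (disc_q \<gamma>))" if ne: "x \<noteq> y" "u \<noteq> 0"
  proof -
    obtain m where "qk (x, y, z, u, v) = 1 / 12 + (of_int j)\<^sup>2 / 12 - of_int m"
      using qk_tri[OF k(2-6) ne] unfolding j_def by blast
    then have "complex_of_real (qk (x, y, z, u, v)) = 2 * (1 / 24) + (of_int j)\<^sup>2 / 12 - of_int m"
      by simp
    then have "e2pi (of_real (qk (x, y, z, u, v))) = e2pi (2 * (1 / 24)) * e2pi ((of_int j)\<^sup>2 / 12)"
      by (simp only: e2pi_diff e2pi_add e2pi_of_int div_by_1)
    then show ?thesis unfolding g disc_q_cl e2pi_of_real_frac e2pi_power by simp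
  qed
  show ?thesis unfolding g b2_cl[OF assms(1)] b2_cl[OF t1] tht_def prod.case j_def[symmetric] eta_T V_T[OF zero_less_numeral]
  proof (cases "x = y \<or> u = 0")
    case True
    then show "(e2pi (1 / 24) * eta \<tau>)\<^sup>2 * of_int (y mod 2 - x mod 2) * sg u * (e2pi ((of_int j)\<^sup>2 / (4 * of_nat 3)) * V 3 j \<tau>) =
      e2pi (of_real (disc_q (cl (x, y, z, u, v)))) * ((eta \<tau>)\<^sup>2 * of_int (y mod 2 - x mod 2) * sg u * V 3 j \<tau>)" by auto
  next
    case False
    then show "(e2pi (1 / 24) * eta \<tau>)\<^sup>2 * of_int (y mod 2 - x mod 2) * sg u * (e2pi ((of_int j)\<^sup>2 / (4 * of_nat 3)) * V 3 j \<tau>) =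
      e2pi (of_real (disc_q (cl (x, y, z, u, v)))) * ((eta \<tau>)\<^sup>2 * of_int (y mod 2 - x mod 2) * sg u * V 3 j \<tau>)"
      using e unfolding g by (simp add: power_mult_distrib)
  qed
qed

text \<open>The finite Fourier transform multiplies the alternating vector by -2 and the odd one by
  i sqrt 3, and it matches the inversion of the theta series. Because sqrt 72 = 2 sqrt 3 sqrt 6,
  exactly the factor 1/sqrt 6 of \<open>V3_S\<close> is left.\<close>

lemma b2_S:
  assumes \<tau>: "\<tau> \<in> upper_half" and "\<gamma> \<in> Disc"
  shows "b2 (- 1 / \<tau>) \<gamma> = \<i> * csqrt (- \<i> * \<tau>) ^ 3 / of_real (sqrt 72) * (\<Sum>\<delta>\<in>Disc. chi \<delta> \<gamma> * b2 \<tau> \<delta>)"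
proof -
  have "ix \<gamma> \<in> KK" by (rule ix_in_KK[OF assms(2)])
  then obtain x y z u v where k: "ix \<gamma> = (x, y, z, u, v)" "x \<in> {0, 1}" "y \<in> {0, 1}" "z \<in> {0, 1}" "u \<in> {0, 1, 2}" "v \<in> {0, 1, 2}" by (rule KK_cases)
  have g: "\<gamma> = cl (x, y, z, u, v)" using cl_ix[OF assms(2)] k(1) by simp
  define s where "s = csqrt (- \<i> * \<tau>)"
  define E where "E = eta \<tau> ^ 2"
  define j where "j = 3 * z + 2 * v"
  have X: "(\<Sum>x'\<in>{0, 1}. \<Sum>y'\<in>{0, 1}. sgnp (x' * x) * sgnp (y' * y) * of_int (y' mod 2 - x' mod 2)) = - 2 * of_int (y mod 2 - x mod 2 :: int)"
    using k(2,3) by (elim insertE emptyE) (simp_all add: sgnp_def)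
  have U: "(\<Sum>u'\<in>{0, 1, 2}. om (u' * u) * sg u') = \<i> * of_real (sqrt 3) * sg u"
    using k(5) by (elim insertE emptyE) (simp_all add: om_1 om_2 complex_eq_iff)
  define Vs where "Vs = V 3 0 \<tau> + (om (- j) * sgnp j + om j * sgnp j) * V 3 1 \<tau> + (om j + om (- j)) * V 3 2 \<tau> + sgnp j * V 3 3 \<tau>"
  have Vr: "V 3 4 \<tau> = V 3 2 \<tau>" "V 3 5 \<tau> = V 3 1 \<tau>" "V 3 7 \<tau> = V 3 1 \<tau>"
    using V_uminus[of 3 2 \<tau>] V_uminus[of 3 1 \<tau>] V_mod[of "- 2"] V_mod[of "- 1"] V_mod[of 7] by simp_all
  have W: "(\<Sum>z'\<in>{0, 1}. \<Sum>v'\<in>{0, 1, 2}. sgnp (z' * z) * om (v' * v) * V 3 (3 * z' + 2 * v') \<tau>) = Vs"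
  proof -
    have m: "om (- 2) = om 1" "om (- 4) = om 2" "om (- 3) = 1" "om (- 5) = om 1" "om (- 7) = om 2" "om 3 = 1" "om 5 = om 2" "om 7 = om 1" "om (- 1) = om 2"
      using om_mod[of "- 2"] om_mod[of "- 4"] om_mod[of "- 3"] om_mod[of "- 5"] om_mod[of "- 7"] om_mod[of 3] om_mod[of 5] om_mod[of 7] om_mod[of "- 1"]
      by simp_all
    show ?thesis unfolding Vs_def j_def using k(4,6)
      by (elim insertE emptyE) (simp_all add: Vr m sgnp_def algebra_simps)
  qed
  have "(\<Sum>\<delta>\<in>Disc. chi \<delta> \<gamma> * b2 \<tau> \<delta>) = (\<Sum>x'\<in>{0, 1}. \<Sum>y'\<in>{0, 1}. \<Sum>z'\<in>{0, 1}. \<Sum>u'\<in>{0, 1, 2}. \<Sum>v'\<in>{0, 1, 2}.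
      (E * (sgnp (x' * x) * sgnp (y' * y) * of_int (y' mod 2 - x' mod 2))) * (om (u' * u) * sg u') * (sgnp (z' * z) * om (v' * v) * V 3 (3 * z' + 2 * v') \<tau>))"
    unfolding sum_Disc g chi_cl b2_cl[OF \<tau>] tht_def prod.case E_def by (intro sum.cong refl) (simp only: mult_ac)
  also have "\<dots> = (\<Sum>x'\<in>{0, 1}. \<Sum>y'\<in>{0, 1}. E * (sgnp (x' * x) * sgnp (y' * y) * of_int (y' mod 2 - x' mod 2)) *
      ((\<Sum>u'\<in>{0, 1, 2}. om (u' * u) * sg u') * Vs))"
    unfolding W[symmetric] sum_distrib_left sum_distrib_right
    by (rule sum.cong[OF refl], rule sum.cong[OF refl], rule sum.cong[OF refl], subst sum.swap, intro sum.cong refl) (simp only: mult_ac)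
  also have "\<dots> = E * (- 2 * of_int (y mod 2 - x mod 2)) * (\<i> * of_real (sqrt 3) * sg u * Vs)"
    unfolding U sum_distrib_right[symmetric] sum_distrib_left[symmetric] X ..
  finally have sum: "(\<Sum>\<delta>\<in>Disc. chi \<delta> \<gamma> * b2 \<tau> \<delta>) = \<dots>" .
  have r: "\<i> * s ^ 3 / of_real (sqrt 72) * (E * (- 2 * c) * (\<i> * of_real (sqrt 3) * d * Vs))
      = (s ^ 2 * E) * c * d * (s / of_real (sqrt 6) * Vs)" for c d
  proof -
    have "sqrt 72 = sqrt 6 * (2 * sqrt 3)"
      using real_sqrt_mult[of 6 12] real_sqrt_mult[of 4 3] by simp
    then have "complex_of_real (sqrt 72) = of_real (sqrt 6) * (2 * of_real (sqrt 3))" by simp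
    moreover have "complex_of_real (sqrt 3) \<noteq> 0" "complex_of_real (sqrt 6) \<noteq> 0" by simp_all
    ultimately show ?thesis by (simp add: field_simps power3_eq_cube power2_eq_square)
  qed
  have "b2 (- 1 / \<tau>) \<gamma> = (s ^ 2 * E) * of_int (y mod 2 - x mod 2) * sg u * (s / of_real (sqrt 6) * Vs)"
    unfolding g b2_cl[OF neg_inverse_upper_half[OF \<tau>]] tht_def prod.case eta_S[OF \<tau>] V3_S[OF \<tau>]
      Vs_def s_def E_def j_def power_mult_distrib ..
  then show ?thesis unfolding sum s_def[symmetric] r .
qed

section \<open>Fourier expansion of the theta product\<close>

type_synonym tri = "(int \<times> int) \<times> int"

definition tri_exp :: "int \<Rightarrow> tri \<Rightarrow> real" where
  "tri_exp j p = of_int ((6 * fst (fst p) + 1)\<^sup>2 + (6 * snd (fst p) + 1)\<^sup>2) / 24 + of_int ((6 * snd p + j)\<^sup>2) / 12"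

definition tri_sign :: "tri \<Rightarrow> complex" where
  "tri_sign p = eta_sign (fst (fst p)) * eta_sign (snd (fst p))"

lemma tri_has_sum:
  assumes "\<tau> \<in> upper_half"
  shows "((\<lambda>p. tri_sign p * e2pi (of_real (tri_exp j p) * \<tau>)) has_sum eta \<tau> ^ 2 * V 3 j \<tau>) UNIV"
proof -
  have "((\<lambda>p. (eta_sign (fst (fst p)) * e2pi (of_real (real_of_int (6 * fst (fst p) + 1) ^ 2 / 24) * \<tau>) *
        (eta_sign (snd (fst p)) * e2pi (of_real (real_of_int (6 * snd (fst p) + 1) ^ 2 / 24) * \<tau>))) *
      e2pi (of_real (real_of_int (2 * int 3 * snd p + j) ^ 2 / (4 * real 3)) * \<tau>)) has_sum (eta \<tau> * eta \<tau>) * V 3 j \<tau>) ((UNIV \<times> UNIV) \<times> UNIV)"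
    by (intro has_sum_Times_mult eta_has_sum[OF assms] V_has_sum[OF _ assms]
        has_sum_Times_mult[of "\<lambda>n. eta_sign n * e2pi (of_real (real_of_int (6 * n + 1) ^ 2 / 24) * \<tau>)"]) simp
  moreover have "tri_sign p * e2pi (of_real (tri_exp j p) * \<tau>) = (eta_sign (fst (fst p)) * e2pi (of_real (real_of_int (6 * fst (fst p) + 1) ^ 2 / 24) * \<tau>) *
        (eta_sign (snd (fst p)) * e2pi (of_real (real_of_int (6 * snd (fst p) + 1) ^ 2 / 24) * \<tau>))) *
      e2pi (of_real (real_of_int (2 * int 3 * snd p + j) ^ 2 / (4 * real 3)) * \<tau>)" for p
  proof -
    have "of_real (tri_exp j p) * \<tau> = of_real (real_of_int (6 * fst (fst p) + 1) ^ 2 / 24) * \<tau> + of_real (real_of_int (6 * snd (fst p) + 1) ^ 2 / 24) * \<tau>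
        + of_real (real_of_int (2 * int 3 * snd p + j) ^ 2 / (4 * real 3)) * \<tau>"
      by (simp add: tri_exp_def add_divide_distrib algebra_simps)
    then show ?thesis by (simp only: e2pi_add tri_sign_def mult_ac)
  qed
  ultimately show ?thesis by (simp add: power2_eq_square)
qed

lemma tri_exp_pos: "tri_exp j p > 0"
proof -
  have pos: "(6 * k + 1)\<^sup>2 > 0" for k :: int by (simp, presburger)
  have "real_of_int ((6 * fst (fst p) + 1)\<^sup>2 + (6 * snd (fst p) + 1)\<^sup>2) > 0"
    unfolding of_int_0_less_iff by (rule add_pos_pos[OF pos pos])
  then show ?thesis unfolding tri_exp_def by (intro add_pos_nonneg divide_pos_pos) simp_all
qed

lemma tri_exp_Ints:
  assumes "x \<in> {0, 1}" "y \<in> {0, 1}" "z \<in> {0, 1}" "u \<in> {0, 1, 2}" "v \<in> {0, 1, 2}" "x \<noteq> y" "u \<noteq> 0"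
  shows "tri_exp (3 * z + 2 * v) p - disc_q (cl (x, y, z, u, v)) \<in> \<int>"
proof -
  obtain k l n where p: "p = ((k, l), n)" by (metis prod.exhaust)
  obtain m where m: "qk (x, y, z, u, v) = 1 / 12 + (of_int (3 * z + 2 * v))\<^sup>2 / 12 - of_int m"
    using qk_tri[OF assms] by blast
  define j where "j = 3 * z + 2 * v"
  have "even (k * (3 * k + 1))" "even (l * (3 * l + 1))" by auto
  then obtain a b where ab: "k * (3 * k + 1) = 2 * a" "l * (3 * l + 1) = 2 * b" by (elim evenE)
  have "tri_exp j p - qk (x, y, z, u, v) = of_int (12 * (k * (3 * k + 1)) + 12 * (l * (3 * l + 1))) / 24 + of_int (3 * n * n + n * j + m)"
    unfolding m j_def[symmetric] by (simp add: p tri_exp_def power2_eq_square field_simps)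
  also have "\<dots> = of_int (a + b + 3 * n * n + n * j + m)" unfolding ab by simp
  finally have "tri_exp j p - qk (x, y, z, u, v) \<in> \<int>" by (metis Ints_of_int)
  moreover have "qk (x, y, z, u, v) - disc_q (cl (x, y, z, u, v)) \<in> \<int>" unfolding disc_q_cl by (simp add: frac_def)
  ultimately have "(tri_exp j p - qk (x, y, z, u, v)) + (qk (x, y, z, u, v) - disc_q (cl (x, y, z, u, v))) \<in> \<int>" by (rule Ints_add)
  then show ?thesis unfolding j_def by simp
qed

lemma b2_S32: "b2 \<in> S32"
proof -
  define \<kappa> where "\<kappa> = (\<lambda>\<gamma>. case ix \<gamma> of (x, y, z, u, v) \<Rightarrow> of_int (y mod 2 - x mod 2) * sg u)"
  define j where "j = (\<lambda>\<gamma>. case ix \<gamma> of (x, y, z, u, v) \<Rightarrow> 3 * z + 2 * v)"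
  \<comment> \<open>The index set is emptied where the component is identically zero, since there
    the exponents of the triple series may lie outside the class of \<open>disc_q\<close>.\<close>
  define I where "I = (\<lambda>\<gamma>. if \<kappa> \<gamma> = 0 then {} else UNIV :: tri set)"
  define c where "c = (\<lambda>\<gamma> e. if \<gamma> \<in> Disc \<and> e - disc_q \<gamma> \<in> \<int>
     then \<Sum>\<^sub>\<infinity>p\<in>{p \<in> I \<gamma>. tri_exp (j \<gamma>) p = e}. \<kappa> \<gamma> * tri_sign p else 0)"
  have b2: "b2 \<tau> \<gamma> = \<kappa> \<gamma> * (eta \<tau> ^ 2 * V 3 (j \<gamma>) \<tau>)" if "\<tau> \<in> upper_half" "\<gamma> \<in> Disc" for \<tau> \<gamma>
    using that by (cases "ix \<gamma>") (simp add: b2_def tht_def \<kappa>_def j_def mult_ac)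
  have ex: "fourier_expansion b2 c"
    unfolding fourier_expansion_def
  proof (intro conjI allI ballI impI)
    fix \<gamma> e assume "\<gamma> \<notin> Disc \<or> e - disc_q \<gamma> \<notin> \<int>"
    then show "c \<gamma> e = 0" by (auto simp: c_def)
  next
    fix \<gamma> \<tau> assume g: "\<gamma> \<in> Disc" and t: "\<tau> \<in> upper_half"
    have 1: "((\<lambda>p. (\<kappa> \<gamma> * tri_sign p) * e2pi (of_real (tri_exp (j \<gamma>) p) * \<tau>)) has_sum b2 \<tau> \<gamma>) (I \<gamma>)"
    proof (cases "\<kappa> \<gamma> = 0")
      case True
      then show ?thesis using b2[OF t g] by (simp add: I_def)
    next
      case False
      then show ?thesis unfolding b2[OF t g] I_def
        using has_sum_cmult_right[OF tri_has_sum[OF t], of "\<kappa> \<gamma>" "j \<gamma>"] by (simp add: mult_ac)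
    qed
    have 2: "tri_exp (j \<gamma>) p \<in> {e. e - disc_q \<gamma> \<in> \<int>}" if "p \<in> I \<gamma>" for p
    proof -
      have "\<kappa> \<gamma> \<noteq> 0" using that by (auto simp: I_def split: if_splits)
      moreover have "ix \<gamma> \<in> KK" by (rule ix_in_KK[OF g])
      then obtain x y z u v where k: "ix \<gamma> = (x, y, z, u, v)" "x \<in> {0, 1}" "y \<in> {0, 1}" "z \<in> {0, 1}" "u \<in> {0, 1, 2}" "v \<in> {0, 1, 2}" by (rule KK_cases)
      ultimately have "x \<noteq> y" "u \<noteq> 0" by (auto simp: \<kappa>_def)
      from tri_exp_Ints[OF k(2-6) this] show ?thesis using cl_ix[OF g] k(1) by (simp add: j_def)
    qed
    show "((\<lambda>e. c \<gamma> e * e2pi (of_real e * \<tau>)) has_sum b2 \<tau> \<gamma>) {e. e - disc_q \<gamma> \<in> \<int>}"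
      by (rule has_sum_cong[THEN iffD1, OF _ qseries_collect[OF 1 2]]) (use g in \<open>auto simp: c_def\<close>)
  qed
  have neg: "c \<gamma> e = 0" if "e \<le> 0" for \<gamma> e
  proof -
    have em: "{p \<in> I \<gamma>. tri_exp (j \<gamma>) p = e} = {}" using tri_exp_pos \<open>e \<le> 0\<close> by (auto simp: not_less[symmetric])
    show ?thesis by (simp only: c_def em infsum_empty if_cancel)
  qed
  show ?thesis
  proof (rule S32_I[OF _ _ b2_T b2_S ex neg])
    show "b2 \<tau> \<gamma> = 0" if "\<tau> \<notin> upper_half \<or> \<gamma> \<notin> Disc" for \<tau> \<gamma> using that by (auto simp: b2_def)
    show "(\<lambda>\<tau>. b2 \<tau> \<gamma>) holomorphic_on upper_half" if g: "\<gamma> \<in> Disc" for \<gamma>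
    proof -
      have "(\<lambda>\<tau>. \<kappa> \<gamma> * (eta \<tau> ^ 2 * V 3 (j \<gamma>) \<tau>)) holomorphic_on upper_half" by (intro holomorphic_intros) simp
      then show ?thesis using b2 g by (simp cong: holomorphic_cong)
    qed
  qed
qed

text \<open>The exponents \<open>1/12\<close> and \<open>1/6\<close> of the slots are leading exponents of the components of \<open>b2\<close>.\<close>

definition bt :: "int \<Rightarrow> complex" where
  "bt x = of_int (x mod 2)"

lemma b2_coeff:
  assumes m: "m - disc_q (cl (x, y, z, u, v)) \<in> \<int>" "m \<in> {1 / 12, 1 / 6}"
  shows "fourier_coeff b2 (cl (x, y, z, u, v)) m = - (bt x - bt y) * sg u"
proof -
  have "ix (cl (x, y, z, u, v)) \<in> KK" by (intro ix_in_KK) simp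
  then obtain x' y' z' u' v' where k: "ix (cl (x, y, z, u, v)) = (x', y', z', u', v')" "x' \<in> {0, 1}" "y' \<in> {0, 1}" "z' \<in> {0, 1}" "u' \<in> {0, 1, 2}" "v' \<in> {0, 1, 2}" by (rule KK_cases)
  have x': "x' = x mod 2" "y' = y mod 2" "u' = u mod 3" using k(1) by (simp_all add: ix_cl)
  have g: "cl (x, y, z, u, v) = cl (x', y', z', u', v')" using cl_ix[OF cl_in_Disc] k(1) by metis
  have L: "lead (\<lambda>\<tau>. b2 \<tau> (cl (x', y', z', u', v'))) m (fourier_coeff b2 (cl (x, y, z, u, v)) m)"
    unfolding g[symmetric] by (rule S32_lead[OF b2_S32 cl_in_Disc m(1)]) (use m(2) in auto)
  have r: "- (bt x - bt y) * sg u = of_int (y' mod 2 - x' mod 2) * sg u'" by (simp add: bt_def x' sg_def)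
  show ?thesis
  proof (cases "x' = y' \<or> u' = 0")
    case True
    have "lead (\<lambda>\<tau>. 0) m 0" by (rule lead_zero)
    from lead_unique[OF L this] have "fourier_coeff b2 (cl (x, y, z, u, v)) m = 0"
      using True by (auto simp: b2_cl tht_def)
    then show ?thesis unfolding r using True by auto
  next
    case False
    define j where "j = 3 * z' + 2 * v'"
    obtain n where n: "qk (x', y', z', u', v') = 1 / 12 + (of_int j)\<^sup>2 / 12 - of_int n"
      using qk_tri[OF k(2-6)] False unfolding j_def by blast
    have "m - qk (x', y', z', u', v') \<in> \<int>"
    proof -
      have "qk (x', y', z', u', v') - disc_q (cl (x', y', z', u', v')) \<in> \<int>" unfolding disc_q_cl by (simp add: frac_def)
      from Ints_diff[OF m(1)[unfolded g] this] show ?thesis by simp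
    qed
    then obtain q where q: "m - qk (x', y', z', u', v') = of_int q" by (elim Ints_cases)
    \<comment> \<open>The exponents force j^2 = 12m - 1 modulo 12, so j is 0 for m = 1/12 and
      congruent to 1 or -1 modulo 6 for m = 1/6. In both cases the theta series starts with
      coefficient 1.\<close>
    have jm: "m = 1 / 12 \<and> j = 0 \<or> m = 1 / 6 \<and> (j = 5 \<or> j = 7)"
    proof -
      have "12 * m = 1 + of_int (j\<^sup>2) + of_int (12 * (q - n))" using q unfolding n by simp
      moreover have "12 * m = of_int (if m = 1 / 12 then 1 else 2)" using m(2) by auto
      ultimately have "real_of_int (if m = 1 / 12 then 1 else 2) = of_int (1 + j\<^sup>2 + 12 * (q - n))" by simp
      then have i: "(if m = 1 / 12 then 1 else 2) = 1 + j\<^sup>2 + 12 * (q - n)" by (simp only: of_int_eq_iff)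
      have "j = 0 \<or> j = 2 \<or> j = 4 \<or> j = 3 \<or> j = 5 \<or> j = 7" using k(4,6) unfolding j_def by auto
      then show ?thesis using i m(2) by (elim disjE) (simp_all split: if_splits, presburger+)
    qed
    have Vl: "lead (V 3 j) (m - 1 / 12) 1"
    proof -
      have e: "V 3 5 = V 3 1" "V 3 7 = V 3 1"
        using V_mod[of "- 1"] V_mod[of 7] V_uminus[of 3 1] by (auto simp: fun_eq_iff)
      have l: "lead (V 3 0) 0 1" "lead (V 3 1) (1 / 12) 1" by (rule V_lead'; simp)+
      show ?thesis using jm by (elim disjE conjE; hypsubst; simp add: e l)
    qed
    have "lead (\<lambda>\<tau>. (of_int (y' mod 2 - x' mod 2) * sg u') * (eta \<tau> ^ 2 * V 3 j \<tau>)) m ((of_int (y' mod 2 - x' mod 2) * sg u') * (1 ^ 2 * 1))"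
      using lead_cmult[OF lead_mult[OF lead_power[OF eta_lead, of 2] Vl]] by simp
    from lead_unique[OF L this] show ?thesis unfolding r by (simp add: b2_cl tht_def j_def mult_ac)
  qed
qed

section \<open>The space of cusp forms and its echelon basis\<close>

lemma S32_lin:
  assumes F: "F \<in> S32" and H: "H \<in> S32"
  shows "form_scale a F + form_scale b H \<in> S32"
    "fourier_coeff (form_scale a F + form_scale b H) \<gamma> e = a * fourier_coeff F \<gamma> e + b * fourier_coeff H \<gamma> e"
proof -
  let ?G = "form_scale a F + form_scale b H"
  have G: "?G \<tau> \<gamma> = a * F \<tau> \<gamma> + b * H \<tau> \<gamma>" for \<tau> \<gamma> by (simp add: form_scale_def)
  have ex: "fourier_expansion ?G (\<lambda>\<gamma> e. a * fourier_coeff F \<gamma> e + b * fourier_coeff H \<gamma> e)"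
    unfolding fourier_expansion_def
  proof (intro conjI allI ballI impI)
    fix \<gamma> e assume "\<gamma> \<notin> Disc \<or> e - disc_q \<gamma> \<notin> \<int>"
    then have "fourier_coeff F \<gamma> e = 0" "fourier_coeff H \<gamma> e = 0"
      using S32_expansion(1)[OF F] S32_expansion(1)[OF H] unfolding fourier_expansion_def by blast+
    then show "a * fourier_coeff F \<gamma> e + b * fourier_coeff H \<gamma> e = 0" by simp
  next
    fix \<gamma> \<tau> assume g: "\<gamma> \<in> Disc" "\<tau> \<in> upper_half"
    show "((\<lambda>e. (a * fourier_coeff F \<gamma> e + b * fourier_coeff H \<gamma> e) * e2pi (of_real e * \<tau>)) has_sum ?G \<tau> \<gamma>) {e. e - disc_q \<gamma> \<in> \<int>}"
      using has_sum_add[OF has_sum_cmult_right[OF S32_has_sum[OF F g], of a] has_sum_cmult_right[OF S32_has_sum[OF H g], of b]]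
      unfolding G by (simp add: algebra_simps)
  qed
  from fourier_coeff_eqI[OF ex]
  show "fourier_coeff ?G \<gamma> e = a * fourier_coeff F \<gamma> e + b * fourier_coeff H \<gamma> e" by simp
  show "?G \<in> S32"
  proof (rule S32_I[OF _ _ _ _ ex])
    show "?G \<tau> \<gamma> = 0" if "\<tau> \<notin> upper_half \<or> \<gamma> \<notin> Disc" for \<tau> \<gamma>
      using S32_zero[OF F that] S32_zero[OF H that] G by simp
    show "(\<lambda>\<tau>. ?G \<tau> \<gamma>) holomorphic_on upper_half" if "\<gamma> \<in> Disc" for \<gamma>
      unfolding G by (intro holomorphic_intros S32_hol[OF F that] S32_hol[OF H that])
    show "?G (\<tau> + 1) \<gamma> = e2pi (of_real (disc_q \<gamma>)) * ?G \<tau> \<gamma>" if "\<tau> \<in> upper_half" "\<gamma> \<in> Disc" for \<tau> \<gamma>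
      unfolding G S32_T[OF F that] S32_T[OF H that] by (simp add: algebra_simps)
    show "?G (- 1 / \<tau>) \<gamma> = \<i> * csqrt (- \<i> * \<tau>) ^ 3 / of_real (sqrt 72) * (\<Sum>\<delta>\<in>Disc. chi \<delta> \<gamma> * ?G \<tau> \<delta>)"
      if "\<tau> \<in> upper_half" "\<gamma> \<in> Disc" for \<tau> \<gamma>
    proof -
      define K where "K = \<i> * csqrt (- \<i> * \<tau>) ^ 3 / of_real (sqrt 72)"
      have "(\<Sum>\<delta>\<in>Disc. chi \<delta> \<gamma> * ?G \<tau> \<delta>) = a * (\<Sum>\<delta>\<in>Disc. chi \<delta> \<gamma> * F \<tau> \<delta>) + b * (\<Sum>\<delta>\<in>Disc. chi \<delta> \<gamma> * H \<tau> \<delta>)"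
        unfolding G sum_distrib_left sum.distrib[symmetric] by (intro sum.cong refl) (simp add: algebra_simps)
      then show ?thesis unfolding G S32_S[OF F that] S32_S[OF H that] K_def[symmetric] by (simp add: algebra_simps)
    qed
    show "a * fourier_coeff F \<gamma> e + b * fourier_coeff H \<gamma> e = 0" if "e \<le> 0" for \<gamma> e
      using S32_expansion(2)[OF F that] S32_expansion(2)[OF H that] by simp
  qed
qed

lemma S32_0: "0 \<in> S32" "fourier_coeff 0 \<gamma> e = 0"
  using S32_lin[OF b2_S32 b2_S32, of 0 0] by (simp_all add: form.scale_zero_left)

lemma S32_scale:
  assumes "F \<in> S32"
  shows "form_scale a F \<in> S32" "fourier_coeff (form_scale a F) \<gamma> e = a * fourier_coeff F \<gamma> e"
  using S32_lin[OF assms S32_0(1), of a 0] by simp_all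

lemma S32_add:
  assumes "F \<in> S32" "H \<in> S32"
  shows "F + H \<in> S32" "fourier_coeff (F + H) \<gamma> e = fourier_coeff F \<gamma> e + fourier_coeff H \<gamma> e"
  using S32_lin[OF assms, of 1 1] by simp_all

lemma subspace_S32: "form.subspace S32"
  by (rule form.subspaceI) (auto intro: S32_0 S32_add S32_scale)

lemma S32_sum:
  assumes "finite A" "\<And>i. f i \<in> S32"
  shows "(\<Sum>i\<in>A. form_scale (c i) (f i)) \<in> S32 \<and>
    (\<forall>\<gamma> e. fourier_coeff (\<Sum>i\<in>A. form_scale (c i) (f i)) \<gamma> e = (\<Sum>i\<in>A. c i * fourier_coeff (f i) \<gamma> e))"
  using assms(1)
proof induction
  case empty
  show ?case unfolding sum.empty using S32_0 by blast
next
  case (insert x A)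
  let ?S = "\<Sum>i\<in>A. form_scale (c i) (f i)"
  have 1: "form_scale (c x) (f x) \<in> S32" by (rule S32_scale[OF assms(2)])
  have 2: "?S \<in> S32" using insert.IH by blast
  have "fourier_coeff (form_scale (c x) (f x) + ?S) \<gamma> e = c x * fourier_coeff (f x) \<gamma> e + (\<Sum>i\<in>A. c i * fourier_coeff (f i) \<gamma> e)" for \<gamma> e
    unfolding S32_add(2)[OF 1 2] S32_scale(2)[OF assms(2)] using insert.IH by simp
  then show ?case unfolding sum.insert[OF insert.hyps] using S32_add(1)[OF 1 2] by blast
qed

section \<open>Translates of the theta product and their pivots\<close>

definition sel4 :: "'a \<Rightarrow> 'a \<Rightarrow> 'a \<Rightarrow> 'a \<Rightarrow> 4 \<Rightarrow> 'a" where
  "sel4 a b c d i = (if i = 1 then a else if i = 2 then b else if i = 3 then c else d)"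

lemma sel4_simps [simp]: "sel4 a b c d 1 = a" "sel4 a b c d 2 = b" "sel4 a b c d 3 = c" "sel4 a b c d 4 = d"
  by (simp_all add: sel4_def)

text \<open>The isometries exchange the two 3-parts, the first and third 2-parts, or both; the sign
  in the fourth makes its pivot coefficient 1.\<close>

definition bas :: "4 \<Rightarrow> form" where
  "bas = sel4 (act (sig ((0, 1, 2), (True, 1, 1))) b2) b2
     (act (sig ((2, 1, 0), (False, 1, 1))) b2) (act (sig ((2, 1, 0), (True, 1, - 1))) b2)"

text \<open>The columns of the matrix \<open>Phi\<close>: by \<open>bas_coeff\<close> these are the
  basis coefficients at both slot exponents.\<close>

definition tab :: "4 \<Rightarrow> idx \<Rightarrow> complex" where
  "tab = (\<lambda>i (x, y, z, u, v). sel4 (- (bt x - bt y) * sg v) (- (bt x - bt y) * sg u) (- (bt z - bt y) * sg u) ((bt z - bt y) * sg v) i)"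

text \<open>In the tie-breaking order, the classes of exponent 1/12 whose coefficient is not
  determined by earlier ones through oddness and the two relations.\<close>

definition piv :: "4 \<Rightarrow> idx" where
  "piv = sel4 (1, 0, 0, 0, 2) (1, 0, 0, 2, 0) (0, 0, 1, 2, 0) (0, 0, 1, 0, 1)"

lemma act_sig_coeff:
  assumes F: "F \<in> S32" and g: "g \<in> syms" and e: "cl (move g (x', y', z', u', v')) = cl k"
  shows "fourier_coeff (act (sig g) F) (cl k) m = fourier_coeff F (cl (x', y', z', u', v')) m"
    "disc_q (cl (x', y', z', u', v')) = disc_q (cl k)"
  using act_coeff[OF F sig_O_disc[OF g] cl_in_Disc[of k]] inv_Disc(4)[OF sig_O_disc[OF g] cl_in_Disc[of k]]
  unfolding inv_sig[OF g e] by simp_all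

lemma sg_minus: "sg (- v) = - sg v"
proof -
  have "v mod 3 = 0 \<or> v mod 3 = 1 \<or> v mod 3 = 2" by presburger
  then show ?thesis by (auto simp: sg_def zmod_zminus1_eq_if)
qed

lemma bas_S32: "bas i \<in> S32"
  using exhaust_4[of i] act_S32[OF b2_S32 sig_O_disc] b2_S32 by (auto simp: bas_def syms_def)

lemma bas_coeff:
  assumes m: "m - disc_q (cl k) \<in> \<int>" "m \<in> {1 / 12, 1 / 6}"
  shows "fourier_coeff (bas i) (cl k) m = tab i k"
proof -
  obtain x y z u v where k: "k = (x, y, z, u, v)" by (cases k)
  have s: "((0, 1, 2), (True, 1, 1)) \<in> syms" "((2, 1, 0), (False, 1, 1)) \<in> syms" "((2, 1, 0), (True, 1, - 1)) \<in> syms"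
    by (simp_all add: syms_def)
  note a1 = act_sig_coeff[OF b2_S32 s(1), of x y z v u k]
  note a3 = act_sig_coeff[OF b2_S32 s(2), of z y x u v k]
  note a4 = act_sig_coeff[OF b2_S32 s(3), of z y x "- v" u k]
  have "fourier_coeff (bas 1) (cl k) m = tab 1 k"
    using a1 b2_coeff[of m x y z v u] m by (simp add: k bas_def tab_def)
  moreover have "fourier_coeff (bas 2) (cl k) m = tab 2 k"
    using b2_coeff[of m x y z u v] m by (simp add: k bas_def tab_def)
  moreover have "fourier_coeff (bas 3) (cl k) m = tab 3 k"
    using a3 b2_coeff[of m z y x u v] m by (simp add: k bas_def tab_def)
  moreover have "fourier_coeff (bas 4) (cl k) m = tab 4 k"
    using a4 b2_coeff[of m z y x "- v" u] m by (simp add: k bas_def tab_def sg_minus) (simp add: algebra_simps)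
  ultimately show ?thesis using exhaust_4[of i] by metis
qed

lemma exponent_cl: "of_int a / 12 - disc_q (cl (x, y, z, u, v)) \<in> \<int> \<longleftrightarrow> 12 dvd a - (- 3 * (x\<^sup>2 + y\<^sup>2 + z\<^sup>2) + 4 * (u\<^sup>2 + v\<^sup>2))"
proof -
  have "of_int a / 12 - disc_q (cl (x, y, z, u, v)) = of_int (a - (- 3 * (x\<^sup>2 + y\<^sup>2 + z\<^sup>2) + 4 * (u\<^sup>2 + v\<^sup>2))) / of_int 12 + of_int \<lfloor>qk (x, y, z, u, v)\<rfloor>"
    unfolding disc_q_cl frac_def by (simp add: qk_def diff_divide_distrib)
  then show ?thesis using of_int_div_Ints_iff[of 12 "a - (- 3 * (x\<^sup>2 + y\<^sup>2 + z\<^sup>2) + 4 * (u\<^sup>2 + v\<^sup>2))"]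
    by (metis Ints_of_int Ints_add Ints_diff add_diff_cancel_right' zero_less_numeral)
qed

text \<open>The classes of norm 1/12, with one nonzero coordinate of order 2 and one of order 3.
  Those of norm 1/6, collected in \<open>N6\<close>, have two of each.\<close>

definition N12 :: "idx set" where
  "N12 = {(1, 0, 0, 1, 0), (1, 0, 0, 2, 0), (1, 0, 0, 0, 1), (1, 0, 0, 0, 2), (0, 1, 0, 1, 0), (0, 1, 0, 2, 0),
    (0, 1, 0, 0, 1), (0, 1, 0, 0, 2), (0, 0, 1, 1, 0), (0, 0, 1, 2, 0), (0, 0, 1, 0, 1), (0, 0, 1, 0, 2)}"

definition N6 :: "idx set" where
  "N6 = {(1, 1, 0, 1, 1), (1, 1, 0, 1, 2), (1, 1, 0, 2, 1), (1, 1, 0, 2, 2), (1, 0, 1, 1, 1), (1, 0, 1, 1, 2),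
    (1, 0, 1, 2, 1), (1, 0, 1, 2, 2), (0, 1, 1, 1, 1), (0, 1, 1, 1, 2), (0, 1, 1, 2, 1), (0, 1, 1, 2, 2)}"

lemma Disc_exponent:
  assumes "\<gamma> \<in> Disc"
  shows "1 / 12 - disc_q \<gamma> \<in> \<int> \<Longrightarrow> \<exists>k\<in>N12. \<gamma> = cl k" "1 / 6 - disc_q \<gamma> \<in> \<int> \<Longrightarrow> \<exists>k\<in>N6. \<gamma> = cl k"
proof -
  have "ix \<gamma> \<in> KK" by (rule ix_in_KK[OF assms])
  then obtain x y z u v where k: "ix \<gamma> = (x, y, z, u, v)" "x \<in> {0, 1}" "y \<in> {0, 1}" "z \<in> {0, 1}" "u \<in> {0, 1, 2}" "v \<in> {0, 1, 2}" by (rule KK_cases)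
  have g: "\<gamma> = cl (x, y, z, u, v)" using cl_ix[OF assms] k(1) by simp
  have "(x, y, z, u, v) \<in> N12" if "12 dvd 1 - (- 3 * (x\<^sup>2 + y\<^sup>2 + z\<^sup>2) + 4 * (u\<^sup>2 + v\<^sup>2))"
    using k(2-6) that by (elim insertE emptyE) (simp_all add: N12_def)
  then show "1 / 12 - disc_q \<gamma> \<in> \<int> \<Longrightarrow> \<exists>k\<in>N12. \<gamma> = cl k" using exponent_cl[of 1 x y z u v] g by auto
  have "(x, y, z, u, v) \<in> N6" if "12 dvd 2 - (- 3 * (x\<^sup>2 + y\<^sup>2 + z\<^sup>2) + 4 * (u\<^sup>2 + v\<^sup>2))"
    using k(2-6) that by (elim insertE emptyE) (simp_all add: N6_def)
  then show "1 / 6 - disc_q \<gamma> \<in> \<int> \<Longrightarrow> \<exists>k\<in>N6. \<gamma> = cl k" using exponent_cl[of 2 x y z u v] g by auto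
qed

lemma N12_exponent: "k \<in> N12 \<Longrightarrow> 1 / 12 - disc_q (cl k) \<in> \<int>"
proof -
  assume "k \<in> N12"
  moreover obtain x y z u v where k: "k = (x, y, z, u, v)" by (cases k)
  ultimately show ?thesis using exponent_cl[of 1 x y z u v] unfolding N12_def k by (elim insertE emptyE) simp_all
qed

lemma N6_exponent: "k \<in> N6 \<Longrightarrow> 1 / 6 - disc_q (cl k) \<in> \<int>"
proof -
  assume "k \<in> N6"
  moreover obtain x y z u v where k: "k = (x, y, z, u, v)" by (cases k)
  ultimately show ?thesis using exponent_cl[of 2 x y z u v] unfolding N6_def k by (elim insertE emptyE) simp_all
qed

lemma piv_N12: "piv i \<in> N12"
  using exhaust_4[of i] by (auto simp: piv_def N12_def)

lemma bas_coeff_N12: "k \<in> N12 \<Longrightarrow> fourier_coeff (bas i) (cl k) (1 / 12) = tab i k"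
  using bas_coeff[OF N12_exponent] by simp

lemma bt_simps [simp]: "bt 0 = 0" "bt 1 = 1" by (simp_all add: bt_def)

lemma bas_piv: "fourier_coeff (bas j) (cl (piv i)) (1 / 12) = (if j = i then 1 else 0)"
  unfolding bas_coeff_N12[OF piv_N12]
  using exhaust_4[of i] exhaust_4[of j] by (elim disjE) (simp_all add: tab_def piv_def)

lemma S32_coeff_not_Ints: "F \<in> S32 \<Longrightarrow> \<gamma> \<notin> Disc \<or> e - disc_q \<gamma> \<notin> \<int> \<Longrightarrow> fourier_coeff F \<gamma> e = 0"
  using S32_expansion(1) unfolding fourier_expansion_def by blast

text \<open>Oddness settles the opposites of the pivots. The relation for G and for its image under
  the exchange of u and v then settles the coefficients whose middle coordinate is nonzero, and
  \<open>S32_eq_0\<close> concludes.\<close>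

lemma S32_determined:
  assumes G: "G \<in> S32" and p: "\<And>i. fourier_coeff G (cl (piv i)) (1 / 12) = 0"
  shows "G = 0"
proof -
  define c where "c = (\<lambda>H k. fourier_coeff H (cl k) (1 / 12))"
  have o: "c H (x, y, z, 2, 0) = - c H (x, y, z, 1, 0)" "c H (x, y, z, 0, 2) = - c H (x, y, z, 0, 1)"
    if H: "H \<in> S32" and e: "(x, y, z) \<in> {(1, 0, 0), (0, 1, 0), (0, 0, 1)}" for H x y z
  proof -
    have "(x, y, z, 1, 0) \<in> N12" "(x, y, z, 0, 1) \<in> N12" using e by (auto simp: N12_def)
    note n = this[THEN N12_exponent]
    have "cl (- x, - y, - z, - 1, - 0) = cl (x, y, z, 2, 0)" "cl (- x, - y, - z, - 0, - 1) = cl (x, y, z, 0, 2)"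
      using e by (auto simp: cl_eq_iff)
    then show "c H (x, y, z, 2, 0) = - c H (x, y, z, 1, 0)" "c H (x, y, z, 0, 2) = - c H (x, y, z, 0, 1)"
      using S32_coeff_odd[OF H n(1)] S32_coeff_odd[OF H n(2)] unfolding c_def by simp_all
  qed
  let ?g = "((0, 1, 2), (True, 1, 1)) :: sym"
  have s: "?g \<in> syms" by (simp add: syms_def)
  have GS: "act (sig ?g) G \<in> S32" by (rule act_S32[OF G sig_O_disc[OF s]])
  have sw: "c (act (sig ?g) G) (x, y, z, u, v) = c G (x, y, z, v, u)" for x y z u v
    unfolding c_def by (rule act_sig_coeff(1)[OF G s]) simp
  have p': "c G (1, 0, 0, 0, 2) = 0" "c G (1, 0, 0, 2, 0) = 0" "c G (0, 0, 1, 2, 0) = 0" "c G (0, 0, 1, 0, 1) = 0"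
    using p[of 1] p[of 2] p[of 3] p[of 4] by (simp_all add: c_def piv_def)
  have r: "(c H (1, 0, 0, 1, 0) - c H (1, 0, 0, 2, 0)) + (c H (0, 1, 0, 1, 0) - c H (0, 1, 0, 2, 0)) + (c H (0, 0, 1, 1, 0) - c H (0, 0, 1, 2, 0)) = 0"
    if "H \<in> S32" for H using S32_coeff_relation[OF that] unfolding c_def .
  have z: "c G k = 0" if "k \<in> N12" for k
    using that r[OF G] r[OF GS] o[OF G, of 1 0 0] o[OF G, of 0 1 0] o[OF G, of 0 0 1] p' unfolding sw N12_def
    by (elim insertE emptyE) simp_all
  have "fourier_coeff G \<gamma> (1 / 12) = 0" if "\<gamma> \<in> Disc" for \<gamma>
    using Disc_exponent(1)[OF that] z S32_coeff_not_Ints[OF G] unfolding c_def by blast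
  from S32_eq_0[OF G this] show ?thesis by (simp add: zero_fun_def)
qed

lemma S32_eqI:
  assumes F: "F \<in> S32" and H: "H \<in> S32"
    and "\<And>i. fourier_coeff F (cl (piv i)) (1 / 12) = fourier_coeff H (cl (piv i)) (1 / 12)"
  shows "F = H"
proof -
  have "form_scale 1 F + form_scale (- 1) H = 0"
    by (rule S32_determined[OF S32_lin(1)[OF F H]]) (unfold S32_lin(2)[OF F H] assms(3), simp)
  then show ?thesis by (simp add: form.scale_minus_left)
qed

definition comb :: "(4 \<Rightarrow> complex) \<Rightarrow> form" where
  "comb c = (\<Sum>i\<in>UNIV. form_scale (c i) (bas i))"

definition coord :: "form \<Rightarrow> 4 \<Rightarrow> complex" where
  "coord F i = fourier_coeff F (cl (piv i)) (1 / 12)"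

lemma comb_S32: "comb c \<in> S32"
  and comb_coeff: "fourier_coeff (comb c) \<gamma> e = (\<Sum>i\<in>UNIV. c i * fourier_coeff (bas i) \<gamma> e)"
  using S32_sum[of UNIV bas c] bas_S32 by (simp_all add: comb_def)

lemma coord_comb [simp]: "coord (comb c) = c"
  by (rule ext) (simp add: coord_def comb_coeff bas_piv if_distrib[of "\<lambda>x. _ * x"] cong: if_cong)

lemma comb_piv: "fourier_coeff (comb c) (cl (piv i)) (1 / 12) = c i"
  using fun_cong[OF coord_comb, of c i] unfolding coord_def[of "comb c" i] .

lemma comb_coord: "F \<in> S32 \<Longrightarrow> comb (coord F) = F"
  by (rule S32_eqI[OF comb_S32]) (assumption | simp only: comb_piv coord_def)+

lemma S32_comb: 
  assumes "F \<in> S32"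
  obtains c where "F = comb c"
  using comb_coord[OF assms] by metis

lemma inj_bas: "inj bas"
  by (rule injI) (metis bas_piv zero_neq_one)

lemma independent_bas: "form.independent (range bas)"
proof -
  have "u w = 0" if "(\<Sum>w\<in>range bas. form_scale (u w) w) = 0" "w \<in> range bas" for u w
  proof -
    have "(\<Sum>w\<in>range bas. form_scale (u w) w) = comb (\<lambda>i. u (bas i))"
      unfolding comb_def by (rule sum.reindex[OF inj_bas, unfolded o_def])
    then have "coord (comb (\<lambda>i. u (bas i))) = coord 0" using that(1) by simp
    then have "(\<lambda>i. u (bas i)) = (\<lambda>i. 0)" unfolding coord_comb by (simp add: coord_def S32_0 fun_eq_iff)
    then show ?thesis using that(2) by (auto simp: fun_eq_iff)
  qed
  then show ?thesis using form.independent_explicit_finite_subsets[of "range bas"] form.dependent_finite[of "range bas"] by auto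
qed

lemma span_bas: "form.span (range bas) = S32"
proof
  show "form.span (range bas) \<subseteq> S32" by (rule form.span_minimal) (use bas_S32 subspace_S32 in auto)
  show "S32 \<subseteq> form.span (range bas)"
  proof
    fix F assume "F \<in> S32"
    then obtain c where "F = comb c" by (rule S32_comb)
    show "F \<in> form.span (range bas)" unfolding \<open>F = comb c\<close> comb_def
      by (rule form.span_sum, rule form.span_scale, rule form.span_base, rule rangeI)
  qed
qed

text \<open>Numbers the indices in their intended order, since the literal 4 is the zero of the type
  \<open>4\<close>.\<close>

definition rk :: "4 \<Rightarrow> nat" where "rk = sel4 1 2 3 4"

lemma rk_cases: "rk i \<le> 4" "1 \<le> rk i" "rk i = rk j \<Longrightarrow> i = j"
  using exhaust_4[of i] exhaust_4[of j] by (auto simp: rk_def)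

definition pv :: "4 \<Rightarrow> findex" where "pv i = (cl (piv i), 1 / 12)"

lemma pv_findices: "pv i \<in> findices"
  using N12_exponent[OF piv_N12] by (simp add: findices_def pv_def)

lemma pv_less: "findex_less (pv i) (pv j) \<longleftrightarrow> rk i < rk j"
  using exhaust_4[of i] exhaust_4[of j]
  by (elim disjE) (simp_all add: findex_less_def pv_def disc_less_cl piv_def lab_def lex3_def rk_def)

lemma bas_below_pv:
  assumes s: "s \<in> findices" "findex_less s (pv i)"
  shows "coeff_at (bas i) s = 0"
proof (rule ccontr)
  assume nz: "coeff_at (bas i) s \<noteq> 0"
  obtain \<gamma> e where se: "s = (\<gamma>, e)" by (cases s)
  have g: "\<gamma> \<in> Disc" "e - disc_q \<gamma> \<in> \<int>" using s(1) by (simp_all add: se findices_def)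
  have "e \<ge> 1 / 12" using S32_coeff_nonzero[OF bas_S32 g, of i] nz by (simp add: se)
  then have e: "e = 1 / 12" "disc_less \<gamma> (cl (piv i))" using s(2) by (auto simp: se findex_less_def pv_def)
  obtain k where k: "k \<in> N12" "\<gamma> = cl k" using Disc_exponent(1)[OF g(1)] g(2) e(1) by auto
  have t: "tab i k \<noteq> 0" using nz bas_coeff_N12[OF k(1)] by (simp add: se k(2) e(1))
  have l: "(lab k, lab (piv i)) \<in> lex3" using e(2) unfolding k(2) disc_less_cl .
  show False using exhaust_4[of i] k(1) t l unfolding N12_def
    by (elim disjE insertE emptyE; hypsubst; simp add: tab_def lab_def lex3_def piv_def)
qed

lemma echelon_bas: "is_echelon_basis bas"
  unfolding is_echelon_basis_def
proof (intro conjI exI[of _ pv] allI ballI impI)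
  show "findex_less (pv 1) (pv 2)" "findex_less (pv 2) (pv 3)" "findex_less (pv 3) (pv 4)"
    unfolding pv_less by (simp_all add: rk_def)
  show "coeff_at (bas j) (pv i) = (if j = i then 1 else 0)" for i j by (simp add: pv_def bas_piv)
qed (use inj_bas independent_bas span_bas pv_findices bas_below_pv in auto)

text \<open>The first nonvanishing index of a nonzero combination of \<open>bas\<close> is the pivot
  of least rank in its support. So the pivots of any echelon basis are among the \<open>pv\<close>,
  and being increasing they are the \<open>pv\<close> in order; the coefficients there determine the
  forms.\<close>

lemma echelon_unique:
  assumes "is_echelon_basis b"
  shows "b = bas"
proof -
  obtain p where b: "form.span (range b) = S32" "range p \<subseteq> findices"
    "findex_less (p 1) (p 2)" "findex_less (p 2) (p 3)" "findex_less (p 3) (p 4)"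
    "\<And>i s. s \<in> findices \<Longrightarrow> findex_less s (p i) \<Longrightarrow> coeff_at (b i) s = 0"
    "\<And>i j. coeff_at (b j) (p i) = (if j = i then 1 else 0)"
    using assms unfolding is_echelon_basis_def by blast
  have bS: "b i \<in> S32" for i using form.span_base[of "b i" "range b"] unfolding b(1) by simp
  have "\<exists>j. p i = pv j" for i
  proof -
    obtain c where c: "b i = comb c" by (rule S32_comb[OF bS])
    have pf: "p i \<in> findices" using b(2) by blast
    have "\<exists>j. c j \<noteq> 0"
    proof (rule ccontr)
      assume "\<nexists>j. c j \<noteq> 0"
      then have "coeff_at (b i) (p i) = 0" by (simp add: c comb_coeff)
      then show False by (simp add: b(7))
    qed
    then obtain j0 where "c j0 \<noteq> 0" by blast
    from ex_has_least_nat[of "\<lambda>j. c j \<noteq> 0", OF this, of rk]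
    obtain j where j: "c j \<noteq> 0" "\<And>l. c l \<noteq> 0 \<Longrightarrow> rk j \<le> rk l" by blast
    have "coeff_at (b i) (pv j) = c j" by (simp add: c pv_def comb_piv)
    then have 1: "\<not> findex_less (pv j) (p i)" using b(6)[OF pv_findices] j(1) by metis
    have 2: "\<not> findex_less (p i) (pv j)"
    proof
      assume lt: "findex_less (p i) (pv j)"
      have "c l * coeff_at (bas l) (p i) = 0" for l
      proof (cases "c l = 0")
        case False
        then have "pv j = pv l \<or> findex_less (pv j) (pv l)" using j(2)[OF False] rk_cases(3)[of j l] unfolding pv_less by fastforce
        then have "findex_less (p i) (pv l)" using lt findex_less_linear(2)[OF pf pv_findices pv_findices] by metis
        then show ?thesis using bas_below_pv[OF pf] by simp
      qed simp
      then have "coeff_at (b i) (p i) = 0" unfolding c comb_coeff by (intro sum.neutral) simp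
      then show False by (simp add: b(7))
    qed
    show ?thesis using 1 2 findex_less_linear(3)[OF pf pv_findices pf] by blast
  qed
  then obtain h where h: "\<And>i. p i = pv (h i)" by metis
  have "rk (h 1) < rk (h 2)" "rk (h 2) < rk (h 3)" "rk (h 3) < rk (h 4)" using b(3-5) unfolding h pv_less .
  then have "rk (h 1) = 1" "rk (h 2) = 2" "rk (h 3) = 3" "rk (h 4) = 4"
    using rk_cases(1,2)[of "h 1"] rk_cases(1,2)[of "h 4"] by linarith+
  then have "rk (h i) = rk i" for i using exhaust_4[of i] by (auto simp: rk_def)
  then have hi: "h i = i" for i using rk_cases(3) by blast
  show ?thesis
  proof
    fix i
    show "b i = bas i"
      by (rule S32_eqI[OF bS bas_S32]) (use b(7) in \<open>simp add: h hi pv_def bas_piv\<close>)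
  qed
qed

lemma echelon_basis_eq: "echelon_basis = bas"
  unfolding echelon_basis_def using echelon_bas echelon_unique by blast

section \<open>The representation on cusp forms\<close>

definition rep :: "(coset \<Rightarrow> coset) \<Rightarrow> 4 \<Rightarrow> 4 \<Rightarrow> complex" where
  "rep \<sigma> i j = coord (act \<sigma> (bas j)) i"

lemma act_bas: "\<sigma> \<in> O_disc \<Longrightarrow> act \<sigma> (bas j) = comb (\<lambda>i. rep \<sigma> i j)"
  unfolding rep_def using comb_coord[OF act_S32[OF bas_S32]] by metis

lemma rep_matrix_eq:
  assumes "\<sigma> \<in> O_disc"
  shows "rep_matrix \<sigma> = (\<chi> i j. rep \<sigma> i j)"
  unfolding rep_matrix_def echelon_basis_eq
proof (rule the_equality)
  show "\<forall>j. act \<sigma> (bas j) = (\<Sum>i\<in>UNIV. form_scale ((\<chi> i j. rep \<sigma> i j) $ i $ j) (bas i))"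
    using act_bas[OF assms] by (simp add: comb_def)
  fix R assume R: "\<forall>j. act \<sigma> (bas j) = (\<Sum>i\<in>UNIV. form_scale (R $ i $ j) (bas i))"
  then have "act \<sigma> (bas j) = comb (\<lambda>i. R $ i $ j)" for j by (simp add: comb_def)
  then have "rep \<sigma> i j = R $ i $ j" for i j unfolding rep_def by simp
  then show "R = (\<chi> i j. rep \<sigma> i j)" by (simp add: vec_eq_iff)
qed

lemma rep_eq: "\<sigma> \<in> O_disc \<Longrightarrow> rep \<sigma> i j = fourier_coeff (bas j) (inv_into Disc \<sigma> (cl (piv i))) (1 / 12)"
  by (simp add: rep_def coord_def act_coeff[OF bas_S32])

lemma rep_sig:
  assumes "g \<in> syms" "cl (move g k) = cl (piv i)" "k \<in> N12"
  shows "rep (sig g) i j = tab j k"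
proof -
  obtain x y z u v where k: "k = (x, y, z, u, v)" by (cases k)
  show ?thesis unfolding rep_eq[OF sig_O_disc[OF assms(1)]] using bas_coeff_N12[OF assms(3)] inv_sig[OF assms(1), of x y z u v "piv i"] assms(2)
    by (simp add: k)
qed

text \<open>This sign change and the three exchanges \<open>g2\<close>, \<open>g3\<close>,
  \<open>g4\<close> suffice both to pin down the invariant form and to generate the whole space from
  one nonzero vector.\<close>

definition g1 :: sym where "g1 = ((0, 1, 2), (False, - 1, 1))"

definition g2 :: sym where "g2 = ((0, 1, 2), (True, 1, 1))"

definition g3 :: sym where "g3 = ((2, 1, 0), (False, 1, 1))"

definition g4 :: sym where "g4 = ((1, 0, 2), (False, 1, 1))"

lemma g_syms: "g1 \<in> syms" "g2 \<in> syms" "g3 \<in> syms" "g4 \<in> syms"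
  by (simp_all add: g1_def g2_def g3_def g4_def syms_def)

lemma rep_gens:
  "rep (sig g1) i = sel4 (sel4 1 0 0 0) (sel4 0 (- 1) 0 0) (sel4 0 0 (- 1) 0) (sel4 0 0 0 1) i"
  "rep (sig g2) i = sel4 (sel4 0 1 0 0) (sel4 1 0 0 0) (sel4 0 0 0 (- 1)) (sel4 0 0 (- 1) 0) i"
  "rep (sig g3) i = sel4 (sel4 0 0 0 (- 1)) (sel4 0 0 1 0) (sel4 0 1 0 0) (sel4 (- 1) 0 0 0) i"
  "rep (sig g4) i = sel4 (sel4 (- 1) 0 0 1) (sel4 0 (- 1) (- 1) 0) (sel4 0 0 1 0) (sel4 0 0 0 1) i"
proof -
  have c: "f = sel4 a b c d" if "f 1 = a" "f 2 = b" "f 3 = c" "f 4 = d" for f :: "4 \<Rightarrow> complex" and a b c d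
    using that exhaust_4 by (auto simp: fun_eq_iff sel4_def)
  have r: "rep (sig g) i j = tab j (k i)" if "g \<in> syms" "\<And>i. cl (move g (k i)) = cl (piv i)" "\<And>i. k i \<in> N12" for g k i j
    using rep_sig that by blast
  have all: "P i" if "P 1" "P 2" "P 3" "P 4" for P and i :: 4 using that exhaust_4[of i] by auto
  have 1: "rep (sig g1) i j = tab j (sel4 (1, 0, 0, 0, 2) (1, 0, 0, 1, 0) (0, 0, 1, 1, 0) (0, 0, 1, 0, 1) i)" for i j
    by (rule r[OF g_syms(1)]; rule all) (simp_all add: g1_def piv_def cl_eq_iff N12_def)
  have 2: "rep (sig g2) i j = tab j (sel4 (1, 0, 0, 2, 0) (1, 0, 0, 0, 2) (0, 0, 1, 0, 2) (0, 0, 1, 1, 0) i)" for i j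
    by (rule r[OF g_syms(2)]; rule all) (simp_all add: g2_def piv_def cl_eq_iff N12_def)
  have 3: "rep (sig g3) i j = tab j (sel4 (0, 0, 1, 0, 2) (0, 0, 1, 2, 0) (1, 0, 0, 2, 0) (1, 0, 0, 0, 1) i)" for i j
    by (rule r[OF g_syms(3)]; rule all) (simp_all add: g3_def piv_def cl_eq_iff N12_def)
  have 4: "rep (sig g4) i j = tab j (sel4 (0, 1, 0, 0, 2) (0, 1, 0, 2, 0) (0, 0, 1, 2, 0) (0, 0, 1, 0, 1) i)" for i j
    by (rule r[OF g_syms(4)]; rule all) (simp_all add: g4_def piv_def cl_eq_iff N12_def)
  show "rep (sig g1) i = sel4 (sel4 1 0 0 0) (sel4 0 (- 1) 0 0) (sel4 0 0 (- 1) 0) (sel4 0 0 0 1) i"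
    by (rule all[of _ i]; rule ext; rule all) (simp_all add: 1 tab_def)
  show "rep (sig g2) i = sel4 (sel4 0 1 0 0) (sel4 1 0 0 0) (sel4 0 0 0 (- 1)) (sel4 0 0 (- 1) 0) i"
    by (rule all[of _ i]; rule ext; rule all) (simp_all add: 2 tab_def)
  show "rep (sig g3) i = sel4 (sel4 0 0 0 (- 1)) (sel4 0 0 1 0) (sel4 0 1 0 0) (sel4 (- 1) 0 0 0) i"
    by (rule all[of _ i]; rule ext; rule all) (simp_all add: 3 tab_def)
  show "rep (sig g4) i = sel4 (sel4 (- 1) 0 0 1) (sel4 0 (- 1) (- 1) 0) (sel4 0 0 1 0) (sel4 0 0 0 1) i"
    by (rule all[of _ i]; rule ext; rule all) (simp_all add: 4 tab_def)
qed

lemma act_comb: "\<sigma> \<in> O_disc \<Longrightarrow> act \<sigma> (comb c) = comb (\<lambda>i. \<Sum>j\<in>UNIV. rep \<sigma> i j * c j)"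
proof -
  assume \<sigma>: "\<sigma> \<in> O_disc"
  show ?thesis
  proof (rule S32_eqI[OF act_S32[OF comb_S32 \<sigma>] comb_S32])
    fix i
    have "fourier_coeff (act \<sigma> (comb c)) (cl (piv i)) (1 / 12) = (\<Sum>j\<in>UNIV. rep \<sigma> i j * c j)"
      unfolding act_coeff[OF comb_S32 \<sigma> cl_in_Disc] comb_coeff rep_eq[OF \<sigma>] by (simp add: mult.commute)
    then show "fourier_coeff (act \<sigma> (comb c)) (cl (piv i)) (1 / 12) = fourier_coeff (comb (\<lambda>i. \<Sum>j\<in>UNIV. rep \<sigma> i j * c j)) (cl (piv i)) (1 / 12)"
      unfolding comb_piv .
  qed
qed

lemma BS_eq: "BS $ i $ j = sel4 (sel4 (4 / 3) 0 0 (- 2 / 3)) (sel4 0 (4 / 3) (2 / 3) 0) (sel4 0 (2 / 3) (4 / 3) 0) (sel4 (- 2 / 3) 0 0 (4 / 3)) i j"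
  using exhaust_4[of i] exhaust_4[of j] by (elim disjE) (simp_all add: BS_def vector_def)

text \<open>The pairing of the coefficients at exponent \<open>1/12\<close> is an invariant symmetric form.\<close>

lemma gram_bas: "(\<Sum>\<gamma>\<in>Disc. fourier_coeff (bas i) \<gamma> (1 / 12) * fourier_coeff (bas j) \<gamma> (1 / 12)) = 3 * of_real (BS $ i $ j)"
proof -
  have KK: "N12 \<subseteq> KK" by (auto simp: N12_def KK_def)
  have "(\<Sum>\<gamma>\<in>Disc. fourier_coeff (bas i) \<gamma> (1 / 12) * fourier_coeff (bas j) \<gamma> (1 / 12))
      = (\<Sum>\<gamma>\<in>cl ` N12. fourier_coeff (bas i) \<gamma> (1 / 12) * fourier_coeff (bas j) \<gamma> (1 / 12))"
    using Disc_exponent(1) S32_coeff_not_Ints[OF bas_S32]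
    by (intro sum.mono_neutral_right finite_Disc) auto
  also have "\<dots> = (\<Sum>k\<in>N12. tab i k * tab j k)"
    using inj_on_subset[OF bij_betw_imp_inj_on[OF bij_cl] KK] bas_coeff_N12 by (simp add: sum.reindex)
  also have "\<dots> = 3 * of_real (BS $ i $ j)"
    unfolding BS_eq using exhaust_4[of i] exhaust_4[of j] by (elim disjE) (simp_all add: N12_def tab_def)
  finally show ?thesis .
qed

text \<open>The twelve classes of \<open>N12\<close> form a single orbit under the group of order
  48, so each is hit 48/12 = 4 times.\<close>

lemma sum_syms: "(\<Sum>g\<in>syms. f (sig g (cl k))) = 4 * (\<Sum>k\<in>N12. f (cl k))" if "k \<in> range piv" for f :: "coset \<Rightarrow> complex"
proof -
  have n: "cl (x, y, z, - 1, v) = cl (x, y, z, 2, v)" "cl (x, y, z, u, - 1) = cl (x, y, z, u, 2)"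
    "cl (x, y, z, - 2, v) = cl (x, y, z, 1, v)" "cl (x, y, z, u, - 2) = cl (x, y, z, u, 1)" for x y z u v
    by (simp_all add: cl_eq_iff)
  obtain i where "k = piv i" using \<open>k \<in> range piv\<close> by blast
  moreover obtain x y z u v where k: "k = (x, y, z, u, v)" by (cases k)
  ultimately have "(x, y, z, u, v) \<in> {(1, 0, 0, 0, 2), (1, 0, 0, 2, 0), (0, 0, 1, 2, 0), (0, 0, 1, 0, 1)}"
    using exhaust_4[of i] by (auto simp: piv_def)
  moreover have "(\<Sum>g\<in>syms. f (sig g (cl k))) = (\<Sum>p\<in>{(0, 1, 2), (1, 0, 2), (2, 1, 0), (0, 2, 1), (1, 2, 0), (2, 0, 1)}. \<Sum>w\<in>UNIV. \<Sum>s\<in>{1, - 1}. \<Sum>t\<in>{1, - 1}.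
     f (cl (move (p, (w, s, t)) k)))"
    unfolding sum.cartesian_product by (intro sum.cong) (auto simp: syms_def k sig_cl)
  ultimately show ?thesis unfolding k
    by (elim insertE emptyE) (simp_all add: UNIV_bool n N12_def)
qed

text \<open>An entry of a representation matrix is a basis coefficient at a translate of a pivot.
  Summing over the group replaces each of the four pivots by four times its orbit, whose sum of
  products is 3 \<open>BS\<close>; and 4 * 4 * 3 = 48.\<close>

lemma average_gram: "BSc = (1 / 48) *\<^sub>R (\<Sum>\<sigma>\<in>O_disc. transpose (rep_matrix \<sigma>) ** rep_matrix \<sigma>)"
proof -
  have "(\<Sum>\<sigma>\<in>O_disc. transpose (rep_matrix \<sigma>) ** rep_matrix \<sigma>) $ j $ k = 48 * of_real (BS $ j $ k)" for j k
  proof -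
    define h where "h = (\<lambda>\<gamma>. fourier_coeff (bas j) \<gamma> (1 / 12) * fourier_coeff (bas k) \<gamma> (1 / 12))"
    have s: "(\<Sum>k\<in>N12. h (cl k)) = 3 * of_real (BS $ j $ k)"
    proof -
      have "(\<Sum>k\<in>N12. h (cl k)) = (\<Sum>l\<in>N12. tab j l * tab k l)" by (intro sum.cong refl) (simp add: h_def bas_coeff_N12)
      also have "\<dots> = 3 * of_real (BS $ j $ k)"
        unfolding BS_eq using exhaust_4[of j] exhaust_4[of k] by (elim disjE) (simp_all add: N12_def tab_def)
      finally show ?thesis .
    qed
    have "(\<Sum>\<sigma>\<in>O_disc. transpose (rep_matrix \<sigma>) ** rep_matrix \<sigma>) $ j $ k = (\<Sum>\<sigma>\<in>O_disc. \<Sum>i\<in>UNIV. rep \<sigma> i j * rep \<sigma> i k)"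
      by (simp add: rep_matrix_eq matrix_matrix_mult_def transpose_def)
    also have "\<dots> = (\<Sum>i\<in>UNIV. \<Sum>\<sigma>\<in>O_disc. h (inv_into Disc \<sigma> (cl (piv i))))"
      unfolding h_def by (subst sum.swap) (simp add: rep_eq)
    also have "\<dots> = (\<Sum>i\<in>(UNIV :: 4 set). 4 * (\<Sum>k\<in>N12. h (cl k)))"
      unfolding sum_O_disc_inv[OF cl_in_Disc] sum_O_disc by (intro sum.cong refl sum_syms) simp
    also have "\<dots> = 48 * of_real (BS $ j $ k)" unfolding s by simp
    finally show ?thesis .
  qed
  then show ?thesis by (simp add: vec_eq_iff map_matrix_def; simp add: scaleR_conv_of_real)
qed

lemma gram_rep:
  assumes \<sigma>: "\<sigma> \<in> O_disc"
  shows "(\<Sum>i\<in>UNIV. \<Sum>l\<in>UNIV. rep \<sigma> i j * of_real (BS $ i $ l) * rep \<sigma> l k) = of_real (BS $ j $ k)"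
proof -
  let ?c = "\<lambda>i \<gamma>. fourier_coeff (bas i) \<gamma> (1 / 12)"
  have a: "?c j (inv_into Disc \<sigma> \<gamma>) = (\<Sum>i\<in>UNIV. rep \<sigma> i j * ?c i \<gamma>)" if "\<gamma> \<in> Disc" for j \<gamma>
    using act_coeff[OF bas_S32 \<sigma> that, of j "1 / 12"] unfolding act_bas[OF \<sigma>] comb_coeff by simp
  have "3 * (\<Sum>i\<in>UNIV. \<Sum>l\<in>UNIV. rep \<sigma> i j * of_real (BS $ i $ l) * rep \<sigma> l k)
      = (\<Sum>i\<in>UNIV. \<Sum>l\<in>UNIV. rep \<sigma> i j * (3 * of_real (BS $ i $ l)) * rep \<sigma> l k)"
    by (simp add: sum_distrib_left mult_ac)
  also have "\<dots> = (\<Sum>i\<in>UNIV. \<Sum>l\<in>UNIV. \<Sum>\<gamma>\<in>Disc. rep \<sigma> i j * ?c i \<gamma> * (rep \<sigma> l k * ?c l \<gamma>))"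
    unfolding gram_bas[symmetric] sum_distrib_left sum_distrib_right by (intro sum.cong refl) (simp add: mult_ac)
  also have "\<dots> = (\<Sum>\<gamma>\<in>Disc. \<Sum>i\<in>UNIV. \<Sum>l\<in>UNIV. rep \<sigma> i j * ?c i \<gamma> * (rep \<sigma> l k * ?c l \<gamma>))"
    by (simp only: sum.swap[of _ Disc UNIV])
  also have "\<dots> = (\<Sum>\<gamma>\<in>Disc. ?c j (inv_into Disc \<sigma> \<gamma>) * ?c k (inv_into Disc \<sigma> \<gamma>))"
    by (intro sum.cong refl) (simp add: a sum_product)
  also have "\<dots> = (\<Sum>\<gamma>\<in>Disc. ?c j \<gamma> * ?c k \<gamma>)"
    by (rule sum.reindex_bij_betw[OF bij_inv_Disc[OF \<sigma>]])
  finally show ?thesis unfolding gram_bas by simp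
qed

text \<open>The sign change \<open>g1\<close> kills the entries mixing {1, 4} with {2, 3};
  \<open>g2\<close> and \<open>g3\<close> identify the others up to sign; \<open>g4\<close> makes
  the off-diagonal entry half the diagonal one. The factor 3/4 normalises by the entry 4/3 of
  \<open>BS\<close>.\<close>

lemma invariant_multiple:
  assumes "\<And>\<sigma> j k. \<sigma> \<in> O_disc \<Longrightarrow> (\<Sum>i\<in>UNIV. \<Sum>l\<in>UNIV. rep \<sigma> i j * B i l * rep \<sigma> l k) = B j k"
  shows "B j k = (3 / 4 * B 2 2) * of_real (BS $ j $ k)"
proof -
  note e = assms[OF sig_O_disc[OF g_syms(1)], unfolded rep_gens sum_4 sel4_simps]
    assms[OF sig_O_disc[OF g_syms(2)], unfolded rep_gens sum_4 sel4_simps]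
    assms[OF sig_O_disc[OF g_syms(3)], unfolded rep_gens sum_4 sel4_simps]
    assms[OF sig_O_disc[OF g_syms(4)], unfolded rep_gens sum_4 sel4_simps]
  have "B 1 2 = 0" "B 2 1 = 0" "B 1 3 = 0" "B 3 1 = 0" "B 2 4 = 0" "B 4 2 = 0" "B 3 4 = 0" "B 4 3 = 0"
    using e(1)[of 1 2] e(1)[of 2 1] e(1)[of 1 3] e(1)[of 3 1] e(1)[of 2 4] e(1)[of 4 2] e(1)[of 3 4] e(1)[of 4 3]
    by (simp_all add: neg_equal_zero eq_neg_iff_add_eq_0 equal_neg_zero)
  moreover have "B 1 1 = B 2 2" "B 3 3 = B 2 2" "B 4 4 = B 3 3" "B 1 4 = - B 2 3" "B 4 1 = - B 3 2"
    using e(2)[of 1 1] e(3)[of 2 2] e(2)[of 3 3] e(2)[of 1 4] e(2)[of 4 1] by simp_all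
  moreover have "2 * B 2 3 = B 2 2" "2 * B 3 2 = B 2 2"
    using e(4)[of 2 3] e(4)[of 3 2] by (simp_all add: algebra_simps)
  then have "B 2 3 = B 2 2 / 2" "B 3 2 = B 2 2 / 2" by (simp_all add: field_simps)
  ultimately show ?thesis unfolding BS_eq using exhaust_4[of j] exhaust_4[of k] by (elim disjE) simp_all
qed

lemma invariant_symmetric_iff: "invariant_symmetric B \<longleftrightarrow> (\<exists>c. B = map_matrix ((*) c) BSc)"
proof -
  have m: "(transpose (rep_matrix \<sigma>) ** B ** rep_matrix \<sigma>) $ j $ k = (\<Sum>i\<in>UNIV. \<Sum>l\<in>UNIV. rep \<sigma> i j * B $ i $ l * rep \<sigma> l k)"
    if "\<sigma> \<in> O_disc" for \<sigma> j k and B :: "complex^4^4"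
    unfolding rep_matrix_eq[OF that] by (subst sum.swap) (simp add: matrix_matrix_mult_def transpose_def sum_distrib_right)
  show ?thesis
  proof
    assume B: "invariant_symmetric B"
    have "B $ j $ k = (3 / 4 * B $ 2 $ 2) * of_real (BS $ j $ k)" for j k
    proof (rule invariant_multiple[of "\<lambda>i j. B $ i $ j"])
      fix \<sigma> j k assume s: "\<sigma> \<in> O_disc"
      have "transpose (rep_matrix \<sigma>) ** B ** rep_matrix \<sigma> = B" using B s unfolding invariant_symmetric_def by blast
      then show "(\<Sum>i\<in>UNIV. \<Sum>l\<in>UNIV. rep \<sigma> i j * B $ i $ l * rep \<sigma> l k) = B $ j $ k"
        unfolding m[OF s, symmetric] by (rule arg_cong)
    qed
    then show "\<exists>c. B = map_matrix ((*) c) BSc" by (intro exI[of _ "3 / 4 * B $ 2 $ 2"]) (simp add: vec_eq_iff map_matrix_def)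
  next
    assume "\<exists>c. B = map_matrix ((*) c) BSc"
    then obtain c where "B = map_matrix ((*) c) BSc" by blast
    then have B: "B $ j $ k = c * of_real (BS $ j $ k)" for j k by (simp add: map_matrix_def)
    have "BS $ j $ k = BS $ k $ j" for j k unfolding BS_eq using exhaust_4[of j] exhaust_4[of k] by (elim disjE) simp_all
    then have "transpose B = B" by (simp add: vec_eq_iff transpose_def B)
    moreover have "(transpose (rep_matrix \<sigma>) ** B ** rep_matrix \<sigma>) $ j $ k = B $ j $ k" if "\<sigma> \<in> O_disc" for \<sigma> j k
    proof -
      have "(\<Sum>i\<in>UNIV. \<Sum>l\<in>UNIV. rep \<sigma> i j * B $ i $ l * rep \<sigma> l k) = c * (\<Sum>i\<in>UNIV. \<Sum>l\<in>UNIV. rep \<sigma> i j * of_real (BS $ i $ l) * rep \<sigma> l k)"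
        unfolding sum_distrib_left B by (intro sum.cong refl) (simp only: mult_ac)
      then show ?thesis unfolding m[OF that] gram_rep[OF that] B .
    qed
    ultimately show "invariant_symmetric B" unfolding invariant_symmetric_def by (simp add: vec_eq_iff)
  qed
qed

lemma irreducible: "abs_irreducible_S32"
  unfolding abs_irreducible_S32_def
proof (intro conjI ballI allI impI)
  show "form.subspace S32" by (rule subspace_S32)
  show "S32 \<noteq> {0}" 
  proof
    assume "S32 = {0}"
    then have "bas 2 = 0" using bas_S32[of 2] by blast
    then show False using bas_piv[of 2 2] S32_0(2) by simp
  qed
  show "act \<sigma> ` S32 \<subseteq> S32" if "\<sigma> \<in> O_disc" for \<sigma> using act_S32 that by blast
  fix W assume "form.subspace W \<and> W \<subseteq> S32 \<and> (\<forall>\<sigma>\<in>O_disc. act \<sigma> ` W \<subseteq> W)"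
  then have W: "form.subspace W" "W \<subseteq> S32" "\<And>\<sigma> F. \<sigma> \<in> O_disc \<Longrightarrow> F \<in> W \<Longrightarrow> act \<sigma> F \<in> W" by auto
  define w where "w = (\<lambda>a b c d. comb (sel4 a b c d) \<in> W)"
  have lin: "w (p * a + q * a') (p * b + q * b') (p * c + q * c') (p * d + q * d')" if "w a b c d" "w a' b' c' d'" for p q a b c d a' b' c' d'
  proof -
    have "comb (sel4 (p * a + q * a') (p * b + q * b') (p * c + q * c') (p * d + q * d')) = form_scale p (comb (sel4 a b c d)) + form_scale q (comb (sel4 a' b' c' d'))"
      by (simp add: comb_def sum_4 form_scale_def fun_eq_iff algebra_simps)
    then show ?thesis using that form.subspace_add[OF W(1)] form.subspace_scale[OF W(1)] unfolding w_def by simp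
  qed
  have s: "w (rep (sig g) 1 1 * a + rep (sig g) 1 2 * b + rep (sig g) 1 3 * c + rep (sig g) 1 4 * d)
      (rep (sig g) 2 1 * a + rep (sig g) 2 2 * b + rep (sig g) 2 3 * c + rep (sig g) 2 4 * d)
      (rep (sig g) 3 1 * a + rep (sig g) 3 2 * b + rep (sig g) 3 3 * c + rep (sig g) 3 4 * d)
      (rep (sig g) 4 1 * a + rep (sig g) 4 2 * b + rep (sig g) 4 3 * c + rep (sig g) 4 4 * d)"
    if "w a b c d" "g \<in> syms" for g a b c d
  proof -
    have "act (sig g) (comb (sel4 a b c d)) = comb (sel4 (rep (sig g) 1 1 * a + rep (sig g) 1 2 * b + rep (sig g) 1 3 * c + rep (sig g) 1 4 * d)
      (rep (sig g) 2 1 * a + rep (sig g) 2 2 * b + rep (sig g) 2 3 * c + rep (sig g) 2 4 * d)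
      (rep (sig g) 3 1 * a + rep (sig g) 3 2 * b + rep (sig g) 3 3 * c + rep (sig g) 3 4 * d)
      (rep (sig g) 4 1 * a + rep (sig g) 4 2 * b + rep (sig g) 4 3 * c + rep (sig g) 4 4 * d))"
      unfolding act_comb[OF sig_O_disc[OF that(2)]] by (simp add: comb_def sum_4)
    then show ?thesis using W(3)[OF sig_O_disc[OF that(2)]] that(1) unfolding w_def by metis
  qed
  have r1: "w a (- b) (- c) d" if "w a b c d" for a b c d using s[OF that g_syms(1)] by (simp add: rep_gens)
  have r2: "w b a (- d) (- c)" if "w a b c d" for a b c d using s[OF that g_syms(2)] by (simp add: rep_gens)
  have r3: "w (- d) c b (- a)" if "w a b c d" for a b c d using s[OF that g_syms(3)] by (simp add: rep_gens)
  have r4: "w (d - a) (- b - c) c d" if "w a b c d" for a b c d using s[OF that g_syms(4)] by (simp add: rep_gens)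
  have "W = S32" if ne: "W \<noteq> {0}"
  proof -
    obtain F where F: "F \<in> W" "F \<noteq> 0" using ne form.subspace_0[OF W(1)] by auto
    then obtain x where x: "F = comb x" using W(2) S32_comb by blast
    have xs: "x = sel4 (x 1) (x 2) (x 3) (x 4)" using exhaust_4 by (auto simp: fun_eq_iff sel4_def)
    have c0: "comb (\<lambda>i. 0) = 0" by (simp add: comb_def)
    have nz: "x 1 \<noteq> 0 \<or> x 2 \<noteq> 0 \<or> x 3 \<noteq> 0 \<or> x 4 \<noteq> 0"
    proof (rule ccontr)
      assume "\<not> ?thesis"
      then have "x = (\<lambda>i. 0)" using exhaust_4 by (metis (full_types) ext)
      then show False using F(2) c0 by (simp add: x)
    qed
    have wx: "w (x 1) (x 2) (x 3) (x 4)" using F(1) unfolding w_def x xs[symmetric] .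
    \<comment> \<open>The two eigenspaces of \<open>g1\<close> separate the coordinates 2, 3 from 1,
      4, and \<open>g2\<close> carries the second pair to the first. So W contains a nonzero vector
      supported on 2, 3.\<close>
    have A: "w 0 (x 2) (x 3) 0" using lin[OF wx r1[OF wx], of "1 / 2" "- 1 / 2"] by simp
    have "w (x 1) 0 0 (x 4)" using lin[OF wx r1[OF wx], of "1 / 2" "1 / 2"] by simp
    from r2[OF this] have B: "w 0 (x 1) (- x 4) 0" by simp
    have "\<exists>b c. w 0 b c 0 \<and> (b \<noteq> 0 \<or> c \<noteq> 0)" using A B nz by (metis neg_equal_0_iff_equal)
    then obtain b c where bc: "w 0 b c 0" "b \<noteq> 0 \<or> c \<noteq> 0" by blast
    have 2: "w 0 1 0 0"
    proof (cases "c = 0")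
      case True
      then show ?thesis using lin[OF bc(1) bc(1), of "1 / b" 0] bc(2) by simp
    next
      case False
      \<comment> \<open>Adding the image under \<open>g4\<close> turns (b, c) into (-c, 2c). Next,
        (-1, 2) plus twice its mirror image (2, -1) under \<open>g3\<close> is (3, 0).\<close>
      have 1: "w 0 (- 1) 2 0" using lin[OF bc(1) r4[OF bc(1)], of "1 / c" "1 / c"] False by (simp add: field_simps)
      from lin[OF 1 r3[OF 1], of "1 / 3" "2 / 3"] show ?thesis by simp
    qed
    have 3: "w 0 0 1 0" using r3[OF 2] by simp
    have 1: "w 1 0 0 0" using r2[OF 2] by simp
    have 4: "w 0 0 0 1" using lin[OF r3[OF 1] r3[OF 1], of "- 1" 0] by simp
    have all: "w a b c d" for a b c d
      using lin[OF lin[OF 1 2, of a b] lin[OF 3 4, of c d], of 1 1] by simp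
    have "F \<in> W" if FS: "F \<in> S32" for F
    proof -
      obtain y where y: "F = comb y" by (rule S32_comb[OF FS])
      have "y = sel4 (y 1) (y 2) (y 3) (y 4)" using exhaust_4 by (auto simp: fun_eq_iff sel4_def)
      then show ?thesis using all[of "y 1" "y 2" "y 3" "y 4"] unfolding w_def y by metis
    qed
    then show ?thesis using W(2) by blast
  qed
  then show "W = {0} \<or> W = S32" by blast
qed

section \<open>The Petersson product\<close>

definition pint :: "form \<Rightarrow> form \<Rightarrow> complex \<Rightarrow> complex" where
  "pint F H \<tau> = (\<Sum>\<gamma>\<in>Disc. F \<tau> \<gamma> * cnj (H \<tau> \<gamma>)) * of_real (Im \<tau> powr (3 / 2) / (Im \<tau>)\<^sup>2)"

lemma petersson_eq: "petersson F H = (\<integral>\<tau>. indicator fund_domain \<tau> *\<^sub>R pint F H \<tau> \<partial>lborel)"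
  by (simp add: petersson_def set_lebesgue_integral_def pint_def)

lemma fund_domain_Im: "\<tau> \<in> fund_domain \<Longrightarrow> Im \<tau> \<ge> 1 / 2"
proof -
  assume t: "\<tau> \<in> fund_domain"
  have "(Re \<tau>)\<^sup>2 \<le> (1 / 2)\<^sup>2" using t unfolding fund_domain_def by (intro power2_le_iff_abs_le[THEN iffD2]) auto
  moreover have "1 \<le> (cmod \<tau>)\<^sup>2" using t by (simp add: fund_domain_def one_le_power)
  moreover have q: "(1 / 2 :: real)\<^sup>2 = 1 / 4" by (simp add: power_divide)
  ultimately have "(1 / 2)\<^sup>2 \<le> (Im \<tau>)\<^sup>2" unfolding cmod_power2 q by linarith
  then show ?thesis using t by (intro power2_le_imp_le[of "1 / 2" "Im \<tau>"]) (simp_all add: fund_domain_def)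
qed

lemma fund_domain_upper: "\<tau> \<in> fund_domain \<Longrightarrow> \<tau> \<in> upper_half"
  by (simp add: fund_domain_def upper_half_def)

lemma closed_fund_domain: "closed fund_domain"
proof -
  have fd: "fund_domain = {\<tau>. 1 / 2 \<le> Im \<tau>} \<inter> {\<tau>. \<bar>Re \<tau>\<bar> \<le> 1 / 2} \<inter> {\<tau>. 1 \<le> cmod \<tau>}"
    using fund_domain_Im by (auto simp: fund_domain_def)
  show ?thesis unfolding fd by (intro closed_Int closed_Collect_le continuous_intros)
qed

text \<open>A product of two cusp forms decays like exp(-(pi/3) Im tau), at least as fast as exp(-Im
  tau) because pi > 3. The remaining power of Im tau has exponent -1/2 and is bounded on the
  fundamental domain.\<close>

lemma pint_bound:
  assumes F: "F \<in> S32" and H: "H \<in> S32"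
  shows "\<exists>K. \<forall>\<tau>\<in>fund_domain. norm (pint F H \<tau>) \<le> K * exp (- Im \<tau>)"
proof -
  have "\<exists>B. \<forall>\<gamma>\<in>Disc. \<forall>\<tau>. Im \<tau> \<ge> 1 / 2 \<longrightarrow> norm (G \<tau> \<gamma>) \<le> B \<gamma> * exp (- 2 * pi * (1 / 12) * Im \<tau>)" if "G \<in> S32" for G
    using S32_bound[OF that] S32_coeff_nonzero[OF that] by (intro bchoice ballI) blast
  from this[OF F] this[OF H] obtain B B' where
    B: "\<And>\<gamma> \<tau>. \<gamma> \<in> Disc \<Longrightarrow> Im \<tau> \<ge> 1 / 2 \<Longrightarrow> norm (F \<tau> \<gamma>) \<le> B \<gamma> * exp (- 2 * pi * (1 / 12) * Im \<tau>)" and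
    B': "\<And>\<gamma> \<tau>. \<gamma> \<in> Disc \<Longrightarrow> Im \<tau> \<ge> 1 / 2 \<Longrightarrow> norm (H \<tau> \<gamma>) \<le> B' \<gamma> * exp (- 2 * pi * (1 / 12) * Im \<tau>)" by blast
  define w :: real where "w = (1 / 2) powr (- 1 / 2)"
  have "norm (pint F H \<tau>) \<le> ((\<Sum>\<gamma>\<in>Disc. \<bar>B \<gamma> * B' \<gamma>\<bar>) * w) * exp (- Im \<tau>)" if "\<tau> \<in> fund_domain" for \<tau>
  proof -
    have y: "Im \<tau> \<ge> 1 / 2" by (rule fund_domain_Im[OF that])
    let ?E = "exp (- 2 * pi * (1 / 12) * Im \<tau>)"
    have EE: "?E * ?E \<le> exp (- Im \<tau>)"
    proof -
      have "Im \<tau> * 3 \<le> Im \<tau> * pi" using pi_gt3 y by (intro mult_left_mono) auto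
      then have "- 2 * pi * (1 / 12) * Im \<tau> + - 2 * pi * (1 / 12) * Im \<tau> \<le> - Im \<tau>" by (simp add: mult.commute)
      then show ?thesis unfolding exp_add[symmetric] by simp
    qed
    have t: "norm (F \<tau> \<gamma> * cnj (H \<tau> \<gamma>)) \<le> \<bar>B \<gamma> * B' \<gamma>\<bar> * exp (- Im \<tau>)" if "\<gamma> \<in> Disc" for \<gamma>
    proof -
      have "0 \<le> B \<gamma> * ?E" by (rule order_trans[OF norm_ge_zero B[OF that y]])
      then have "norm (F \<tau> \<gamma> * cnj (H \<tau> \<gamma>)) \<le> (B \<gamma> * ?E) * (B' \<gamma> * ?E)"
        unfolding norm_mult complex_mod_cnj
        by (intro mult_mono B[OF that y] B'[OF that y] norm_ge_zero)
      also have "\<dots> = (B \<gamma> * B' \<gamma>) * (?E * ?E)" by (simp only: mult_ac)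
      also have "\<dots> \<le> \<bar>B \<gamma> * B' \<gamma>\<bar> * (?E * ?E)" by (intro mult_right_mono) auto
      also have "\<dots> \<le> \<bar>B \<gamma> * B' \<gamma>\<bar> * exp (- Im \<tau>)" by (intro mult_left_mono EE) auto
      finally show ?thesis .
    qed
    have "norm (\<Sum>\<gamma>\<in>Disc. F \<tau> \<gamma> * cnj (H \<tau> \<gamma>)) \<le> (\<Sum>\<gamma>\<in>Disc. \<bar>B \<gamma> * B' \<gamma>\<bar> * exp (- Im \<tau>))"
      by (rule sum_norm_le) (rule t)
    also have "\<dots> = (\<Sum>\<gamma>\<in>Disc. \<bar>B \<gamma> * B' \<gamma>\<bar>) * exp (- Im \<tau>)" by (rule sum_distrib_right[symmetric])
    finally have 1: "norm (\<Sum>\<gamma>\<in>Disc. F \<tau> \<gamma> * cnj (H \<tau> \<gamma>)) \<le> \<dots>" .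
    have "Im \<tau> powr (3 / 2) / (Im \<tau>)\<^sup>2 = Im \<tau> powr (3 / 2 - 2)"
      using y by (subst powr_diff) (simp add: powr_numeral)
    also have "\<dots> \<le> w" unfolding w_def using y powr_mono2'[of "- 1 / 2" "1 / 2" "Im \<tau>"] by simp
    finally have 2: "\<bar>Im \<tau> powr (3 / 2) / (Im \<tau>)\<^sup>2\<bar> \<le> w" by simp
    have "norm (pint F H \<tau>) \<le> ((\<Sum>\<gamma>\<in>Disc. \<bar>B \<gamma> * B' \<gamma>\<bar>) * exp (- Im \<tau>)) * w"
      unfolding pint_def norm_mult norm_of_real by (intro mult_mono 1 2) (auto intro!: mult_nonneg_nonneg sum_nonneg)
    then show ?thesis by (simp only: mult_ac)
  qed
  then show ?thesis by blast
qed

lemma emeasure_strip: "0 \<le> c \<Longrightarrow> 0 \<le> d \<Longrightarrow> emeasure lborel (cbox (Complex a b) (Complex (a + c) (b + d))) = ennreal (c * d)"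
  by (simp add: emeasure_lborel_cbox_eq Basis_complex_def inner_complex_def)

text \<open>The fundamental domain is covered by unit squares stacked upwards, over which the
  exponential bound sums to a geometric series.\<close>

lemma pint_integrable:
  assumes F: "F \<in> S32" and H: "H \<in> S32"
  shows "integrable lborel (\<lambda>\<tau>. indicator fund_domain \<tau> *\<^sub>R pint F H \<tau>)"
proof (rule integrableI_bounded)
  have ch: "continuous_on fund_domain (\<lambda>\<tau>. G \<tau> \<gamma>)" if "G \<in> S32" "\<gamma> \<in> Disc" for G \<gamma>
    by (rule continuous_on_subset[OF holomorphic_on_imp_continuous_on[OF S32_hol[OF that]]]) (use fund_domain_upper in blast)
  have "continuous_on fund_domain (pint F H)"
    unfolding pint_def by (intro continuous_intros ch F H) (auto simp: fund_domain_def)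
  then show "(\<lambda>\<tau>. indicator fund_domain \<tau> *\<^sub>R pint F H \<tau>) \<in> borel_measurable lborel"
    using borel_measurable_continuous_on_indicator[OF borel_closed[OF closed_fund_domain]] by simp
  obtain K where K: "\<And>\<tau>. \<tau> \<in> fund_domain \<Longrightarrow> norm (pint F H \<tau>) \<le> K * exp (- Im \<tau>)" using pint_bound[OF F H] by blast
  define box where "box = (\<lambda>n. cbox (Complex (- 1 / 2) (real n)) (Complex (- 1 / 2 + 1) (real n + 1)))"
  define f where "f = (\<lambda>n \<tau>. ennreal (\<bar>K\<bar> * exp (- real n)) * indicator (box n) \<tau>)"
  have em: "emeasure lborel (box n) = 1" for n unfolding box_def using emeasure_strip[of 1 1 "- 1 / 2" "real n"] by simp
  have le: "ennreal (norm (indicator fund_domain \<tau> *\<^sub>R pint F H \<tau>)) \<le> (\<Sum>n. f n \<tau>)" for \<tau>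
  proof (cases "\<tau> \<in> fund_domain")
    case True
    define n where "n = nat \<lfloor>Im \<tau>\<rfloor>"
    have y: "Im \<tau> \<ge> 1 / 2" by (rule fund_domain_Im[OF True])
    have n: "real n \<le> Im \<tau>" "Im \<tau> \<le> real n + 1" using y unfolding n_def by linarith+
    have "\<tau> \<in> box n" using True n by (auto simp: box_def in_cbox_complex_iff fund_domain_def abs_le_iff)
    have "norm (pint F H \<tau>) \<le> K * exp (- Im \<tau>)" by (rule K[OF True])
    also have "\<dots> \<le> \<bar>K\<bar> * exp (- Im \<tau>)" by (intro mult_right_mono) auto
    also have "\<dots> \<le> \<bar>K\<bar> * exp (- real n)" using n by (intro mult_left_mono) auto
    finally have "ennreal (norm (indicator fund_domain \<tau> *\<^sub>R pint F H \<tau>)) \<le> f n \<tau>"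
      using True \<open>\<tau> \<in> box n\<close> by (simp add: f_def ennreal_leI)
    also have "f n \<tau> \<le> (\<Sum>n. f n \<tau>)" using sum_le_suminf[of "\<lambda>n. f n \<tau>" "{n}"] by simp
    finally show ?thesis .
  qed simp
  have s: "summable (\<lambda>n. \<bar>K\<bar> * exp (- real n))"
  proof -
    have "exp (- real n) = exp (- 1) ^ n" for n by (simp flip: exp_of_nat_mult)
    then show ?thesis by (simp add: summable_mult summable_geometric)
  qed
  have "(\<integral>\<^sup>+\<tau>. ennreal (norm (indicator fund_domain \<tau> *\<^sub>R pint F H \<tau>)) \<partial>lborel) \<le> (\<integral>\<^sup>+\<tau>. (\<Sum>n. f n \<tau>) \<partial>lborel)"
    by (intro nn_integral_mono le)
  also have "\<dots> = (\<Sum>n. \<integral>\<^sup>+\<tau>. f n \<tau> \<partial>lborel)"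
    by (rule nn_integral_suminf) (simp add: f_def box_def)
  also have "\<dots> = (\<Sum>n. ennreal (\<bar>K\<bar> * exp (- real n)))"
  proof -
    have "(\<integral>\<^sup>+\<tau>. f n \<tau> \<partial>lborel) = ennreal (\<bar>K\<bar> * exp (- real n)) * emeasure lborel (box n)" for n
      unfolding f_def by (rule nn_integral_cmult_indicator) (simp add: box_def)
    then show ?thesis unfolding em by simp
  qed
  also have "\<dots> = ennreal (\<Sum>n. \<bar>K\<bar> * exp (- real n))" by (rule suminf_ennreal2) (use s in auto)
  finally show "(\<integral>\<^sup>+\<tau>. ennreal (norm (indicator fund_domain \<tau> *\<^sub>R pint F H \<tau>)) \<partial>lborel) < \<infinity>"
    by (rule le_less_trans) simp
qed

lemma comb_apply: "comb c \<tau> \<gamma> = (\<Sum>i\<in>UNIV. c i * bas i \<tau> \<gamma>)"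
  by (simp add: comb_def sum_4 form_scale_def)

lemma petersson_comb:
  "petersson (comb c) (comb d) = (\<Sum>i\<in>UNIV. \<Sum>j\<in>UNIV. c i * cnj (d j) * petersson (bas i) (bas j))"
proof -
  have p: "pint (comb c) (comb d) \<tau> = (\<Sum>i\<in>UNIV. \<Sum>j\<in>UNIV. c i * cnj (d j) * pint (bas i) (bas j) \<tau>)" for \<tau>
  proof -
    let ?w = "complex_of_real (Im \<tau> powr (3 / 2) / (Im \<tau>)\<^sup>2)"
    have "pint (comb c) (comb d) \<tau> = (\<Sum>\<gamma>\<in>Disc. \<Sum>i\<in>UNIV. \<Sum>j\<in>UNIV. c i * cnj (d j) * (bas i \<tau> \<gamma> * cnj (bas j \<tau> \<gamma>)) * ?w)"
    proof -
      have e: "comb c \<tau> \<gamma> * cnj (comb d \<tau> \<gamma>) = (\<Sum>i\<in>UNIV. \<Sum>j\<in>UNIV. c i * cnj (d j) * (bas i \<tau> \<gamma> * cnj (bas j \<tau> \<gamma>)))" for \<gamma>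
        unfolding comb_apply cnj_sum complex_cnj_mult sum_product by (intro sum.cong refl) (simp only: mult_ac)
      show ?thesis unfolding pint_def e sum_distrib_right ..
    qed
    also have "\<dots> = (\<Sum>i\<in>UNIV. \<Sum>j\<in>UNIV. \<Sum>\<gamma>\<in>Disc. c i * cnj (d j) * (bas i \<tau> \<gamma> * cnj (bas j \<tau> \<gamma>)) * ?w)"
      by (subst sum.swap, intro sum.cong refl, rule sum.swap)
    also have "\<dots> = (\<Sum>i\<in>UNIV. \<Sum>j\<in>UNIV. c i * cnj (d j) * pint (bas i) (bas j) \<tau>)"
      unfolding pint_def sum_distrib_left sum_distrib_right by (intro sum.cong refl) (simp only: mult_ac)
    finally show ?thesis .
  qed
  have i: "integrable lborel (\<lambda>\<tau>. c i * cnj (d j) * (indicator fund_domain \<tau> *\<^sub>R pint (bas i) (bas j) \<tau>))" for i j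
    by (intro integrable_mult_right pint_integrable bas_S32)
  have "petersson (comb c) (comb d) = (\<integral>\<tau>. (\<Sum>i\<in>UNIV. \<Sum>j\<in>UNIV. c i * cnj (d j) * (indicator fund_domain \<tau> *\<^sub>R pint (bas i) (bas j) \<tau>)) \<partial>lborel)"
    unfolding petersson_eq p by (intro Bochner_Integration.integral_cong refl) (simp add: scaleR_sum_right)
  also have "\<dots> = (\<Sum>i\<in>UNIV. \<integral>\<tau>. (\<Sum>j\<in>UNIV. c i * cnj (d j) * (indicator fund_domain \<tau> *\<^sub>R pint (bas i) (bas j) \<tau>)) \<partial>lborel)"
    by (rule Bochner_Integration.integral_sum) (intro Bochner_Integration.integrable_sum i)
  also have "\<dots> = (\<Sum>i\<in>UNIV. \<Sum>j\<in>UNIV. \<integral>\<tau>. c i * cnj (d j) * (indicator fund_domain \<tau> *\<^sub>R pint (bas i) (bas j) \<tau>) \<partial>lborel)"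
    by (intro sum.cong refl Bochner_Integration.integral_sum i)
  finally show ?thesis unfolding petersson_eq by (simp only: integral_mult_right_zero)
qed

lemma petersson_act:
  assumes "\<sigma> \<in> O_disc"
  shows "petersson (act \<sigma> F) (act \<sigma> H) = petersson F H"
proof -
  have "pint (act \<sigma> F) (act \<sigma> H) \<tau> = pint F H \<tau>" for \<tau>
    using sum.reindex_bij_betw[OF bij_inv_Disc[OF assms], of "\<lambda>\<gamma>. F \<tau> \<gamma> * cnj (H \<tau> \<gamma>)"] by (simp add: pint_def act_def)
  then show ?thesis unfolding petersson_eq by simp
qed

text \<open>A nonzero leading coefficient keeps F away from 0 on a rectangle high in the fundamental
  domain, a set of positive measure.\<close>

lemma petersson_pos:
  assumes F: "F \<in> S32" and g: "\<gamma> \<in> Disc" "e - disc_q \<gamma> \<in> \<int>" "0 < e" "e \<le> 1" and nz: "fourier_coeff F \<gamma> e \<noteq> 0"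
  shows "\<exists>r>0. petersson F F = of_real r"
proof -
  define p where "p = (\<lambda>\<tau>. (\<Sum>\<gamma>\<in>Disc. (norm (F \<tau> \<gamma>))\<^sup>2) * (Im \<tau> powr (3 / 2) / (Im \<tau>)\<^sup>2))"
  define f where "f = (\<lambda>\<tau>. indicator fund_domain \<tau> * p \<tau>)"
  have p0: "p \<tau> \<ge> 0" for \<tau> unfolding p_def by (intro mult_nonneg_nonneg sum_nonneg) auto
  have eq: "indicator fund_domain \<tau> *\<^sub>R pint F F \<tau> = of_real (f \<tau>)" for \<tau>
  proof -
    have "(\<Sum>\<gamma>\<in>Disc. F \<tau> \<gamma> * cnj (F \<tau> \<gamma>)) = of_real (\<Sum>\<gamma>\<in>Disc. (norm (F \<tau> \<gamma>))\<^sup>2)"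
      by (simp only: of_real_sum complex_norm_square)
    then show ?thesis by (simp only: pint_def f_def p_def scaleR_conv_of_real of_real_mult)
  qed
  have "integrable lborel (\<lambda>\<tau>. Re (indicator fund_domain \<tau> *\<^sub>R pint F F \<tau>))"
    by (intro integrable_Re pint_integrable F)
  then have int: "integrable lborel f" unfolding eq by simp
  have val: "petersson F F = of_real (integral\<^sup>L lborel f)"
    unfolding petersson_eq eq by (rule integral_complex_of_real)
  have "integral\<^sup>L lborel f \<noteq> 0"
  proof
    assume "integral\<^sup>L lborel f = 0"
    then have "AE \<tau> in lborel. f \<tau> = 0"
      using integral_nonneg_eq_0_iff_AE[OF int] p0 by (simp add: f_def)
    then obtain N where N: "N \<in> null_sets lborel" "{\<tau> \<in> space lborel. f \<tau> \<noteq> 0} \<subseteq> N"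
      unfolding eventually_ae_filter by blast
    have "((\<lambda>\<tau>. F \<tau> \<gamma> * e2pi (- of_real e * \<tau>)) \<longlongrightarrow> fourier_coeff F \<gamma> e) i_inf"
      using S32_lead[OF F g] unfolding lead_def by blast
    from tendsto_imp_eventually_ne[OF this nz] obtain Y where Y: "\<And>\<tau>. Im \<tau> \<ge> Y \<Longrightarrow> F \<tau> \<gamma> * e2pi (- of_real e * \<tau>) \<noteq> 0"
      unfolding eventually_i_inf by blast
    define b where "b = max Y 1"
    have "cbox (Complex 0 b) (Complex (0 + 1 / 2) (b + 1)) \<subseteq> N"
    proof
      fix \<tau> assume "\<tau> \<in> cbox (Complex 0 b) (Complex (0 + 1 / 2) (b + 1))"
      then have t: "0 \<le> Re \<tau>" "Re \<tau> \<le> 1 / 2" "b \<le> Im \<tau>" by (auto simp: in_cbox_complex_iff)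
      have y: "Im \<tau> \<ge> 1" "Im \<tau> \<ge> Y" using t by (auto simp: b_def)
      have "cmod \<tau> \<ge> 1" using abs_Im_le_cmod[of \<tau>] y by linarith
      then have fd: "\<tau> \<in> fund_domain" using t y by (simp add: fund_domain_def)
      have "F \<tau> \<gamma> \<noteq> 0" using Y[OF y(2)] by auto
      then have "0 < (\<Sum>\<gamma>\<in>Disc. (norm (F \<tau> \<gamma>))\<^sup>2)"
        using finite_Disc g(1) by (intro sum_pos2[of Disc \<gamma>]) auto
      moreover have "0 < Im \<tau> powr (3 / 2) / (Im \<tau>)\<^sup>2" using y by (intro divide_pos_pos) auto
      moreover have "Im \<tau> \<noteq> 0" using y(1) by linarith
      ultimately have "f \<tau> \<noteq> 0" unfolding f_def p_def using fd by simp
      then show "\<tau> \<in> N" using N(2) by auto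
    qed
    then have "emeasure lborel (cbox (Complex 0 b) (Complex (0 + 1 / 2) (b + 1))) \<le> emeasure lborel N"
      using N(1) by (intro emeasure_mono) auto
    also have "\<dots> = 0" using N(1) by auto
    finally have le: "emeasure lborel (cbox (Complex 0 b) (Complex (0 + 1 / 2) (b + 1))) \<le> 0" .
    have em: "emeasure lborel (cbox (Complex 0 b) (Complex (0 + 1 / 2) (b + 1))) = ennreal (1 / 2 * 1)"
      by (rule emeasure_strip) simp_all
    have "ennreal (1 / 2 * 1) \<le> 0" using le unfolding em .
    then have "1 / 2 * 1 \<le> (0 :: real)" by (simp only: le_zero_eq ennreal_eq_0_iff)
    then show False by simp
  qed
  moreover have "integral\<^sup>L lborel f \<ge> 0" by (rule Bochner_Integration.integral_nonneg) (simp add: f_def p0)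
  ultimately show ?thesis using val by (intro exI[of _ "integral\<^sup>L lborel f"]) auto
qed

lemma tab_Ints: "tab i k \<in> \<int>"
proof -
  obtain x y z u v where "k = (x, y, z, u, v)" by (cases k)
  moreover have "bt n \<in> \<int>" "sg n \<in> \<int>" for n by (auto simp: bt_def sg_def)
  ultimately show ?thesis using exhaust_4[of i] by (elim disjE) (simp_all add: tab_def)
qed

text \<open>The Petersson product is sesquilinear while \<open>invariant_multiple\<close> speaks of
  bilinear invariance; real matrix entries reconcile the two.\<close>

lemma rep_real: "\<sigma> \<in> O_disc \<Longrightarrow> cnj (rep \<sigma> i j) = rep \<sigma> i j"
proof -
  assume \<sigma>: "\<sigma> \<in> O_disc"
  define \<gamma> where "\<gamma> = inv_into Disc \<sigma> (cl (piv i))"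
  have g: "\<gamma> \<in> Disc" unfolding \<gamma>_def by (rule inv_Disc(1)[OF \<sigma> cl_in_Disc])
  have "fourier_coeff (bas j) \<gamma> (1 / 12) \<in> \<int>"
  proof (cases "1 / 12 - disc_q \<gamma> \<in> \<int>")
    case True
    then obtain k where "k \<in> N12" "\<gamma> = cl k" using Disc_exponent(1)[OF g] by blast
    then show ?thesis by (simp add: bas_coeff_N12 tab_Ints)
  qed (simp add: S32_coeff_not_Ints[OF bas_S32])
  then show ?thesis unfolding rep_eq[OF \<sigma>] \<gamma>_def[symmetric] by (elim Ints_cases) simp
qed

lemma petersson_bas: "\<exists>t>0. \<forall>j k. petersson (bas j) (bas k) = of_real (t * BS $ j $ k)"
proof -
  have inv: "petersson (bas j) (bas k) = (3 / 4 * petersson (bas 2) (bas 2)) * of_real (BS $ j $ k)" for j k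
  proof (rule invariant_multiple[of "\<lambda>i l. petersson (bas i) (bas l)"])
    fix \<sigma> j k assume \<sigma>: "\<sigma> \<in> O_disc"
    have "petersson (bas j) (bas k) = petersson (comb (\<lambda>i. rep \<sigma> i j)) (comb (\<lambda>i. rep \<sigma> i k))"
      unfolding act_bas[OF \<sigma>, symmetric] petersson_act[OF \<sigma>] ..
    then show "(\<Sum>i\<in>UNIV. \<Sum>l\<in>UNIV. rep \<sigma> i j * petersson (bas i) (bas l) * rep \<sigma> l k) = petersson (bas j) (bas k)"
      unfolding petersson_comb rep_real[OF \<sigma>] by (simp add: mult_ac)
  qed
  obtain r where r: "r > 0" "petersson (bas 2) (bas 2) = of_real r"
    using petersson_pos[OF bas_S32[of 2] cl_in_Disc N12_exponent[OF piv_N12[of 2]]] bas_piv[of 2 2] by auto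
  have "petersson (bas j) (bas k) = of_real ((3 / 4 * r) * BS $ j $ k)" for j k
    using inv[of j k] unfolding r(2) by simp
  then show ?thesis using r(1) by (intro exI[of _ "3 / 4 * r"]) auto
qed

section \<open>The root lattice\<close>

lemma gram_A2: "is_gram_of_lattice ((3 / 2) *\<^sub>R BS) (A2 \<times> A2)"
proof -
  define a b :: "real^3" where "a = vector [1, - 1, 0]" and "b = vector [0, 1, - 1]"
  \<comment> \<open>Simple roots of the two copies, ordered and signed to match \<open>BS\<close>:
    the first and fourth have product -1, and replacing b by -b makes the product of the second and
    third +1.\<close>
  define v :: "4 \<Rightarrow> (real^3) \<times> (real^3)" where "v = sel4 (a, 0) (0, a) (0, - b) (b, 0)"
  have ab: "a \<bullet> a = 2" "b \<bullet> b = 2" "a \<bullet> b = - 1" "b \<bullet> a = - 1"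
    by (simp_all add: a_def b_def inner_vec_def sum_3)
  have lc: "(\<Sum>i\<in>UNIV. c i *\<^sub>R v i) = (c 1 *\<^sub>R a + c 4 *\<^sub>R b, c 2 *\<^sub>R a - c 3 *\<^sub>R b)" for c
    by (simp add: sum_4 v_def algebra_simps)
  have z: "c 1 = 0 \<and> c 4 = 0 \<and> c 2 = 0 \<and> c 3 = 0" if "(\<Sum>i\<in>UNIV. c i *\<^sub>R v i) = 0" for c
    using that unfolding lc zero_prod_def by (auto simp: vec3_eq_iff a_def b_def)
  have "inj v"
  proof (rule injI)
    fix i j assume ij: "v i = v j"
    show "i = j"
    proof (rule ccontr)
      assume ne: "i \<noteq> j"
      have "(\<Sum>l\<in>UNIV. (if l = i then 1 else if l = j then - 1 else 0) *\<^sub>R v l) = v i - v j"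
      proof -
        have "(\<Sum>l\<in>UNIV. (if l = i then 1 else if l = j then - 1 else 0) *\<^sub>R v l) = (\<Sum>l\<in>UNIV. (if l = i then v i else 0) - (if l = j then v j else 0))"
          using ne by (intro sum.cong) auto
        then show ?thesis by (simp add: sum_subtractf)
      qed
      from z[OF this[unfolded ij diff_self]] show False using exhaust_4[of i] by auto
    qed
  qed
  moreover have "independent (range v)"
  proof (rule independent_if_scalars_zero)
    fix f x assume s: "(\<Sum>x\<in>range v. f x *\<^sub>R x) = 0" and "x \<in> range v"
    have "(\<Sum>i\<in>UNIV. f (v i) *\<^sub>R v i) = 0" using s by (simp add: sum.reindex[OF \<open>inj v\<close>] o_def)
    from z[OF this] show "f x = 0" using \<open>x \<in> range v\<close> exhaust_4 by auto metis
  qed simp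
  moreover have "A2 \<times> A2 = {x. \<exists>k :: 4 \<Rightarrow> int. x = (\<Sum>i\<in>UNIV. of_int (k i) *\<^sub>R v i)}"
  proof (intro equalityI subsetI)
    have d: "\<exists>m n :: int. x = of_int m *\<^sub>R a + of_int n *\<^sub>R b" if "x \<in> A2" for x
    proof -
      have "x $ 1 \<in> \<int>" "x $ 2 \<in> \<int>" "x $ 1 + x $ 2 + x $ 3 = 0" using that by (simp_all add: A2_def sum_3)
      moreover then obtain m n where "x $ 1 = of_int m" "x $ 2 = of_int n" by (auto elim!: Ints_cases)
      ultimately have "x = of_int m *\<^sub>R a + of_int (m + n) *\<^sub>R b" by (simp add: vec3_eq_iff a_def b_def)
      then show ?thesis by blast
    qed
    fix x assume "x \<in> A2 \<times> A2"
    then obtain m n m' n' where "fst x = of_int m *\<^sub>R a + of_int n *\<^sub>R b" "snd x = of_int m' *\<^sub>R a + of_int n' *\<^sub>R b"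
      using d by (metis mem_Times_iff)
    then have "x = (\<Sum>i\<in>UNIV. of_int (sel4 m m' (- n') n i) *\<^sub>R v i)" unfolding lc by (simp add: prod_eq_iff)
    then show "x \<in> {x. \<exists>k :: 4 \<Rightarrow> int. x = (\<Sum>i\<in>UNIV. of_int (k i) *\<^sub>R v i)}" by blast
  next
    fix x assume "x \<in> {x. \<exists>k :: 4 \<Rightarrow> int. x = (\<Sum>i\<in>UNIV. of_int (k i) *\<^sub>R v i)}"
    then obtain k :: "4 \<Rightarrow> int" where "x = (\<Sum>i\<in>UNIV. of_int (k i) *\<^sub>R v i)" by blast
    then show "x \<in> A2 \<times> A2" unfolding lc by (simp add: A2_def forall_3 sum_3 a_def b_def)
  qed
  moreover have "v i \<bullet> v j = ((3 / 2) *\<^sub>R BS) $ i $ j" for i j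
    unfolding vector_scaleR_component BS_eq using exhaust_4[of i] exhaust_4[of j]
    by (elim disjE) (simp_all add: v_def inner_prod_def ab)
  ultimately show ?thesis unfolding is_gram_of_lattice_def by blast
qed

section \<open>Shadows\<close>

definition IB :: "4 \<Rightarrow> 4 \<Rightarrow> complex" where
  "IB i = sel4 (sel4 1 0 0 (1 / 2)) (sel4 0 1 (- 1 / 2) 0) (sel4 0 (- 1 / 2) 1 0) (sel4 (1 / 2) 0 0 1) i"

lemma BS_solve: "(\<forall>i. (\<Sum>j\<in>UNIV. of_real (BS $ i $ j) * x j) = y i) \<longleftrightarrow> (\<forall>i. x i = (\<Sum>j\<in>UNIV. IB i j * y j))"
proof (intro iffI allI)
  fix i assume h: "\<forall>i. (\<Sum>j\<in>UNIV. of_real (BS $ i $ j) * x j) = y i"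
  show "x i = (\<Sum>j\<in>UNIV. IB i j * y j)" unfolding h[rule_format, symmetric]
    using exhaust_4[of i] by (elim disjE) (simp_all add: sum_4 BS_eq IB_def field_simps)
next
  fix i assume h: "\<forall>i. x i = (\<Sum>j\<in>UNIV. IB i j * y j)"
  show "(\<Sum>j\<in>UNIV. of_real (BS $ i $ j) * x j) = y i" unfolding h[rule_format]
    using exhaust_4[of i] by (elim disjE) (simp_all add: sum_4 BS_eq IB_def field_simps)
qed

lemma matrix_inv_BSc: "matrix_inv BSc = (\<chi> i j. IB i j)"
proof -
  let ?X = "\<chi> i j. IB i j"
  have 1: "BSc ** ?X = mat 1" "?X ** BSc = mat 1"
    by (simp_all add: vec_eq_iff matrix_matrix_mult_def sum_4 forall_4 map_matrix_def BS_eq IB_def mat_def)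
  then have "BSc ** matrix_inv BSc = mat 1"
    unfolding matrix_inv_def by (metis (mono_tags, lifting) someI_ex)
  then have "?X ** (BSc ** matrix_inv BSc) = ?X" by simp
  then show ?thesis unfolding matrix_mul_assoc 1 by simp
qed

text \<open>The quadratic form of the inverse of \<open>BS\<close>: an orthogonal sum of two A2
  forms, on the coordinates 1, 4 and 2, 3, each with minimum 1 on nonzero integral vectors.\<close>

definition qd :: "complex^4 \<Rightarrow> complex" where
  "qd l = (l $ 1)\<^sup>2 + (l $ 2)\<^sup>2 + (l $ 3)\<^sup>2 + (l $ 4)\<^sup>2 + l $ 1 * l $ 4 - l $ 2 * l $ 3"

lemma r_val_qd: "r_val Q \<epsilon> = qd (lam Q \<epsilon>)"
  unfolding r_val_def matrix_inv_BSc qd_def by (simp add: sum_4 IB_def power2_eq_square)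

lemma slots_cases:
  assumes "s \<in> slots"
  shows "(\<exists>k\<in>N12. s = (cl k, 1 / 12)) \<or> (\<exists>k\<in>N6. s = (cl k, 1 / 6))"
proof -
  obtain \<gamma> m where s: "s = (\<gamma>, m)" by (cases s)
  have g: "\<gamma> \<in> Disc" "m = 1 / 12 \<or> m = 1 / 6" "m - disc_q \<gamma> \<in> \<int>" using assms unfolding slots_def s by blast+
  from g(2) show ?thesis
  proof
    assume m: "m = 1 / 12"
    show ?thesis using Disc_exponent(1)[OF g(1) g(3)[unfolded m]] unfolding s m by blast
  next
    assume m: "m = 1 / 6"
    show ?thesis using Disc_exponent(2)[OF g(1) g(3)[unfolded m]] unfolding s m by blast
  qed
qed

lemma Phi_cl:
  assumes "(cl k, m) \<in> slots"
  shows "Phi (cl k, m) = (\<chi> i. tab i k)"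
  using assms bas_coeff[of m k] unfolding slots_def Phi_def echelon_basis_eq by (simp add: vec_eq_iff)

lemma N_slots: "k \<in> N12 \<Longrightarrow> (cl k, 1 / 12) \<in> slots" "k \<in> N6 \<Longrightarrow> (cl k, 1 / 6) \<in> slots"
  using N12_exponent N6_exponent by (auto simp: slots_def)

text \<open>At exponent 1/12 one of u, v vanishes, so the column is a minimal vector of one A2
  summand; at exponent 1/6 it has a minimal component in both.\<close>

lemma qd_Phi:
  assumes "s \<in> slots"
  shows "qd (Phi s) = (if snd s = 1 / 12 then 1 else 2)"
proof -
  have "qd (\<chi> i. tab i k) = 1" if "k \<in> N12" for k
    using that unfolding N12_def by (elim insertE emptyE) (simp_all add: qd_def tab_def)
  moreover have "qd (\<chi> i. tab i k) = 2" if "k \<in> N6" for k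
    using that unfolding N6_def by (elim insertE emptyE) (simp_all add: qd_def tab_def)
  ultimately show ?thesis using slots_cases[OF assms] Phi_cl N_slots by fastforce
qed

lemma finite_slots: "finite slots"
proof (rule finite_subset)
  show "slots \<subseteq> Disc \<times> {1 / 12, 1 / 6}" by (auto simp: slots_def)
qed (simp add: finite_Disc)

lemma Phi_Ints: "s \<in> slots \<Longrightarrow> Phi s $ i \<in> \<int>"
  using slots_cases[of s] Phi_cl N_slots tab_Ints by fastforce

lemma lam_Ints: "Q \<subseteq> slots \<Longrightarrow> lam Q \<epsilon> $ i \<in> \<int>"
  unfolding lam_def using Phi_Ints by (auto simp: sum_component intro!: Ints_sum Ints_mult)

lemma petersson_BS:
  assumes "\<And>j k. petersson (bas j) (bas k) = of_real (t * BS $ j $ k)"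
  shows "petersson (comb c) (comb d) = of_real t * (\<Sum>i\<in>UNIV. c i * (\<Sum>j\<in>UNIV. of_real (BS $ i $ j) * cnj (d j)))"
  unfolding petersson_comb assms sum_distrib_left by (intro sum.cong refl) (simp add: mult_ac)

lemma bas_comb: "bas i = comb (\<lambda>j. if j = i then 1 else 0)"
  using exhaust_4[of i] by (elim disjE) (simp_all add: comb_def sum_4 form_scale_def fun_eq_iff)

text \<open>The coordinates d of the shadow solve t \<open>BS\<close> d = lambda. Integrality of
  lambda makes d real, so the conjugation in the second argument disappears and the norm becomes the
  product of d with lambda.\<close>

lemma shadow_norm:
  assumes t: "t > 0" and P: "\<And>j k. petersson (bas j) (bas k) = of_real (t * BS $ j $ k)" and Q: "Q \<subseteq> slots"
  shows "is_shadow Q \<epsilon> (shadow Q \<epsilon>)" "norm_sq (shadow Q \<epsilon>) = r_val Q \<epsilon> / of_real t"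
proof -
  let ?l = "\<lambda>i. lam Q \<epsilon> $ i"
  define d where "d = (\<lambda>i. \<Sum>j\<in>UNIV. IB i j * (?l j / of_real t))"
  have l: "cnj (?l i) = ?l i" for i using lam_Ints[OF Q, of \<epsilon> i] by (elim Ints_cases) simp
  have dr: "cnj (d i) = d i" for i
  proof -
    have "cnj (IB i j) = IB i j" for j using exhaust_4[of i] exhaust_4[of j] by (elim disjE) (simp_all add: IB_def)
    then show ?thesis unfolding d_def cnj_sum complex_cnj_mult complex_cnj_divide l complex_cnj_complex_of_real by simp
  qed
  have b: "petersson (bas i) (comb c) = of_real t * (\<Sum>j\<in>UNIV. of_real (BS $ i $ j) * cnj (c j))" for i c
  proof -
    have "petersson (bas i) (comb c) = of_real t * (\<Sum>l\<in>UNIV. (if l = i then 1 else 0) * (\<Sum>j\<in>UNIV. of_real (BS $ l $ j) * cnj (c j)))"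
      by (subst bas_comb) (rule petersson_BS[OF P])
    then show ?thesis using exhaust_4[of i] by (auto simp: sum_4)
  qed
  have iff: "(\<forall>i. petersson (bas i) (comb c) = ?l i) \<longleftrightarrow> (\<forall>i. c i = d i)" for c
  proof -
    have "(\<forall>i. petersson (bas i) (comb c) = ?l i) \<longleftrightarrow> (\<forall>i. (\<Sum>j\<in>UNIV. of_real (BS $ i $ j) * cnj (c j)) = ?l i / of_real t)"
      unfolding b using t by (simp add: eq_divide_eq mult.commute)
    also have "\<dots> \<longleftrightarrow> (\<forall>i. cnj (c i) = d i)" unfolding BS_solve d_def ..
    also have "\<dots> \<longleftrightarrow> (\<forall>i. c i = d i)" by (metis dr complex_cnj_cnj)
    finally show ?thesis .
  qed
  have sh: "is_shadow Q \<epsilon> (comb d)" unfolding is_shadow_def echelon_basis_eq using comb_S32 iff[of d] by simp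
  have "\<Xi> = comb d" if "is_shadow Q \<epsilon> \<Xi>" for \<Xi>
  proof -
    have S: "\<Xi> \<in> S32" using that by (simp add: is_shadow_def)
    obtain c where c: "\<Xi> = comb c" by (rule S32_comb[OF S])
    have "\<forall>i. c i = d i" using that iff[of c] unfolding is_shadow_def echelon_basis_eq c by blast
    then have "c = d" by blast
    then show ?thesis using c by simp
  qed
  with sh have e: "shadow Q \<epsilon> = comb d" unfolding shadow_def by (rule the_equality)
  show "is_shadow Q \<epsilon> (shadow Q \<epsilon>)" unfolding e by (rule sh)
  have "norm_sq (comb d) = (\<Sum>i\<in>UNIV. d i * petersson (bas i) (comb d))"
    unfolding norm_sq_def petersson_BS[OF P] b sum_distrib_left by (intro sum.cong refl) (simp add: mult_ac)
  also have "\<dots> = (\<Sum>i\<in>UNIV. d i * ?l i)" using iff[of d] by simp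
  also have "\<dots> = r_val Q \<epsilon> / of_real t"
    unfolding r_val_def matrix_inv_BSc d_def sum_distrib_right sum_divide_distrib by (intro sum.cong refl) (simp add: mult_ac)
  finally show "norm_sq (shadow Q \<epsilon>) = r_val Q \<epsilon> / of_real t" unfolding e .
qed

lemma r_val_Rats:
  assumes "Q \<subseteq> slots"
  shows "r_val Q \<epsilon> \<in> \<rat>"
proof -
  have "lam Q \<epsilon> $ i \<in> \<rat>" for i using lam_Ints[OF assms, of \<epsilon> i] Ints_subset_Rats by blast
  then show ?thesis unfolding r_val_qd qd_def power2_eq_square by (intro Rats_add Rats_diff Rats_mult)
qed

section \<open>Flips\<close>

lemma lam_flip:
  assumes "finite Q" "s \<in> Q"
  shows "lam Q (flip s \<epsilon>) = lam Q \<epsilon> - of_int (2 * \<epsilon> s) *s Phi s"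
proof -
  have "lam Q (flip s \<epsilon>) = of_int (- \<epsilon> s) *s Phi s + (\<Sum>x\<in>Q - {s}. of_int (\<epsilon> x) *s Phi x)"
  proof -
    have "(\<Sum>x\<in>Q - {s}. of_int (flip s \<epsilon> x) *s Phi x) = (\<Sum>x\<in>Q - {s}. of_int (\<epsilon> x) *s Phi x)"
      by (intro sum.cong refl) (auto simp: flip_def)
    then show ?thesis unfolding lam_def sum.remove[OF assms] by (simp add: flip_def)
  qed
  moreover have "lam Q \<epsilon> = of_int (\<epsilon> s) *s Phi s + (\<Sum>x\<in>Q - {s}. of_int (\<epsilon> x) *s Phi x)"
    unfolding lam_def by (rule sum.remove[OF assms])
  ultimately show ?thesis by (simp add: vec_eq_iff algebra_simps)
qed

text \<open>The deck isometry rotates x, y, z, and the differences in the columns of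
  \<open>Phi\<close> cancel over a full rotation. Averaging lambda over the three rotations,
  permitted by the invariance of the orientation, gives 0.\<close>

lemma deck_invariant_lam:
  assumes reps: "slot_reps Q" and inv: "deck_invariant Q \<epsilon>"
  shows "lam Q \<epsilon> = 0"
proof -
  have Q: "Q \<subseteq> slots" "slot_deck ` Q = Q" using reps by (auto simp: slot_reps_def)
  have fin: "finite Q" by (rule finite_subset[OF Q(1) finite_slots])
  have bij: "bij_betw slot_deck Q Q"
    using Q(2) fin by (simp add: bij_betw_def finite_surj_inj)
  have step: "(\<Sum>s\<in>Q. of_int (\<epsilon> s) *s f (slot_deck s)) = (\<Sum>s\<in>Q. of_int (\<epsilon> s) *s f s)" for f :: "findex \<Rightarrow> complex^4"
  proof -
    have "(\<Sum>s\<in>Q. of_int (\<epsilon> s) *s f s) = (\<Sum>s\<in>Q. of_int (\<epsilon> (slot_deck s)) *s f (slot_deck s))"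
      by (rule sum.reindex_bij_betw[OF bij, symmetric])
    then show ?thesis using inv unfolding deck_invariant_def by simp
  qed
  have z: "Phi s + Phi (slot_deck s) + Phi (slot_deck (slot_deck s)) = 0" if s: "s \<in> Q" for s
  proof -
    have dk: "slot_deck (cl (x, y, z, u, v), m) = (cl (z, x, y, u, v), m)" for x y z u v m
      by (simp add: slot_deck_def deck_cl)
    obtain k m where k: "s = (cl k, m)" using slots_cases[of s] s Q(1) by blast
    obtain x y z u v where xyz: "k = (x, y, z, u, v)" by (cases k)
    have "slot_deck s \<in> slots" "slot_deck (slot_deck s) \<in> slots" using s Q by blast+
    then have sl: "(cl (x, y, z, u, v), m) \<in> slots" "(cl (z, x, y, u, v), m) \<in> slots" "(cl (y, z, x, u, v), m) \<in> slots"
      using s Q(1) unfolding k xyz dk by blast+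
    show ?thesis unfolding k xyz dk Phi_cl[OF sl(1)] Phi_cl[OF sl(2)] Phi_cl[OF sl(3)]
      by (simp add: vec_eq_iff forall_4 tab_def algebra_simps)
  qed
  have "3 *s lam Q \<epsilon> = lam Q \<epsilon> + lam Q \<epsilon> + lam Q \<epsilon>" by (simp add: vec_eq_iff)
  also have "\<dots> = (\<Sum>s\<in>Q. of_int (\<epsilon> s) *s Phi s) + (\<Sum>s\<in>Q. of_int (\<epsilon> s) *s Phi (slot_deck s)) + (\<Sum>s\<in>Q. of_int (\<epsilon> s) *s Phi (slot_deck (slot_deck s)))"
    unfolding lam_def step[of "\<lambda>s. Phi (slot_deck s)"] step[of Phi] ..
  also have "\<dots> = (\<Sum>s\<in>Q. of_int (\<epsilon> s) *s (Phi s + Phi (slot_deck s) + Phi (slot_deck (slot_deck s))))"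
    unfolding sum.distrib[symmetric] by (intro sum.cong refl) (simp add: vec_eq_iff algebra_simps)
  also have "\<dots> = 0" using z by simp
  finally show ?thesis by (simp add: vec_eq_iff)
qed

lemma single_flip:
  assumes reps: "slot_reps Q" and o: "orientation Q \<epsilon>" and l: "lam Q \<epsilon> = 0" and s: "s \<in> Q"
  shows "r_val Q (flip s \<epsilon>) = (if snd s = 1 / 12 then 4 else 8)"
proof -
  have Q: "Q \<subseteq> slots" using reps by (simp add: slot_reps_def)
  have e: "(of_int (\<epsilon> s))\<^sup>2 = (1 :: complex)" using o s by (auto simp: orientation_def)
  have "qd (0 - of_int (2 * \<epsilon> s) *s Phi s) = 4 * (of_int (\<epsilon> s))\<^sup>2 * qd (Phi s)"
    by (simp add: qd_def algebra_simps power2_eq_square)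
  then show ?thesis
    unfolding r_val_qd lam_flip[OF finite_subset[OF Q finite_slots] s] l e using qd_Phi[of s] s Q by auto
qed

text \<open>The four products of signs between two slots of exponent \<open>1/12\<close> and two slots of exponent
  \<open>1/6\<close> multiply to \<open>-1\<close>, so they cannot all be wrong.\<close>

lemma double_flip:
  assumes reps: "slot_reps Q" and o: "orientation Q \<epsilon>" and l: "lam Q \<epsilon> = 0"
  shows "\<exists>s\<in>Q. \<exists>s'\<in>Q. snd s = 1 / 12 \<and> snd s' = 1 / 6 \<and> r_val Q (flip s (flip s' \<epsilon>)) = 20"
proof -
  have Q: "Q \<subseteq> slots" using reps by (simp add: slot_reps_def)
  have fin: "finite Q" by (rule finite_subset[OF Q finite_slots])
  have ex: "\<exists>s\<in>Q. \<exists>c. (c = 1 \<or> c = - 1) \<and> snd s = m \<and> of_int (\<epsilon> s) *s Phi s = c *s (\<chi> i. tab i (x, y, z, u, v))"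
    if sl: "(cl (x, y, z, u, v), m) \<in> slots" for x y z u v m
  proof -
    let ?s = "(cl (x, y, z, u, v), m)"
    have n: "slot_neg ?s = (cl (- x, - y, - z, - u, - v), m)" by (simp add: slot_neg_def uminus_cl)
    have cases: "?s \<in> Q \<or> slot_neg ?s \<in> Q" using reps sl unfolding slot_reps_def by blast
    have bm: "bt (- w) = bt w" for w by (simp add: bt_def) presburger
    have tn: "tab i (- x, - y, - z, - u, - v) = - tab i (x, y, z, u, v)" for i
      using exhaust_4[of i] by (elim disjE) (simp_all add: tab_def sg_minus bm)
    have eps: "s \<in> Q \<Longrightarrow> \<epsilon> s = 1 \<or> \<epsilon> s = - 1" for s using o by (auto simp: orientation_def)
    from cases show ?thesis
    proof
      assume s: "?s \<in> Q"
      then show ?thesis using eps[OF s] Phi_cl[OF sl] by (intro bexI[OF _ s] exI[of _ "of_int (\<epsilon> ?s)"]) auto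
    next
      assume s: "slot_neg ?s \<in> Q"
      have "Phi (slot_neg ?s) = - (\<chi> i. tab i (x, y, z, u, v))"
        using s Q Phi_cl unfolding n by (simp add: subset_eq tn vec_eq_iff)
      then show ?thesis using eps[OF s] n
        by (intro bexI[OF _ s] exI[of _ "- of_int (\<epsilon> (slot_neg ?s))"]) (auto simp: vec_eq_iff)
    qed
  qed
  \<comment> \<open>On the first two coordinates these columns are -e2, -e1, e1 + e2 and e2 - e1,
    and they vanish on the others. With signs, the sum of one of the first two and one of the last
    two has \<open>qd\<close> equal to 1 or 5, and 4 * 5 = 20.\<close>
  have m12: "(1, 0, 0, 1, 0) \<in> N12" "(1, 0, 0, 0, 1) \<in> N12" and m6: "(0, 1, 1, 1, 1) \<in> N6" "(0, 1, 1, 1, 2) \<in> N6"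
    by (simp_all add: N12_def N6_def)
  obtain s1 a where a: "s1 \<in> Q" "a = 1 \<or> a = - 1" "snd s1 = 1 / 12" "of_int (\<epsilon> s1) *s Phi s1 = a *s (\<chi> i. tab i (1, 0, 0, 1, 0))"
    using ex[OF N_slots(1)[OF m12(1)]] by blast
  obtain s2 b where b: "s2 \<in> Q" "b = 1 \<or> b = - 1" "snd s2 = 1 / 12" "of_int (\<epsilon> s2) *s Phi s2 = b *s (\<chi> i. tab i (1, 0, 0, 0, 1))"
    using ex[OF N_slots(1)[OF m12(2)]] by blast
  obtain s3 c where c: "s3 \<in> Q" "c = 1 \<or> c = - 1" "snd s3 = 1 / 6" "of_int (\<epsilon> s3) *s Phi s3 = c *s (\<chi> i. tab i (0, 1, 1, 1, 1))"
    using ex[OF N_slots(2)[OF m6(1)]] by blast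
  obtain s4 d where d: "s4 \<in> Q" "d = 1 \<or> d = - 1" "snd s4 = 1 / 6" "of_int (\<epsilon> s4) *s Phi s4 = d *s (\<chi> i. tab i (0, 1, 1, 1, 2))"
    using ex[OF N_slots(2)[OF m6(2)]] by blast
  have r: "r_val Q (flip s (flip s' \<epsilon>)) = 4 * qd (of_int (\<epsilon> s) *s Phi s + of_int (\<epsilon> s') *s Phi s')"
    if "s \<in> Q" "s' \<in> Q" "snd s = 1 / 12" "snd s' = 1 / 6" for s s'
  proof -
    have ne: "s \<noteq> s'" using that by auto
    have e: "lam Q (flip s (flip s' \<epsilon>)) = - (2 *s (of_int (\<epsilon> s) *s Phi s + of_int (\<epsilon> s') *s Phi s'))"
      unfolding lam_flip[OF fin that(1)] lam_flip[OF fin that(2)] l using ne by (simp add: flip_def vec_eq_iff algebra_simps)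
    have "qd (- (2 *s x)) = 4 * qd x" for x by (simp add: qd_def algebra_simps power2_eq_square)
    then show ?thesis unfolding r_val_qd e .
  qed
  have "r_val Q (flip s1 (flip s3 \<epsilon>)) = 20 \<or> r_val Q (flip s1 (flip s4 \<epsilon>)) = 20 \<or> r_val Q (flip s2 (flip s3 \<epsilon>)) = 20 \<or> r_val Q (flip s2 (flip s4 \<epsilon>)) = 20"
    unfolding r[OF a(1) c(1) a(3) c(3)] r[OF a(1) d(1) a(3) d(3)] r[OF b(1) c(1) b(3) c(3)] r[OF b(1) d(1) b(3) d(3)] a(4) b(4) c(4) d(4)
    using a(2) b(2) c(2) d(2) by (elim disjE) (simp_all add: qd_def tab_def)
  then show ?thesis using a(1,3) b(1,3) c(1,3) d(1,3) by blast
qed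

theorem theorem12p1:
  fixes Q :: "findex set"
  assumes reps: "slot_reps Q"
  shows "is_echelon_basis echelon_basis
    \<and> abs_irreducible_S32
    \<and> (\<forall>B. invariant_symmetric B \<longleftrightarrow> (\<exists>c. B = map_matrix ((*) c) BSc))
    \<and> BSc = (1 / 48) *\<^sub>R (\<Sum>\<sigma>\<in>O_disc. transpose (rep_matrix \<sigma>) ** rep_matrix \<sigma>)
    \<and> is_gram_of_lattice ((3 / 2) *\<^sub>R BS) (A2 \<times> A2)
    \<and> (\<exists>t :: real. t > 0
        \<and> P32 = t *\<^sub>R BSc
        \<and> (\<forall>\<epsilon>. orientation Q \<epsilon> \<longrightarrow>
              r_val Q \<epsilon> \<in> \<rat>
            \<and> is_shadow Q \<epsilon> (shadow Q \<epsilon>)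
            \<and> norm_sq (shadow Q \<epsilon>) = r_val Q \<epsilon> / of_real t))
    \<and> (\<forall>\<epsilon>. orientation Q \<epsilon> \<and> deck_invariant Q \<epsilon> \<longrightarrow> lam Q \<epsilon> = 0)
    \<and> (\<forall>\<epsilon>. orientation Q \<epsilon> \<and> lam Q \<epsilon> = 0 \<longrightarrow>
          (\<forall>s\<in>Q. r_val Q (flip s \<epsilon>) = (if snd s = 1 / 12 then 4 else 8))
        \<and> (\<exists>s\<in>Q. \<exists>s'\<in>Q. snd s = 1 / 12 \<and> snd s' = 1 / 6
              \<and> r_val Q (flip s (flip s' \<epsilon>)) = 20))
    \<and> (\<forall>\<epsilon> \<epsilon>'. orientation Q \<epsilon> \<and> orientation Q \<epsilon>' \<and> r_val Q \<epsilon>' \<noteq> 0 \<longrightarrow>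
          norm_sq (shadow Q \<epsilon>) / norm_sq (shadow Q \<epsilon>') = r_val Q \<epsilon> / r_val Q \<epsilon>')
    \<and> (\<forall>\<epsilon> \<epsilon>'. orientation Q \<epsilon> \<and> orientation Q \<epsilon>' \<and> r_val Q \<epsilon> = 8 \<and> r_val Q \<epsilon>' = 20 \<longrightarrow>
          norm_sq (shadow Q \<epsilon>) / norm_sq (shadow Q \<epsilon>') = 2 / 5)"
proof -
  have Q: "Q \<subseteq> slots" using reps by (simp add: slot_reps_def)
  obtain t where t: "t > 0" "\<And>j k. petersson (bas j) (bas k) = of_real (t * BS $ j $ k)"
    using petersson_bas by blast
  have P: "P32 = t *\<^sub>R BSc"
    unfolding P32_def echelon_basis_eq by (simp add: vec_eq_iff t(2) map_matrix_def; simp add: scaleR_conv_of_real)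
  have n: "norm_sq (shadow Q \<epsilon>) = r_val Q \<epsilon> / of_real t" for \<epsilon> by (rule shadow_norm(2)[OF t Q])
  have q: "norm_sq (shadow Q \<epsilon>) / norm_sq (shadow Q \<epsilon>') = r_val Q \<epsilon> / r_val Q \<epsilon>'" for \<epsilon> \<epsilon>'
    unfolding n using t(1) by simp
  show ?thesis
  proof (intro conjI allI impI)
    show "is_echelon_basis echelon_basis" unfolding echelon_basis_eq by (rule echelon_bas)
    show "abs_irreducible_S32" by (rule irreducible)
    show "invariant_symmetric B \<longleftrightarrow> (\<exists>c. B = map_matrix ((*) c) BSc)" for B by (rule invariant_symmetric_iff)
    show "BSc = (1 / 48) *\<^sub>R (\<Sum>\<sigma>\<in>O_disc. transpose (rep_matrix \<sigma>) ** rep_matrix \<sigma>)" by (rule average_gram)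
    show "is_gram_of_lattice ((3 / 2) *\<^sub>R BS) (A2 \<times> A2)" by (rule gram_A2)
    show "\<exists>t :: real. t > 0 \<and> P32 = t *\<^sub>R BSc \<and> (\<forall>\<epsilon>. orientation Q \<epsilon> \<longrightarrow> r_val Q \<epsilon> \<in> \<rat>
        \<and> is_shadow Q \<epsilon> (shadow Q \<epsilon>) \<and> norm_sq (shadow Q \<epsilon>) = r_val Q \<epsilon> / of_real t)"
      using t(1) P r_val_Rats[OF Q] shadow_norm(1)[OF t Q] n by blast
    show "lam Q \<epsilon> = 0" if "orientation Q \<epsilon> \<and> deck_invariant Q \<epsilon>" for \<epsilon> using deck_invariant_lam[OF reps] that by blast
    show "\<forall>s\<in>Q. r_val Q (flip s \<epsilon>) = (if snd s = 1 / 12 then 4 else 8)" if "orientation Q \<epsilon> \<and> lam Q \<epsilon> = 0" for \<epsilon>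
      using single_flip[OF reps] that by blast
    show "\<exists>s\<in>Q. \<exists>s'\<in>Q. snd s = 1 / 12 \<and> snd s' = 1 / 6 \<and> r_val Q (flip s (flip s' \<epsilon>)) = 20"
      if "orientation Q \<epsilon> \<and> lam Q \<epsilon> = 0" for \<epsilon> using double_flip[OF reps] that by blast
    show "norm_sq (shadow Q \<epsilon>) / norm_sq (shadow Q \<epsilon>') = r_val Q \<epsilon> / r_val Q \<epsilon>'" for \<epsilon> \<epsilon>' by (rule q)
    show "norm_sq (shadow Q \<epsilon>) / norm_sq (shadow Q \<epsilon>') = 2 / 5"
      if "orientation Q \<epsilon> \<and> orientation Q \<epsilon>' \<and> r_val Q \<epsilon> = 8 \<and> r_val Q \<epsilon>' = 20" for \<epsilon> \<epsilon>'
      using q[of \<epsilon> \<epsilon>'] that by simp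
  qed
qed

end
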